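(* Let assumptions (i), (ii'), (iii') (the last for the on-line case only) and (iv) of the context hold, and treat $\Delta,L,\sigma,\rho$ as positive constants. There is a randomized algorithm, accessing $f$ only through stochastic (component) gradients, which with high probability finds an $(\epsilon,\delta)$-approximate second-order stationary point with gradient cost $$\tilde{\mathcal{O}}\left(\epsilon^{-3}+\delta^{-2}\epsilon^{-2}+\delta^{-5}\right)$$ in the on-line case, and $$\tilde{\mathcal{O}}\left(n^{1/2}\epsilon^{-2}+n^{1/2}\delta^{-2}\epsilon^{-1}+\delta^{-3}\epsilon^{-1}+\delta^{-5}+n\right)$$ in the finite-sum case. When $\delta$ is of order $\epsilon^{0.5}$, the gradient cost is $\tilde{\mathcal{O}}\left(\min\left(n^{1/2}\epsilon^{-2}+\epsilon^{-2.5},\ \epsilon^{-3}\right)\right)$.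
   Context: Setting: $f:\mathbb{R}^d\to\mathbb{R}$ is $f(\mathbf{x})=\mathbb{E}_i[f_i(\mathbf{x})]$; in the finite-sum case $i$ is uniform on $\{1,\dots,n\}$, so $f=\frac1n\sum_{i=1}^nf_i$; in the on-line case $i$ is a random index from a possibly infinite set. Each $f_i$ is twice differentiable, possibly non-convex, and $\mathbb{E}_i\nabla f_i=\nabla f$. $\|\cdot\|$ is the Euclidean norm of vectors / spectral norm of matrices. Assumptions: (i) $\Delta:=f(\mathbf{x}^0)-\inf f<\infty$, where $\mathbf{x}^0$ is the starting point; (ii') $\|\nabla f_i(\mathbf{x})-\nabla f_i(\mathbf{y})\|\le L\|\mathbf{x}-\mathbf{y}\|$ for all $i,\mathbf{x},\mathbf{y}$; (iii') (on-line case only) $\|\nabla f_i(\mathbf{x})-\nabla f(\mathbf{x})\|^2\le\sigma^2$ for all $i,\mathbf{x}$; (iv) $\|\nabla^2f_i(\mathbf{x})-\nabla^2f_i(\mathbf{y})\|\le\rho\|\mathbf{x}-\mathbf{y}\|$ for all $i,\mathbf{x},\mathbf{y}$. A point $\mathbf{x}$ is an $(\epsilon,\delta)$-approximate second-order stationary point if $\|\nabla f(\mathbf{x})\|\le\epsilon$ and $\lambda_{\min}(\nabla^2f(\mathbf{x}))\ge-\delta$. Gradient cost is the total number of evaluations of stochastic gradients $\nabla f_i(\mathbf{x})$. $\tilde{\mathcal{O}}$ hides poly-logarithmic factors of the parameters (including $d$ and the inverse failure probability). Here $\epsilon,\delta$ are small accuracies in $(0,1)$. The $\min$ in the last claim refers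 to using the better of the finite-sum and on-line bounds. *)

theory Defs
  imports "HOL-Probability.Probability" "Jordan_Normal_Form.Spectral_Radius"
begin

unbundle no inner_syntax
unbundle no vec_syntax

text \<open>
  The space R^d is \<^term>\<open>carrier_vec d :: real vec set\<close>: the dimension is a number and not a type,
  so that the constants of a complexity bound can be chosen before d.  As \<^typ>\<open>real vec\<close> is no
  normed space, the Euclidean norm, gradient, Hessian and spectral norm are spelled out.
\<close>

definition enorm :: "real vec \<Rightarrow> real" where
  "enorm x = sqrt (x \<bullet> x)"

definition has_gradient :: "nat \<Rightarrow> (real vec \<Rightarrow> real) \<Rightarrow> real vec \<Rightarrow> real vec \<Rightarrow> bool" where
  "has_gradient d f g x \<longleftrightarrow>
     x \<in> carrier_vec d \<and> g \<in> carrier_vec d \<and>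
     (\<forall>e>0. \<exists>r>0. \<forall>y\<in>carrier_vec d. enorm (y - x) < r \<longrightarrow>
        \<bar>f y - f x - g \<bullet> (y - x)\<bar> \<le> e * enorm (y - x))"

definition grad :: "nat \<Rightarrow> (real vec \<Rightarrow> real) \<Rightarrow> real vec \<Rightarrow> real vec" where
  "grad d f x = (THE g. has_gradient d f g x)"

definition has_hessian :: "nat \<Rightarrow> (real vec \<Rightarrow> real) \<Rightarrow> real mat \<Rightarrow> real vec \<Rightarrow> bool" where
  "has_hessian d f H x \<longleftrightarrow>
     x \<in> carrier_vec d \<and> H \<in> carrier_mat d d \<and>
     (\<forall>e>0. \<exists>r>0. \<forall>y\<in>carrier_vec d. enorm (y - x) < r \<longrightarrow>
        enorm (grad d f y - grad d f x - H *\<^sub>v (y - x)) \<le> e * enorm (y - x))"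

definition hessian :: "nat \<Rightarrow> (real vec \<Rightarrow> real) \<Rightarrow> real vec \<Rightarrow> real mat" where
  "hessian d f x = (THE H. has_hessian d f H x)"

definition twice_differentiable :: "nat \<Rightarrow> (real vec \<Rightarrow> real) \<Rightarrow> bool" where
  "twice_differentiable d f \<longleftrightarrow>
     (\<forall>x\<in>carrier_vec d. (\<exists>g. has_gradient d f g x) \<and> (\<exists>H. has_hessian d f H x))"

definition spectral_norm :: "real mat \<Rightarrow> real" where
  "spectral_norm M = (SUP v\<in>{v \<in> carrier_vec (dim_col M). enorm v \<le> 1}. enorm (M *\<^sub>v v))"

definition lambda_min :: "real mat \<Rightarrow> real" where
  "lambda_min M = Min (spectrum M)"

definition approx_sosp :: "nat \<Rightarrow> (real vec \<Rightarrow> real) \<Rightarrow> real \<Rightarrow> real \<Rightarrow> real vec \<Rightarrow> bool" where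
  "approx_sosp d f \<epsilon> \<delta> x \<longleftrightarrow>
     x \<in> carrier_vec d \<and> enorm (grad d f x) \<le> \<epsilon> \<and> lambda_min (hessian d f x) \<ge> - \<delta>"


definition smooth_components ::
  "nat \<Rightarrow> 'i set \<Rightarrow> ('i \<Rightarrow> real vec \<Rightarrow> real) \<Rightarrow> real \<Rightarrow> real \<Rightarrow> bool" where
  "smooth_components d I F L \<rho> \<longleftrightarrow>
     (\<forall>i\<in>I. twice_differentiable d (F i) \<and>
       (\<forall>x\<in>carrier_vec d. \<forall>y\<in>carrier_vec d.
          enorm (grad d (F i) x - grad d (F i) y) \<le> L * enorm (x - y) \<and>
          spectral_norm (hessian d (F i) x - hessian d (F i) y) \<le> \<rho> * enorm (x - y)))"

definition initial_gap :: "nat \<Rightarrow> (real vec \<Rightarrow> real) \<Rightarrow> real vec \<Rightarrow> real \<Rightarrow> bool" where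
  "initial_gap d f x0 \<Delta> \<longleftrightarrow>
     x0 \<in> carrier_vec d \<and> bdd_below (f ` carrier_vec d) \<and>
     \<Delta> = f x0 - (INF x\<in>carrier_vec d. f x)"

definition bounded_deviation ::
  "nat \<Rightarrow> 'i set \<Rightarrow> ('i \<Rightarrow> real vec \<Rightarrow> real) \<Rightarrow> (real vec \<Rightarrow> real) \<Rightarrow> real \<Rightarrow> bool" where
  "bounded_deviation d I F f \<sigma> \<longleftrightarrow>
     (\<forall>i\<in>I. \<forall>x\<in>carrier_vec d. (enorm (grad d (F i) x - grad d f x))\<^sup>2 \<le> \<sigma>\<^sup>2)"

definition avg :: "nat \<Rightarrow> (nat \<Rightarrow> real vec \<Rightarrow> real) \<Rightarrow> real vec \<Rightarrow> real" where
  "avg n F x = (\<Sum>i<n. F i x) / real n"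

definition finite_sum_problem ::
  "nat \<Rightarrow> nat \<Rightarrow> (nat \<Rightarrow> real vec \<Rightarrow> real) \<Rightarrow> real vec \<Rightarrow> real \<Rightarrow> real \<Rightarrow> real \<Rightarrow> bool" where
  "finite_sum_problem d n F x0 \<Delta> L \<rho> \<longleftrightarrow>
     smooth_components d {..<n} F L \<rho> \<and> initial_gap d (avg n F) x0 \<Delta>"

definition expect :: "'i measure \<Rightarrow> ('i \<Rightarrow> real vec \<Rightarrow> real) \<Rightarrow> real vec \<Rightarrow> real" where
  "expect D F x = (LINT i|D. F i x)"

definition online_problem ::
  "nat \<Rightarrow> 'i measure \<Rightarrow> ('i \<Rightarrow> real vec \<Rightarrow> real) \<Rightarrow> real vec \<Rightarrow>
     real \<Rightarrow> real \<Rightarrow> real \<Rightarrow> real \<Rightarrow> bool" where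
  "online_problem d D F x0 \<Delta> L \<sigma> \<rho> \<longleftrightarrow>
     prob_space D \<and>
     (\<forall>x\<in>carrier_vec d. integrable D (\<lambda>i. F i x)) \<and>
     (\<forall>x\<in>carrier_vec d. \<forall>j<d. integrable D (\<lambda>i. grad d (F i) x $ j)) \<and>
     (\<forall>x\<in>carrier_vec d.
        has_gradient d (expect D F) (vec d (\<lambda>j. LINT i|D. grad d (F i) x $ j)) x) \<and>
     smooth_components d (space D) F L \<rho> \<and>
     initial_gap d (expect D F) x0 \<Delta> \<and>
     bounded_deviation d (space D) F (expect D F) \<sigma>"


text \<open>
  An algorithm is a function of its internal random bits (an i.i.d. sequence of uniform variables)
  and of the gradients it has been given so far.  It either asks for one more component gradient
  or stops with an output.  The number in a query is the component index in the finite-sum case.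
  In the on-line case \<open>Query k x\<close> asks for the gradient at x of the k-th of a sequence of i.i.d.
  sampled components; the same sample may be queried at several points, and the index itself is
  never revealed.
\<close>

datatype action = Query nat "real vec" | Output "real vec"

type_synonym algorithm = "(nat \<Rightarrow> real) \<Rightarrow> real vec list \<Rightarrow> action"

primrec answers ::
  "algorithm \<Rightarrow> (nat \<Rightarrow> real) \<Rightarrow> (nat \<Rightarrow> real vec \<Rightarrow> real vec) \<Rightarrow> nat \<Rightarrow> real vec list" where
  "answers alg s G 0 = []"
| "answers alg s G (Suc t) =
     (case alg s (answers alg s G t) of
        Query k x \<Rightarrow> answers alg s G t @ [G k x]
      | Output x \<Rightarrow> answers alg s G t)"

text \<open>The gradient cost of a run is the length of its list of answers.\<close>

definition outputs_within ::
  "algorithm \<Rightarrow> (nat \<Rightarrow> real) \<Rightarrow> (nat \<Rightarrow> real vec \<Rightarrow> real vec) \<Rightarrow> real \<Rightarrow> real vec \<Rightarrow> bool" where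
  "outputs_within alg s G B x \<longleftrightarrow>
     (\<exists>t. alg s (answers alg s G t) = Output x \<and> real (length (answers alg s G t)) \<le> B)"

definition random_bits :: "(nat \<Rightarrow> real) measure" where
  "random_bits = (\<Pi>\<^sub>M _\<in>UNIV. uniform_measure lborel {0..1})"

text \<open>
  In both definitions below the measure of a non-measurable set is 0, so for a failure probability
  p < 1 measurability of the success event is part of the claim.
\<close>

definition finite_sum_finds ::
  "algorithm \<Rightarrow> nat \<Rightarrow> nat \<Rightarrow> (nat \<Rightarrow> real vec \<Rightarrow> real) \<Rightarrow>
     real \<Rightarrow> real \<Rightarrow> real \<Rightarrow> real \<Rightarrow> bool" where
  "finite_sum_finds alg d n F \<epsilon> \<delta> p B \<longleftrightarrow>
     measure random_bits
       {s \<in> space random_bits.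
          \<exists>x. outputs_within alg s (\<lambda>k y. if k < n then grad d (F k) y else 0\<^sub>v d) B x \<and>
              approx_sosp d (avg n F) \<epsilon> \<delta> x} \<ge> 1 - p"

definition online_finds ::
  "algorithm \<Rightarrow> nat \<Rightarrow> 'i measure \<Rightarrow> ('i \<Rightarrow> real vec \<Rightarrow> real) \<Rightarrow>
     real \<Rightarrow> real \<Rightarrow> real \<Rightarrow> real \<Rightarrow> bool" where
  "online_finds alg d D F \<epsilon> \<delta> p B \<longleftrightarrow>
     (let P = random_bits \<Otimes>\<^sub>M (\<Pi>\<^sub>M _\<in>(UNIV :: nat set). D) in
      measure P
       {(s, \<iota>) \<in> space P.
          \<exists>x. outputs_within alg s (\<lambda>k y. grad d (F (\<iota> k)) y) B x \<and>
              approx_sosp d (expect D F) \<epsilon> \<delta> x} \<ge> 1 - p)"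

text \<open>
  What the algorithm is told in advance.  \<open>components\<close> is \<^const>\<open>None\<close> in the on-line case;
  \<open>deviation\<close> is \<^const>\<open>None\<close> if no bound on the deviation of the component gradients is assumed.
\<close>

record params =
  dimension :: nat
  components :: "nat option"
  start :: "real vec"
  gap :: real
  grad_lipschitz :: real
  deviation :: "real option"
  hess_lipschitz :: real
  accuracy :: real
  curvature :: real
  failure :: real

text \<open>The hidden factors are powers of the sum of the logarithms of the listed parameters.\<close>

definition log_factor :: "real list \<Rightarrow> real" where
  "log_factor ps = 1 + (\<Sum>a\<leftarrow>ps. \<bar>ln a\<bar>)"

end

theory Submission
  imports Defs
begin

text \<open>
  The algorithm alternates variance-reduced gradient descent with a search for directions of negative
  curvature.  A gradient estimate is refreshed by a large batch (or by the full sum) whenever the iterate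
  has travelled a fixed length since the last refresh; in between it is updated by gradient differences,
  whose variance is proportional to the squared length of the step.  If the estimate is large, a
  gradient step decreases f by an amount of order epsilon^2.  Otherwise Oja's iteration, with Hessian-vector
  products replaced by finite differences of component gradients, either certifies
  that there is no direction of curvature below -delta, or yields a unit vector along which a step of length of
  order delta and of random sign decreases f by an amount of order delta^3 on average.  Hence there are at most
  O(epsilon^-2) gradient steps and O(delta^-3) curvature steps.  The error of the gradient estimate
  is controlled by an exponential supermartingale that does not depend on the dimension, and the
  length of the iterates of Oja's recursion by another one; restarting the search a logarithmic
  number of times gives high probability.

  The on-line problem is reduced to a finite sum: a huge but fixed number of samples is available, of which
  only a few are ever queried, and by Hoeffding's inequality on a grid their average approximates the
  gradient of f uniformly on the ball that the iterates cannot leave.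
\<close>

section \<open>Randomized programs with an oracle\<close>

text \<open>The analysis treats the oracle as a fixed function and every random choice as a uniform
  draw from a finite set. All expectations are then finite averages, and measure theory enters only
  when programs become algorithms. The costs come from a balance. Per unit of length travelled, a
  refresh of size \<open>B0\<close> every \<open>len\<close> costs \<open>B0 / len\<close>, and the
  difference batches cost about \<open>ell\<^sup>2 * len\<close>. Since \<open>ell\<close> is of
  order 1/\<epsilon> up to logarithms, \<open>len = sqrt B0 * \<epsilon>\<close> makes both about
  sqrt(B0)/\<epsilon>. The gradient steps travel a length of order 1/\<epsilon> and the curvature
  steps one of order 1/\<delta>^2, while a search takes about \<delta>^-2 queries. In the curvature
  search no spectral gap is available, so the last iterate need not align with the extreme
  eigenvector. The squared norm is therefore discounted by the exponential of the Rayleigh quotients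
  met on the way: a long final vector forces most visited iterates to have curvature near the
  minimum, and a uniformly random stopping time hits one of them.\<close>

datatype ('q, 'a) prog =
  Ret 'a
| Draw nat "nat \<Rightarrow> ('q, 'a) prog"
| Ask nat 'q "'q \<Rightarrow> ('q, 'a) prog"

primrec bindP :: "('q, 'a) prog \<Rightarrow> ('a \<Rightarrow> ('q, 'b) prog) \<Rightarrow> ('q, 'b) prog" where
  "bindP (Ret a) Q = Q a"
| "bindP (Draw m k) Q = Draw m (\<lambda>i. bindP (k i) Q)"
| "bindP (Ask i x k) Q = Ask i x (\<lambda>a. bindP (k a) Q)"

text \<open>\<open>Draw m\<close> has the Suc m outcomes 0..m, so that the average is never over an
  empty set. With \<open>G\<close> fixed, the draws are the only randomness.\<close>

primrec ev :: "(nat \<Rightarrow> 'q \<Rightarrow> 'q) \<Rightarrow> ('q, 'a) prog \<Rightarrow> ('a \<Rightarrow> real) \<Rightarrow> real" where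
  "ev G (Ret a) h = h a"
| "ev G (Draw m k) h = (\<Sum>i\<le>m. ev G (k i) h) / real (Suc m)"
| "ev G (Ask i x k) h = ev G (k (G i x)) h"

primrec results :: "(nat \<Rightarrow> 'q \<Rightarrow> 'q) \<Rightarrow> ('q, 'a) prog \<Rightarrow> 'a set" where
  "results G (Ret a) = {a}"
| "results G (Draw m k) = (\<Union>i\<in>{..m}. results G (k i))"
| "results G (Ask i x k) = results G (k (G i x))"

text \<open>A worst case over all draws and over arbitrary answers, not only those of an oracle: the
  bound then holds for every problem at once.\<close>

primrec costs :: "('q, 'a) prog \<Rightarrow> nat \<Rightarrow> bool" where
  "costs (Ret a) b = True"
| "costs (Draw m k) b = (\<forall>i\<le>m. costs (k i) b)"
| "costs (Ask i x k) b = (b > 0 \<and> (\<forall>a. costs (k a) (b - 1)))"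

lemma ev_bind: "ev G (bindP P Q) h = ev G P (\<lambda>a. ev G (Q a) h)"
  by (induction P) auto

lemma results_bind: "results G (bindP P Q) = (\<Union>a\<in>results G P. results G (Q a))"
  by (induction P) auto

lemma ev_mono_on:
  assumes "\<And>a. a \<in> results G P \<Longrightarrow> h a \<le> h' a"
  shows "ev G P h \<le> ev G P h'"
  using assms by (induction P) (auto intro!: divide_right_mono sum_mono)

lemma ev_mono: "(\<And>a. h a \<le> h' a) \<Longrightarrow> ev G P h \<le> ev G P h'"
  by (rule ev_mono_on)

lemma ev_cong_on: "(\<And>a. a \<in> results G P \<Longrightarrow> h a = h' a) \<Longrightarrow> ev G P h = ev G P h'"
  by (intro antisym ev_mono_on) auto

lemma ev_const: "ev G P (\<lambda>_. c) = c"
  by (induction P) (auto simp: field_simps)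

lemma ev_add: "ev G P (\<lambda>a. h a + h' a) = ev G P h + ev G P h'"
  by (induction P) (auto simp: sum.distrib add_divide_distrib)

lemma ev_cmult: "ev G P (\<lambda>a. c * h a) = c * ev G P h"
  by (induction P) (auto simp: sum_distrib_left)

lemma ev_cmult_right: "ev G P (\<lambda>a. h a * c) = ev G P h * c"
  using ev_cmult[of G P c h] by (simp add: mult.commute)

lemma ev_diff: "ev G P (\<lambda>a. h a - h' a) = ev G P h - ev G P h'"
  using ev_add[of G P h "\<lambda>a. (-1) * h' a"] ev_cmult[of G P "-1" h'] by simp

lemma ev_sum: "finite I \<Longrightarrow> ev G P (\<lambda>a. \<Sum>i\<in>I. h i a) = (\<Sum>i\<in>I. ev G P (h i))"
  by (induction I rule: finite_induct) (auto simp: ev_const ev_add)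

lemma ev_divide: "ev G P (\<lambda>a. h a / c) = ev G P h / c"
  using ev_cmult[of G P "1/c" h] by simp

text \<open>Fubini for independent programs. It allows the index sequence to be fixed first and the
  random start to be averaged afterwards.\<close>

lemma ev_commute: "ev G P (\<lambda>a. ev G Q (\<lambda>b. h a b)) = ev G Q (\<lambda>b. ev G P (\<lambda>a. h a b))"
proof (induction P)
  case (Draw m k)
  have "ev G (Draw m k) (\<lambda>a. ev G Q (h a)) = (\<Sum>i\<le>m. ev G Q (\<lambda>b. ev G (k i) (\<lambda>a. h a b))) / real (Suc m)"
    using Draw by auto
  also have "\<dots> = ev G Q (\<lambda>b. (\<Sum>i\<le>m. ev G (k i) (\<lambda>a. h a b)) / real (Suc m))"
    by (simp add: ev_sum ev_divide)
  finally show ?case by simp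
qed auto

lemma ev_nonneg: "(\<And>a. a \<in> results G P \<Longrightarrow> 0 \<le> h a) \<Longrightarrow> 0 \<le> ev G P h"
  using ev_mono_on[of G P "\<lambda>_. 0" h] by (simp add: ev_const)

lemma ev_le_const: "(\<And>a. a \<in> results G P \<Longrightarrow> h a \<le> c) \<Longrightarrow> ev G P h \<le> c"
  using ev_mono_on[of G P h "\<lambda>_. c"] by (simp add: ev_const)

lemma ev_Draw_le:
  assumes "\<And>i. i \<le> m \<Longrightarrow> ev G (k i) h \<le> c"
  shows "ev G (Draw m k) h \<le> c"
proof -
  have "(\<Sum>i\<le>m. ev G (k i) h) \<le> (\<Sum>i\<le>m. c)" using assms by (intro sum_mono) auto
  then show ?thesis by (simp add: field_simps)
qed

lemma ev_bind_le: "(\<And>a. ev G (Q a) h \<le> c) \<Longrightarrow> ev G (bindP P Q) h \<le> c"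
  unfolding ev_bind by (rule ev_le_const)

lemma ev_markov:
  assumes "\<And>a. a \<in> results G P \<Longrightarrow> 0 \<le> h a" "c > 0" "\<And>a. a \<in> results G P \<Longrightarrow> A a \<Longrightarrow> c \<le> h a"
  shows "ev G P (\<lambda>a. of_bool (A a)) \<le> ev G P h / c"
proof -
  have "ev G P (\<lambda>a. of_bool (A a)) \<le> ev G P (\<lambda>a. h a / c)"
    using assms by (intro ev_mono_on) (auto simp: of_bool_def field_simps)
  then show ?thesis by (simp add: ev_divide)
qed

lemma costs_mono: "costs P b \<Longrightarrow> b \<le> b' \<Longrightarrow> costs P b'"
proof (induction P arbitrary: b b')
  case (Ask i x k)
  have "costs (k a) (b' - 1)" for a
    using Ask.IH[of "k a" "b - 1" "b' - 1"] Ask.prems by auto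
  then show ?case using Ask.prems by auto
next
  case (Draw m k)
  then show ?case by (auto intro: Draw.IH[OF rangeI])
qed auto

lemma costs_bind: "costs P b \<Longrightarrow> (\<And>a. costs (Q a) b') \<Longrightarrow> costs (bindP P Q) (b + b')"
proof (induction P arbitrary: b)
  case (Ret a) then show ?case using costs_mono[of "Q a" b' "b + b'"] by simp
next
  case (Ask i x k)
  have "costs (bindP (k a) Q) (b + b' - 1)" for a
  proof -
    have "costs (bindP (k a) Q) (b - 1 + b')"
      using Ask.prems by (intro Ask.IH[OF rangeI]) auto
    moreover have "b > 0" using Ask.prems by simp
    ultimately show ?thesis by simp
  qed
  then show ?case using Ask(2) by auto
next
  case (Draw m k)
  then show ?case using Draw.IH[OF rangeI] by simp
qed

primrec samp :: "nat \<Rightarrow> nat \<Rightarrow> (nat \<Rightarrow> ('q, 'v::real_vector) prog) \<Rightarrow> 'v \<Rightarrow> ('q, 'v) prog" where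
  "samp m 0 X acc = Ret acc"
| "samp m (Suc b) X acc = Draw m (\<lambda>i. bindP (X i) (\<lambda>a. samp m b X (acc + a)))"

lemma costs_samp: "(\<And>i. costs (X i) c) \<Longrightarrow> costs (samp m b X acc) (b * c)"
proof (induction b arbitrary: acc)
  case (Suc b)
  have "costs (bindP (X i) (\<lambda>a. samp m b X (acc + a))) (c + b * c)" for i
    using Suc.prems Suc.IH[OF Suc.prems] by (intro costs_bind)
  then show ?case by simp
qed simp

section \<open>Dimension-free concentration\<close>

text \<open>A smooth substitute for the exponential of the norm: along a martingale with bounded steps in an inner
  product space it grows by a bounded factor per step, whatever the dimension.\<close>

definition Phi :: "real \<Rightarrow> 'v::real_normed_vector \<Rightarrow> real" where
  "Phi l e = exp (sqrt (1 + l\<^sup>2 * (norm e)\<^sup>2))"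

text \<open>Hoeffding's lemma for the uniform distribution on {..m} and an interval of length 2B,
  whose constant (2B)^2/8 is B^2/2.\<close>

lemma mean_exp_le:
  assumes "(\<Sum>i\<le>m. w i) = 0" "\<And>i. i \<le> m \<Longrightarrow> \<bar>w i\<bar> \<le> (B::real)"
  shows "(\<Sum>i\<le>m. exp (w i)) / real (Suc m) \<le> exp (B\<^sup>2 / 2)"
proof -
  interpret p: prob_space "measure_pmf (pmf_of_set {..m})" by (rule prob_space_measure_pmf)
  interpret interval_bounded_random_variable "measure_pmf (pmf_of_set {..m})" w "-B" B
  proof unfold_locales
    show "AE x in measure_pmf (pmf_of_set {..m}). w x \<in> {-B..B}"
      using assms(2) by (auto simp: AE_measure_pmf_iff abs_le_iff minus_le_iff)
  qed auto
  have 1: "measure_pmf.expectation (pmf_of_set {..m}) w = 0"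
    using assms(1) by (simp add: integral_pmf_of_set)
  have "nn_integral (measure_pmf (pmf_of_set {..m})) (\<lambda>x. ennreal (exp (1 * w x))) \<le> ennreal (exp (1\<^sup>2 * (B - - B)\<^sup>2 / 8))"
    by (rule Hoeffdings_lemma_nn_integral_0) (use 1 in auto)
  moreover have "nn_integral (measure_pmf (pmf_of_set {..m})) (\<lambda>x. ennreal (exp (1 * w x)))
      = ennreal (measure_pmf.expectation (pmf_of_set {..m}) (\<lambda>x. exp (w x)))"
    by (subst nn_integral_eq_integral) (auto intro!: integrable_measure_pmf_finite)
  ultimately have "measure_pmf.expectation (pmf_of_set {..m}) (\<lambda>x. exp (w x)) \<le> exp ((B - - B)\<^sup>2 / 8)"
    by simp
  then show ?thesis by (simp add: integral_pmf_of_set power2_eq_square field_simps)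
qed

text \<open>The exponent is expanded around its old value r. Its increment is at most a mean-zero
  term w, bounded by l \<beta> through Cauchy-Schwarz and l |e| \<le> r, plus l^2 \<beta>^2/2;
  Hoeffding's lemma for w costs another l^2 \<beta>^2/2. Only inner products occur, hence no
  dimension.\<close>

lemma Phi_step:
  fixes \<xi> :: "nat \<Rightarrow> 'v::real_inner"
  assumes z: "(\<Sum>i\<le>m. \<xi> i) = 0" and b: "\<And>i. i \<le> m \<Longrightarrow> norm (\<xi> i) \<le> \<beta>" and "l \<ge> 0"
  shows "(\<Sum>i\<le>m. Phi l (e + \<xi> i)) / real (Suc m) \<le> Phi l e * exp (l\<^sup>2 * \<beta>\<^sup>2)"
proof -
  define r where "r = sqrt (1 + l\<^sup>2 * (norm e)\<^sup>2)"
  have r1: "r \<ge> 1" by (simp add: r_def)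
  have r2: "r\<^sup>2 = 1 + l\<^sup>2 * (norm e)\<^sup>2" by (simp add: r_def)
  have rl: "l * norm e \<le> r" 
    by (rule power2_le_imp_le) (use r1 r2 in \<open>auto simp: power_mult_distrib\<close>)
  have \<beta>: "\<beta> \<ge> 0" using b[of 0] norm_ge_zero[of "\<xi> 0"] by linarith
  define w where "w = (\<lambda>i. l\<^sup>2 * inner e (\<xi> i) / r)"
  have w0: "(\<Sum>i\<le>m. w i) = 0"
    using z by (simp add: w_def sum_divide_distrib[symmetric] sum_distrib_left[symmetric] inner_sum_right[symmetric])
  have wb: "\<bar>w i\<bar> \<le> l * \<beta>" if "i \<le> m" for i
  proof -
    have "\<bar>inner e (\<xi> i)\<bar> \<le> norm e * \<beta>"
      using Cauchy_Schwarz_ineq2[of e "\<xi> i"] b[OF that] by (meson mult_left_mono norm_ge_zero order_trans)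
    then have "l\<^sup>2 * \<bar>inner e (\<xi> i)\<bar> \<le> l\<^sup>2 * (norm e * \<beta>)" by (intro mult_left_mono) auto
    also have "\<dots> = (l * norm e) * (l * \<beta>)" by (simp add: power2_eq_square)
    also have "\<dots> \<le> r * (l * \<beta>)" using rl \<open>l \<ge> 0\<close> \<beta> by (intro mult_right_mono) auto
    finally show ?thesis using r1 by (simp add: w_def abs_mult field_simps)
  qed
  have ri: "sqrt (1 + l\<^sup>2 * (norm (e + \<xi> i))\<^sup>2) \<le> r + w i + l\<^sup>2 * \<beta>\<^sup>2 / 2" if "i \<le> m" for i
  proof -
    have nb: "(norm (\<xi> i))\<^sup>2 \<le> \<beta>\<^sup>2" using b[OF that] by (intro power_mono) auto
    have ne: "1 + l\<^sup>2 * (norm (e + \<xi> i))\<^sup>2 = r\<^sup>2 + 2 * r * w i + l\<^sup>2 * (norm (\<xi> i))\<^sup>2"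
      using r1 unfolding r2 w_def power2_norm_eq_inner
      by (simp add: inner_add_left inner_add_right inner_commute algebra_simps)
    \<comment> \<open>Completing the square: r^2 + 2ru \<le> (r + u)^2, so r + u dominates the new
      root once it is known to be nonnegative.\<close>
    define u where "u = w i + l\<^sup>2 * (norm (\<xi> i))\<^sup>2 / (2*r)"
    have "1 + l\<^sup>2 * (norm (e + \<xi> i))\<^sup>2 = r\<^sup>2 + 2 * r * u"
      unfolding ne u_def using r1 by (simp add: field_simps)
    also have "\<dots> \<le> (r + u)\<^sup>2" by (simp add: power2_eq_square algebra_simps)
    finally have le: "1 + l\<^sup>2 * (norm (e + \<xi> i))\<^sup>2 \<le> (r + u)\<^sup>2" .
    have "0 \<le> r\<^sup>2 + 2 * r * u"
      using \<open>1 + _ = r\<^sup>2 + 2 * r * u\<close>[symmetric] by auto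
    then have "0 \<le> r * (r + 2 * u)" by (simp add: power2_eq_square algebra_simps)
    then have "0 \<le> r + 2 * u" using r1 by (simp add: zero_le_mult_iff)
    then have "0 \<le> r + u" using r1 by linarith
    then have "sqrt (1 + l\<^sup>2 * (norm (e + \<xi> i))\<^sup>2) \<le> r + u"
      using le real_le_lsqrt by blast
    also have "l\<^sup>2 * (norm (\<xi> i))\<^sup>2 / (2*r) \<le> l\<^sup>2 * \<beta>\<^sup>2 / 2"
      using nb r1 by (intro frac_le mult_mono) auto
    then have "r + u \<le> r + w i + l\<^sup>2 * \<beta>\<^sup>2 / 2" by (simp add: u_def)
    finally show ?thesis .
  qed
  have "(\<Sum>i\<le>m. Phi l (e + \<xi> i)) / real (Suc m) \<le> (\<Sum>i\<le>m. exp (r + l\<^sup>2 * \<beta>\<^sup>2 / 2) * exp (w i)) / real (Suc m)"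
    unfolding Phi_def exp_add[symmetric] using ri by (intro divide_right_mono sum_mono) (auto simp: algebra_simps)
  also have "\<dots> = exp (r + l\<^sup>2 * \<beta>\<^sup>2 / 2) * ((\<Sum>i\<le>m. exp (w i)) / real (Suc m))"
    by (simp add: sum_distrib_left)
  also have "\<dots> \<le> exp (r + l\<^sup>2 * \<beta>\<^sup>2 / 2) * exp ((l * \<beta>)\<^sup>2 / 2)"
    using mean_exp_le[OF w0 wb] by (intro mult_left_mono) auto
  also have "\<dots> = Phi l e * exp (l\<^sup>2 * \<beta>\<^sup>2)"
    by (simp add: Phi_def r_def exp_add[symmetric] power_mult_distrib)
  finally show ?thesis .
qed

text \<open>The draws are peeled off one at a time. The offset \<open>e\<close> moves by -k \<mu>
  with each of them, which is why it is arbitrary in the statement.\<close>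

lemma ev_samp_Phi:
  fixes val :: "nat \<Rightarrow> 'v::real_inner"
  assumes X: "\<And>i h. i \<le> m \<Longrightarrow> ev G (X i) h = h (val i)"
    and mu: "(\<Sum>i\<le>m. val i) = real (Suc m) *\<^sub>R \<mu>"
    and b: "\<And>i. i \<le> m \<Longrightarrow> norm (val i - \<mu>) \<le> \<beta>" and "l \<ge> 0"
  shows "ev G (samp m n X acc) (\<lambda>S. Phi l (e + k *\<^sub>R (S - real n *\<^sub>R \<mu>)))
    \<le> Phi l (e + k *\<^sub>R acc) * exp (real n * (l * k * \<beta>)\<^sup>2)"
proof (induction n arbitrary: acc e)
  case 0
  then show ?case by simp
next
  case (Suc n)
  define E where "E = exp (real n * (l * k * \<beta>)\<^sup>2)"
  have IH: "ev G (samp m n X (acc + val i)) (\<lambda>S. Phi l (e + k *\<^sub>R (S - real (Suc n) *\<^sub>R \<mu>)))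
     \<le> Phi l ((e + k *\<^sub>R acc) + k *\<^sub>R (val i - \<mu>)) * E" for i
    using Suc.IH[of "acc + val i" "e - k *\<^sub>R \<mu>"] by (simp add: algebra_simps E_def)
  have "ev G (samp m (Suc n) X acc) (\<lambda>S. Phi l (e + k *\<^sub>R (S - real (Suc n) *\<^sub>R \<mu>)))
     = (\<Sum>i\<le>m. ev G (samp m n X (acc + val i)) (\<lambda>S. Phi l (e + k *\<^sub>R (S - real (Suc n) *\<^sub>R \<mu>)))) / real (Suc m)"
    by (auto simp: ev_bind X intro!: sum.cong arg_cong2[where f="(/)"])
  also have "\<dots> \<le> (\<Sum>i\<le>m. Phi l ((e + k *\<^sub>R acc) + k *\<^sub>R (val i - \<mu>)) * E) / real (Suc m)"
    using IH by (intro divide_right_mono sum_mono) auto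
  also have "\<dots> = ((\<Sum>i\<le>m. Phi l ((e + k *\<^sub>R acc) + k *\<^sub>R (val i - \<mu>))) / real (Suc m)) * E"
    by (simp add: sum_distrib_right)
  also have "\<dots> \<le> (Phi l (e + k *\<^sub>R acc) * exp (l\<^sup>2 * (\<bar>k\<bar> * \<beta>)\<^sup>2)) * E"
  proof (intro mult_right_mono Phi_step)
    show "(\<Sum>i\<le>m. k *\<^sub>R (val i - \<mu>)) = 0"
      using mu by (simp add: scaleR_sum_right[symmetric] sum_subtractf sum_constant_scaleR)
  qed (use b \<open>l \<ge> 0\<close> in \<open>auto simp: E_def intro!: mult_left_mono\<close>)
  also have "\<dots> = Phi l (e + k *\<^sub>R acc) * exp (real (Suc n) * (l * k * \<beta>)\<^sup>2)"
    by (simp add: E_def exp_add[symmetric] algebra_simps power_mult_distrib)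
  finally show ?case .
qed

lemma Phi_pos: "Phi l e > 0" by (simp add: Phi_def)

lemma Phi_zero: "Phi l 0 = exp 1" by (simp add: Phi_def)

lemma Phi_ge: "l \<ge> 0 \<Longrightarrow> exp (l * norm e) \<le> Phi l e"
  unfolding Phi_def by (auto intro!: real_le_rsqrt simp: power_mult_distrib)

section \<open>Oja's iteration\<close>

lemma norm_sub_sq:
  "(norm (z - e *\<^sub>R w))\<^sup>2 = (norm z)\<^sup>2 - 2 * e * inner z w + e\<^sup>2 * (norm (w::'a::real_inner))\<^sup>2"
  unfolding power2_norm_eq_inner
  by (simp add: inner_diff_left inner_diff_right inner_commute algebra_simps power2_eq_square)

text \<open>The bits of k code the signs, so that one uniform draw below 2^d gives a random sign
  vector and changing a sign is \<open>flip_bit\<close>.\<close>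

definition sign_vec :: "nat \<Rightarrow> (nat \<Rightarrow> 'v::real_vector) \<Rightarrow> nat \<Rightarrow> 'v" where
  "sign_vec d b k = (\<Sum>j<d. (if bit k j then 1 else - 1) *\<^sub>R b j)"

definition rademacher :: "nat \<Rightarrow> (nat \<Rightarrow> 'v::real_vector) \<Rightarrow> ('q, 'v) prog" where
  "rademacher d b = Draw (2 ^ d - 1) (\<lambda>k. Ret (sign_vec d b k))"

text \<open>\<open>H\<close> is the mean Hessian with smallest eigenvalue \<open>- lm\<close>, the
  \<open>A i\<close> are its linear components and the \<open>hv i\<close> the finite differences
  that are actually computed. The relative error \<omega> has to beat the factor T 2^T by which
  errors may accumulate, and \<eta> lm T has to beat a multiple of ln d because the bounds on the
  start and on the growth both lose powers of d.\<close>

locale oja =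
  fixes m d :: nat and A :: "nat \<Rightarrow> 'v::real_inner \<Rightarrow> 'v" and H :: "'v \<Rightarrow> 'v" and hv :: "nat \<Rightarrow> 'v \<Rightarrow> 'v"
    and c \<eta> \<omega> lm :: real and u :: 'v and b :: "nat \<Rightarrow> 'v" and a :: "nat \<Rightarrow> real" and T :: nat
  assumes lin_A: "\<And>i. i \<le> m \<Longrightarrow> linear (A i)"
    and A_le: "\<And>i y. i \<le> m \<Longrightarrow> norm (A i y) \<le> c * norm y"
    and mean_A: "\<And>y. (\<Sum>i\<le>m. A i y) = real (Suc m) *\<^sub>R H y"
    and hv_A: "\<And>i y. i \<le> m \<Longrightarrow> norm (hv i y - A i y) \<le> \<omega> * norm y"
    and u1: "norm u = 1" and Hu: "H u = - (lm *\<^sub>R u)" and H_ge: "\<And>z. inner z (H z) \<ge> - lm * (norm z)\<^sup>2"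
    and u_eq: "u = (\<Sum>j<d. a j *\<^sub>R b j)" and a1: "\<And>j. \<bar>a j\<bar> \<le> 1" and b1: "\<And>j. norm (b j) \<le> 1"
    and lam: "lm > 0" and c1: "c \<ge> 1" and eta: "\<eta> > 0" "\<eta>\<^sup>2 * c\<^sup>2 * real T \<le> 1/4" "\<eta> * c \<le> 1/2"
    and T: "T > 0" and om: "\<omega> \<ge> 0" "real T * 2 ^ T * \<omega> * (4 * (real d)\<^sup>2) \<le> 1" and d: "d \<ge> 1"
    and gap: "\<eta> * lm * real T \<ge> 38 + 20 * ln (real d)"
begin

lemma eta_le: "\<eta> \<le> 1/2"
proof -
  have "\<eta> * 1 \<le> \<eta> * c" using c1 eta by (intro mult_left_mono) auto
  then show ?thesis using eta by linarith
qed

lemma om_le: "real T * 2 ^ T * \<omega> \<le> 1 / (4 * (real d)\<^sup>2)"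
  using om(2) d by (simp add: field_simps)

lemma T_om: "real T * \<omega> \<le> 1/8" "\<omega> \<le> 1/8"
proof -
  have T1: "real T \<ge> 1" using T by simp
  have "(2::real) ^ 1 \<le> 2 ^ T" using T by (intro power_increasing) auto
  then have "(real T * \<omega>) * (2 * 4) \<le> (real T * \<omega>) * (2 ^ T * (4 * (real d)\<^sup>2))"
    using om(1) d by (intro mult_left_mono mult_mono) (auto simp: power2_eq_square intro: mult_mono[of 1 "real d" 1 "real d", simplified])
  then show *: "real T * \<omega> \<le> 1/8" using om(2) by (simp add: algebra_simps)
  have "1 * \<omega> \<le> real T * \<omega>" using T1 om by (intro mult_right_mono) auto
  with * show "\<omega> \<le> 1/8" by simp
qed

lemma lam_le: "lm \<le> c"
proof -
  have "norm ((\<Sum>i\<le>m. A i u)) \<le> (\<Sum>i\<le>m. c * norm u)"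
    using A_le by (intro sum_norm_le) auto
  then have "real (Suc m) * norm (H u) \<le> real (Suc m) * c"
    by (simp add: mean_A u1)
  then have "norm (H u) \<le> c" by (simp only: mult_le_cancel_left_pos of_nat_0_less_iff zero_less_Suc)
  then show ?thesis using lam by (simp add: Hu u1)
qed

text \<open>Drawing the whole index sequence in advance makes the exact and the perturbed recursion
  functions of the same list, so that they can be compared path by path.\<close>

primrec idx :: "nat \<Rightarrow> ('q, nat list) prog" where
  "idx 0 = Ret []"
| "idx (Suc t) = Draw m (\<lambda>i. bindP (idx t) (\<lambda>l. Ret (i # l)))"

lemma results_idx: "l \<in> results G (idx t) \<Longrightarrow> set l \<subseteq> {..m} \<and> length l = t"
proof (induction t arbitrary: l)
  case (Suc t)
  then obtain i l' where "i \<le> m" "l' \<in> results G (idx t)" "l = i # l'" by (auto simp: results_bind)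
  with Suc.IH[of l'] show ?case by auto
qed simp

lemma ev_idx_Suc: "ev G (idx (Suc t)) h = (\<Sum>i\<le>m. ev G (idx t) (\<lambda>l. h (i # l))) / real (Suc m)"
  by (simp add: ev_bind)

primrec run :: "'v \<Rightarrow> nat list \<Rightarrow> 'v" where
  "run y [] = y" | "run y (i # l) = run (y - \<eta> *\<^sub>R hv i y) l"

primrec lin :: "'v \<Rightarrow> nat list \<Rightarrow> 'v" where
  "lin y [] = y" | "lin y (i # l) = lin (y - \<eta> *\<^sub>R A i y) l"

primrec tot :: "('v \<Rightarrow> real) \<Rightarrow> 'v \<Rightarrow> nat list \<Rightarrow> real" where
  "tot g y [] = 0" | "tot g y (i # l) = g y + tot g (y - \<eta> *\<^sub>R hv i y) l"

definition ray :: "'v \<Rightarrow> real" where "ray y = - inner y (H y) / (norm y)\<^sup>2"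

lemma ray_le: "ray y \<le> lm"
  using H_ge[of y] lam by (auto simp: ray_def divide_simps)

lemma lin_linear: "set l \<subseteq> {..m} \<Longrightarrow> linear (\<lambda>y. lin y l)"
proof (induction l)
  case (Cons i l)
  have "linear (\<lambda>y. y - \<eta> *\<^sub>R A i y)"
    using lin_A[of i] Cons.prems by (intro linear_compose_sub linear_ident linear_compose_scale_right) auto
  from linear_compose[OF this Cons.IH] Cons.prems show ?case by (simp add: o_def)
qed (simp add: linear_ident)

text \<open>Turns the sum over all stopping times into an additive functional along a single path of
  full length.\<close>

lemma sum_tot: "(\<Sum>t<n. ev G (idx t) (\<lambda>l. g (run y l))) = ev G (idx n) (tot g y)"
proof (induction n arbitrary: y)
  case (Suc n)
  have "(\<Sum>t<Suc n. ev G (idx t) (\<lambda>l. g (run y l))) =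
     g y + (\<Sum>t<n. ev G (idx (Suc t)) (\<lambda>l. g (run y l)))"
    by (simp add: sum.lessThan_Suc_shift del: sum.lessThan_Suc idx.simps(2))
  also have "\<dots> = g y + (\<Sum>i\<le>m. \<Sum>t<n. ev G (idx t) (\<lambda>l. g (run (y - \<eta> *\<^sub>R hv i y) l))) / real (Suc m)"
    unfolding ev_idx_Suc by (subst sum.swap) (simp add: sum_divide_distrib)
  also have "\<dots> = g y + (\<Sum>i\<le>m. ev G (idx n) (tot g (y - \<eta> *\<^sub>R hv i y))) / real (Suc m)"
    by (simp add: Suc)
  also have "\<dots> = ev G (idx (Suc n)) (tot g y)"
    unfolding ev_idx_Suc by (simp add: ev_add ev_const sum.distrib add_divide_distrib)
  finally show ?case .
qed (simp add: ev_const)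

lemma mean_inner: "(\<Sum>i\<le>m. inner y (A i y)) = real (Suc m) * inner y (H y)"
  using mean_A[of y] by (metis inner_scaleR_right inner_sum_right)

section \<open>Growth of the linear recursion with constant probability\<close>

lemma ev_lin_sq: "ev G (idx t) (\<lambda>l. (norm (lin z l))\<^sup>2) \<le> (1 + 2 * \<eta> * lm + \<eta>\<^sup>2 * c\<^sup>2) ^ t * (norm z)\<^sup>2"
proof (induction t arbitrary: z)
  case (Suc t)
  define B where "B = 1 + 2 * \<eta> * lm + \<eta>\<^sup>2 * c\<^sup>2"
  have B: "B \<ge> 0" using eta lam by (simp add: B_def)
  have le: "(norm (z - \<eta> *\<^sub>R A i z))\<^sup>2 \<le> (1 + \<eta>\<^sup>2 * c\<^sup>2) * (norm z)\<^sup>2 - 2 * \<eta> * inner z (A i z)" if "i \<le> m" for i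
  proof -
    have "(norm (A i z))\<^sup>2 \<le> (c * norm z)\<^sup>2" using A_le[OF that] by (intro power_mono) auto
    then have "\<eta>\<^sup>2 * (norm (A i z))\<^sup>2 \<le> \<eta>\<^sup>2 * (c * norm z)\<^sup>2" by (intro mult_left_mono) auto
    then show ?thesis by (simp add: norm_sub_sq algebra_simps)
  qed
  have "ev G (idx (Suc t)) (\<lambda>l. (norm (lin z l))\<^sup>2) \<le> (\<Sum>i\<le>m. B ^ t * (norm (z - \<eta> *\<^sub>R A i z))\<^sup>2) / real (Suc m)"
    unfolding ev_idx_Suc lin.simps using Suc by (intro divide_right_mono sum_mono) (auto simp: B_def)
  also have "\<dots> \<le> (\<Sum>i\<le>m. B ^ t * ((1 + \<eta>\<^sup>2 * c\<^sup>2) * (norm z)\<^sup>2 - 2 * \<eta> * inner z (A i z))) / real (Suc m)"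
    using le B by (intro divide_right_mono sum_mono mult_left_mono) auto
  also have "\<dots> = B ^ t * ((1 + \<eta>\<^sup>2 * c\<^sup>2) * (norm z)\<^sup>2 - 2 * \<eta> * inner z (H z))"
  proof -
    have "(\<Sum>i\<le>m. ((1 + \<eta>\<^sup>2 * c\<^sup>2) * (norm z)\<^sup>2 - 2 * \<eta> * inner z (A i z)))
       = real (Suc m) * ((1 + \<eta>\<^sup>2 * c\<^sup>2) * (norm z)\<^sup>2 - 2 * \<eta> * inner z (H z))"
      by (simp only: sum_subtractf sum_distrib_left[symmetric] mean_inner) (simp add: algebra_simps)
    then show ?thesis by (simp only: sum_distrib_left[symmetric]) simp
  qed
  also have "\<dots> \<le> B ^ t * (B * (norm z)\<^sup>2)"
  proof (intro mult_left_mono)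
    have "2 * \<eta> * (- lm * (norm z)\<^sup>2) \<le> 2 * \<eta> * inner z (H z)" using H_ge[of z] eta by (intro mult_left_mono) auto
    moreover have "B * (norm z)\<^sup>2 = (1 + \<eta>\<^sup>2 * c\<^sup>2) * (norm z)\<^sup>2 - 2 * \<eta> * (- lm * (norm z)\<^sup>2)"
      by (simp add: B_def algebra_simps)
    ultimately show "(1 + \<eta>\<^sup>2 * c\<^sup>2) * (norm z)\<^sup>2 - 2 * \<eta> * inner z (H z) \<le> B * (norm z)\<^sup>2"
      by linarith
  qed (use B in auto)
  finally show ?case by (simp add: B_def algebra_simps)
qed simp

text \<open>By linearity in the start the first step can be averaged inside \<open>lin\<close>, and
  the mean step multiplies the eigenvector u by 1 + \<eta> lm.\<close>

lemma ev_lin_u: "ev G (idx t) (\<lambda>l. inner u (lin u l)) = (1 + \<eta> * lm) ^ t"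
proof (induction t)
  case (Suc t)
  have "ev G (idx (Suc t)) (\<lambda>l. inner u (lin u l)) =
     ev G (idx t) (\<lambda>l. (\<Sum>i\<le>m. inner u (lin (u - \<eta> *\<^sub>R A i u) l)) / real (Suc m))"
    unfolding ev_idx_Suc by (simp add: ev_divide ev_sum)
  also have "\<dots> = ev G (idx t) (\<lambda>l. (1 + \<eta> * lm) * inner u (lin u l))"
  proof (rule ev_cong_on)
    fix l assume "l \<in> results G (idx t)"
    then have L: "linear (\<lambda>y. lin y l)" using results_idx by (intro lin_linear) auto
    have "(\<Sum>i\<le>m. inner u (lin (u - \<eta> *\<^sub>R A i u) l)) = inner u (lin (\<Sum>i\<le>m. u - \<eta> *\<^sub>R A i u) l)"
      by (simp add: linear_sum[OF L] inner_sum_right)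
    also have "(\<Sum>i\<le>m. u - \<eta> *\<^sub>R A i u) = real (Suc m) *\<^sub>R ((1 + \<eta> * lm) *\<^sub>R u)"
      by (simp only: sum_subtractf scaleR_sum_right[symmetric] mean_A Hu sum_constant_scaleR card_atMost)
         (simp add: algebra_simps)
    finally show "(\<Sum>i\<le>m. inner u (lin (u - \<eta> *\<^sub>R A i u) l)) / real (Suc m) = (1 + \<eta> * lm) * inner u (lin u l)"
      by (simp only: linear_scale[OF L] inner_scaleR_right) simp
  qed
  finally show ?case by (simp add: ev_cmult Suc)
qed (simp add: u1 power2_norm_eq_inner[symmetric])

definition gr :: real where "gr = (1 + \<eta> * lm) ^ T"

lemma gr_ge1: "gr \<ge> 1" unfolding gr_def using eta lam by (intro one_le_power) auto

text \<open>A Paley-Zygmund argument: the mean is \<open>gr\<close>, and the second moment is at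
  most 4/3 gr^2 because \<eta>^2 c^2 T \<le> 1/4. Half the mean is therefore exceeded with
  probability at least (1/4)(3/4).\<close>

lemma prob_lin_u: "ev G (idx T) (\<lambda>l. of_bool (inner u (lin u l) \<ge> gr / 2)) \<ge> 3/16"
proof -
  define m2 where "m2 = (1 + 2 * \<eta> * lm + \<eta>\<^sup>2 * c\<^sup>2) ^ T"
  have m2: "m2 > 0" unfolding m2_def using eta lam by (intro zero_less_power) (auto intro!: add_pos_nonneg)
  \<comment> \<open>The weight for which the second moment term m2/(2 al) becomes gr/4, leaving a
    quarter of the mean for the event.\<close>
  define al where "al = 2 * m2 / gr"
  have al: "al > 0" using m2 gr_ge1 by (simp add: al_def)
  have "gr = ev G (idx T) (\<lambda>l. inner u (lin u l))" by (simp add: ev_lin_u gr_def)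
  also have "\<dots> \<le> ev G (idx T) (\<lambda>l. gr / 2 + ((al / 2) * of_bool (inner u (lin u l) \<ge> gr / 2) + 1 / (2 * al) * (norm (lin u l))\<^sup>2))"
  proof (rule ev_mono)
    fix l
    define U where "U = inner u (lin u l)"
    have "\<bar>U\<bar> \<le> norm (lin u l)" using Cauchy_Schwarz_ineq2[of u "lin u l"] by (simp add: U_def u1)
    then have Us: "U\<^sup>2 \<le> (norm (lin u l))\<^sup>2" using power_mono[of "\<bar>U\<bar>" "norm (lin u l)" 2] by simp
    have "0 \<le> (al - U)\<^sup>2" by simp
    then have "2 * al * U \<le> al\<^sup>2 + U\<^sup>2" by (simp add: power2_eq_square algebra_simps)
    then have "U \<le> al / 2 + 1 / (2 * al) * U\<^sup>2" using al by (simp add: field_simps power2_eq_square)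
    also have "1 / (2 * al) * U\<^sup>2 \<le> 1 / (2 * al) * (norm (lin u l))\<^sup>2" using Us al by (intro mult_left_mono) auto
    finally have 1: "U \<le> al / 2 + 1 / (2 * al) * (norm (lin u l))\<^sup>2" by simp
    have "0 \<le> 1 / (2 * al) * (norm (lin u l))\<^sup>2" using al by simp
    with 1 show "inner u (lin u l) \<le> gr / 2 + ((al / 2) * of_bool (inner u (lin u l) \<ge> gr / 2) + 1 / (2 * al) * (norm (lin u l))\<^sup>2)"
      unfolding U_def[symmetric] using gr_ge1 by (cases "U \<ge> gr / 2") auto
  qed
  also have "\<dots> = gr / 2 + (al / 2) * ev G (idx T) (\<lambda>l. of_bool (inner u (lin u l) \<ge> gr / 2)) + 1 / (2 * al) * ev G (idx T) (\<lambda>l. (norm (lin u l))\<^sup>2)"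
    by (simp only: ev_add ev_const ev_cmult add.assoc)
  also have "1 / (2 * al) * ev G (idx T) (\<lambda>l. (norm (lin u l))\<^sup>2) \<le> 1 / (2 * al) * m2"
    using ev_lin_sq[of G T u] al by (intro mult_left_mono) (auto simp: m2_def u1)
  also have "1 / (2 * al) * m2 = gr / 4" using m2 gr_ge1 by (simp add: al_def)
  finally have "gr / 4 \<le> (al / 2) * ev G (idx T) (\<lambda>l. of_bool (inner u (lin u l) \<ge> gr / 2))" by simp
  then have 1: "gr\<^sup>2 / (4 * m2) \<le> ev G (idx T) (\<lambda>l. of_bool (inner u (lin u l) \<ge> gr / 2))"
    using m2 gr_ge1 by (simp add: al_def field_simps power2_eq_square)
  have "m2 \<le> ((1 + \<eta> * lm)\<^sup>2 * (1 + \<eta>\<^sup>2 * c\<^sup>2)) ^ T"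
    unfolding m2_def
  proof (intro power_mono)
    have "0 \<le> \<eta>\<^sup>2 * lm\<^sup>2" "0 \<le> (2 * \<eta> * lm + \<eta>\<^sup>2 * lm\<^sup>2) * (\<eta>\<^sup>2 * c\<^sup>2)" using eta lam by auto
    then show "1 + 2 * \<eta> * lm + \<eta>\<^sup>2 * c\<^sup>2 \<le> (1 + \<eta> * lm)\<^sup>2 * (1 + \<eta>\<^sup>2 * c\<^sup>2)"
      by (simp add: power2_eq_square algebra_simps)
  qed (use eta lam in auto)
  also have "\<dots> = gr\<^sup>2 * (1 + \<eta>\<^sup>2 * c\<^sup>2) ^ T" by (simp add: gr_def power_mult_distrib power_mult[symmetric] mult.commute)
  also have "(1 + \<eta>\<^sup>2 * c\<^sup>2) ^ T \<le> exp (\<eta>\<^sup>2 * c\<^sup>2) ^ T" by (intro power_mono exp_ge_add_one_self) auto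
  also have "exp (\<eta>\<^sup>2 * c\<^sup>2) ^ T = exp (\<eta>\<^sup>2 * c\<^sup>2 * real T)" by (simp add: exp_of_nat_mult[symmetric] mult.commute)
  also have "\<dots> \<le> exp (1/4)" using eta by simp
  also have "exp (1/4 :: real) \<le> 4/3" using exp_bound[of "1/4::real"] by (simp add: power2_eq_square)
  finally have "m2 \<le> gr\<^sup>2 * (4/3)" using gr_ge1 by simp
  then have "3/16 \<le> gr\<^sup>2 / (4 * m2)" using m2 by (simp add: field_simps)
  with 1 show ?thesis by linarith
qed

section \<open>Random sign vectors as starting points\<close>

abbreviation sgnv :: "nat \<Rightarrow> 'v" where "sgnv \<equiv> sign_vec d b"

abbreviation rad :: "('q, 'v) prog" where "rad \<equiv> rademacher d b"

lemma norm_sgnv: "norm (sgnv k) \<le> real d"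
proof -
  have "norm (sgnv k) \<le> (\<Sum>j<d. 1)"
    unfolding sign_vec_def using b1 by (intro sum_norm_le) auto
  then show ?thesis by simp
qed

lemma norm_rad: "y \<in> results G rad \<Longrightarrow> norm y \<le> real d"
  by (auto simp: rademacher_def norm_sgnv)

text \<open>Flipping the j-th sign changes the image under a linear map by twice the image of the j-th basis
  vector, so the two images cannot both be short.\<close>

lemma ev_rad:
  assumes L: "linear Z" and j: "j < d" "norm (Z (b j)) \<ge> \<theta>"
  shows "ev G rad (\<lambda>y. of_bool (norm (Z y) \<ge> \<theta>)) \<ge> 1/2"
proof -
  define N where "N = {..<(2::nat)^d}"
  have eqN: "{..2 ^ d - Suc 0} = N"
    unfolding N_def by (metis One_nat_def Suc_pred' lessThan_Suc_atMost pos2 zero_less_power)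
  define P where "P = (\<lambda>k. of_bool (norm (Z (sgnv k)) \<ge> \<theta>) :: real)"
  have fl: "flip_bit j k \<in> N" if "k \<in> N" for k
  proof -
    have "take_bit d (flip_bit j k) = flip_bit j k"
      using that j by (simp add: N_def take_bit_flip_bit_eq take_bit_nat_eq_self)
    then show ?thesis by (metis N_def lessThan_iff take_bit_nat_less_exp)
  qed
  have ff: "flip_bit j (flip_bit j k) = k" for k :: nat
    by (rule bit_eqI) (auto simp: bit_flip_bit_iff)
  have "bij_betw (flip_bit j) N N"
    by (rule bij_betw_byWitness[where f' = "flip_bit j"]) (use fl ff in auto)
  then have "(\<Sum>k\<in>N. P k) = (\<Sum>k\<in>N. P (flip_bit j k))"
    by (rule sum.reindex_bij_betw[symmetric])
  moreover have "P k + P (flip_bit j k) \<ge> 1" for k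
  proof -
    define s where "s = (if bit k j then 1 else - 1 :: real)"
    have "sgnv k - sgnv (flip_bit j k) = (\<Sum>i<d. (if i = j then (2 * s) *\<^sub>R b j else 0))"
      unfolding sign_vec_def sum_subtractf[symmetric]
      by (rule sum.cong) (auto simp: bit_flip_bit_iff s_def scaleR_2)
    also have "\<dots> = (2 * s) *\<^sub>R b j" using j by simp
    finally have "Z (sgnv k) - Z (sgnv (flip_bit j k)) = (2 * s) *\<^sub>R Z (b j)"
      using linear_diff[OF L] linear_scale[OF L] by metis
    then have "2 * norm (Z (b j)) = norm (Z (sgnv k) - Z (sgnv (flip_bit j k)))"
      by (simp add: s_def)
    also have "\<dots> \<le> norm (Z (sgnv k)) + norm (Z (sgnv (flip_bit j k)))" by (rule norm_triangle_ineq4)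
    finally show ?thesis using j by (auto simp: P_def)
  qed
  then have "(\<Sum>k\<in>N. 1) \<le> (\<Sum>k\<in>N. P k + P (flip_bit j k))" by (intro sum_mono)
  ultimately have "real (card N) \<le> 2 * (\<Sum>k\<in>N. P k)" by (simp add: sum.distrib)
  then show ?thesis by (simp add: rademacher_def eqN P_def N_def field_simps)
qed

text \<open>Fix an index sequence on which u grows. As u combines the basis vectors with
  coefficients at most 1, one of them grows by a 1/d share, and then at least half of the sign
  vectors do by \<open>ev_rad\<close>. This gives (1/2)(3/16).\<close>

lemma prob_lin: "ev G rad (\<lambda>y. ev G (idx T) (\<lambda>l. of_bool (norm (lin y l) \<ge> gr / (2 * real d)))) \<ge> 3/32"
proof -
  have "ev G rad (\<lambda>y. ev G (idx T) (\<lambda>l. of_bool (norm (lin y l) \<ge> gr / (2 * real d))))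
     = ev G (idx T) (\<lambda>l. ev G rad (\<lambda>y. of_bool (norm (lin y l) \<ge> gr / (2 * real d))))"
    by (rule ev_commute)
  also have "\<dots> \<ge> ev G (idx T) (\<lambda>l. 1/2 * of_bool (inner u (lin u l) \<ge> gr / 2))"
  proof (rule ev_mono_on)
    fix l assume "l \<in> results G (idx T)"
    then have L: "linear (\<lambda>y. lin y l)" using results_idx by (intro lin_linear) auto
    show "1/2 * of_bool (inner u (lin u l) \<ge> gr / 2) \<le> ev G rad (\<lambda>y. of_bool (norm (lin y l) \<ge> gr / (2 * real d)))"
    proof (cases "inner u (lin u l) \<ge> gr / 2")
      case True
      have "gr / 2 \<le> norm (lin u l)" using True norm_cauchy_schwarz[of u "lin u l"] by (simp add: u1)
      have "\<exists>j<d. norm (lin (b j) l) \<ge> gr / (2 * real d)"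
      proof (rule ccontr)
        assume "\<not> ?thesis"
        then have lt: "norm (lin (b j) l) < gr / (2 * real d)" if "j < d" for j using that by force
        have "norm (lin u l) = norm (\<Sum>j<d. a j *\<^sub>R lin (b j) l)"
          by (subst u_eq) (simp add: linear_sum[OF L] linear_scale[OF L])
        also have "\<dots> \<le> (\<Sum>j<d. norm (lin (b j) l))"
          using a1 by (intro sum_norm_le) (auto intro: mult_left_le_one_le)
        also have "\<dots> < (\<Sum>j<d. gr / (2 * real d))"
          using lt d by (intro sum_strict_mono) (auto simp: lessThan_empty_iff)
        also have "\<dots> = gr / 2" using d by simp
        finally show False using \<open>gr / 2 \<le> norm (lin u l)\<close> by simp
      qed
      then obtain j where "j < d" "norm (lin (b j) l) \<ge> gr / (2 * real d)" by blast
      from ev_rad[OF L this] show ?thesis using True by simp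
    next
      case False
      then show ?thesis by (auto intro!: ev_nonneg)
    qed
  qed
  finally show ?thesis using prob_lin_u[of G] unfolding ev_cmult by linarith
qed

lemma norm_lin: "set l \<subseteq> {..m} \<Longrightarrow> norm (lin z l) \<le> 2 ^ length l * norm z"
proof (induction l arbitrary: z)
  case (Cons i l)
  have "norm (z - \<eta> *\<^sub>R A i z) \<le> norm z + \<eta> * (c * norm z)"
    using A_le[of i z] Cons.prems eta by (intro order_trans[OF norm_triangle_ineq4]) (auto intro!: mult_left_mono)
  also have "\<dots> \<le> 2 * norm z"
  proof -
    have "\<eta> * (c * norm z) \<le> 1/2 * norm z" using eta unfolding mult.assoc[symmetric] by (intro mult_right_mono) auto
    then show ?thesis using norm_ge_zero[of z] by linarith
  qed
  finally have "norm (z - \<eta> *\<^sub>R A i z) \<le> 2 * norm z" .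
  then have "2 ^ length l * norm (z - \<eta> *\<^sub>R A i z) \<le> 2 ^ length l * (2 * norm z)" by (intro mult_left_mono) auto
  also have "\<dots> = 2 ^ length (i # l) * norm z" by simp
  finally have fin: "2 ^ length l * norm (z - \<eta> *\<^sub>R A i z) \<le> 2 ^ length (i # l) * norm z" .
  from Cons.prems have "set l \<subseteq> {..m}" by auto
  from order_trans[OF Cons.IH[OF this] fin] show ?case by simp
qed simp

text \<open>Each step injects an error of at most \<omega> times the current norm, and both
  recursions at most double norms. The crude factor T 2^T is harmless because the finite-difference
  length, and with it \<omega>, can be chosen exponentially small.\<close>

lemma run_lin: "set l \<subseteq> {..m} \<Longrightarrow> norm (run y l - lin y l) \<le> real (length l) * 2 ^ length l * \<omega> * norm y"
proof (induction l arbitrary: y)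
  case (Cons i l)
  define y1 where "y1 = y - \<eta> *\<^sub>R hv i y"
  define y2 where "y2 = y - \<eta> *\<^sub>R A i y"
  have im: "i \<le> m" using Cons.prems by auto
  have L: "linear (\<lambda>y. lin y l)" using Cons.prems by (intro lin_linear) auto
  have "norm (y1 - y2) = \<eta> * norm (hv i y - A i y)" using eta by (simp add: y1_def y2_def norm_minus_commute algebra_simps flip: scaleR_diff_right)
  also have "\<dots> \<le> 1 * (\<omega> * norm y)" using hv_A[OF im] eta_le eta om by (intro mult_mono) auto
  finally have d12: "norm (y1 - y2) \<le> \<omega> * norm y" by simp
  have "norm (hv i y) \<le> (c + \<omega>) * norm y"
    using norm_triangle_ineq[of "A i y" "hv i y - A i y"] A_le[OF im, of y] hv_A[OF im, of y] by (simp add: algebra_simps)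
  then have "norm y1 \<le> norm y + \<eta> * ((c + \<omega>) * norm y)"
    unfolding y1_def using eta by (intro order_trans[OF norm_triangle_ineq4]) (auto intro!: mult_left_mono)
  also have "\<eta> * ((c + \<omega>) * norm y) \<le> 1 * norm y"
  proof -
    have "\<eta> * \<omega> \<le> 1/2 * 1" using eta eta_le T_om om by (intro mult_mono) auto
    then show ?thesis using eta unfolding mult.assoc[symmetric] by (intro mult_right_mono) (auto simp: algebra_simps)
  qed
  finally have y1: "norm y1 \<le> 2 * norm y" by simp
  have "norm (run y1 l - lin y2 l) \<le> norm (run y1 l - lin y1 l) + norm (lin (y1 - y2) l)"
    using norm_triangle_ineq[of "run y1 l - lin y1 l" "lin (y1 - y2) l"] by (simp add: linear_diff[OF L])
  also have "\<dots> \<le> real (length l) * 2 ^ length l * \<omega> * norm y1 + 2 ^ length l * norm (y1 - y2)"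
    using Cons by (intro add_mono norm_lin) auto
  also have "\<dots> \<le> real (length l) * 2 ^ length l * \<omega> * (2 * norm y) + 2 ^ length l * (\<omega> * norm y)"
    using y1 d12 om by (intro add_mono mult_left_mono) auto
  also have "\<dots> \<le> real (length l) * 2 ^ length l * \<omega> * (2 * norm y) + 2 ^ Suc (length l) * (\<omega> * norm y)"
    using om by simp
  finally show ?case by (simp add: y1_def y2_def algebra_simps)
qed simp

lemma prob_run:
  "ev G rad (\<lambda>y. ev G (idx T) (\<lambda>l. of_bool (norm (run y l) \<ge> gr / (4 * real d)))) \<ge> 3/32"
proof (rule order_trans[OF prob_lin[of G]], intro ev_mono_on)
  fix y l assume y: "y \<in> results G rad" and l: "l \<in> results G (idx T)"
  have "norm (run y l - lin y l) \<le> real T * 2 ^ T * \<omega> * norm y"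
    using run_lin[of l y] results_idx[OF l] by auto
  also have "\<dots> \<le> real T * 2 ^ T * \<omega> * real d" using norm_rad[OF y] om by (intro mult_left_mono) auto
  also have "\<dots> \<le> 1 / (4 * (real d)\<^sup>2) * real d" using om_le by (intro mult_right_mono) auto
  also have "\<dots> = 1 / (4 * real d)" using d by (simp add: power2_eq_square)
  also have "\<dots> \<le> gr / (4 * real d)" using gr_ge1 by (intro divide_right_mono) auto
  finally have *: "norm (run y l - lin y l) \<le> gr / (4 * real d)" .
  have "norm (lin y l) \<le> norm (run y l) + norm (run y l - lin y l)" 
    by (metis add.commute norm_triangle_sub norm_minus_commute)
  moreover have "gr / (2 * real d) = gr / (4 * real d) + gr / (4 * real d)" by simp
  ultimately have "norm (lin y l) \<ge> gr / (2 * real d) \<Longrightarrow> norm (run y l) \<ge> gr / (4 * real d)" using * by linarith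
  then show "(of_bool (norm (lin y l) \<ge> gr / (2 * real d)) :: real) \<le> of_bool (norm (run y l) \<ge> gr / (4 * real d))"
    by auto
qed

text \<open>One step multiplies the mean squared norm by at most 1 + x + 2 \<eta>
  \<open>ray y\<close>, which is below the exponential of x + 2 \<eta> \<open>ray y\<close>.
  Discounting by the quotients met on the way leaves exp x per step, so a long final vector must
  have collected large quotients.\<close>

lemma ev_run_sq:
  "ev G (idx t) (\<lambda>l. (norm (run y l))\<^sup>2 * exp (- (2 * \<eta> * tot ray y l)))
     \<le> (norm y)\<^sup>2 * exp (real t * (2 * \<eta> * \<omega> + \<eta>\<^sup>2 * (c + \<omega>)\<^sup>2))"
proof (induction t arbitrary: y)
  case (Suc t)
  define x where "x = 2 * \<eta> * \<omega> + \<eta>\<^sup>2 * (c + \<omega>)\<^sup>2"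
  have le: "(norm (y - \<eta> *\<^sub>R hv i y))\<^sup>2 \<le> (1 + x) * (norm y)\<^sup>2 - 2 * \<eta> * inner y (A i y)" if i: "i \<le> m" for i
  proof -
    have nh: "norm (hv i y) \<le> (c + \<omega>) * norm y"
      using norm_triangle_ineq[of "A i y" "hv i y - A i y"] A_le[OF i, of y] hv_A[OF i, of y] by (simp add: algebra_simps)
    have "(norm (hv i y))\<^sup>2 \<le> ((c + \<omega>) * norm y)\<^sup>2" using nh by (intro power_mono) auto
    then have 1: "\<eta>\<^sup>2 * (norm (hv i y))\<^sup>2 \<le> \<eta>\<^sup>2 * ((c + \<omega>) * norm y)\<^sup>2" by (intro mult_left_mono) auto
    have "- inner y (hv i y - A i y) \<le> norm y * norm (hv i y - A i y)"
      using Cauchy_Schwarz_ineq2[of y "hv i y - A i y"] by linarith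
    also have "\<dots> \<le> norm y * (\<omega> * norm y)" using hv_A[OF i] by (intro mult_left_mono) auto
    finally have "\<eta> * (- inner y (hv i y - A i y)) \<le> \<eta> * (norm y * (\<omega> * norm y))" using eta by (intro mult_left_mono) auto
    then show ?thesis using 1 unfolding x_def
      unfolding norm_sub_sq by (simp add: inner_diff_right algebra_simps power2_eq_square)
  qed
  have "ev G (idx (Suc t)) (\<lambda>l. (norm (run y l))\<^sup>2 * exp (- (2 * \<eta> * tot ray y l)))
      = (\<Sum>i\<le>m. exp (- (2 * \<eta> * ray y)) * ev G (idx t) (\<lambda>l. (norm (run (y - \<eta> *\<^sub>R hv i y) l))\<^sup>2 * exp (- (2 * \<eta> * tot ray (y - \<eta> *\<^sub>R hv i y) l)))) / real (Suc m)"
  proof -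
    have "exp (- (2 * \<eta> * (p + q))) = exp (- (2 * \<eta> * p)) * exp (- (2 * \<eta> * q))" for p q
      by (simp add: exp_add[symmetric] algebra_simps)
    then show ?thesis unfolding ev_idx_Suc by (simp only: ev_cmult[symmetric] run.simps tot.simps mult.left_commute)
  qed
  also have "\<dots> \<le> (\<Sum>i\<le>m. exp (- (2 * \<eta> * ray y)) * (((1 + x) * (norm y)\<^sup>2 - 2 * \<eta> * inner y (A i y)) * exp (real t * x))) / real (Suc m)"
  proof (intro divide_right_mono sum_mono mult_left_mono)
    fix i assume "i \<in> {..m}"
    then show "ev G (idx t) (\<lambda>l. (norm (run (y - \<eta> *\<^sub>R hv i y) l))\<^sup>2 * exp (- (2 * \<eta> * tot ray (y - \<eta> *\<^sub>R hv i y) l)))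
       \<le> ((1 + x) * (norm y)\<^sup>2 - 2 * \<eta> * inner y (A i y)) * exp (real t * x)"
      using le[of i] by (intro order_trans[OF Suc]) (auto simp: x_def intro!: mult_right_mono)
  qed auto
  also have "\<dots> = exp (- (2 * \<eta> * ray y)) * exp (real t * x) * ((1 + x) * (norm y)\<^sup>2 - 2 * \<eta> * inner y (H y))"
  proof -
    have "(\<Sum>i\<le>m. (1 + x) * (norm y)\<^sup>2 - 2 * \<eta> * inner y (A i y)) = real (Suc m) * ((1 + x) * (norm y)\<^sup>2 - 2 * \<eta> * inner y (H y))"
      by (simp only: sum_subtractf sum_distrib_left[symmetric] mean_inner) (simp add: algebra_simps)
    then show ?thesis by (simp only: sum_distrib_left[symmetric] sum_distrib_right[symmetric]) simp
  qed
  also have "(1 + x) * (norm y)\<^sup>2 - 2 * \<eta> * inner y (H y) = (1 + (x + 2 * \<eta> * ray y)) * (norm y)\<^sup>2"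
    by (cases "y = 0") (auto simp: ray_def field_simps power2_eq_square)
  also have "exp (- (2 * \<eta> * ray y)) * exp (real t * x) * ((1 + (x + 2 * \<eta> * ray y)) * (norm y)\<^sup>2)
     \<le> exp (- (2 * \<eta> * ray y)) * exp (real t * x) * (exp (x + 2 * \<eta> * ray y) * (norm y)\<^sup>2)"
    by (intro mult_left_mono mult_right_mono exp_ge_add_one_self) auto
  also have "\<dots> = (norm y)\<^sup>2 * exp (real (Suc t) * x)" by (simp add: exp_add[symmetric] algebra_simps flip: exp_diff)
  finally show ?case by (simp add: x_def)
qed simp

lemma prob_upper:
  "ev G rad (\<lambda>y. ev G (idx T) (\<lambda>l. of_bool ((norm (run y l))\<^sup>2 * exp (- (2 * \<eta> * tot ray y l)) \<ge> 88 * (real d)\<^sup>2))) \<le> 1/22"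
proof (rule ev_le_const)
  fix y assume y: "y \<in> results G rad"
  have "ev G (idx T) (\<lambda>l. of_bool ((norm (run y l))\<^sup>2 * exp (- (2 * \<eta> * tot ray y l)) \<ge> 88 * (real d)\<^sup>2))
      \<le> ev G (idx T) (\<lambda>l. (norm (run y l))\<^sup>2 * exp (- (2 * \<eta> * tot ray y l))) / (88 * (real d)\<^sup>2)"
    using d by (intro ev_markov) auto
  also have "\<dots> \<le> (norm y)\<^sup>2 * exp (real T * (2 * \<eta> * \<omega> + \<eta>\<^sup>2 * (c + \<omega>)\<^sup>2)) / (88 * (real d)\<^sup>2)"
    by (intro divide_right_mono ev_run_sq) auto
  \<comment> \<open>The assumptions on \<eta> and \<omega> keep the exponent below 9/8, and exp(9/8)
    < 4. The threshold 88 is chosen to make the failure 1/22, which is less than 3/32.\<close>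
  also have "\<dots> \<le> (real d)\<^sup>2 * 4 / (88 * (real d)\<^sup>2)"
  proof (intro divide_right_mono mult_mono power_mono norm_rad[OF y])
    have "real T * (2 * \<eta> * \<omega>) = 2 * \<eta> * (real T * \<omega>)" by simp
    also have "\<dots> \<le> 1 * (1/8)" using eta_le eta T_om om by (intro mult_mono) auto
    finally have 1: "real T * (2 * \<eta> * \<omega>) \<le> 1/8" by simp
    have "real T * (\<eta>\<^sup>2 * (c + \<omega>)\<^sup>2) \<le> real T * (\<eta>\<^sup>2 * (2 * c)\<^sup>2)"
      using T_om c1 om by (intro mult_left_mono power_mono) auto
    also have "\<dots> = 4 * (\<eta>\<^sup>2 * c\<^sup>2 * real T)" by (simp add: power_mult_distrib)
    also have "\<dots> \<le> 1" using eta by simp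
    finally have "real T * (2 * \<eta> * \<omega> + \<eta>\<^sup>2 * (c + \<omega>)\<^sup>2) \<le> 1 + 1/8" using 1 by (simp add: algebra_simps)
    then have "exp (real T * (2 * \<eta> * \<omega> + \<eta>\<^sup>2 * (c + \<omega>)\<^sup>2)) \<le> exp (1 + 1/8)" by simp
    also have "\<dots> = exp 1 * exp (1/8)" by (rule exp_add)
    also have "\<dots> \<le> 3 * (1 + 1/8 + (1/8)\<^sup>2)" using exp_le exp_bound[of "1/8::real"] by (intro mult_mono) auto
    also have "\<dots> \<le> 4" by (simp add: power2_eq_square)
    finally show "exp (real T * (2 * \<eta> * \<omega> + \<eta>\<^sup>2 * (c + \<omega>)\<^sup>2)) \<le> 4" .
  qed auto
  also have "\<dots> = 1/22" using d by simp
  finally show "ev G (idx T) (\<lambda>l. of_bool ((norm (run y l))\<^sup>2 * exp (- (2 * \<eta> * tot ray y l)) \<ge> 88 * (real d)\<^sup>2)) \<le> 1/22" .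
qed

text \<open>From ln(1 + x) \<ge> x - x^2/2: the quadratic loss over T steps is at most half of
  \<eta>^2 c^2 T \<le> 1/4.\<close>

lemma ln_gr: "ln gr \<ge> \<eta> * lm * real T - 1/8"
proof -
  have x: "0 \<le> \<eta> * lm" using eta lam by auto
  have xle: "\<eta> * lm \<le> 1" using mult_left_mono[OF lam_le, of \<eta>] eta by linarith
  have "\<eta> * lm - (\<eta> * lm)\<^sup>2 / 2 \<le> ln (1 + \<eta> * lm)"
  proof -
    have "ln (1 + t) - (t - t\<^sup>2 / 2) \<ge> ln (1 + 0) - (0 - 0\<^sup>2 / 2)" if "0 \<le> t" for t :: real
    proof (rule DERIV_nonneg_imp_nondecreasing[OF that])
      fix s :: real assume s: "0 \<le> s" "s \<le> t"
      have "((\<lambda>s. ln (1 + s) - (s - s\<^sup>2 / 2)) has_real_derivative (1 / (1 + s) - (1 - s))) (at s)"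
        using s by (auto intro!: derivative_eq_intros)
      moreover have "1 / (1 + s) - (1 - s) \<ge> 0" using s by (simp add: field_simps)
      ultimately show "\<exists>y. ((\<lambda>s. ln (1 + s) - (s - s\<^sup>2 / 2)) has_real_derivative y) (at s) \<and> 0 \<le> y" by blast
    qed
    from this[OF x] show ?thesis by simp
  qed
  then have "real T * (\<eta> * lm - (\<eta> * lm)\<^sup>2 / 2) \<le> real T * ln (1 + \<eta> * lm)" by (intro mult_left_mono) auto
  also have "\<dots> = ln gr" unfolding gr_def using x by (simp add: ln_realpow)
  finally have 1: "real T * (\<eta> * lm - (\<eta> * lm)\<^sup>2 / 2) \<le> ln gr" .
  have "real T * (\<eta> * lm)\<^sup>2 \<le> real T * (\<eta> * c)\<^sup>2"
    using lam_le lam eta by (intro mult_left_mono power_mono) auto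
  also have "\<dots> \<le> 1/4" using eta by (simp add: power_mult_distrib algebra_simps)
  finally show ?thesis using 1 by (simp add: algebra_simps)
qed

definition good :: "'v \<Rightarrow> bool" where
  "good y \<longleftrightarrow> y \<noteq> 0 \<and> inner y (H y) \<le> - (lm / 2) * (norm y)\<^sup>2"

text \<open>Since the quotient never exceeds \<open>lm\<close>, this makes an average close to
  \<open>lm\<close> force most visited points above lm/2.\<close>

lemma good_ray: "ray y \<le> lm / 2 + lm / 2 * of_bool (good y)"
proof (cases "good y")
  case True then show ?thesis using ray_le[of y] by simp
next
  case False
  show ?thesis
  proof (cases "y = 0")
    case True then show ?thesis using lam by (simp add: ray_def)
  next
    case f: False
    then have "inner y (H y) > - (lm / 2) * (norm y)\<^sup>2" using False by (auto simp: good_def)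
    then show ?thesis using f False by (simp add: ray_def divide_simps)
  qed
qed

lemma tot_good: "tot (\<lambda>y. of_bool (good y)) y l \<ge> 2 / lm * tot ray y l - real (length l)"
proof (induction l arbitrary: y)
  case (Cons i l)
  have "2 / lm * ray y - 1 \<le> of_bool (good y)"
    using mult_left_mono[OF good_ray[of y], of "2 / lm"] lam by (simp add: field_simps)
  then show ?case using Cons[of "y - \<eta> *\<^sub>R hv i y"] by (simp add: algebra_simps)
qed simp

lemma tot_nonneg: "(\<And>y. g y \<ge> 0) \<Longrightarrow> tot g y l \<ge> 0"
  by (induction l arbitrary: y) auto

text \<open>The two events squeeze the accumulated quotient S: 2 \<eta> S is at least 2 ln gr -
  ln(16 * 88) - 4 ln d, which by \<open>gap\<close> is at least 1.78 \<eta> lm T. The average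
  quotient is thus at least 0.89 lm, and \<open>tot_good\<close> yields a share of at least 2 * 0.89
  - 1 = 0.78 of good iterates.\<close>

lemma tot_ge:
  assumes "norm (run y l) \<ge> gr / (4 * real d)"
    and "(norm (run y l))\<^sup>2 * exp (- (2 * \<eta> * tot ray y l)) < 88 * (real d)\<^sup>2" and "length l = T"
  shows "tot (\<lambda>y. of_bool (good y)) y l \<ge> 7/10 * real T"
proof -
  define S where "S = tot ray y l"
  have dd: "real d \<ge> 1" using d by simp
  have "gr\<^sup>2 / (16 * (real d)\<^sup>2) \<le> (norm (run y l))\<^sup>2"
    using power_mono[OF assms(1), of 2] gr_ge1 dd by (simp add: power_divide power_mult_distrib)
  then have "gr\<^sup>2 / (16 * (real d)\<^sup>2) * exp (- (2 * \<eta> * S)) \<le> (norm (run y l))\<^sup>2 * exp (- (2 * \<eta> * S))"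
    by (intro mult_right_mono) auto
  also have "\<dots> \<le> 88 * (real d)\<^sup>2" using assms(2) by (simp add: S_def)
  finally have "gr\<^sup>2 \<le> 1408 * real d ^ 4 * exp (2 * \<eta> * S)"
    using dd by (simp add: exp_minus field_simps power2_eq_square eval_nat_numeral)
  moreover have "gr\<^sup>2 > 0" using gr_ge1 by simp
  ultimately have "ln (gr\<^sup>2) \<le> ln (1408 * real d ^ 4 * exp (2 * \<eta> * S))"
    by (subst ln_le_cancel_iff) (use dd in auto)
  then have 1: "2 * ln gr \<le> ln 1408 + 4 * ln (real d) + 2 * \<eta> * S"
    using gr_ge1 dd by (simp add: ln_mult ln_realpow)
  have "ln (1408::real) \<le> 7 * ln 3"
  proof -
    have "ln (1408::real) \<le> ln (3 ^ 7)" by (subst ln_le_cancel_iff) auto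
    also have "ln ((3::real) ^ 7) = 7 * ln 3" by (subst ln_realpow) auto
    finally show ?thesis .
  qed
  also have "ln (3::real) \<le> 1.1"
  proof -
    have "(3::real) \<le> exp 1 * exp 0.1"
    proof -
      have "(2.74::real) \<le> exp 1 * (1 + 0.1)" using exp_ge_add_one_self[of "1/10::real"] e_approx_32 by (simp add: abs_if split: if_splits)
      have "(2.71828::real) \<le> exp 1" using e_approx_32 by (simp add: abs_if split: if_splits)
      moreover have "(1.105::real) \<le> exp 0.1" using exp_lower_Taylor_quadratic[of "0.1::real"] by (simp add: power2_eq_square)
      ultimately have "(2.71828::real) * 1.105 \<le> exp 1 * exp 0.1" by (intro mult_mono) auto
      then show ?thesis by simp
    qed
    then have "(3::real) \<le> exp 1.1" by (simp add: exp_add[symmetric])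
    then have "ln 3 \<le> ln (exp (1.1 :: real))" by (subst ln_le_cancel_iff) auto
    then show ?thesis by simp
  qed
  finally have "2 * ln gr \<le> 7.7 + 4 * ln (real d) + 2 * \<eta> * S" using 1 by simp
  then have "2 * \<eta> * S \<ge> 2 * (\<eta> * lm * real T) - 8 - 4 * ln (real d)" using ln_gr by simp
  moreover have "8 + 4 * ln (real d) \<le> 0.2 * (\<eta> * lm * real T) + 0.4" using gap by simp
  ultimately have "2 * \<eta> * S \<ge> 1.8 * (\<eta> * lm * real T) - 0.4" by simp
  moreover have "38 \<le> \<eta> * lm * real T"
    using gap ln_ge_zero[OF dd] by linarith
  ultimately have "2 * \<eta> * S \<ge> 1.78 * (\<eta> * lm * real T)" by simp
  then have "\<eta> * (2 * S) \<ge> \<eta> * (1.78 * (lm * real T))" by (simp add: algebra_simps)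
  then have "2 * S \<ge> 1.78 * (lm * real T)" using eta by (simp only: mult_le_cancel_left_pos)
  then have "2 / lm * S \<ge> 1.78 * real T" using lam by (simp add: field_simps)
  then show ?thesis using tot_good[of y l] T by (simp add: assms(3) S_def)
qed

text \<open>On the first event without the second, seven tenths of all times are good, and 0.7 (3/32
  - 1/22) exceeds 1/32.\<close>

lemma ev_good: "(\<Sum>t<T. ev G rad (\<lambda>y. ev G (idx t) (\<lambda>l. of_bool (good (run y l))))) / real T \<ge> 1/32"
proof -
  let ?E1 = "\<lambda>y l. norm (run y l) \<ge> gr / (4 * real d)"
  let ?E2 = "\<lambda>y l. (norm (run y l))\<^sup>2 * exp (- (2 * \<eta> * tot ray y l)) \<ge> 88 * (real d)\<^sup>2"
  have "(\<Sum>t<T. ev G rad (\<lambda>y. ev G (idx t) (\<lambda>l. of_bool (good (run y l)))))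
     = ev G rad (\<lambda>y. ev G (idx T) (tot (\<lambda>y. of_bool (good y)) y))"
    using sum_tot[of G "\<lambda>y. of_bool (good y)" _ T] by (simp add: ev_sum[symmetric])
  also have "\<dots> \<ge> ev G rad (\<lambda>y. ev G (idx T) (\<lambda>l. 7/10 * real T * (of_bool (?E1 y l) - of_bool (?E2 y l))))"
  proof (intro ev_mono_on)
    fix y l assume l: "l \<in> results G (idx T)"
    have "0 \<le> tot (\<lambda>y. of_bool (good y)) y l" by (rule tot_nonneg) auto
    then show "7/10 * real T * (of_bool (?E1 y l) - of_bool (?E2 y l)) \<le> tot (\<lambda>y. of_bool (good y)) y l"
      using tot_ge[of y l] results_idx[OF l] by (cases "?E1 y l"; cases "?E2 y l") auto
  qed
  also have "ev G rad (\<lambda>y. ev G (idx T) (\<lambda>l. 7/10 * real T * (of_bool (?E1 y l) - of_bool (?E2 y l))))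
     = 7/10 * real T * (ev G rad (\<lambda>y. ev G (idx T) (\<lambda>l. of_bool (?E1 y l))) - ev G rad (\<lambda>y. ev G (idx T) (\<lambda>l. of_bool (?E2 y l))))"
    by (simp only: ev_cmult ev_diff)
  also have "\<dots> \<ge> 7/10 * real T * (3/32 - 1/22)"
    using prob_run[of G] prob_upper[of G] by (intro mult_left_mono) auto
  finally show ?thesis using T by (simp add: field_simps)
qed

end

section \<open>The descent loop\<close>

text \<open>Search and estimator are parameters, so that the loop is analysed from their one-step
  guarantees alone.\<close>

locale descent_program =
  fixes nc :: "'v::real_inner \<Rightarrow> ('v, 'v option) prog"
    and move :: "real \<Rightarrow> 'v \<Rightarrow> 'v \<Rightarrow> real \<Rightarrow> 'v \<Rightarrow> ('v, 'v \<times> real) prog"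
    and \<epsilon> s D :: real
begin

text \<open>A state consists of the iterate, the gradient estimate, the length travelled since the estimate
  was last refreshed, and the numbers of gradient steps and of curvature steps that are left.\<close>

primrec loop :: "nat \<Rightarrow> 'v \<Rightarrow> 'v \<Rightarrow> real \<Rightarrow> nat \<Rightarrow> nat \<Rightarrow> ('v, 'v option) prog" where
  "loop 0 x v acc gr cr = Ret None"
| "loop (Suc n) x v acc gr cr =
    (if norm v > \<epsilon> / 2 then
       if gr = 0 then Ret None
       else bindP (move s x v acc (x - (s / norm v) *\<^sub>R v))
              (\<lambda>p. loop n (x - (s / norm v) *\<^sub>R v) (fst p) (snd p) (gr - 1) cr)
     else bindP (nc x) (\<lambda>r. case r of
         None \<Rightarrow> Ret (Some x)
       | Some w \<Rightarrow> if cr = 0 then Ret None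
           else Draw 1 (\<lambda>i. bindP (move D x v acc (x + (if i = 0 then D else - D) *\<^sub>R w))
              (\<lambda>p. loop n (x + (if i = 0 then D else - D) *\<^sub>R w) (fst p) (snd p) gr (cr - 1)))))"

end

text \<open>\<open>nc_None\<close> and \<open>nc_Some\<close> bound the two kinds of error of the
  search. \<open>move\<close> is the supermartingale property of the estimator: the discount
  exp(-acc/len) absorbs the growth of \<open>Phi\<close> along updates, and \<open>C0\<close> pays
  for a fresh start. All guarantees except the two about \<open>move\<close> are required only on
  the ball that NG gradient and NC curvature steps cannot leave.\<close>

locale descent_analysis = descent_program nc move \<epsilon> s D
  for nc :: "'v::real_inner \<Rightarrow> ('v, 'v option) prog" and move \<epsilon> s D +
  fixes G :: "nat \<Rightarrow> 'v \<Rightarrow> 'v" and f :: "'v \<Rightarrow> real" and Gbar :: "'v \<Rightarrow> 'v"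
    and curv_ok good :: "'v \<Rightarrow> bool" and x0 :: 'v and NG NC :: nat
    and flow \<alpha> \<beta> q1 q2 l len C0 :: real
  assumes pos: "s > 0" "D > 0" "\<alpha> \<ge> 0" "\<beta> \<ge> 0" "q1 \<ge> 0" "q2 \<ge> 0" "l > 0" "len > 0" "C0 \<ge> 0"
    and flow: "\<And>x. norm (x - x0) \<le> s * real NG + D * real NC \<Longrightarrow> flow \<le> f x"
    and nc_None: "\<And>x. norm (x - x0) \<le> s * real NG + D * real NC \<Longrightarrow> \<not> curv_ok x \<Longrightarrow>
      ev G (nc x) (\<lambda>r. of_bool (r = None)) \<le> q1"
    and nc_Some: "\<And>x. norm (x - x0) \<le> s * real NG + D * real NC \<Longrightarrow>
      ev G (nc x) (\<lambda>r. of_bool (\<exists>w. r = Some w \<and>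
        \<not> (norm w = 1 \<and> f (x + D *\<^sub>R w) + f (x - D *\<^sub>R w) \<le> 2 * (f x - \<beta>)))) \<le> q2"
    and grad_step: "\<And>x v. norm (x - x0) \<le> s * real NG + D * real NC \<Longrightarrow> norm v > \<epsilon> / 2 \<Longrightarrow>
      norm (v - Gbar x) \<le> \<epsilon> / 16 \<Longrightarrow> f (x - (s / norm v) *\<^sub>R v) \<le> f x - \<alpha>"
    and good: "\<And>x v. norm (x - x0) \<le> s * real NG + D * real NC \<Longrightarrow> norm v \<le> \<epsilon> / 2 \<Longrightarrow>
      norm (v - Gbar x) \<le> \<epsilon> / 16 \<Longrightarrow> curv_ok x \<Longrightarrow> good x"
    and move: "\<And>E x v acc x'. norm (x' - x) \<le> E \<Longrightarrow> E = s \<or> E = D \<Longrightarrow>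
      ev G (move E x v acc x') (\<lambda>p. Phi l (fst p - Gbar x') * exp (- (snd p / len)))
        \<le> Phi l (v - Gbar x) * exp (- (acc / len)) + C0"
    and move_acc: "\<And>E x v acc x' p. p \<in> results G (move E x v acc x') \<Longrightarrow> snd p \<le> len"
begin

text \<open>Normalised so that \<open>kap * pot \<ge> 1\<close> whenever the estimate is off by more
  than \<epsilon>/16. The summand 1 in the exponent pays for the discount, which is at least exp(-1)
  while acc \<le> len.\<close>

definition kap :: real where "kap = exp (1 - l * (\<epsilon> / 16))"

definition pot :: "'v \<Rightarrow> 'v \<Rightarrow> real \<Rightarrow> real" where
  "pot x v acc = Phi l (v - Gbar x) * exp (- (acc / len))"

lemma pot_nonneg: "pot x v acc \<ge> 0" by (simp add: pot_def Phi_pos less_imp_le)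

lemma pot_large:
  assumes "acc \<le> len" "norm (v - Gbar x) > \<epsilon> / 16" shows "kap * pot x v acc \<ge> 1"
proof -
  have "exp (l * (\<epsilon> / 16)) * exp (-1) \<le> Phi l (v - Gbar x) * exp (- (acc / len))"
  proof (intro mult_mono)
    have "l * (\<epsilon> / 16) \<le> l * norm (v - Gbar x)" using assms pos by (intro mult_left_mono) auto
    then show "exp (l * (\<epsilon> / 16)) \<le> Phi l (v - Gbar x)"
      using Phi_ge[of l "v - Gbar x"] pos by (meson exp_le_cancel_iff less_imp_le order_trans)
  qed (use assms pos in \<open>auto simp: Phi_pos less_imp_le field_simps\<close>)
  then have "kap * (exp (l * (\<epsilon> / 16)) * exp (-1)) \<le> kap * pot x v acc"
    unfolding pot_def by (intro mult_left_mono) (auto simp: kap_def)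
  then show ?thesis by (simp add: kap_def exp_add[symmetric])
qed

text \<open>A Lyapunov function: the height of f above \<open>flow\<close> plus the decrease that
  the steps already taken should have earned. Accurate steps do not increase it on average, and once
  a budget is exhausted it outweighs \<open>Ret None\<close>.\<close>

definition pval :: "real \<Rightarrow> 'v \<Rightarrow> nat \<Rightarrow> nat \<Rightarrow> real" where
  "pval \<theta> x gr cr = \<theta> * (f x - flow + \<alpha> * (real NG - real gr) + \<beta> * (real NC - real cr))"

text \<open>The second summand bounds the probability that a curvature search errs, the third one the
  probability that the gradient estimate becomes inaccurate.\<close>

definition wt :: "real \<Rightarrow> nat \<Rightarrow> 'v \<Rightarrow> 'v \<Rightarrow> real \<Rightarrow> nat \<Rightarrow> nat \<Rightarrow> real" where
  "wt \<theta> n x v acc gr cr = pval \<theta> x gr cr + real n * (q1 + q2)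
     + kap * (real n * pot x v acc + C0 * (real n)\<^sup>2)"

lemma kap_pos: "kap > 0" by (simp add: kap_def)

text \<open>A general test h serves two purposes: \<theta> = 0 bounds the probability of a wrong
  output, a positive \<theta> that of giving up. States with an inaccurate estimate are settled at
  once by \<open>pot_large\<close>, so every step that is analysed may assume an error of at most
  \<epsilon>/16.\<close>

lemma loop_bound:
  assumes h: "\<And>r. 0 \<le> h r" "\<And>r. h r \<le> 1" "\<And>x. good x \<Longrightarrow> h (Some x) = 0"
    and \<theta>: "\<theta> \<ge> 0" "h None \<le> \<theta> * (\<alpha> * real NG)" "h None \<le> \<theta> * (\<beta> * real NC)"
  shows "gr + cr < n \<Longrightarrow> gr \<le> NG \<Longrightarrow> cr \<le> NC \<Longrightarrow> acc \<le> len \<Longrightarrow>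
    norm (x - x0) \<le> s * (real NG - real gr) + D * (real NC - real cr) \<Longrightarrow>
    ev G (loop n x v acc gr cr) h \<le> wt \<theta> n x v acc gr cr"
proof (induction n arbitrary: x v acc gr cr)
  case 0
  then show ?case by simp
next
  case (Suc n)
  note le = Suc.prems
  have ball: "norm (x - x0) \<le> s * real NG + D * real NC"
  proof -
    have "s * (real NG - real gr) \<le> s * real NG" "D * (real NC - real cr) \<le> D * real NC"
      using pos by (auto intro!: mult_left_mono)
    then show ?thesis using le by linarith
  qed
  have fx: "f x - flow \<ge> 0" using flow[OF ball] by simp
  have p1: "\<alpha> * (real NG - real gr) \<ge> 0" "\<beta> * (real NC - real cr) \<ge> 0" using le pos by auto
  have pv: "pval \<theta> x gr cr \<ge> 0" unfolding pval_def using \<theta> fx p1 by (intro mult_nonneg_nonneg) auto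
  \<comment> \<open>The bound after one move, with one unit of fuel spent and the errors q1 + q2 of
    the current search not yet charged.\<close>
  define mid where "mid = pval \<theta> x gr cr + real n * (q1 + q2) + kap * (real n * (pot x v acc + C0) + C0 * (real n)\<^sup>2)"
  have rest0: "0 \<le> real n * (q1 + q2) + kap * (real n * (pot x v acc + C0) + C0 * (real n)\<^sup>2)"
    using pos kap_pos pot_nonneg[of x v acc] by (intro add_nonneg_nonneg mult_nonneg_nonneg) auto
  have mid0: "pval \<theta> x gr cr \<le> mid" using rest0 by (simp add: mid_def)
  have mid: "mid + (q1 + q2) \<le> wt \<theta> (Suc n) x v acc gr cr"
  proof -
    have "kap * (real n * (pot x v acc + C0) + C0 * (real n)\<^sup>2) \<le> kap * (real (Suc n) * pot x v acc + C0 * (real (Suc n))\<^sup>2)"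
    proof (intro mult_left_mono)
      \<comment> \<open>Each move adds \<open>C0\<close> to a potential that is weighted by the
        remaining fuel, which is where the square in \<open>wt\<close> comes from.\<close>
      have "C0 * (real n + (real n)\<^sup>2) \<le> C0 * (real (Suc n))\<^sup>2"
        using pos by (intro mult_left_mono) (auto simp: power2_eq_square algebra_simps)
      then show "real n * (pot x v acc + C0) + C0 * (real n)\<^sup>2 \<le> real (Suc n) * pot x v acc + C0 * (real (Suc n))\<^sup>2"
        using pot_nonneg[of x v acc] by (simp add: algebra_simps)
    qed (use kap_pos in auto)
    then show ?thesis unfolding mid_def wt_def by (simp add: algebra_simps)
  qed
  show ?case
  proof (cases "norm (v - Gbar x) > \<epsilon> / 16")
    case True
    have "ev G (loop (Suc n) x v acc gr cr) h \<le> 1" using h by (intro ev_le_const)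
    also have "1 \<le> kap * pot x v acc" using pot_large[OF _ True] le by auto
    also have "\<dots> \<le> wt \<theta> (Suc n) x v acc gr cr"
    proof -
      have "0 \<le> real (Suc n) * (q1 + q2)" using pos by auto
      moreover have "kap * pot x v acc \<le> kap * (real (Suc n) * pot x v acc + C0 * (real (Suc n))\<^sup>2)"
      proof (intro mult_left_mono)
        have "0 \<le> real n * pot x v acc" "0 \<le> C0 * (real (Suc n))\<^sup>2" using pos pot_nonneg[of x v acc] by auto
        then show "pot x v acc \<le> real (Suc n) * pot x v acc + C0 * (real (Suc n))\<^sup>2" by (simp add: algebra_simps)
      qed (use kap_pos in auto)
      ultimately show ?thesis using pv unfolding wt_def by linarith
    qed
    finally show ?thesis .
  next
    case err: False
    have step: "ev G (bindP (move E x v acc x') (\<lambda>p. loop n x' (fst p) (snd p) gr' cr')) h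
       \<le> pval \<theta> x' gr' cr' + real n * (q1 + q2) + kap * (real n * (pot x v acc + C0) + C0 * (real n)\<^sup>2)"
      if "gr' + cr' < n" "gr' \<le> NG" "cr' \<le> NC" "norm (x' - x) \<le> E" "E = s \<or> E = D"
        "norm (x' - x0) \<le> s * (real NG - real gr') + D * (real NC - real cr')" for E x' gr' cr'
    proof -
      have "ev G (bindP (move E x v acc x') (\<lambda>p. loop n x' (fst p) (snd p) gr' cr')) h
        \<le> ev G (move E x v acc x') (\<lambda>p. wt \<theta> n x' (fst p) (snd p) gr' cr')"
        unfolding ev_bind using that by (intro ev_mono_on Suc.IH) (auto intro: move_acc)
      also have "\<dots> = pval \<theta> x' gr' cr' + real n * (q1 + q2) + kap * (real n * ev G (move E x v acc x') (\<lambda>p. pot x' (fst p) (snd p)) + C0 * (real n)\<^sup>2)"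
        unfolding wt_def by (simp only: ev_add ev_const ev_cmult)
      also have "\<dots> \<le> pval \<theta> x' gr' cr' + real n * (q1 + q2) + kap * (real n * (pot x v acc + C0) + C0 * (real n)\<^sup>2)"
        using move[OF that(4,5), of v acc] kap_pos
        by (intro add_mono mult_left_mono order_refl) (auto simp: pot_def)
      finally show ?thesis .
    qed
    show ?thesis
    proof (cases "norm v > \<epsilon> / 2")
      case big: True
      show ?thesis
      proof (cases "gr = 0")
        case True
        have "h None \<le> pval \<theta> x gr cr"
        proof -
          have "\<theta> * (\<alpha> * real NG) \<le> pval \<theta> x gr cr" unfolding pval_def using True fx p1 \<theta>
            by (intro mult_left_mono) auto
          then show ?thesis using \<theta> by linarith
        qed
        then have "h None \<le> wt \<theta> (Suc n) x v acc gr cr" using mid0 mid pos by linarith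
        then show ?thesis using big True by simp
      next
        case False
        define x' where "x' = x - (s / norm v) *\<^sub>R v"
        have nv: "norm v > 0 \<or> v = 0" by auto
        have d: "norm (x' - x) \<le> s" using pos by (cases "v = 0") (auto simp: x'_def)
        have "norm (x' - x0) \<le> norm (x' - x) + norm (x - x0)" using norm_triangle_ineq[of "x' - x" "x - x0"] by simp
        then have d0: "norm (x' - x0) \<le> s * (real NG - real (gr - 1)) + D * (real NC - real cr)"
          using d le False by (simp add: of_nat_diff algebra_simps)
        have "ev G (loop (Suc n) x v acc gr cr) h = ev G (bindP (move s x v acc x') (\<lambda>p. loop n x' (fst p) (snd p) (gr - 1) cr)) h"
          using big False by (simp add: x'_def)
        also have "\<dots> \<le> pval \<theta> x' (gr - 1) cr + real n * (q1 + q2) + kap * (real n * (pot x v acc + C0) + C0 * (real n)\<^sup>2)"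
          using le False d d0 by (intro step) auto
        also have "pval \<theta> x' (gr - 1) cr \<le> pval \<theta> x gr cr"
        proof -
          have "f x' \<le> f x - \<alpha>" using grad_step[OF ball big] err by (simp add: x'_def)
          then show ?thesis unfolding pval_def using \<theta> False by (intro mult_left_mono) (auto simp: of_nat_diff algebra_simps)
        qed
        finally show ?thesis using mid pos by (simp add: mid_def)
      qed
    next
      case small: False
      define bad where "bad = (\<lambda>r. \<exists>w. r = Some w \<and>
        \<not> (norm w = 1 \<and> f (x + D *\<^sub>R w) + f (x - D *\<^sub>R w) \<le> 2 * (f x - \<beta>)))"
      define cont where "cont = (\<lambda>r. case r of
         None \<Rightarrow> Ret (Some x)
       | Some w \<Rightarrow> if cr = 0 then Ret None
           else Draw 1 (\<lambda>i. bindP (move D x v acc (x + (if i = 0 then D else - D) *\<^sub>R w))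
              (\<lambda>p. loop n (x + (if i = 0 then D else - D) *\<^sub>R w) (fst p) (snd p) gr (cr - 1))))"
      have "ev G (loop (Suc n) x v acc gr cr) h = ev G (nc x) (\<lambda>r. ev G (cont r) h)"
        using small by (simp add: ev_bind cont_def)
      also have "\<dots> \<le> ev G (nc x) (\<lambda>r. mid + (of_bool (\<not> curv_ok x) * of_bool (r = None) + of_bool (bad r)))"
      proof (rule ev_mono)
        fix r
        have c1: "ev G (cont r) h \<le> 1" using h by (intro ev_le_const)
        have m0: "mid \<ge> 0" using mid0 pv by linarith
        show "ev G (cont r) h \<le> mid + (of_bool (\<not> curv_ok x) * of_bool (r = None) + of_bool (bad r))"
        proof (cases r)
          case None
          show ?thesis
          proof (cases "curv_ok x")
            case True
            then have "good x" using good[OF ball _ _ True, of v] small err by auto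
            then show ?thesis using None h m0 by (simp add: cont_def)
          next
            case False
            then show ?thesis using None c1 m0 by simp
          qed
        next
          case (Some w)
          show ?thesis
          proof (cases "bad r")
            case True show ?thesis using c1 m0 True by (auto simp: Some split: if_splits)
          next
            case False
            then have w: "norm w = 1" "f (x + D *\<^sub>R w) + f (x - D *\<^sub>R w) \<le> 2 * (f x - \<beta>)"
              using Some by (auto simp: bad_def)
            show ?thesis
            proof (cases "cr = 0")
              case True
              have "\<theta> * (\<beta> * real NC) \<le> pval \<theta> x gr cr" unfolding pval_def using True fx p1 \<theta>
                by (intro mult_left_mono) auto
              then show ?thesis using \<theta> mid0 True Some by (simp add: cont_def)
            next
              case cr: False
              define y where "y = (\<lambda>i::nat. x + (if i = 0 then D else - D) *\<^sub>R w)"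
              define rest where "rest = real n * (q1 + q2) + kap * (real n * (pot x v acc + C0) + C0 * (real n)\<^sup>2)"
              have B: "ev G (bindP (move D x v acc (y i)) (\<lambda>p. loop n (y i) (fst p) (snd p) gr (cr - 1))) h
                  \<le> pval \<theta> (y i) gr (cr - 1) + rest" for i
              proof -
                have d: "norm (y i - x) \<le> D" using pos w by (auto simp: y_def)
                have "norm (y i - x0) \<le> norm (y i - x) + norm (x - x0)" using norm_triangle_ineq[of "y i - x" "x - x0"] by simp
                then have d0: "norm (y i - x0) \<le> s * (real NG - real gr) + D * (real NC - real (cr - 1))"
                  using d le cr by (simp add: of_nat_diff algebra_simps)
                show ?thesis unfolding rest_def add.assoc[symmetric] using le cr d d0 by (intro step) auto
              qed
              have "ev G (cont r) h = (\<Sum>i\<le>1. ev G (bindP (move D x v acc (y i)) (\<lambda>p. loop n (y i) (fst p) (snd p) gr (cr - 1))) h) / 2"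
                using Some cr by (simp add: cont_def y_def)
              also have "\<dots> \<le> (\<Sum>i\<le>1. pval \<theta> (y i) gr (cr - 1) + rest) / 2"
                using B by (intro divide_right_mono sum_mono) auto
              also have "\<dots> = (pval \<theta> (y 0) gr (cr - 1) + pval \<theta> (y 1) gr (cr - 1)) / 2 + rest" by simp
              \<comment> \<open>The random sign removes the first order term: only the sum of the
                two values of f is under control, and averaging needs no more.\<close>
              also have "pval \<theta> (y 0) gr (cr - 1) + pval \<theta> (y 1) gr (cr - 1) \<le> 2 * pval \<theta> x gr cr"
              proof -
                have "f (y 0) + f (y 1) \<le> 2 * (f x - \<beta>)" using w by (simp add: y_def)
                then have "\<theta> * (f (y 0) + f (y 1)) \<le> \<theta> * (2 * (f x - \<beta>))" using \<theta> by (intro mult_left_mono) auto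
                then show ?thesis unfolding pval_def using cr by (simp add: of_nat_diff algebra_simps)
              qed
              finally have "ev G (cont r) h \<le> mid" by (simp add: mid_def rest_def)
              then show ?thesis by (simp add: Some)
            qed
          qed
        qed
      qed
      also have "\<dots> = mid + (of_bool (\<not> curv_ok x) * ev G (nc x) (\<lambda>r. of_bool (r = None)) + ev G (nc x) (\<lambda>r. of_bool (bad r)))"
        by (simp only: ev_add ev_const ev_cmult)
      also have "\<dots> \<le> mid + (q1 + q2)"
        using nc_None[OF ball] nc_Some[OF ball] pos by (cases "curv_ok x") (auto simp: bad_def)
      finally show ?thesis using mid by linarith
    qed
  qed
qed

end

section \<open>Estimation and curvature search\<close>

definition mean_est :: "nat \<Rightarrow> nat \<Rightarrow> (nat \<Rightarrow> ('q, 'v::real_vector) prog) \<Rightarrow> ('q, 'v) prog" where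
  "mean_est m b X = bindP (samp m b X 0) (\<lambda>S. Ret ((1 / real b) *\<^sub>R S))"

lemma costs_mean_est: "(\<And>i. costs (X i) c) \<Longrightarrow> costs (mean_est m b X) (b * c)"
  unfolding mean_est_def using costs_bind[OF costs_samp, of X c "\<lambda>S. Ret ((1 / real b) *\<^sub>R S)" 0] by simp

lemma ev_mean_est_Phi:
  fixes val :: "nat \<Rightarrow> 'v::real_inner"
  assumes X: "\<And>i h. i \<le> m \<Longrightarrow> ev G (X i) h = h (val i)"
    and mu: "(\<Sum>i\<le>m. val i) = real (Suc m) *\<^sub>R \<mu>"
    and b: "\<And>i. i \<le> m \<Longrightarrow> norm (val i - \<mu>) \<le> \<beta>" and "l \<ge> 0" "b > 0"
  shows "ev G (mean_est m b X) (\<lambda>h. Phi l (e + (h - \<mu>))) \<le> Phi l e * exp (l\<^sup>2 * \<beta>\<^sup>2 / real b)"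
proof -
  have "ev G (mean_est m b X) (\<lambda>h. Phi l (e + (h - \<mu>))) =
     ev G (samp m b X 0) (\<lambda>S. Phi l (e + (1 / real b) *\<^sub>R (S - real b *\<^sub>R \<mu>)))"
    using \<open>b > 0\<close> by (simp add: mean_est_def ev_bind scaleR_diff_right)
  also have "\<dots> \<le> Phi l (e + (1 / real b) *\<^sub>R 0) * exp (real b * (l * (1 / real b) * \<beta>)\<^sup>2)"
    by (rule ev_samp_Phi[OF X mu b \<open>l \<ge> 0\<close>])
  also have "real b * (l * (1 / real b) * \<beta>)\<^sup>2 = l\<^sup>2 * \<beta>\<^sup>2 / real b"
    using \<open>b > 0\<close> by (simp add: power2_eq_square field_simps)
  finally show ?thesis by simp
qed

lemma ev_mean_est_Phi0:
  fixes val :: "nat \<Rightarrow> 'v::real_inner"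
  assumes "\<And>i h. i \<le> m \<Longrightarrow> ev G (X i) h = h (val i)"
    and "(\<Sum>i\<le>m. val i) = real (Suc m) *\<^sub>R \<mu>"
    and "\<And>i. i \<le> m \<Longrightarrow> norm (val i - \<mu>) \<le> \<beta>" and "l \<ge> 0" "b > 0" "l\<^sup>2 * \<beta>\<^sup>2 \<le> real b"
  shows "ev G (mean_est m b X) (\<lambda>h. Phi l (h - \<mu>)) \<le> exp 2"
proof -
  have "ev G (mean_est m b X) (\<lambda>h. Phi l (0 + (h - \<mu>))) \<le> Phi l (0::'v) * exp (l\<^sup>2 * \<beta>\<^sup>2 / real b)"
    by (rule ev_mean_est_Phi[OF assms(1-5)])
  also have "\<dots> \<le> exp 1 * exp 1" using assms(5,6) by (intro mult_mono) (auto simp: Phi_zero)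
  finally show ?thesis by (simp add: exp_add[symmetric])
qed

lemma ev_mean_est_tail:
  fixes val :: "nat \<Rightarrow> 'v::real_inner"
  assumes "\<And>i h. i \<le> m \<Longrightarrow> ev G (X i) h = h (val i)"
    and "(\<Sum>i\<le>m. val i) = real (Suc m) *\<^sub>R \<mu>"
    and "\<And>i. i \<le> m \<Longrightarrow> norm (val i - \<mu>) \<le> \<beta>" and "l \<ge> 0" "b > 0" "l\<^sup>2 * \<beta>\<^sup>2 \<le> real b"
  shows "ev G (mean_est m b X) (\<lambda>h. of_bool (norm (h - \<mu>) > t)) \<le> exp (2 - l * t)"
proof -
  have "ev G (mean_est m b X) (\<lambda>h. of_bool (norm (h - \<mu>) > t)) \<le> ev G (mean_est m b X) (\<lambda>h. Phi l (h - \<mu>)) / exp (l * t)"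
  proof (rule ev_markov)
    fix h assume "norm (h - \<mu>) > t"
    then have "exp (l * t) \<le> exp (l * norm (h - \<mu>))" using assms(4) by (simp add: mult_left_mono less_imp_le)
    then show "exp (l * t) \<le> Phi l (h - \<mu>)" by (rule order_trans[OF _ Phi_ge[OF assms(4)]])
  qed (auto simp: Phi_pos less_imp_le)
  also have "\<dots> \<le> exp 2 / exp (l * t)" by (intro divide_right_mono ev_mean_est_Phi0[OF assms]) auto
  finally show ?thesis by (simp add: exp_diff)
qed

primrec iter :: "nat \<Rightarrow> real \<Rightarrow> (nat \<Rightarrow> 'v::real_vector \<Rightarrow> ('q, 'v) prog) \<Rightarrow> nat \<Rightarrow> 'v \<Rightarrow> ('q, 'v) prog" where
  "iter m \<eta> X 0 y = Ret y"
| "iter m \<eta> X (Suc t) y = Draw m (\<lambda>i. bindP (X i y) (\<lambda>h. iter m \<eta> X t (y - \<eta> *\<^sub>R h)))"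

lemma costs_iter: "(\<And>i y. costs (X i y) c) \<Longrightarrow> costs (iter m \<eta> X t y) (t * c)"
proof (induction t arbitrary: y)
  case (Suc t)
  have "costs (bindP (X i y) (\<lambda>h. iter m \<eta> X t (y - \<eta> *\<^sub>R h))) (c + t * c)" for i
    using Suc.prems Suc.IH[OF Suc.prems] by (intro costs_bind)
  then show ?case by simp
qed simp

text \<open>The iterate at a uniform time below T is normalised and its curvature is tested with
  fresh samples. The threshold 3/8 \<delta> is halfway between \<delta>/4 and \<delta>/2, so a total
  error of \<delta>/8 neither accepts a direction of curvature above -\<delta>/4 nor rejects one
  below -\<delta>/2.\<close>

definition nc_try :: "nat \<Rightarrow> nat \<Rightarrow> (nat \<Rightarrow> 'v::real_inner) \<Rightarrow> nat \<Rightarrow> real \<Rightarrow> nat \<Rightarrow> real \<Rightarrow>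
    (nat \<Rightarrow> 'v \<Rightarrow> ('q, 'v) prog) \<Rightarrow> ('q, 'v option) prog" where
  "nc_try m d b T \<eta> nb \<delta> X =
     bindP (rademacher d b) (\<lambda>y0. Draw (T - 1) (\<lambda>t. bindP (iter m \<eta> X t y0) (\<lambda>y.
       bindP (mean_est m nb (\<lambda>i. X i ((1 / norm y) *\<^sub>R y))) (\<lambda>h.
         Ret (if inner ((1 / norm y) *\<^sub>R y) h \<le> - (3/8 * \<delta>) then Some ((1 / norm y) *\<^sub>R y) else None)))))"

primrec nc_rep :: "nat \<Rightarrow> ('q, 'a option) prog \<Rightarrow> ('q, 'a option) prog" where
  "nc_rep 0 P = Ret None"
| "nc_rep (Suc k) P = bindP P (\<lambda>r. case r of None \<Rightarrow> nc_rep k P | Some w \<Rightarrow> Ret (Some w))"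

lemma costs_nc_rep: "costs P c \<Longrightarrow> costs (nc_rep k P) (k * c)"
proof (induction k)
  case (Suc k)
  have "costs (bindP P (\<lambda>r. case r of None \<Rightarrow> nc_rep k P | Some w \<Rightarrow> Ret (Some w))) (c + k * c)"
    using Suc by (intro costs_bind) (auto split: option.split)
  then show ?case by simp
qed simp

lemma ev_nc_rep_None: "ev G (nc_rep k P) (\<lambda>r. of_bool (r = None)) = (ev G P (\<lambda>r. of_bool (r = None))) ^ k"
proof (induction k)
  case (Suc k)
  have "ev G (nc_rep (Suc k) P) (\<lambda>r. of_bool (r = None)) =
     ev G P (\<lambda>r. of_bool (r = None) * ev G P (\<lambda>r. of_bool (r = None)) ^ k)"
    unfolding nc_rep.simps ev_bind by (rule ev_cong_on) (auto split: option.split simp: Suc)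
  then show ?case by (simp add: ev_cmult_right)
qed simp

lemma ev_nc_rep_Some:
  assumes "ev G P (\<lambda>r. of_bool (\<exists>w. r = Some w \<and> Q w)) \<le> q" "q \<ge> 0"
  shows "ev G (nc_rep k P) (\<lambda>r. of_bool (\<exists>w. r = Some w \<and> Q w)) \<le> real k * q"
proof (induction k)
  case (Suc k)
  have "ev G (nc_rep (Suc k) P) (\<lambda>r. of_bool (\<exists>w. r = Some w \<and> Q w)) \<le>
     ev G P (\<lambda>r. of_bool (\<exists>w. r = Some w \<and> Q w) + real k * q)"
    unfolding nc_rep.simps ev_bind using Suc assms(2) by (intro ev_mono) (auto split: option.split)
  also have "\<dots> \<le> real (Suc k) * q" using assms by (simp add: ev_add ev_const algebra_simps)
  finally show ?case .
qed simp

lemma (in oja) ev_iter: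
  assumes "\<And>i y h. i \<le> m \<Longrightarrow> ev G (X i y) h = h (hv i y)"
  shows "ev G (iter m \<eta> X t y) h = ev G (idx t) (\<lambda>l. h (run y l))"
proof (induction t arbitrary: y)
  case (Suc t)
  then show ?case unfolding ev_idx_Suc by (simp add: ev_bind assms)
qed simp

lemma costs_nc_try:
  assumes "\<And>i y. costs (X i y) c" "T > 0"
  shows "costs (nc_try m d b T \<eta> nb \<delta> X) (T * c + nb * c)"
proof -
  let ?Q = "\<lambda>y. bindP (mean_est m nb (\<lambda>i. X i ((1 / norm y) *\<^sub>R y))) (\<lambda>h.
         Ret (if inner ((1 / norm y) *\<^sub>R y) h \<le> - (3/8 * \<delta>) then Some ((1 / norm y) *\<^sub>R y) else None))"
  have "costs (?Q y) (nb * c + 0)" for y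
    using assms(1) by (intro costs_bind costs_mean_est) auto
  then have Q: "costs (?Q y) (nb * c)" for y by (simp only: add_0_right)
  have I: "costs (bindP (iter m \<eta> X t y0) ?Q) (T * c + nb * c)" if "t < T" for t y0
    by (rule costs_bind[OF costs_mono[OF costs_iter[OF assms(1)]] Q]) (use that in auto)
  have R: "costs (rademacher d b) 0" by (simp add: rademacher_def)
  show ?thesis
    unfolding nc_try_def using costs_bind[OF R, of "\<lambda>y0. Draw (T - 1) (\<lambda>t. bindP (iter m \<eta> X t y0) ?Q)" "T * c + nb * c"] I assms(2)
    by simp
qed

text \<open>Whatever the candidate y is and however it was found, a bad direction is accepted only
  if the final mean errs by more than \<delta>/16.\<close>

lemma nc_try_sound:
  fixes hv :: "nat \<Rightarrow> 'v::real_inner \<Rightarrow> 'v"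
  assumes X: "\<And>i y h. i \<le> m \<Longrightarrow> ev G (X i y) h = h (hv i y)"
    and mu: "\<And>w. (\<Sum>i\<le>m. hv i w) = real (Suc m) *\<^sub>R \<mu> w"
    and b: "\<And>i w. i \<le> m \<Longrightarrow> norm w = 1 \<Longrightarrow> norm (hv i w - \<mu> w) \<le> \<beta>"
    and H: "\<And>w. norm w = 1 \<Longrightarrow> norm (\<mu> w - H w) \<le> \<delta> / 16"
    and l: "l \<ge> 0" "nb > 0" "l\<^sup>2 * \<beta>\<^sup>2 \<le> real nb" and "\<delta> > 0"
  shows "ev G (nc_try m d bs T \<eta> nb \<delta> X) (\<lambda>r. of_bool (\<exists>w. r = Some w \<and>
      \<not> (norm w = 1 \<and> inner w (H w) \<le> - (\<delta> / 4)))) \<le> exp (2 - l * (\<delta> / 16))"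
proof -
  define bad where "bad = (\<lambda>r. \<exists>w. r = Some w \<and> \<not> (norm w = 1 \<and> inner w (H w) \<le> - (\<delta> / 4)))"
  have *: "ev G (mean_est m nb (\<lambda>i. X i ((1 / norm y) *\<^sub>R y))) (\<lambda>h.
         of_bool (bad (if inner ((1 / norm y) *\<^sub>R y) h \<le> - (3/8 * \<delta>) then Some ((1 / norm y) *\<^sub>R y) else None)))
     \<le> exp (2 - l * (\<delta> / 16))" for y
  proof (cases "y = 0")
    \<comment> \<open>The normalised vector is 0 here, its test value 0 misses the negative
      threshold, and the answer is \<open>None\<close>.\<close>
    case True
    then show ?thesis using \<open>\<delta> > 0\<close> by (simp add: bad_def ev_const)
  next
    case False
    define w where "w = (1 / norm y) *\<^sub>R y"
    have w: "norm w = 1" using False by (simp add: w_def)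
    have "ev G (mean_est m nb (\<lambda>i. X i w)) (\<lambda>h. of_bool (bad (if inner w h \<le> - (3/8 * \<delta>) then Some w else None)))
        \<le> ev G (mean_est m nb (\<lambda>i. X i w)) (\<lambda>h. of_bool (norm (h - \<mu> w) > \<delta> / 16))"
    proof (rule ev_mono)
      fix h
      have "norm (h - \<mu> w) > \<delta> / 16" if "bad (if inner w h \<le> - (3/8 * \<delta>) then Some w else None)"
      proof (rule ccontr)
        assume "\<not> ?thesis"
        then have 1: "norm (h - \<mu> w) \<le> \<delta> / 16" by simp
        have "inner w (H w) = inner w h - inner w (h - \<mu> w) - inner w (\<mu> w - H w)"
          by (simp add: inner_diff_right)
        also have "\<dots> \<le> inner w h + \<delta> / 16 + \<delta> / 16"
          using Cauchy_Schwarz_ineq2[of w "h - \<mu> w"] Cauchy_Schwarz_ineq2[of w "\<mu> w - H w"] 1 H[OF w] w by simp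
        finally show False using that w by (auto simp: bad_def split: if_splits)
      qed
      then show "of_bool (bad (if inner w h \<le> - (3/8 * \<delta>) then Some w else None)) \<le> (of_bool (norm (h - \<mu> w) > \<delta> / 16) :: real)"
        by auto
    qed
    also have "\<dots> \<le> exp (2 - l * (\<delta> / 16))"
      by (rule ev_mean_est_tail[OF _ mu b[OF _ w] l]) (auto simp: X)
    finally show ?thesis unfolding w_def .
  qed
  have "ev G (nc_try m d bs T \<eta> nb \<delta> X) (\<lambda>r. of_bool (bad r)) \<le> exp (2 - l * (\<delta> / 16))"
    unfolding nc_try_def by (rule ev_bind_le, rule ev_Draw_le, rule ev_bind_le) (unfold ev_bind ev.simps(1), rule *)
  then show ?thesis unfolding bad_def .
qed

text \<open>A good iterate has curvature at most -lm/2 \<le> -\<delta>/2 after normalisation and is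
  rejected only if the test errs; \<open>ev_good\<close> bounds the chance of stopping at
  one.\<close>

lemma (in oja) nc_try_complete:
  assumes X: "\<And>i y h. i \<le> m \<Longrightarrow> ev G (X i y) h = h (hv i y)"
    and mu: "\<And>w. (\<Sum>i\<le>m. hv i w) = real (Suc m) *\<^sub>R \<mu> w"
    and b: "\<And>i w. i \<le> m \<Longrightarrow> norm w = 1 \<Longrightarrow> norm (hv i w - \<mu> w) \<le> \<beta>"
    and H: "\<And>w. norm w = 1 \<Longrightarrow> norm (\<mu> w - H w) \<le> \<delta> / 16"
    and l: "l \<ge> 0" "nb > 0" "l\<^sup>2 * \<beta>\<^sup>2 \<le> real nb" and "\<delta> > 0" "lm \<ge> \<delta>"
  shows "ev G (nc_try m d b T \<eta> nb \<delta> X) (\<lambda>r. of_bool (r = None)) \<le> 1 - 1/32 + exp (2 - l * (\<delta> / 16))"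
proof -
  define q where "q = exp (2 - l * (\<delta> / 16))"
  have *: "ev G (mean_est m nb (\<lambda>i. X i ((1 / norm y) *\<^sub>R y))) (\<lambda>h.
         of_bool ((if inner ((1 / norm y) *\<^sub>R y) h \<le> - (3/8 * \<delta>) then Some ((1 / norm y) *\<^sub>R y) else None) = None))
     \<le> 1 + q - of_bool (good y)" for y
  proof (cases "good y")
    case False
    have "ev G (mean_est m nb (\<lambda>i. X i ((1 / norm y) *\<^sub>R y))) (\<lambda>h.
         of_bool ((if inner ((1 / norm y) *\<^sub>R y) h \<le> - (3/8 * \<delta>) then Some ((1 / norm y) *\<^sub>R y) else None) = None)) \<le> 1"
      by (intro ev_le_const) auto
    then show ?thesis using False by (simp add: q_def add_increasing2)
  next
    case True
    define w where "w = (1 / norm y) *\<^sub>R y"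
    have y0: "norm y > 0" using True by (simp add: good_def)
    have w: "norm w = 1" using y0 by (simp add: w_def)
    have "H y = norm y *\<^sub>R H w"
    proof -
      have "real (Suc m) *\<^sub>R H y = (\<Sum>i\<le>m. A i (norm y *\<^sub>R w))" using y0 by (simp add: w_def mean_A)
      also have "\<dots> = (\<Sum>i\<le>m. norm y *\<^sub>R A i w)" using lin_A by (intro sum.cong) (auto simp: linear_scale)
      also have "\<dots> = real (Suc m) *\<^sub>R (norm y *\<^sub>R H w)" by (simp only: scaleR_sum_right[symmetric] mean_A scaleR_left_commute)
      finally show ?thesis by (simp only: scaleR_cancel_left) simp
    qed
    then have "inner y (H y) = (norm y)\<^sup>2 * inner w (H w)" using y0 by (simp add: w_def power2_eq_square)
    then have "(norm y)\<^sup>2 * inner w (H w) \<le> (norm y)\<^sup>2 * (- (lm / 2))" using True by (simp add: good_def mult.commute)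
    then have "inner w (H w) \<le> - (lm / 2)" using y0 by (simp only: mult_le_cancel_left_pos zero_less_power)
    then have wH: "inner w (H w) \<le> - (\<delta> / 2)" using \<open>lm \<ge> \<delta>\<close> by simp
    have "ev G (mean_est m nb (\<lambda>i. X i w)) (\<lambda>h. of_bool ((if inner w h \<le> - (3/8 * \<delta>) then Some w else None) = None))
        \<le> ev G (mean_est m nb (\<lambda>i. X i w)) (\<lambda>h. of_bool (norm (h - \<mu> w) > \<delta> / 16))"
    proof (rule ev_mono)
      fix h
      have "norm (h - \<mu> w) > \<delta> / 16" if "inner w h > - (3/8 * \<delta>)"
      proof (rule ccontr)
        assume "\<not> ?thesis"
        then have 1: "norm (h - \<mu> w) \<le> \<delta> / 16" by simp
        have "inner w h = inner w (H w) + inner w (h - \<mu> w) + inner w (\<mu> w - H w)"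
          by (simp add: inner_diff_right)
        also have "\<dots> \<le> - (\<delta> / 2) + \<delta> / 16 + \<delta> / 16"
          using Cauchy_Schwarz_ineq2[of w "h - \<mu> w"] Cauchy_Schwarz_ineq2[of w "\<mu> w - H w"] 1 H[OF w] w wH by simp
        finally show False using that by simp
      qed
      then show "of_bool ((if inner w h \<le> - (3/8 * \<delta>) then Some w else None) = None) \<le> (of_bool (norm (h - \<mu> w) > \<delta> / 16) :: real)"
        by auto
    qed
    also have "\<dots> \<le> q" unfolding q_def
      by (rule ev_mean_est_tail[OF _ mu b[OF _ w] l]) (auto simp: X)
    finally show ?thesis unfolding w_def by (simp only: True of_bool_eq add_diff_cancel_left')
  qed
  have eqT: "{..T - 1} = {..<T}" "real (Suc (T - 1)) = real T" using T by auto
  have "ev G (nc_try m d b T \<eta> nb \<delta> X) (\<lambda>r. of_bool (r = None)) \<le>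
     ev G rad (\<lambda>y0. (\<Sum>t<T. ev G (iter m \<eta> X t y0) (\<lambda>y. 1 + q - of_bool (good y))) / real T)"
    unfolding nc_try_def ev_bind ev.simps(1,2) eqT using *
    by (intro ev_mono divide_right_mono sum_mono) auto
  also have "\<dots> = 1 + q - (\<Sum>t<T. ev G rad (\<lambda>y. ev G (idx t) (\<lambda>l. of_bool (good (run y l))))) / real T"
    using T by (simp add: ev_iter[OF X] ev_diff ev_const ev_divide ev_sum sum_subtractf diff_divide_distrib)
  also have "\<dots> \<le> 1 + q - 1/32" using ev_good[of G] by simp
  finally show ?thesis by (simp add: q_def)
qed

section \<open>The search algorithm\<close>

primrec ask_all :: "'v::real_vector \<Rightarrow> nat \<Rightarrow> ('v, 'v) prog" where
  "ask_all x 0 = Ret 0"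
| "ask_all x (Suc k) = Ask k x (\<lambda>a. bindP (ask_all x k) (\<lambda>S. Ret (S + a)))"

lemma ev_ask_all: "ev G (ask_all x k) h = h (\<Sum>i<k. G i x)"
  by (induction k arbitrary: h) (auto simp: ev_bind)

lemma costs_ask_all: "costs (ask_all x k) k"
proof (induction k)
  case (Suc k)
  have "costs (bindP (ask_all x k) (\<lambda>S. Ret (S + a))) (k + 0)" for a
    using Suc by (intro costs_bind) auto
  then show ?case by simp
qed simp

primrec boost :: "nat \<Rightarrow> ('q, 'a option) prog \<Rightarrow> 'a \<Rightarrow> ('q, 'a) prog" where
  "boost 0 P z = Ret z"
| "boost (Suc r) P z = bindP P (\<lambda>o'. case o' of Some x \<Rightarrow> Ret x | None \<Rightarrow> boost r P z)"

lemma costs_boost: "costs P c \<Longrightarrow> costs (boost k P z) (k * c)"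
proof (induction k)
  case (Suc k)
  have "costs (bindP P (\<lambda>r. case r of Some x \<Rightarrow> Ret x | None \<Rightarrow> boost k P z)) (c + k * c)"
    using Suc by (intro costs_bind) (auto split: option.split)
  then show ?case by simp
qed simp

text \<open>Giving up is visible, so repetition halves its probability each time. A wrong output
  goes unnoticed, and its probability adds up over the runs.\<close>

lemma ev_boost:
  assumes "ev G P (\<lambda>r. of_bool (r = None)) \<le> 1/2" "ev G P (\<lambda>r. of_bool (\<exists>x. r = Some x \<and> \<not> Q x)) \<le> q"
  shows "ev G (boost k P z) (\<lambda>x. of_bool (\<not> Q x)) \<le> real k * q + (1/2) ^ k"
proof (induction k)
  case (Suc k)
  have q: "q \<ge> 0" by (rule order_trans[OF ev_nonneg assms(2)]) simp
  have "ev G (boost (Suc k) P z) (\<lambda>x. of_bool (\<not> Q x)) \<le>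
     ev G P (\<lambda>r. of_bool (\<exists>x. r = Some x \<and> \<not> Q x) + (real k * q + of_bool (r = None) * (1/2) ^ k))"
    unfolding boost.simps ev_bind using Suc q by (intro ev_mono) (auto split: option.split)
  also have "\<dots> = ev G P (\<lambda>r. of_bool (\<exists>x. r = Some x \<and> \<not> Q x)) + (real k * q + ev G P (\<lambda>r. of_bool (r = None)) * (1/2) ^ k)"
    by (simp only: ev_add ev_const ev_cmult_right)
  also have "\<dots> \<le> q + (real k * q + 1/2 * (1/2) ^ k)"
    by (rule add_mono[OF assms(2)], rule add_left_mono, rule mult_right_mono[OF assms(1)]) simp
  finally show ?case by (simp add: algebra_simps)
qed simp

locale search_params =
  fixes m d :: nat and b :: "nat \<Rightarrow> 'v::real_inner" and c \<epsilon> \<delta> La \<tau> :: real and full :: bool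
begin

text \<open>Dictated by \<open>Qf_le\<close>: the union bound over all steps costs at most c^7 exp(9
  La) times a number below exp 51, and 60 = 9 + 51.\<close>

definition k1 :: real where "k1 = 60 + 7 * c"
text \<open>Chosen so that ell \<epsilon>/16 = k1 La: an error of \<epsilon>/16 in the gradient
  estimate then has weight exp(-k1 La) up to a constant. \<open>ell2\<close> plays the same role for
  errors of \<delta>/16.\<close>

definition ell :: real where "ell = 16 * k1 * La / \<epsilon>"
definition ell2 :: real where "ell2 = 16 * k1 * La / \<delta>"
definition stp :: real where "stp = \<epsilon> / (4 * c)"
definition jmp :: real where "jmp = \<delta> / (4 * c)"
definition B0 :: nat where "B0 = (if full then Suc m else nat \<lceil>16 * c\<^sup>2 * ell\<^sup>2\<rceil>)"
definition len :: real where "len = sqrt (real B0) * \<epsilon>"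
text \<open>With this batch an update over length E multiplies \<open>Phi\<close> by at most exp(E /
  len); the 16 c^2 stems from the bound 4cE for the deviation of a gradient difference.\<close>

definition bsz :: "real \<Rightarrow> nat" where "bsz E = nat \<lceil>16 * c\<^sup>2 * ell\<^sup>2 * E * len\<rceil>"
text \<open>With T = J^2 and \<eta> = 1/(2cJ) one has \<eta>^2 c^2 T = 1/4 exactly, and \<eta> lm T
  = lm J/(2c) is at least 60 La as soon as lm \<ge> \<delta>.\<close>

definition Jn :: nat where "Jn = nat \<lceil>120 * c * La / \<delta>\<rceil>"
definition Tn :: nat where "Tn = Jn\<^sup>2"
definition eta :: real where "eta = 1 / (2 * c * real Jn)"
definition nbn :: nat where "nbn = nat \<lceil>16 * c\<^sup>2 * ell2\<^sup>2\<rceil>"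
text \<open>A single search misses with probability at most 1 - 1/64, so this many leave exp(-k1
  La).\<close>

definition Kn :: nat where "Kn = nat \<lceil>64 * k1 * La\<rceil>"
text \<open>The budgets \<open>NG\<close> and \<open>NC\<close> are such that exhausting either one
  would account for a decrease of 4c, four times the bound c on the initial gap.\<close>

definition NG :: nat where "NG = nat \<lceil>64 * c\<^sup>2 / \<epsilon>\<^sup>2\<rceil>"
definition NC :: nat where "NC = nat \<lceil>768 * c ^ 3 / \<delta> ^ 3\<rceil>"
definition Rn :: nat where "Rn = nat \<lceil>4 * La\<rceil>"

definition radius :: real where "radius = stp * real NG + jmp * real NC"

definition difP :: "'v \<Rightarrow> 'v \<Rightarrow> nat \<Rightarrow> ('v, 'v) prog" where
  "difP x' x i = Ask i x' (\<lambda>a. Ask i x (\<lambda>a'. Ret (a - a')))"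

text \<open>A difference quotient over the fixed length \<tau>, rescaled by the norm of y so that
  its error is proportional to that norm.\<close>

definition hvP :: "'v \<Rightarrow> nat \<Rightarrow> 'v \<Rightarrow> ('v, 'v) prog" where
  "hvP x i y = Ask i (x + (\<tau> / norm y) *\<^sub>R y) (\<lambda>a. Ask i x (\<lambda>a'. Ret ((norm y / \<tau>) *\<^sub>R (a - a'))))"

definition ncP :: "'v \<Rightarrow> ('v, 'v option) prog" where
  "ncP x = nc_rep Kn (nc_try m d b Tn eta nbn \<delta> (hvP x))"

definition refresh :: "'v \<Rightarrow> ('v, 'v) prog" where
  "refresh x = (if full then bindP (ask_all x (Suc m)) (\<lambda>S. Ret ((1 / real (Suc m)) *\<^sub>R S))
     else mean_est m B0 (\<lambda>i. Ask i x Ret))"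

definition moveP :: "real \<Rightarrow> 'v \<Rightarrow> 'v \<Rightarrow> real \<Rightarrow> 'v \<Rightarrow> ('v, 'v \<times> real) prog" where
  "moveP E x v acc x' = (if acc + E > len then bindP (refresh x') (\<lambda>v'. Ret (v', 0))
     else bindP (mean_est m (bsz E) (difP x' x)) (\<lambda>h. Ret (v + h, acc + E)))"

abbreviation loopP :: "nat \<Rightarrow> 'v \<Rightarrow> 'v \<Rightarrow> real \<Rightarrow> nat \<Rightarrow> nat \<Rightarrow> ('v, 'v option) prog" where
  "loopP \<equiv> descent_program.loop ncP moveP \<epsilon> stp jmp"

definition onceP :: "'v \<Rightarrow> ('v, 'v option) prog" where
  "onceP x0 = bindP (refresh x0) (\<lambda>v. loopP (NG + NC + 1) x0 v 0 NG NC)"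

definition searchP :: "'v \<Rightarrow> ('v, 'v) prog" where
  "searchP x0 = boost Rn (onceP x0) x0"

end

locale search_consts = search_params m d b c \<epsilon> \<delta> La \<tau> full
  for m d :: nat and b :: "nat \<Rightarrow> 'v::real_inner" and c \<epsilon> \<delta> La \<tau> :: real and full :: bool +
  fixes p :: real
  assumes c1: "c \<ge> 1" and eps: "0 < \<epsilon>" "\<epsilon> < 1" and del: "0 < \<delta>" "\<delta> < 1" and p: "0 < p" "p < 1"
    and d1: "d \<ge> 1" and La: "La = 1 + ln (real d) - ln \<epsilon> - ln \<delta> - ln p"
begin

section \<open>Sizes of the parameters and the failure budget\<close>

lemma lns: "ln (real d) \<ge> 0" "ln \<epsilon> \<le> 0" "ln \<delta> \<le> 0" "ln p \<le> 0"
  using d1 eps del p by (auto simp: ln_le_zero_iff)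

lemma La1: "La \<ge> 1" using lns La by linarith

lemma La_d: "La \<ge> 1 + ln (real d)" using lns La by linarith

lemma k1: "k1 \<ge> 67" "k1 \<le> 67 * c" using c1 by (auto simp: k1_def)

lemma inv_le: "1 / \<epsilon> \<le> exp La" "1 / \<delta> \<le> exp La" "1 / p \<le> exp La"
proof -
  have "exp (- ln \<epsilon>) \<le> exp La" "exp (- ln \<delta>) \<le> exp La" "exp (- ln p) \<le> exp La" using lns La by auto
  then show "1 / \<epsilon> \<le> exp La" "1 / \<delta> \<le> exp La" "1 / p \<le> exp La" using eps del p by (auto simp: exp_minus field_simps)
qed

lemma ceil_le: "0 \<le> x \<Longrightarrow> real (nat \<lceil>x\<rceil>) \<le> x + 1" "real (nat \<lceil>x\<rceil>) \<ge> x"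
  by linarith+

lemma ceil_mult: "1 \<le> y \<Longrightarrow> 0 \<le> k \<Longrightarrow> real (nat \<lceil>k * y\<rceil>) \<le> (k + 1) * y"
proof -
  assume "1 \<le> y" "0 \<le> k"
  then have "real (nat \<lceil>k * y\<rceil>) \<le> k * y + 1" by (intro ceil_le) auto
  then show ?thesis using \<open>1 \<le> y\<close> by (simp add: distrib_right)
qed

lemma ell: "ell > 0" "ell2 > 0" using k1 La1 eps del by (auto simp: ell_def ell2_def)

lemma B0: "B0 \<ge> 1"
proof (cases full)
  case False
  have "0 < 16 * c\<^sup>2 * ell\<^sup>2" using c1 ell by auto
  then have "nat \<lceil>16 * c\<^sup>2 * ell\<^sup>2\<rceil> > 0" by simp
  moreover have "B0 = nat \<lceil>16 * c\<^sup>2 * ell\<^sup>2\<rceil>" using False unfolding B0_def by simp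
  ultimately show ?thesis by linarith
next
  case True
  then have "B0 = Suc m" unfolding B0_def by simp
  then show ?thesis by simp
qed

lemma len: "len > 0" using B0 eps by (simp add: len_def)

lemma sj: "stp > 0" "jmp > 0" using eps del c1 by (auto simp: stp_def jmp_def)

lemma bsz_pos: "E > 0 \<Longrightarrow> bsz E > 0"
  using c1 ell len by (simp add: bsz_def)

lemma Jn: "real Jn \<ge> 120 * c * La / \<delta>" "Jn \<ge> 1"
proof -
  show 1: "real Jn \<ge> 120 * c * La / \<delta>" unfolding Jn_def by (rule ceil_le)
  have "120 * c * La / \<delta> > 0" using c1 La1 del by auto
  with 1 show "Jn \<ge> 1" by (smt (verit) of_nat_0 One_nat_def Suc_leI gr0I)
qed

lemma nbn: "nbn > 0" using c1 ell by (simp add: nbn_def)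

lemma Kn: "real Kn \<ge> 64 * k1 * La" "real Kn \<le> 65 * k1 * La"
proof -
  have "1 \<le> k1 * La" using k1 La1 mult_mono[of 1 k1 1 La] by simp
  from ceil_mult[OF this, of 64] show "real Kn \<le> 65 * k1 * La" by (simp add: Kn_def mult.assoc)
  show "real Kn \<ge> 64 * k1 * La" unfolding Kn_def by (rule ceil_le)
qed

lemma NG: "real NG \<ge> 64 * c\<^sup>2 / \<epsilon>\<^sup>2" "real NG \<le> 65 * c\<^sup>2 / \<epsilon>\<^sup>2"
proof -
  have "\<epsilon>\<^sup>2 \<le> 1" "1 \<le> c\<^sup>2" using eps c1 by (auto simp: power_le_one)
  then have "1 \<le> c\<^sup>2 / \<epsilon>\<^sup>2" using eps by (simp add: field_simps)
  from ceil_mult[OF this, of 64] show "real NG \<le> 65 * c\<^sup>2 / \<epsilon>\<^sup>2" by (simp add: NG_def)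
  show "real NG \<ge> 64 * c\<^sup>2 / \<epsilon>\<^sup>2" unfolding NG_def by (rule ceil_le)
qed

lemma NC: "real NC \<ge> 768 * c ^ 3 / \<delta> ^ 3" "real NC \<le> 769 * c ^ 3 / \<delta> ^ 3"
proof -
  have "\<delta> ^ 3 \<le> 1" "1 \<le> c ^ 3" using del c1 by (auto simp: power_le_one)
  then have "1 \<le> c ^ 3 / \<delta> ^ 3" using del by (simp add: field_simps)
  from ceil_mult[OF this, of 768] show "real NC \<le> 769 * c ^ 3 / \<delta> ^ 3" by (simp add: NC_def)
  show "real NC \<ge> 768 * c ^ 3 / \<delta> ^ 3" unfolding NC_def by (rule ceil_le)
qed

lemma Rn: "real Rn \<ge> 4 * La" "real Rn \<le> 5 * La"
  using ceil_le(2)[of "4 * La"] ceil_mult[OF La1, of 4] by (auto simp: Rn_def)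

definition Nn :: nat where "Nn = NG + NC + 1"

lemma Nn_le: "real Nn \<le> 835 * c ^ 3 * exp La ^ 3"
proof -
  define E where "E = exp La"
  have E: "E \<ge> 1" using La1 by (simp add: E_def)
  have cc: "c\<^sup>2 \<le> c ^ 3" "1 \<le> c ^ 3" using c1 by (auto intro: power_increasing)
  have EE: "E\<^sup>2 \<le> E ^ 3" "1 \<le> E ^ 3" using E by (auto intro: power_increasing)
  have e2: "1 / \<epsilon>\<^sup>2 \<le> E\<^sup>2" using power_mono[OF inv_le(1), of 2] eps by (simp add: power_divide E_def)
  have d3: "1 / \<delta> ^ 3 \<le> E ^ 3" using power_mono[OF inv_le(2), of 3] del by (simp add: power_divide E_def)
  have ce: "1 \<le> c ^ 3 * E ^ 3" using cc EE mult_mono[of 1 "c^3" 1 "E^3"] c1 by simp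
  have "real NG \<le> 64 * c\<^sup>2 / \<epsilon>\<^sup>2 + 1" unfolding NG_def by (rule ceil_le) simp
  moreover have "c\<^sup>2 * (1 / \<epsilon>\<^sup>2) \<le> c ^ 3 * E ^ 3"
    using e2 EE cc E c1 by (intro mult_mono) auto
  moreover have "real NC \<le> 768 * c ^ 3 / \<delta> ^ 3 + 1" unfolding NC_def using c1 del by (intro ceil_le) auto
  moreover have "c ^ 3 * (1 / \<delta> ^ 3) \<le> c ^ 3 * E ^ 3" using d3 c1 by (intro mult_left_mono) auto
  ultimately show ?thesis using ce by (simp add: Nn_def E_def)
qed

definition q1 :: real where "q1 = exp (- (k1 * La))"
definition q2 :: real where "q2 = real Kn * exp (2 - k1 * La)"

text \<open>The failure budget of one run: the errors of a search in each of at most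
  \<open>Nn\<close> rounds, plus the weight of the estimate's potential, where the first estimate
  and every later move contribute exp 2.\<close>

definition Qf :: real where
  "Qf = real Nn * (q1 + q2) + 2 * exp (1 - k1 * La) * exp 2 * (real Nn)\<^sup>2"

lemma exp2_le: "exp (2::real) \<le> 8" "exp (3::real) \<le> 21"
proof -
  have e: "exp (1::real) \<le> 2.72" using e_approx_32 by (simp add: abs_if split: if_splits)
  have "exp (2::real) = exp 1 ^ 2" "exp (3::real) = exp 1 ^ 3" by (auto simp: exp_of_nat_mult[symmetric])
  moreover have "exp (1::real) ^ 2 \<le> 2.72 ^ 2" "exp (1::real) ^ 3 \<le> 2.72 ^ 3" using e by (auto intro!: power_mono)
  ultimately show "exp (2::real) \<le> 8" "exp (3::real) \<le> 21" by (auto simp: power2_eq_square power3_eq_cube)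
qed

text \<open>Everything polynomial is absorbed into exponentials: Nn^2 contributes c^6 exp(6 La),
  \<open>Kn\<close> a factor k1 exp La with k1 \<le> 67 c, and the claim itself exp(2 La). The total
  exponent 7c + 9 La - k1 La is at most -51, and already 2^51 beats the numerical factor.\<close>

lemma Qf_le: "Qf \<le> 1 / (10 * (exp La)\<^sup>2)"
proof -
  define E where "E = exp La"
  define u where "u = exp (- (k1 * La))"
  have E: "E \<ge> 1" using La1 by (simp add: E_def)
  have u: "u > 0" by (simp add: u_def)
  have LE: "La \<le> E" unfolding E_def using exp_ge_add_one_self[of La] by linarith
  have N1: "real Nn \<ge> 1" by (simp add: Nn_def)
  have kE: "1 \<le> k1 * E" using k1 E mult_mono[of 1 k1 1 E] by simp
  have Kn': "real Kn \<le> 65 * (k1 * E)" using Kn(2) mult_left_mono[OF LE, of "65 * k1"] k1 by linarith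
  have "q2 = real Kn * (exp 2 * u)" by (simp add: q2_def u_def exp_diff exp_minus field_simps)
  also have "\<dots> \<le> (65 * (k1 * E)) * (8 * u)" using Kn' exp2_le u k1 E by (intro mult_mono) auto
  finally have "q2 \<le> 520 * (k1 * E) * u" by simp
  moreover have "1 * u \<le> k1 * E * u" using kE u by (intro mult_right_mono) auto
  moreover have "q1 = u" by (simp add: q1_def u_def)
  ultimately have q: "q1 + q2 \<le> 521 * (k1 * E) * u" by linarith
  have "exp (1 - k1 * La) * exp 2 = exp 3 * u" by (simp add: u_def exp_add[symmetric])
  also have "\<dots> \<le> 21 * (k1 * E) * u" using exp2_le u kE by (intro mult_right_mono) auto
  finally have q3: "exp (1 - k1 * La) * exp 2 \<le> 21 * (k1 * E) * u" .
  have NN: "real Nn \<le> (real Nn)\<^sup>2" using N1 by (simp add: power2_eq_square)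
  have "real Nn * (q1 + q2) \<le> (real Nn)\<^sup>2 * (521 * (k1 * E) * u)"
    using q NN u k1 E by (intro mult_mono) (auto simp: q1_def q2_def)
  moreover have "2 * exp (1 - k1 * La) * exp 2 * (real Nn)\<^sup>2 \<le> 2 * (21 * (k1 * E) * u) * (real Nn)\<^sup>2"
    using mult_left_mono[OF q3, of 2] by (intro mult_right_mono) (simp_all only: mult.assoc, simp_all)
  ultimately have "Qf \<le> (real Nn)\<^sup>2 * (563 * (k1 * E) * u)" by (simp add: Qf_def algebra_simps)
  also have "\<dots> \<le> (835 * c ^ 3 * E ^ 3)\<^sup>2 * (563 * (k1 * E) * u)"
    using Nn_le u k1 E by (intro mult_right_mono power_mono) (auto simp: E_def)
  also have "\<dots> = 392537675 * (c ^ 6 * k1) * E ^ 7 * u"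
    by (simp add: power_mult_distrib power_mult[symmetric] eval_nat_numeral)
  finally have Q: "Qf \<le> 392537675 * (c ^ 6 * k1) * E ^ 7 * u" .
  have "c ^ 6 * k1 \<le> c ^ 6 * (67 * c)" using k1 c1 by (intro mult_left_mono) auto
  also have "\<dots> = 67 * c ^ 7" by (simp add: eval_nat_numeral)
  also have "\<dots> \<le> 67 * exp c ^ 7" using exp_ge_add_one_self[of c] c1 by (intro mult_left_mono power_mono) linarith+
  finally have ck: "c ^ 6 * k1 \<le> 67 * exp (7 * c)" by (simp add: exp_of_nat_mult[symmetric])
  have "392537675 * (c ^ 6 * k1) * E ^ 7 * u * (10 * E\<^sup>2) = 3925376750 * (c ^ 6 * k1) * E ^ 9 * u"
    by (simp add: eval_nat_numeral)
  also have "\<dots> \<le> 3925376750 * (67 * exp (7 * c)) * E ^ 9 * u"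
    using ck u E by (intro mult_right_mono mult_left_mono) auto
  also have "\<dots> = 263000242250 * (exp (7 * c) * E ^ 9 * u)" by simp
  also have "exp (7 * c) * E ^ 9 * u \<le> exp (-51)"
  proof -
    have "exp (7 * c) * E ^ 9 * u = exp (7 * c + 9 * La - k1 * La)"
      by (simp add: E_def u_def exp_of_nat_mult[symmetric] exp_add[symmetric] exp_diff exp_minus field_simps)
    also have "7 * c + 9 * La - k1 * La \<le> - 51"
    proof -
      have "(51 + 7 * c) * 1 \<le> (51 + 7 * c) * La" using La1 c1 by (intro mult_left_mono) auto
      then show ?thesis by (simp add: k1_def algebra_simps)
    qed
    finally show ?thesis by simp
  qed
  also have "263000242250 * exp (-51 :: real) \<le> 1"
  proof -
    have "(2::real) ^ 51 \<le> exp 1 ^ 51" using exp_ge_add_one_self[of 1] by (intro power_mono) auto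
    then have "(2::real) ^ 51 \<le> exp 51" by (simp add: exp_of_nat_mult[symmetric])
    then have "263000242250 \<le> exp (51::real)" by simp
    then show ?thesis by (simp add: exp_minus field_simps)
  qed
  finally have "392537675 * (c ^ 6 * k1) * E ^ 7 * u * (10 * E\<^sup>2) \<le> 1" by simp
  moreover have "Qf * (10 * E\<^sup>2) \<le> 392537675 * (c ^ 6 * k1) * E ^ 7 * u * (10 * E\<^sup>2)"
    by (rule mult_right_mono[OF Q]) simp
  ultimately have "Qf * (10 * E\<^sup>2) \<le> 1" by linarith
  then show ?thesis using E by (simp add: E_def field_simps)
qed

text \<open>p is split between wrong outputs in any of the \<open>Rn\<close> runs and the event that
  all of them give up; 4 La runs make the latter at most exp(-2 La).\<close>

lemma Qf_consequences: "Qf \<le> 1/8" "real Rn * Qf + (1/2) ^ Rn \<le> p"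
proof -
  define E where "E = exp La"
  have E: "E \<ge> 2" unfolding E_def using exp_ge_add_one_self[of La] La1 by linarith
  have E4: "E\<^sup>2 \<ge> 4" using power_mono[OF E, of 2] by simp
  have LE: "La \<le> E" unfolding E_def using exp_ge_add_one_self[of La] by linarith
  have Q: "Qf \<le> 1 / (10 * E\<^sup>2)" using Qf_le by (simp add: E_def)
  also have "\<dots> \<le> 1 / (10 * 4)" using E4 by (intro divide_left_mono) auto
  also have "\<dots> \<le> 1/8" by simp
  finally show "Qf \<le> 1/8" .
  have pE: "1 / E \<le> p" using inv_le(3) p E by (simp add: E_def field_simps)
  have "real Rn * Qf \<le> (5 * E) * (1 / (10 * E\<^sup>2))" 
    using Rn LE Q E by (intro mult_mono) (auto simp: Qf_def q1_def q2_def)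
  also have "\<dots> = 1 / E / 2" using E by (simp add: power2_eq_square)
  also have "\<dots> \<le> p / 2" using pE by simp
  finally have 1: "real Rn * Qf \<le> p / 2" .
  have "(1/2::real) \<le> exp (-1/2)" using exp_ge_add_one_self[of "-1/2::real"] by simp
  then have "(1/2::real) ^ Rn \<le> exp (-1/2) ^ Rn" by (intro power_mono) auto
  also have "\<dots> = exp (- (real Rn / 2))" by (simp add: exp_of_nat_mult[symmetric])
  also have "\<dots> \<le> exp (- (2 * La))" using Rn by simp
  also have "\<dots> = 1 / E * (1 / E)" by (simp add: E_def exp_minus field_simps exp_add[symmetric])
  also have "\<dots> \<le> p * (1/2)" using pE E p by (intro mult_mono) (auto simp: field_simps)
  finally show "real Rn * Qf + (1/2) ^ Rn \<le> p" using 1 by simp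
qed

end

text \<open>The hypotheses leave room for rounded answers. The mean answer need only be within
  \<epsilon>/16 of the gradient, and the Lipschitz bound is asked only at the two step lengths
  because a rounding error does not shrink with the distance. The operators \<open>A\<close> average
  exactly to \<open>H\<close>, and the deviation of the answers from them is put into
  \<omega>.\<close>

locale search = search_consts m d b c \<epsilon> \<delta> La \<tau> full p
  for m d :: nat and b :: "nat \<Rightarrow> 'v::real_inner" and c \<epsilon> \<delta> La \<tau> :: real and full :: bool and p :: real +
  fixes G :: "nat \<Rightarrow> 'v \<Rightarrow> 'v" and f :: "'v \<Rightarrow> real" and g :: "'v \<Rightarrow> 'v" and H :: "'v \<Rightarrow> 'v \<Rightarrow> 'v"
    and A :: "'v \<Rightarrow> nat \<Rightarrow> 'v \<Rightarrow> 'v" and x0 :: 'v and flow \<omega> :: real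
  assumes descent: "\<And>x y. norm (x - x0) \<le> radius \<Longrightarrow> f y \<le> f x + inner (g x) (y - x) + c / 2 * (norm (y - x))\<^sup>2"
    and second: "\<And>x w t. norm (x - x0) \<le> radius \<Longrightarrow> norm w = 1 \<Longrightarrow> t \<ge> 0 \<Longrightarrow>
        f (x + t *\<^sub>R w) + f (x - t *\<^sub>R w) \<le> 2 * f x + t\<^sup>2 * inner w (H x w) + c / 3 * t ^ 3"
    and mean_g: "\<And>x. norm (x - x0) \<le> radius \<Longrightarrow> norm ((1 / real (Suc m)) *\<^sub>R (\<Sum>i\<le>m. G i x) - g x) \<le> \<epsilon> / 16"
    and G_lip: "\<And>i x y E. i \<le> m \<Longrightarrow> norm (x - y) \<le> E \<Longrightarrow> E = stp \<or> E = jmp \<Longrightarrow> norm (G i x - G i y) \<le> 2 * c * E"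
    and G_dev: "\<And>i x. i \<le> m \<Longrightarrow> \<not> full \<Longrightarrow> norm (G i x - (1 / real (Suc m)) *\<^sub>R (\<Sum>i\<le>m. G i x)) \<le> 4 * c"
    and A_lin: "\<And>x i. norm (x - x0) \<le> radius \<Longrightarrow> i \<le> m \<Longrightarrow> linear (A x i)"
    and A_le: "\<And>x i y. norm (x - x0) \<le> radius \<Longrightarrow> i \<le> m \<Longrightarrow> norm (A x i y) \<le> c * norm y"
    and A_mean: "\<And>x y. norm (x - x0) \<le> radius \<Longrightarrow> (\<Sum>i\<le>m. A x i y) = real (Suc m) *\<^sub>R H x y"
    and A_hv: "\<And>x i y. norm (x - x0) \<le> radius \<Longrightarrow> i \<le> m \<Longrightarrow>
        norm ((norm y / \<tau>) *\<^sub>R (G i (x + (\<tau> / norm y) *\<^sub>R y) - G i x) - A x i y) \<le> \<omega> * norm y"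
    and eigen: "\<And>x z. norm (x - x0) \<le> radius \<Longrightarrow> inner z (H x z) < - \<delta> * (norm z)\<^sup>2 \<Longrightarrow> \<exists>lm u a. norm u = 1 \<and> H x u = - (lm *\<^sub>R u) \<and>
        (\<forall>z. inner z (H x z) \<ge> - lm * (norm z)\<^sup>2) \<and> u = (\<Sum>j<d. a j *\<^sub>R b j) \<and> (\<forall>j. \<bar>a j\<bar> \<le> 1)"
    and b_le: "\<And>j. norm (b j) \<le> 1"
    and omega: "\<omega> \<ge> 0" "\<omega> \<le> \<delta> / 16" "real Tn * 2 ^ Tn * \<omega> * (4 * (real d)\<^sup>2) \<le> 1"
    and f_low: "\<And>x. norm (x - x0) \<le> radius \<Longrightarrow> flow \<le> f x" and f_gap: "f x0 - flow \<le> c"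
begin

section \<open>Verification of the one-step guarantees\<close>

definition Gbar :: "'v \<Rightarrow> 'v" where "Gbar x = (1 / real (Suc m)) *\<^sub>R (\<Sum>i\<le>m. G i x)"

lemma Gbar_sum: "(\<Sum>i\<le>m. G i x) = real (Suc m) *\<^sub>R Gbar x" by (simp add: Gbar_def)

definition hv :: "'v \<Rightarrow> nat \<Rightarrow> 'v \<Rightarrow> 'v" where
  "hv x i y = (norm y / \<tau>) *\<^sub>R (G i (x + (\<tau> / norm y) *\<^sub>R y) - G i x)"

lemma ev_hvP: "ev G (hvP x i y) h = h (hv x i y)" by (simp add: hvP_def hv_def)

lemma ev_difP: "ev G (difP x' x i) h = h (G i x' - G i x)" by (simp add: difP_def)

definition curv_ok :: "'v \<Rightarrow> bool" where
  "curv_ok x \<longleftrightarrow> (\<forall>z. inner z (H x z) \<ge> - \<delta> * (norm z)\<^sup>2)"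

definition sosp :: "'v \<Rightarrow> bool" where
  "sosp x \<longleftrightarrow> norm (x - x0) \<le> radius \<and> norm (g x) \<le> \<epsilon> \<and> curv_ok x"

lemma mean_dev:
  fixes val :: "nat \<Rightarrow> 'v"
  assumes "(\<Sum>i\<le>m. val i) = real (Suc m) *\<^sub>R \<mu>" "\<And>i. i \<le> m \<Longrightarrow> norm (val i) \<le> B" "i \<le> m"
  shows "norm (val i - \<mu>) \<le> 2 * B"
proof -
  have "norm (real (Suc m) *\<^sub>R \<mu>) \<le> (\<Sum>i\<le>m. B)" unfolding assms(1)[symmetric] using assms(2) by (intro sum_norm_le) auto
  then have "real (Suc m) * norm \<mu> \<le> real (Suc m) * B" by simp
  then have "norm \<mu> \<le> B" by (simp only: mult_le_cancel_left_pos of_nat_0_less_iff zero_less_Suc)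
  then show ?thesis using norm_triangle_ineq4[of "val i" \<mu>] assms(2)[OF assms(3)] by linarith
qed

lemma refresh_bound: "ev G (refresh x) (\<lambda>v. Phi ell (v - Gbar x)) \<le> exp 2"
proof (cases full)
  case True
  show ?thesis
    unfolding refresh_def if_P[OF True] ev_bind ev.simps ev_ask_all lessThan_Suc_atMost Gbar_def diff_self Phi_zero exp_le_cancel_iff by simp
next
  case False
  have "ev G (mean_est m B0 (\<lambda>i. Ask i x Ret)) (\<lambda>v. Phi ell (v - Gbar x)) \<le> exp 2"
  proof (rule ev_mean_est_Phi0)
    show "(\<Sum>i\<le>m. G i x) = real (Suc m) *\<^sub>R Gbar x" by (rule Gbar_sum)
    show "norm (G i x - Gbar x) \<le> 4 * c" if "i \<le> m" for i using G_dev[OF that False] by (simp add: Gbar_def)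
    have "B0 = nat \<lceil>16 * c\<^sup>2 * ell\<^sup>2\<rceil>" using False unfolding B0_def by simp
    then show "ell\<^sup>2 * (4 * c)\<^sup>2 \<le> real B0"
      using ceil_le(2)[of "16 * c\<^sup>2 * ell\<^sup>2"] by (simp add: power_mult_distrib mult.commute)
  qed (use ell B0 in auto)
  then show ?thesis unfolding refresh_def if_not_P[OF False] .
qed

text \<open>An update over length E multiplies \<open>Phi\<close> by at most exp(E / len), exactly
  what the discount returns when \<open>acc\<close> grows by E. A refresh forgets the past and costs
  the additive exp 2.\<close>

lemma moveP_bound:
  assumes "norm (x' - x) \<le> E" "E = stp \<or> E = jmp"
  shows "ev G (moveP E x v acc x') (\<lambda>q. Phi ell (fst q - Gbar x') * exp (- (snd q / len)))
    \<le> Phi ell (v - Gbar x) * exp (- (acc / len)) + exp 2"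
proof -
  have E: "E > 0" using assms sj by auto
  have P0: "0 \<le> Phi ell (v - Gbar x) * exp (- (acc / len))" by (simp add: Phi_pos less_imp_le)
  show ?thesis
  proof (cases "acc + E > len")
    case True
    then show ?thesis using refresh_bound[of x'] P0 by (simp add: moveP_def ev_bind)
  next
    case False
    define \<mu> where "\<mu> = Gbar x' - Gbar x"
    have b0: "bsz E > 0" by (rule bsz_pos[OF E])
    have "ev G (mean_est m (bsz E) (difP x' x)) (\<lambda>h. Phi ell ((v - Gbar x) + (h - \<mu>)))
        \<le> Phi ell (v - Gbar x) * exp (ell\<^sup>2 * (4 * c * E)\<^sup>2 / real (bsz E))"
    proof (rule ev_mean_est_Phi)
      show mu: "(\<Sum>i\<le>m. G i x' - G i x) = real (Suc m) *\<^sub>R \<mu>"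
        by (simp only: sum_subtractf Gbar_sum \<mu>_def scaleR_diff_right)
      show "norm (G i x' - G i x - \<mu>) \<le> 4 * c * E" if "i \<le> m" for i
        using mean_dev[OF mu, of "2 * c * E" i] G_lip assms that by auto
    qed (use ell b0 in \<open>auto simp: ev_difP\<close>)
    also have "ell\<^sup>2 * (4 * c * E)\<^sup>2 / real (bsz E) \<le> E / len"
    proof -
      have "16 * c\<^sup>2 * ell\<^sup>2 * E * len \<le> real (bsz E)" unfolding bsz_def by (rule ceil_le)
      then have "E * (16 * c\<^sup>2 * ell\<^sup>2 * E * len) \<le> E * real (bsz E)" using E by (intro mult_left_mono) auto
      then show ?thesis using b0 len by (simp add: field_simps power2_eq_square)
    qed
    finally have 1: "ev G (mean_est m (bsz E) (difP x' x)) (\<lambda>h. Phi ell ((v - Gbar x) + (h - \<mu>)))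
        \<le> Phi ell (v - Gbar x) * exp (E / len)" by (simp add: Phi_pos)
    have "ev G (moveP E x v acc x') (\<lambda>q. Phi ell (fst q - Gbar x') * exp (- (snd q / len)))
       = ev G (mean_est m (bsz E) (difP x' x)) (\<lambda>h. Phi ell ((v - Gbar x) + (h - \<mu>))) * exp (- ((acc + E) / len))"
      using False by (simp add: moveP_def ev_bind ev_cmult \<mu>_def algebra_simps)
    also have "\<dots> \<le> Phi ell (v - Gbar x) * exp (E / len) * exp (- ((acc + E) / len))"
      using 1 by (intro mult_right_mono) auto
    also have "\<dots> = Phi ell (v - Gbar x) * exp (- (acc / len))"
      by (simp add: exp_add[symmetric] add_divide_distrib mult.assoc)
    finally show ?thesis by (smt (verit) exp_gt_zero)
  qed
qed

definition hm :: "'v \<Rightarrow> 'v \<Rightarrow> 'v" where "hm x y = (1 / real (Suc m)) *\<^sub>R (\<Sum>i\<le>m. hv x i y)"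

lemma hm: "(\<Sum>i\<le>m. hv x i w) = real (Suc m) *\<^sub>R hm x w" by (simp add: hm_def)

lemma hm_H:
  assumes x: "norm (x - x0) \<le> radius"
  shows "norm (hm x w - H x w) \<le> \<omega> * norm w"
proof -
  have "real (Suc m) *\<^sub>R (hm x w - H x w) = (\<Sum>i\<le>m. hv x i w - A x i w)"
    by (simp only: scaleR_diff_right hm[symmetric] A_mean[OF x, symmetric] sum_subtractf)
  then have "real (Suc m) * norm (hm x w - H x w) = norm (\<Sum>i\<le>m. hv x i w - A x i w)"
    by (metis abs_of_nat norm_scaleR)
  also have "\<dots> \<le> (\<Sum>i\<le>m. \<omega> * norm w)" using A_hv[OF x] by (intro sum_norm_le) (auto simp: hv_def)
  also have "\<dots> = real (Suc m) * (\<omega> * norm w)" by simp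
  finally show ?thesis by (simp only: mult_le_cancel_left_pos of_nat_0_less_iff zero_less_Suc)
qed

lemma hm_H1: "norm (x - x0) \<le> radius \<Longrightarrow> norm w = 1 \<Longrightarrow> norm (hm x w - H x w) \<le> \<delta> / 16"
  using hm_H[of x w] omega by simp

lemma hv_dev:
  assumes x: "norm (x - x0) \<le> radius" and i: "i \<le> m" and w: "norm w = 1"
  shows "norm (hv x i w - hm x w) \<le> 4 * c"
proof -
  have "norm (hv x i w) \<le> 2 * c" if "i \<le> m" for i
    using norm_triangle_ineq[of "A x i w" "hv x i w - A x i w"] A_le[OF x that, of w] A_hv[OF x that, of w]
      omega del c1 by (simp add: hv_def w)
  then show ?thesis using mean_dev[OF hm, of x w "2 * c" i] i by simp
qed

lemma nbn_ge: "ell2\<^sup>2 * (4 * c)\<^sup>2 \<le> real nbn"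
  using ceil_le(2)[of "16 * c\<^sup>2 * ell2\<^sup>2"] by (simp add: nbn_def power_mult_distrib mult.commute)

lemma ell2_del: "ell2 * (\<delta> / 16) = k1 * La" using del by (simp add: ell2_def)

lemma nc_sound:
  assumes x: "norm (x - x0) \<le> radius"
  shows "ev G (ncP x) (\<lambda>r. of_bool (\<exists>w. r = Some w \<and> \<not> (norm w = 1 \<and> inner w (H x w) \<le> - (\<delta> / 4)))) \<le> q2"
proof -
  have "ev G (nc_try m d b Tn eta nbn \<delta> (hvP x)) (\<lambda>r. of_bool (\<exists>w. r = Some w \<and>
      \<not> (norm w = 1 \<and> inner w (H x w) \<le> - (\<delta> / 4)))) \<le> exp (2 - ell2 * (\<delta> / 16))"
    using hv_dev[OF x] hm_H1[OF x] ell nbn nbn_ge del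
    by (intro nc_try_sound[where hv = "hv x" and \<mu> = "hm x" and \<beta> = "4 * c"])
       (auto simp: ev_hvP hm)
  from ev_nc_rep_Some[OF this] show ?thesis unfolding ncP_def ell2_del q2_def by simp
qed

lemma nc_complete:
  assumes x: "norm (x - x0) \<le> radius" and "\<not> curv_ok x"
  shows "ev G (ncP x) (\<lambda>r. of_bool (r = None)) \<le> q1"
proof -
  obtain z where z: "inner z (H x z) < - \<delta> * (norm z)\<^sup>2" using assms(2) by (auto simp: curv_ok_def not_le)
  obtain lm u a where e: "norm u = 1" "H x u = - (lm *\<^sub>R u)" "\<And>z. inner z (H x z) \<ge> - lm * (norm z)\<^sup>2"
    "u = (\<Sum>j<d. a j *\<^sub>R b j)" "\<And>j. \<bar>a j\<bar> \<le> 1" using eigen[OF x z] by blast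
  have "lm > \<delta>"
  proof (rule ccontr)
    assume "\<not> lm > \<delta>"
    then have "- \<delta> * (norm z)\<^sup>2 \<le> - lm * (norm z)\<^sup>2" by (intro mult_right_mono) auto
    then show False using e(3)[of z] z by linarith
  qed
  have J: "real Jn > 0" using Jn by simp
  have eT: "eta\<^sup>2 * c\<^sup>2 * real Tn = 1/4" using J c1 by (simp add: eta_def Tn_def power_mult_distrib power_divide field_simps)
  interpret oja m d "A x" "H x" "hv x" c eta \<omega> lm u b a Tn
  proof unfold_locales
    show "0 < eta" using J c1 by (simp add: eta_def)
    show "eta * c \<le> 1/2" using J Jn c1 by (simp add: eta_def field_simps)
    show "0 < Tn" using Jn by (simp add: Tn_def)
    have "1 \<le> Jn\<^sup>2" using Jn by simp
    have "eta * lm * real Tn = lm * real Jn / (2 * c)" using J c1 by (simp add: eta_def Tn_def power2_eq_square)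
    also have "\<dots> \<ge> \<delta> * (120 * c * La / \<delta>) / (2 * c)" using \<open>lm > \<delta>\<close> Jn c1 del La1 by (intro divide_right_mono mult_mono) auto
    also have "\<delta> * (120 * c * La / \<delta>) / (2 * c) = 60 * La" using del c1 by simp
    finally show "38 + 20 * ln (real d) \<le> eta * lm * real Tn" using La_d lns by simp
  qed (use linear_add[OF A_lin[OF x]] linear_scale[OF A_lin[OF x]] e x A_le A_mean A_hv b_le c1 omega d1 eT \<open>lm > \<delta>\<close> del in \<open>auto simp: hv_def\<close>)
  define t where "t = ev G (nc_try m d b Tn eta nbn \<delta> (hvP x)) (\<lambda>r. of_bool (r = None))"
  have "t \<le> 1 - 1/32 + exp (2 - ell2 * (\<delta> / 16))"
    unfolding t_def using hv_dev[OF x] hm_H1[OF x] ell nbn nbn_ge del \<open>lm > \<delta>\<close>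
    by (intro nc_try_complete[where \<mu> = "hm x" and \<beta> = "4 * c"])
       (auto simp: ev_hvP hm)
  also have "exp (2 - ell2 * (\<delta> / 16)) \<le> 1/64"
  proof -
    have "67 * 1 \<le> k1 * La" using k1 La1 by (intro mult_mono) auto
    then have "exp (2 - k1 * La) \<le> exp (-6)" by simp
    also have "\<dots> \<le> (1/64 :: real)"
    proof -
      have "(2::real) ^ 6 \<le> exp 1 ^ 6" using exp_ge_add_one_self[of 1] by (intro power_mono) auto
      then show ?thesis by (simp add: exp_of_nat_mult[symmetric] exp_minus field_simps)
    qed
    finally show ?thesis unfolding ell2_del .
  qed
  finally have "t \<le> 1 + (- 1/64)" by simp
  also have "\<dots> \<le> exp (- 1/64)" by (rule exp_ge_add_one_self)
  finally have t: "t \<le> exp (- 1/64)" .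
  have "t \<ge> 0" unfolding t_def by (intro ev_nonneg) auto
  then have "t ^ Kn \<le> exp (- 1/64) ^ Kn" using t by (intro power_mono)
  also have "\<dots> = exp (- (real Kn / 64))" by (simp add: exp_of_nat_mult[symmetric])
  also have "\<dots> \<le> q1" unfolding q1_def using Kn by simp
  finally show ?thesis by (simp add: ncP_def ev_nc_rep_None t_def)
qed

text \<open>The estimate is within \<epsilon>/8 of the gradient and longer than \<epsilon>/2, so its
  inner product with the gradient is at least 3/8 \<epsilon> |v|. The step length \<epsilon>/(4c)
  gains 3 \<epsilon>^2/(32c) and loses \<epsilon>^2/(32c) to the quadratic term.\<close>

lemma grad_step:
  assumes x: "norm (x - x0) \<le> radius" and v: "norm v > \<epsilon> / 2" "norm (v - Gbar x) \<le> \<epsilon> / 16"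
  shows "f (x - (stp / norm v) *\<^sub>R v) \<le> f x - \<epsilon>\<^sup>2 / (16 * c)"
proof -
  have v0: "norm v > 0" using v eps by linarith
  have "norm (v - g x) \<le> norm (v - Gbar x) + norm (Gbar x - g x)" using norm_triangle_ineq[of "v - Gbar x" "Gbar x - g x"] by simp
  then have err: "norm (v - g x) \<le> \<epsilon> / 8" using v mean_g[OF x] by (simp add: Gbar_def)
  have "inner v (v - g x) \<le> norm v * (\<epsilon> / 8)"
    using norm_cauchy_schwarz[of v "v - g x"] mult_left_mono[OF err, of "norm v"] by simp
  then have "inner (g x) v \<ge> (norm v)\<^sup>2 - norm v * (\<epsilon> / 8)"
    by (simp add: inner_diff_right power2_norm_eq_inner inner_commute)
  also have "(norm v)\<^sup>2 - norm v * (\<epsilon> / 8) = norm v * (norm v - \<epsilon> / 8)" by (simp add: power2_eq_square algebra_simps)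
  also have "norm v * (norm v - \<epsilon> / 8) \<ge> norm v * (3 * \<epsilon> / 8)" using v v0 by (intro mult_left_mono) auto
  finally have ig: "inner (g x) v \<ge> norm v * (3 * \<epsilon> / 8)" .
  have "f (x - (stp / norm v) *\<^sub>R v) \<le> f x - stp / norm v * inner (g x) v + c / 2 * stp\<^sup>2"
    using descent[OF x, of "x - (stp / norm v) *\<^sub>R v"] v0 by (simp add: power_mult_distrib power_divide)
  moreover have "stp / norm v * inner (g x) v \<ge> stp / norm v * (norm v * (3 * \<epsilon> / 8))"
    using ig sj v0 by (intro mult_left_mono) auto
  moreover have "stp / norm v * (norm v * (3 * \<epsilon> / 8)) = stp * (3 * \<epsilon> / 8)" using v0 by simp
  ultimately have "f (x - (stp / norm v) *\<^sub>R v) \<le> f x - stp * (3 * \<epsilon> / 8) + c / 2 * stp\<^sup>2" by linarith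
  also have "\<dots> = f x - \<epsilon>\<^sup>2 / (16 * c)" using c1 by (simp add: stp_def power2_eq_square field_simps)
  finally show ?thesis .
qed

text \<open>The second order gain jmp^2 \<delta>/4 is three times the cubic error c jmp^3/3; what
  remains is shared by the two signs.\<close>

lemma curv_step:
  assumes x: "norm (x - x0) \<le> radius" and w: "norm w = 1" "inner w (H x w) \<le> - (\<delta> / 4)"
  shows "f (x + jmp *\<^sub>R w) + f (x - jmp *\<^sub>R w) \<le> 2 * (f x - \<delta> ^ 3 / (192 * c\<^sup>2))"
proof -
  have "f (x + jmp *\<^sub>R w) + f (x - jmp *\<^sub>R w) \<le> 2 * f x + jmp\<^sup>2 * inner w (H x w) + c / 3 * jmp ^ 3"
    using second[OF x w(1)] sj by simp
  also have "\<dots> \<le> 2 * f x + jmp\<^sup>2 * (- (\<delta> / 4)) + c / 3 * jmp ^ 3" using w by (intro add_right_mono add_left_mono mult_left_mono) auto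
  also have "\<dots> = 2 * (f x - \<delta> ^ 3 / (192 * c\<^sup>2))"
    using c1 by (simp add: jmp_def power2_eq_square power3_eq_cube field_simps)
  finally show ?thesis .
qed

sublocale descent_analysis ncP moveP \<epsilon> stp jmp G f Gbar curv_ok sosp x0 NG NC flow
  "\<epsilon>\<^sup>2 / (16 * c)" "\<delta> ^ 3 / (192 * c\<^sup>2)" q1 q2 ell len "exp 2"
proof unfold_locales
  show "ev G (ncP x) (\<lambda>r. of_bool (\<exists>w. r = Some w \<and>
        \<not> (norm w = 1 \<and> f (x + jmp *\<^sub>R w) + f (x - jmp *\<^sub>R w) \<le> 2 * (f x - \<delta> ^ 3 / (192 * c\<^sup>2))))) \<le> q2"
    if "norm (x - x0) \<le> stp * real NG + jmp * real NC" for x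
  proof (rule order_trans[OF ev_mono nc_sound])
    show "norm (x - x0) \<le> radius" using that by (simp add: radius_def)
    then show "(of_bool (\<exists>w. r = Some w \<and> \<not> (norm w = 1 \<and> f (x + jmp *\<^sub>R w) + f (x - jmp *\<^sub>R w) \<le> 2 * (f x - \<delta> ^ 3 / (192 * c\<^sup>2)))) :: real)
      \<le> of_bool (\<exists>w. r = Some w \<and> \<not> (norm w = 1 \<and> inner w (H x w) \<le> - (\<delta> / 4)))" for r
      using curv_step[of x] by auto
  qed
  show "sosp x" if "norm (x - x0) \<le> stp * real NG + jmp * real NC" "norm v \<le> \<epsilon> / 2" "norm (v - Gbar x) \<le> \<epsilon> / 16" "curv_ok x" for x v
  proof -
    have r: "norm (x - x0) \<le> radius" using that by (simp add: radius_def)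
    have "norm (g x) \<le> norm v + norm (v - Gbar x) + norm (Gbar x - g x)"
      using norm_triangle_ineq4[of v "v - g x"] norm_triangle_ineq[of "v - Gbar x" "Gbar x - g x"] by simp
    then have "norm (g x) \<le> \<epsilon>" using that mean_g[OF r] eps unfolding Gbar_def by linarith
    then show ?thesis using r that by (simp add: sosp_def)
  qed
  show "snd q \<le> len" if "q \<in> results G (moveP E x v acc x')" for E x v acc x' q
    using that len by (auto simp: moveP_def results_bind split: if_splits)
qed (use sj ell len c1 del f_low nc_complete grad_step moveP_bound in \<open>auto simp: radius_def q1_def q2_def\<close>)

lemma once_bound:
  assumes h: "\<And>r. 0 \<le> h r" "\<And>r. h r \<le> 1" "\<And>x. sosp x \<Longrightarrow> h (Some x) = 0"
    and \<theta>: "\<theta> \<ge> 0" "h None \<le> \<theta> * (\<epsilon>\<^sup>2 / (16 * c) * real NG)" "h None \<le> \<theta> * (\<delta> ^ 3 / (192 * c\<^sup>2) * real NC)"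
  shows "ev G (onceP x0) h \<le> \<theta> * c + Qf"
proof -
  have "ev G (onceP x0) h \<le> ev G (refresh x0) (\<lambda>v. wt \<theta> Nn x0 v 0 NG NC)"
    unfolding onceP_def ev_bind Nn_def using len by (intro ev_mono loop_bound h \<theta>) auto
  also have "\<dots> = pval \<theta> x0 NG NC + real Nn * (q1 + q2) + kap * (real Nn * ev G (refresh x0) (\<lambda>v. pot x0 v 0) + exp 2 * (real Nn)\<^sup>2)"
    unfolding wt_def by (simp only: ev_add ev_const ev_cmult)
  also have "\<dots> \<le> \<theta> * c + real Nn * (q1 + q2) + kap * ((real Nn)\<^sup>2 * exp 2 + exp 2 * (real Nn)\<^sup>2)"
  proof (intro add_mono mult_left_mono order_refl)
    show "pval \<theta> x0 NG NC \<le> \<theta> * c" unfolding pval_def using f_gap \<theta> by (intro mult_left_mono) auto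
    have "real Nn * ev G (refresh x0) (\<lambda>v. pot x0 v 0) \<le> real Nn * exp 2"
      using refresh_bound[of x0] by (intro mult_left_mono) (auto simp: pot_def)
    also have "\<dots> \<le> (real Nn)\<^sup>2 * exp 2" by (intro mult_right_mono) (auto simp: power2_eq_square Nn_def)
    finally show "real Nn * ev G (refresh x0) (\<lambda>v. pot x0 v 0) \<le> (real Nn)\<^sup>2 * exp 2" .
  qed (use kap_pos in auto)
  also have "kap = exp (1 - k1 * La)" unfolding kap_def using eps by (simp add: ell_def)
  also have "\<theta> * c + real Nn * (q1 + q2) + exp (1 - k1 * La) * ((real Nn)\<^sup>2 * exp 2 + exp 2 * (real Nn)\<^sup>2) = \<theta> * c + Qf"
    by (simp add: Qf_def algebra_simps)
  finally show ?thesis .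
qed

text \<open>\<open>once_bound\<close> is used twice: with \<theta> = 0 for wrong outputs, which only
  cost \<open>Qf\<close>, and with \<theta> = 1/(4c) for giving up, where the initial gap
  contributes 1/4 and an exhausted budget weighs at least 1.\<close>

theorem search_fails: "ev G (searchP x0) (\<lambda>x. of_bool (\<not> sosp x)) \<le> p"
proof -
  have "ev G (onceP x0) (\<lambda>r. of_bool (\<exists>x. r = Some x \<and> \<not> sosp x)) \<le> 0 * c + Qf"
    by (rule once_bound) auto
  then have bad: "ev G (onceP x0) (\<lambda>r. of_bool (\<exists>x. r = Some x \<and> \<not> sosp x)) \<le> Qf" by simp
  have "ev G (onceP x0) (\<lambda>r. of_bool (r = None)) \<le> 1 / (4 * c) * c + Qf"
  proof (rule once_bound)
    have "4 * c = \<epsilon>\<^sup>2 / (16 * c) * (64 * c\<^sup>2 / \<epsilon>\<^sup>2)" using eps c1 by (simp add: power2_eq_square)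
    also have "\<dots> \<le> \<epsilon>\<^sup>2 / (16 * c) * real NG" using NG(1) c1 by (intro mult_left_mono) auto
    finally have "1 / (4 * c) * (4 * c) \<le> 1 / (4 * c) * (\<epsilon>\<^sup>2 / (16 * c) * real NG)" using c1 by (intro mult_left_mono) auto
    then show "of_bool (None = None) \<le> 1 / (4 * c) * (\<epsilon>\<^sup>2 / (16 * c) * real NG)" using c1 by simp
    have "4 * c = \<delta> ^ 3 / (192 * c\<^sup>2) * (768 * c ^ 3 / \<delta> ^ 3)" using del c1 by (simp add: power2_eq_square power3_eq_cube)
    also have "\<dots> \<le> \<delta> ^ 3 / (192 * c\<^sup>2) * real NC" using NC(1) c1 del by (intro mult_left_mono) auto
    finally have "1 / (4 * c) * (4 * c) \<le> 1 / (4 * c) * (\<delta> ^ 3 / (192 * c\<^sup>2) * real NC)" using c1 by (intro mult_left_mono) auto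
    then show "of_bool (None = None) \<le> 1 / (4 * c) * (\<delta> ^ 3 / (192 * c\<^sup>2) * real NC)" using c1 by simp
  qed (use c1 in auto)
  also have "\<dots> \<le> 1/2" using Qf_consequences(1) c1 by simp
  finally have "ev G (searchP x0) (\<lambda>x. of_bool (\<not> sosp x)) \<le> real Rn * Qf + (1/2) ^ Rn"
    unfolding searchP_def using bad by (intro ev_boost)
  then show ?thesis using Qf_consequences(2) by linarith
qed

end

section \<open>Gradient cost\<close>

lemma bind_assoc: "bindP (bindP P Q) R = bindP P (\<lambda>a. bindP (Q a) R)"
  by (induction P) auto

context search_consts
begin

definition cNC :: nat where "cNC = Kn * (Tn * 2 + nbn * 2)"

lemma costs_ncP: "costs (ncP x) cNC"
  unfolding ncP_def cNC_def
  by (intro costs_nc_rep costs_nc_try) (use Jn in \<open>auto simp: hvP_def Tn_def\<close>)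

lemma costs_refresh: "costs (refresh x) B0"
proof (cases full)
  case True
  then have "B0 = Suc m" unfolding B0_def by simp
  moreover have "costs (bindP (ask_all x (Suc m)) (\<lambda>S. Ret ((1 / real (Suc m)) *\<^sub>R S))) (Suc m + 0)"
    by (intro costs_bind costs_ask_all) simp
  ultimately show ?thesis unfolding refresh_def if_P[OF True] by simp
next
  case False
  have "costs (mean_est m B0 (\<lambda>i. Ask i x Ret)) (B0 * 1)" by (intro costs_mean_est) auto
  then show ?thesis unfolding refresh_def if_not_P[OF False] by simp
qed

text \<open>Amortised accounting: every unit of length puts aside \<open>B0 / len\<close>, and a
  refresh is due only when the length since the last one, including the present step, exceeds
  \<open>len\<close>; the savings then cover its cost B0. The continuation belongs to the statement
  because the savings carried over depend on the result of the move.\<close>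

lemma costs_move_bind:
  assumes E: "E > 0" and acc: "0 \<le> acc" "acc \<le> len"
    and Q: "\<And>q b'. 0 \<le> snd q \<Longrightarrow> snd q \<le> len \<Longrightarrow> rest + real B0 * snd q / len \<le> real b' \<Longrightarrow> costs (Q q) b'"
    and rest: "rest \<ge> 0"
    and b: "2 * real (bsz E) + real B0 * E / len + real B0 * acc / len + rest \<le> real b'"
  shows "costs (bindP (moveP E x v acc x') Q) b'"
proof (cases "acc + E > len")
  case True
  have "real B0 * len \<le> real B0 * (acc + E)" using True by (intro mult_left_mono) auto
  then have "real B0 \<le> real B0 * E / len + real B0 * acc / len" using len by (simp add: field_simps)
  then have le: "rest + real B0 \<le> real b'" using b by simp
  have "costs (bindP (refresh x') (\<lambda>v'. Q (v', 0))) (B0 + (b' - B0))"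
  proof (rule costs_bind[OF costs_refresh])
    have "B0 \<le> b'" using le rest by linarith
    then have "rest + real B0 * snd (v', 0::real) / len \<le> real (b' - B0)" for v' :: 'v
      using le by (simp add: of_nat_diff)
    then show "costs (Q (v', 0)) (b' - B0)" for v'
      by (rule Q[rotated 2]) (use len in simp_all)
  qed
  moreover have "B0 + (b' - B0) = b'" using le rest by simp
  moreover have "bindP (bindP (refresh x') (\<lambda>v'. Ret (v', 0))) Q = bindP (refresh x') (\<lambda>v'. Q (v', 0))"
    by (simp add: bind_assoc)
  ultimately show ?thesis using True by (simp add: moveP_def)
next
  case False
  have nn: "0 \<le> real B0 * E / len" "0 \<le> real B0 * acc / len" using E acc len by auto
  have "real (2 * bsz E) \<le> real b'" using b nn rest unfolding of_nat_mult of_nat_numeral by linarith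
  then have le: "2 * bsz E \<le> b'" by (simp only: of_nat_le_iff)
  have "costs (bindP (mean_est m (bsz E) (difP x' x)) (\<lambda>h. Q (v + h, acc + E))) (bsz E * 2 + (b' - 2 * bsz E))"
  proof (rule costs_bind[OF costs_mean_est])
    show "costs (difP x' x i) 2" for i by (simp add: difP_def)
    have "rest + real B0 * (acc + E) / len \<le> real (b' - 2 * bsz E)"
      using b le by (simp add: of_nat_diff add_divide_distrib distrib_left)
    then show "costs (Q (v + h, acc + E)) (b' - 2 * bsz E)" for h
      using Q[of "(v + h, acc + E)" "b' - 2 * bsz E"] acc E False by simp
  qed
  moreover have "bsz E * 2 + (b' - 2 * bsz E) = b'" using le by simp
  ultimately show ?thesis using False by (simp add: moveP_def bind_assoc)
qed

definition step_cost :: "real \<Rightarrow> real" where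
  "step_cost E = 2 * real (bsz E) + real B0 * E / len"

lemma step_cost_nonneg: "E > 0 \<Longrightarrow> step_cost E \<ge> 0" using len by (simp add: step_cost_def)

text \<open>Suc cr bounds the number of searches: each one but the last is followed by a curvature
  step that uses up the budget.\<close>

lemma costs_loop:
  "0 \<le> acc \<Longrightarrow> acc \<le> len \<Longrightarrow>
   real gr * step_cost stp + real cr * step_cost jmp + real (Suc cr) * real cNC + real B0 * acc / len \<le> real b' \<Longrightarrow>
   costs (loopP n x v acc gr cr) b'"
proof (induction n arbitrary: x v acc gr cr b')
  case 0
  then show ?case by (simp add: descent_program.loop.simps)
next
  case (Suc n)
  note prems = Suc.prems
  have nn: "0 \<le> step_cost stp" "0 \<le> step_cost jmp" "0 \<le> real B0 * acc / len" using sj step_cost_nonneg len prems by auto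
  show ?case
  proof (cases "norm v > \<epsilon> / 2")
    case True
    show ?thesis
    proof (cases "gr = 0")
      case False
      define x' where "x' = x - (stp / norm v) *\<^sub>R v"
      define rest where "rest = real (gr - 1) * step_cost stp + real cr * step_cost jmp + real (Suc cr) * real cNC"
      have rest: "rest \<ge> 0" unfolding rest_def using nn by (intro add_nonneg_nonneg mult_nonneg_nonneg) auto
      have "costs (bindP (moveP stp x v acc x') (\<lambda>q. loopP n x' (fst q) (snd q) (gr - 1) cr)) b'"
      proof (rule costs_move_bind[OF sj(1) prems(1,2) _ rest])
        show "costs (loopP n x' (fst q) (snd q) (gr - 1) cr) b''"
          if "0 \<le> snd q" "snd q \<le> len" "rest + real B0 * snd q / len \<le> real b''" for q b''
          using that by (intro Suc.IH) (auto simp: rest_def)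
        show "2 * real (bsz stp) + real B0 * stp / len + real B0 * acc / len + rest \<le> real b'"
          using prems(3) False unfolding rest_def step_cost_def[symmetric]
          by (simp add: of_nat_diff left_diff_distrib step_cost_def[symmetric] del: of_nat_Suc)
      qed
      then show ?thesis using True False by (simp add: descent_program.loop.simps x'_def)
    qed (use True in \<open>simp add: descent_program.loop.simps\<close>)
  next
    case False
    have cb: "real cNC \<le> real b'"
    proof -
      have "1 * real cNC \<le> real (Suc cr) * real cNC" by (intro mult_right_mono) auto
      moreover have "0 \<le> real gr * step_cost stp" "0 \<le> real cr * step_cost jmp" using nn by auto
      ultimately show ?thesis using prems(3) nn by linarith
    qed
    have "costs (bindP (ncP x) (\<lambda>r. case r of
         None \<Rightarrow> Ret (Some x)
       | Some w \<Rightarrow> if cr = 0 then Ret None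
           else Draw 1 (\<lambda>i. bindP (moveP jmp x v acc (x + (if i = 0 then jmp else - jmp) *\<^sub>R w))
              (\<lambda>p. loopP n (x + (if i = 0 then jmp else - jmp) *\<^sub>R w) (fst p) (snd p) gr (cr - 1))))) (cNC + (b' - cNC))"
    proof (intro costs_bind costs_ncP)
      fix r :: "'v option"
      show "costs (case r of
         None \<Rightarrow> Ret (Some x)
       | Some w \<Rightarrow> if cr = 0 then Ret None
           else Draw 1 (\<lambda>i. bindP (moveP jmp x v acc (x + (if i = 0 then jmp else - jmp) *\<^sub>R w))
              (\<lambda>p. loopP n (x + (if i = 0 then jmp else - jmp) *\<^sub>R w) (fst p) (snd p) gr (cr - 1)))) (b' - cNC)"
      proof (cases "r = None \<or> cr = 0")
        case True
        then show ?thesis by (auto split: option.split)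
      next
        case rc: False
        define rest where "rest = real gr * step_cost stp + real (cr - 1) * step_cost jmp + real (Suc (cr - 1)) * real cNC"
        have rest: "rest \<ge> 0" unfolding rest_def using nn by (intro add_nonneg_nonneg mult_nonneg_nonneg) auto
        have "costs (bindP (moveP jmp x v acc x') (\<lambda>q. loopP n x' (fst q) (snd q) gr (cr - 1))) (b' - cNC)" for x'
        proof (rule costs_move_bind[OF sj(2) prems(1,2) _ rest])
          show "costs (loopP n x' (fst q) (snd q) gr (cr - 1)) b''"
            if "0 \<le> snd q" "snd q \<le> len" "rest + real B0 * snd q / len \<le> real b''" for q b''
            using that by (intro Suc.IH) (auto simp: rest_def)
          show "2 * real (bsz jmp) + real B0 * jmp / len + real B0 * acc / len + rest \<le> real (b' - cNC)"
            using prems(3) rc cb unfolding rest_def step_cost_def[symmetric]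
            by (simp add: of_nat_diff left_diff_distrib distrib_right step_cost_def[symmetric])
        qed
        then show ?thesis using rc by (auto split: option.split)
      qed
    qed
    then show ?thesis using False cb by (simp add: descent_program.loop.simps)
  qed
qed

definition once_cost :: real where
  "once_cost = real B0 + real NG * step_cost stp + real NC * step_cost jmp + real (Suc NC) * real cNC"

lemma costs_searchP: "costs (searchP x0) (Rn * nat \<lceil>once_cost\<rceil>)"
  unfolding searchP_def
proof (rule costs_boost)
  define R where "R = real NG * step_cost stp + real NC * step_cost jmp + real (Suc NC) * real cNC"
  have R: "R \<ge> 0" unfolding R_def using step_cost_nonneg sj by (intro add_nonneg_nonneg mult_nonneg_nonneg) auto
  have oc: "once_cost = real B0 + R" by (simp add: once_cost_def R_def)
  have le: "real B0 + R \<le> real (nat \<lceil>once_cost\<rceil>)" unfolding oc by (rule ceil_le)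
  then have B: "B0 \<le> nat \<lceil>once_cost\<rceil>" using R by linarith
  have "costs (onceP x0) (B0 + (nat \<lceil>once_cost\<rceil> - B0))"
    unfolding onceP_def
  proof (intro costs_bind costs_refresh costs_loop)
    show "real NG * step_cost stp + real NC * step_cost jmp + real (Suc NC) * real cNC + real B0 * 0 / len
       \<le> real (nat \<lceil>once_cost\<rceil> - B0)"
      using le B unfolding R_def[symmetric] by (simp add: of_nat_diff)
  qed (use len in auto)
  then show "costs (onceP x0) (nat \<lceil>once_cost\<rceil>)" using B by simp
qed

text \<open>With B0 = n this is the cost of full batches; with B0 of order \<epsilon>^-2 it becomes
  the on-line bound up to logarithms.\<close>

definition shape :: real where
  "shape = sqrt (real B0) / \<epsilon>\<^sup>2 + sqrt (real B0) / (\<epsilon> * \<delta>\<^sup>2) + real B0 + 1 / \<delta> ^ 5"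

section \<open>Numerical estimates of the cost\<close>

lemma powers_ge1: "1 \<le> c ^ k" "1 \<le> k1 ^ k" "1 \<le> La ^ k"
  using c1 k1 La1 by (auto intro: one_le_power)

lemma bsz_le:
  "real (bsz stp) \<le> 1025 * c * k1\<^sup>2 * La\<^sup>2 * sqrt (real B0)"
  "real (bsz jmp) \<le> 1024 * c * k1\<^sup>2 * La\<^sup>2 * sqrt (real B0) * \<delta> / \<epsilon> + 1"
proof -
  have e: "16 * c\<^sup>2 * ell\<^sup>2 * stp * len = 1024 * c * k1\<^sup>2 * La\<^sup>2 * sqrt (real B0)"
    using c1 eps by (simp add: ell_def stp_def len_def power2_eq_square field_simps)
  have "1 * 1 * 1 * 1 * 1 \<le> c * k1\<^sup>2 * La\<^sup>2 * sqrt (real B0)"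
    using c1 B0 powers_ge1(2)[of 2] powers_ge1(3)[of 2] by (intro mult_mono) auto
  moreover have "real (bsz stp) \<le> 1024 * c * k1\<^sup>2 * La\<^sup>2 * sqrt (real B0) + 1"
    unfolding bsz_def e using c1 by (intro ceil_le) auto
  ultimately show "real (bsz stp) \<le> 1025 * c * k1\<^sup>2 * La\<^sup>2 * sqrt (real B0)" by linarith
  have e2: "16 * c\<^sup>2 * ell\<^sup>2 * jmp * len = 1024 * c * k1\<^sup>2 * La\<^sup>2 * sqrt (real B0) * \<delta> / \<epsilon>"
    using c1 eps by (simp add: ell_def jmp_def len_def power2_eq_square field_simps)
  show "real (bsz jmp) \<le> 1024 * c * k1\<^sup>2 * La\<^sup>2 * sqrt (real B0) * \<delta> / \<epsilon> + 1"
    unfolding bsz_def e2 using c1 del eps by (intro ceil_le) auto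
qed

lemma cNC_le: "real cNC \<le> 2500000 * (c\<^sup>2 * k1 ^ 3 * La ^ 3) / \<delta>\<^sup>2"
proof -
  have J1: "1 \<le> c * La / \<delta>"
  proof -
    have "1 * 1 \<le> c * La" using c1 La1 by (intro mult_mono) auto
    then show ?thesis using del by (simp add: field_simps)
  qed
  have J: "real Jn \<le> 121 * (c * La / \<delta>)"
    using ceil_mult[OF J1, of 120] by (simp add: Jn_def mult.assoc)
  then have "(real Jn)\<^sup>2 \<le> (121 * (c * La / \<delta>))\<^sup>2" by (intro power_mono) auto
  then have T: "real Tn \<le> 14641 * (c\<^sup>2 * La\<^sup>2 / \<delta>\<^sup>2)" by (simp add: Tn_def power_mult_distrib power_divide)
  have n1: "1 \<le> c\<^sup>2 * k1\<^sup>2 * La\<^sup>2 / \<delta>\<^sup>2"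
  proof -
    have "1 * 1 * 1 \<le> c\<^sup>2 * k1\<^sup>2 * La\<^sup>2" using powers_ge1 by (intro mult_mono) auto
    moreover have "\<delta>\<^sup>2 \<le> 1" using del by (simp add: power_le_one)
    ultimately show ?thesis using del by (simp add: field_simps)
  qed
  have "16 * c\<^sup>2 * ell2\<^sup>2 = 4096 * (c\<^sup>2 * k1\<^sup>2 * La\<^sup>2 / \<delta>\<^sup>2)" by (simp add: ell2_def power_mult_distrib power_divide)
  then have n: "real nbn \<le> 4097 * (c\<^sup>2 * k1\<^sup>2 * La\<^sup>2 / \<delta>\<^sup>2)" using ceil_mult[OF n1, of 4096] by (simp add: nbn_def)
  have "1 * (c\<^sup>2 * La\<^sup>2 / \<delta>\<^sup>2) \<le> k1\<^sup>2 * (c\<^sup>2 * La\<^sup>2 / \<delta>\<^sup>2)" using powers_ge1 by (intro mult_right_mono) auto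
  then have "real Tn \<le> 14641 * (c\<^sup>2 * k1\<^sup>2 * La\<^sup>2 / \<delta>\<^sup>2)"
  proof -
    assume "1 * (c\<^sup>2 * La\<^sup>2 / \<delta>\<^sup>2) \<le> k1\<^sup>2 * (c\<^sup>2 * La\<^sup>2 / \<delta>\<^sup>2)"
    then have "c\<^sup>2 * La\<^sup>2 / \<delta>\<^sup>2 \<le> c\<^sup>2 * k1\<^sup>2 * La\<^sup>2 / \<delta>\<^sup>2" by (simp add: mult_ac)
    with T show ?thesis by linarith
  qed
  then have "real (Tn * 2 + nbn * 2) \<le> 37476 * (c\<^sup>2 * k1\<^sup>2 * La\<^sup>2 / \<delta>\<^sup>2)" using n by simp
  then have "real Kn * real (Tn * 2 + nbn * 2) \<le> (65 * k1 * La) * (37476 * (c\<^sup>2 * k1\<^sup>2 * La\<^sup>2 / \<delta>\<^sup>2))"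
    using Kn k1 La1 by (intro mult_mono) auto
  also have "\<dots> = 2435940 * (c\<^sup>2 * k1 ^ 3 * La ^ 3) / \<delta>\<^sup>2" by (simp add: power2_eq_square power3_eq_cube)
  also have "\<dots> \<le> 2500000 * (c\<^sup>2 * k1 ^ 3 * La ^ 3) / \<delta>\<^sup>2"
    using k1 La1 by (intro divide_right_mono mult_right_mono) auto
  finally show ?thesis by (simp add: cNC_def)
qed

text \<open>NG updates of cost about sqrt(B0) give the first summand of \<open>shape\<close>, NC
  jumps of cost about sqrt(B0) \<delta>/\<epsilon> the second, the first batch the third, and NC
  searches of cost about \<delta>^-2 the last. \<open>W\<close> majorises all powers of c, k1 and La
  that occur.\<close>

lemma once_cost_le: "once_cost + 1 \<le> 2000000000 * (c ^ 5 * k1 ^ 3 * La ^ 3) * shape"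
proof -
  define W where "W = c ^ 5 * k1 ^ 3 * La ^ 3"
  define r where "r = sqrt (real B0)"
  have r1: "r \<ge> 1" using B0 by (simp add: r_def)
  have Wge: "c ^ i * k1 ^ j * La ^ k \<le> W" if "i \<le> 5" "j \<le> 3" "k \<le> 3" for i j k
    unfolding W_def using that c1 k1 La1 by (intro mult_mono power_increasing) auto
  have W1: "1 \<le> W" using Wge[of 0 0 0] by simp
  have blen: "real B0 * E / len = r * E / \<epsilon>" for E
    using B0 eps by (simp add: len_def r_def real_div_sqrt field_simps)
  have eps2: "\<epsilon>\<^sup>2 > 0" using eps by simp
  have t1: "real NG * step_cost stp \<le> 200000 * W * (r / \<epsilon>\<^sup>2)"
  proof -
    have "step_cost stp \<le> 2050 * (c * k1\<^sup>2 * La\<^sup>2) * r + r / (4 * c)"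
    proof -
      have "r * stp / \<epsilon> = r / (4 * c)" using eps by (simp add: stp_def)
      then show ?thesis using bsz_le(1) unfolding step_cost_def blen r_def by (simp add: mult_ac)
    qed
    also have "r / (4 * c) \<le> 1 * r" using c1 r1 by (simp add: field_simps)
    also have "1 * r \<le> (c * k1\<^sup>2 * La\<^sup>2) * r"
      using c1 powers_ge1(2)[of 2] powers_ge1(3)[of 2] r1 mult_mono[OF mult_mono[of 1 c 1 "k1\<^sup>2"], of 1 "La\<^sup>2"]
      by (intro mult_right_mono) auto
    finally have s: "step_cost stp \<le> 2051 * (c * k1\<^sup>2 * La\<^sup>2) * r" by (simp add: mult_ac)
    have "real NG * step_cost stp \<le> (65 * c\<^sup>2 / \<epsilon>\<^sup>2) * (2051 * (c * k1\<^sup>2 * La\<^sup>2) * r)"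
      using NG(2) s step_cost_nonneg sj by (intro mult_mono) auto
    also have "\<dots> = 133315 * (c ^ 3 * k1\<^sup>2 * La\<^sup>2) * (r / \<epsilon>\<^sup>2)" by (simp add: power2_eq_square power3_eq_cube)
    also have "\<dots> \<le> 200000 * W * (r / \<epsilon>\<^sup>2)" using Wge[of 3 2 2] W1 r1 c1 by (intro mult_right_mono mult_mono) auto
    finally show ?thesis .
  qed
  have t2: "real NC * step_cost jmp \<le> 2000000 * W * (r / (\<epsilon> * \<delta>\<^sup>2)) + 2000 * W * (1 / \<delta> ^ 5)"
  proof -
    have "step_cost jmp \<le> 2048 * (c * k1\<^sup>2 * La\<^sup>2) * (r * \<delta> / \<epsilon>) + 2 + r * \<delta> / \<epsilon> / (4 * c)"
    proof -
      have "r * jmp / \<epsilon> = r * \<delta> / \<epsilon> / (4 * c)" by (simp add: jmp_def)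
      then show ?thesis using bsz_le(2) unfolding step_cost_def blen r_def by (simp add: mult.assoc)
    qed
    also have "r * \<delta> / \<epsilon> / (4 * c) \<le> 1 * (r * \<delta> / \<epsilon>)"
    proof -
      have "0 \<le> r * \<delta> / \<epsilon>" using r1 del eps by auto
      then have "r * \<delta> / \<epsilon> / (4 * c) \<le> r * \<delta> / \<epsilon> / 1" using c1 by (intro divide_left_mono) auto
      then show ?thesis by (simp only: div_by_1 mult_1)
    qed
    also have "1 * (r * \<delta> / \<epsilon>) \<le> (c * k1\<^sup>2 * La\<^sup>2) * (r * \<delta> / \<epsilon>)"
      using c1 powers_ge1(2)[of 2] powers_ge1(3)[of 2] r1 del eps mult_mono[OF mult_mono[of 1 c 1 "k1\<^sup>2"], of 1 "La\<^sup>2"]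
      by (intro mult_right_mono) auto
    finally have s: "step_cost jmp \<le> 2049 * (c * k1\<^sup>2 * La\<^sup>2) * (r * \<delta> / \<epsilon>) + 2" by (simp add: mult_ac)
    have "real NC * step_cost jmp \<le> (769 * c ^ 3 / \<delta> ^ 3) * (2049 * (c * k1\<^sup>2 * La\<^sup>2) * (r * \<delta> / \<epsilon>) + 2)"
      using NC(2) s step_cost_nonneg sj del c1 by (intro mult_mono) auto
    also have "\<dots> = 1575681 * (c ^ 4 * k1\<^sup>2 * La\<^sup>2) * (r / (\<epsilon> * \<delta>\<^sup>2)) + 1538 * c ^ 3 * (1 / \<delta> ^ 3)"
      using del eps by (simp add: power2_eq_square power3_eq_cube eval_nat_numeral field_simps)
    also have "\<dots> \<le> 2000000 * W * (r / (\<epsilon> * \<delta>\<^sup>2)) + 2000 * W * (1 / \<delta> ^ 5)"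
    proof (intro add_mono mult_mono)
      have "\<delta> ^ 5 \<le> \<delta> ^ 3" using del by (intro power_decreasing) auto
      then show "1 / \<delta> ^ 3 \<le> 1 / \<delta> ^ 5" using del by (simp add: frac_le)
      show "c ^ 4 * k1\<^sup>2 * La\<^sup>2 \<le> W" using Wge[of 4 2 2] by simp
      show "c ^ 3 \<le> W" using Wge[of 3 0 0] by simp
    qed (use W1 r1 del eps c1 in auto)
    finally show ?thesis .
  qed
  have t3: "real (Suc NC) * real cNC \<le> 1925000000 * W * (1 / \<delta> ^ 5)"
  proof -
    have "1 \<le> c ^ 3 / \<delta> ^ 3"
    proof -
      have "\<delta> ^ 3 \<le> 1" using del by (simp add: power_le_one)
      then show ?thesis using powers_ge1(1)[of 3] del by (simp add: field_simps)
    qed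
    then have "real (Suc NC) \<le> 770 * (c ^ 3 / \<delta> ^ 3)" using NC(2) by simp
    then have "real (Suc NC) * real cNC \<le> (770 * (c ^ 3 / \<delta> ^ 3)) * (2500000 * (c\<^sup>2 * k1 ^ 3 * La ^ 3) / \<delta>\<^sup>2)"
      using cNC_le del c1 by (intro mult_mono) auto
    also have "\<dots> = 1925000000 * W * (1 / \<delta> ^ 5)"
      using del by (simp add: W_def eval_nat_numeral field_simps)
    finally show ?thesis .
  qed
  have "1 * real B0 \<le> W * real B0" using W1 by (intro mult_right_mono) auto
  moreover have "1 \<le> real B0" using B0 by simp
  ultimately have B: "real B0 + 1 \<le> 2 * (W * real B0)" by linarith
  have nn: "0 \<le> W * (r / \<epsilon>\<^sup>2)" "0 \<le> W * (r / (\<epsilon> * \<delta>\<^sup>2))" "0 \<le> W * real B0" "0 \<le> W * (1 / \<delta> ^ 5)" using W1 r1 del eps by auto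
  have "2000000000 * W * shape = 2000000000 * (W * (r / \<epsilon>\<^sup>2)) + 2000000000 * (W * (r / (\<epsilon> * \<delta>\<^sup>2))) + 2000000000 * (W * real B0) + 2000000000 * (W * (1 / \<delta> ^ 5))"
    by (simp add: shape_def r_def distrib_left)
  moreover have "once_cost + 1 \<le> 2 * (W * real B0) + 200000 * (W * (r / \<epsilon>\<^sup>2)) + 2000000 * (W * (r / (\<epsilon> * \<delta>\<^sup>2))) + 2000 * (W * (1 / \<delta> ^ 5)) + 1925000000 * (W * (1 / \<delta> ^ 5))"
    using t1 t2 t3 B unfolding once_cost_def by (simp only: mult.assoc)
  ultimately show ?thesis unfolding W_def[symmetric] using nn by linarith
qed

lemma search_cost: "real (Rn * nat \<lceil>once_cost\<rceil>) \<le> 10000000000 * (c ^ 5 * k1 ^ 3 * La ^ 4) * shape"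
proof -
  have "once_cost \<ge> 0" unfolding once_cost_def using step_cost_nonneg sj by (intro add_nonneg_nonneg mult_nonneg_nonneg) auto
  then have "real (nat \<lceil>once_cost\<rceil>) \<le> 2000000000 * (c ^ 5 * k1 ^ 3 * La ^ 3) * shape" using ceil_le(1)[of once_cost] once_cost_le by linarith
  then have "real Rn * real (nat \<lceil>once_cost\<rceil>) \<le> (5 * La) * (2000000000 * (c ^ 5 * k1 ^ 3 * La ^ 3) * shape)"
    using Rn La1 by (intro mult_mono) auto
  then show ?thesis by (simp add: eval_nat_numeral algebra_simps)
qed

lemma shape_full:
  assumes full
  shows "shape = sqrt (real (Suc m)) / \<epsilon>\<^sup>2 + sqrt (real (Suc m)) / (\<epsilon> * \<delta>\<^sup>2) + real (Suc m) + 1 / \<delta> ^ 5"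
  unfolding shape_def B0_def if_P[OF assms] ..

lemma shape_sampled:
  assumes "\<not> full"
  shows "shape \<le> 10000 * (c\<^sup>2 * k1\<^sup>2 * La\<^sup>2) * (1 / \<epsilon> ^ 3 + 1 / (\<epsilon>\<^sup>2 * \<delta>\<^sup>2) + 1 / \<delta> ^ 5)"
proof -
  define w where "w = c * k1 * La / \<epsilon>"
  define W where "W = c\<^sup>2 * k1\<^sup>2 * La\<^sup>2"
  have W1: "1 \<le> W" unfolding W_def using powers_ge1 mult_mono[OF mult_mono[of 1 "c\<^sup>2" 1 "k1\<^sup>2"], of 1 "La\<^sup>2"] by simp
  have w0: "c * k1 * La \<ge> 1" using c1 k1 La1 mult_mono[OF mult_mono[of 1 c 1 k1], of 1 La] by simp
  then have w1: "w \<ge> 1" using eps by (simp add: w_def field_simps)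
  have w2: "1 \<le> w\<^sup>2" using w1 by simp
  have e: "16 * c\<^sup>2 * ell\<^sup>2 = 4096 * w\<^sup>2" by (simp add: ell_def w_def power_mult_distrib power_divide)
  have B: "real B0 \<le> 4097 * w\<^sup>2" unfolding B0_def if_not_P[OF assms] e using ceil_mult[OF w2, of 4096] by simp
  have "sqrt (real B0) \<le> sqrt (4097 * w\<^sup>2)" using B by simp
  \<comment> \<open>65^2 = 4225 exceeds 4097.\<close>
  also have "\<dots> \<le> 65 * w" using w1 by (intro real_le_lsqrt) (auto simp: power_mult_distrib)
  finally have s: "sqrt (real B0) \<le> 65 * w" .
  have ww: "w \<le> W / \<epsilon>"
  proof -
    have "c * k1 * La * 1 \<le> (c * k1 * La) * (c * k1 * La)" using w0 by (intro mult_left_mono) auto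
    then show ?thesis using eps by (simp add: w_def W_def divide_right_mono power2_eq_square algebra_simps)
  qed
  have "shape \<le> 65 * (W / \<epsilon>) / \<epsilon>\<^sup>2 + 65 * (W / \<epsilon>) / (\<epsilon> * \<delta>\<^sup>2) + 4097 * w\<^sup>2 + 1 / \<delta> ^ 5"
    unfolding shape_def using s ww B eps del by (intro add_mono divide_right_mono) auto
  also have "w\<^sup>2 = W * (1 / \<epsilon>\<^sup>2)" by (simp add: w_def W_def power_mult_distrib power_divide)
  also have "65 * (W / \<epsilon>) / \<epsilon>\<^sup>2 + 65 * (W / \<epsilon>) / (\<epsilon> * \<delta>\<^sup>2) + 4097 * (W * (1 / \<epsilon>\<^sup>2)) + 1 / \<delta> ^ 5
    = 65 * (W * (1 / \<epsilon> ^ 3)) + 65 * (W * (1 / (\<epsilon>\<^sup>2 * \<delta>\<^sup>2))) + 4097 * (W * (1 / \<epsilon>\<^sup>2)) + 1 / \<delta> ^ 5"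
    by (simp add: power2_eq_square power3_eq_cube)
  also have "\<dots> \<le> 65 * (W * (1 / \<epsilon> ^ 3)) + 65 * (W * (1 / (\<epsilon>\<^sup>2 * \<delta>\<^sup>2))) + 4097 * (W * (1 / \<epsilon> ^ 3)) + W * (1 / \<delta> ^ 5)"
  proof (intro add_mono mult_left_mono order_refl)
    have "\<epsilon> ^ 3 \<le> \<epsilon>\<^sup>2" using eps by (intro power_decreasing) auto
    then show "1 / \<epsilon>\<^sup>2 \<le> 1 / \<epsilon> ^ 3" using eps by (simp add: frac_le)
    show "1 / \<delta> ^ 5 \<le> W * (1 / \<delta> ^ 5)" using W1 del mult_right_mono[of 1 W "1 / \<delta> ^ 5"] by simp
  qed (use W1 in auto)
  also have "\<dots> \<le> 10000 * W * (1 / \<epsilon> ^ 3 + 1 / (\<epsilon>\<^sup>2 * \<delta>\<^sup>2) + 1 / \<delta> ^ 5)"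
  proof -
    have "0 \<le> W * (1 / \<epsilon> ^ 3)" "0 \<le> W * (1 / (\<epsilon>\<^sup>2 * \<delta>\<^sup>2))" "0 \<le> W * (1 / \<delta> ^ 5)" using W1 eps del by auto
    then show ?thesis unfolding distrib_left mult.assoc by linarith
  qed
  finally show ?thesis by (simp add: W_def)
qed

end

section \<open>Finitely supported vectors\<close>

text \<open>One real inner product space containing every R^d, so that the analysis can use the type classes of the
  library although the dimension is a number.\<close>

typedef fvec = "{f :: nat \<Rightarrow> real. finite {i. f i \<noteq> 0}}"
  morphisms coord Fvec
  by (rule exI[of _ "\<lambda>_. 0"]) simp

setup_lifting type_definition_fvec

lemma finite_coord: "finite {i. coord x i \<noteq> 0}" using coord[of x] by simp

lemma fvec_eqI: "(\<And>i. coord x i = coord y i) \<Longrightarrow> x = y"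
  by (simp add: coord_inject[symmetric] fun_eq_iff)

instantiation fvec :: real_inner
begin

lift_definition zero_fvec :: fvec is "\<lambda>_. 0" by simp

lift_definition plus_fvec :: "fvec \<Rightarrow> fvec \<Rightarrow> fvec" is "\<lambda>f g i. f i + g i"
  subgoal for f g by (rule finite_subset[of _ "{i. f i \<noteq> 0} \<union> {i. g i \<noteq> 0}"]) auto
  done

lift_definition minus_fvec :: "fvec \<Rightarrow> fvec \<Rightarrow> fvec" is "\<lambda>f g i. f i - g i"
  subgoal for f g by (rule finite_subset[of _ "{i. f i \<noteq> 0} \<union> {i. g i \<noteq> 0}"]) auto
  done

lift_definition uminus_fvec :: "fvec \<Rightarrow> fvec" is "\<lambda>f i. - f i" by simp

lift_definition scaleR_fvec :: "real \<Rightarrow> fvec \<Rightarrow> fvec" is "\<lambda>c f i. c * f i"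
  subgoal for c f by (rule finite_subset[of _ "{i. f i \<noteq> 0}"]) auto
  done

definition inner_fvec :: "fvec \<Rightarrow> fvec \<Rightarrow> real" where
  "inner_fvec x y = (\<Sum>i | coord x i \<noteq> 0. coord x i * coord y i)"

definition norm_fvec :: "fvec \<Rightarrow> real" where "norm_fvec x = sqrt (inner x x)"
definition sgn_fvec :: "fvec \<Rightarrow> fvec" where "sgn_fvec x = scaleR (inverse (norm x)) x"
definition dist_fvec :: "fvec \<Rightarrow> fvec \<Rightarrow> real" where "dist_fvec x y = norm (x - y)"
definition uniformity_fvec :: "(fvec \<times> fvec) filter" where
  "uniformity_fvec = (INF e\<in>{0 <..}. principal {(x, y). dist x y < e})"
definition open_fvec :: "fvec set \<Rightarrow> bool" where
  "open_fvec U \<longleftrightarrow> (\<forall>x\<in>U. eventually (\<lambda>(x', y). x' = x \<longrightarrow> y \<in> U) uniformity)"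

lemma inner_fvec_sum:
  "finite S \<Longrightarrow> {i. coord x i \<noteq> 0} \<subseteq> S \<Longrightarrow> inner x y = (\<Sum>i\<in>S. coord x i * coord y i)"
  unfolding inner_fvec_def by (rule sum.mono_neutral_left) auto

instance
proof
  fix x y z :: fvec and r s :: real
  define S where "S = {i. coord x i \<noteq> 0} \<union> {i. coord y i \<noteq> 0}"
  have S: "finite S" "{i. coord x i \<noteq> 0} \<subseteq> S" "{i. coord y i \<noteq> 0} \<subseteq> S"
    "{i. coord (x + y) i \<noteq> 0} \<subseteq> S" "{i. coord (r *\<^sub>R x) i \<noteq> 0} \<subseteq> S"
    by (auto simp: S_def finite_coord plus_fvec.rep_eq scaleR_fvec.rep_eq)
  show "inner x y = inner y x"
    using S by (simp add: inner_fvec_sum[of S] mult.commute)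
  show "inner (x + y) z = inner x z + inner y z"
    using S by (simp add: inner_fvec_sum[of S] plus_fvec.rep_eq sum.distrib distrib_right)
  show "inner (r *\<^sub>R x) y = r * inner x y"
    using S by (simp add: inner_fvec_sum[of S] scaleR_fvec.rep_eq sum_distrib_left mult.assoc)
  show "0 \<le> inner x x" by (auto simp: inner_fvec_def intro: sum_nonneg)
  show "inner x x = 0 \<longleftrightarrow> x = 0"
    by (auto simp: inner_fvec_def sum_nonneg_eq_0_iff finite_coord zero_fvec.rep_eq intro: fvec_eqI)
  show "norm x = sqrt (inner x x)" by (rule norm_fvec_def)
  show "a + b + c = a + (b + c)" "a + b = b + a" "0 + a = a" "- a + a = 0" "a - b = a + - b" for a b c :: fvec
    by (transfer, simp add: fun_eq_iff)+
  show "sgn x = scaleR (inverse (norm x)) x" by (rule sgn_fvec_def)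
  show "dist x y = norm (x - y)" by (rule dist_fvec_def)
  show "r *\<^sub>R (x + y) = r *\<^sub>R x + r *\<^sub>R y" "(r + s) *\<^sub>R x = r *\<^sub>R x + s *\<^sub>R x"
    "r *\<^sub>R s *\<^sub>R x = (r * s) *\<^sub>R x" "1 *\<^sub>R x = x"
    by (transfer, simp add: fun_eq_iff algebra_simps)+
  show "uniformity = (INF e\<in>{0 <..}. principal {(x, y). dist x (y::fvec) < e})" by (rule uniformity_fvec_def)
  show "open U \<longleftrightarrow> (\<forall>x\<in>U. eventually (\<lambda>(x', y). x' = x \<longrightarrow> y \<in> U) uniformity)" for U :: "fvec set" by (rule open_fvec_def)
qed

end

section \<open>Passage between R^d and finitely supported vectors\<close>

definition fv :: "real vec \<Rightarrow> fvec" where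
  "fv v = Fvec (\<lambda>i. if i < dim_vec v then v $ i else 0)"

definition tv :: "nat \<Rightarrow> fvec \<Rightarrow> real vec" where "tv d x = vec d (coord x)"

lemma coord_fv: "coord (fv v) i = (if i < dim_vec v then v $ i else 0)"
proof -
  have "finite {i. (if i < dim_vec v then v $ i else 0) \<noteq> 0}"
    by (rule finite_subset[of _ "{..<dim_vec v}"]) auto
  then show ?thesis unfolding fv_def by (subst Fvec_inverse) auto
qed

lemma coord_simps:
  "coord (x + y) i = coord x i + coord y i" "coord (x - y) i = coord x i - coord y i"
  "coord (c *\<^sub>R x) i = c * coord x i" "coord 0 i = 0" "coord (- x) i = - coord x i"
  by (transfer, simp)+

lemma coord_sum: "coord (\<Sum>i\<in>I. h i) j = (\<Sum>i\<in>I. coord (h i) j)"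
  by (induction I rule: infinite_finite_induct) (auto simp: coord_simps)

lemma tv_carrier[simp]: "tv d x \<in> carrier_vec d" "dim_vec (tv d x) = d"
  by (auto simp: tv_def)

lemma tv_fv[simp]: "v \<in> carrier_vec d \<Longrightarrow> tv d (fv v) = v"
  by (auto simp: tv_def coord_fv)

lemma tv_add: "tv d (x + y) = tv d x + tv d y" and tv_diff: "tv d (x - y) = tv d x - tv d y"
  and tv_scaleR: "tv d (c *\<^sub>R x) = c \<cdot>\<^sub>v tv d x"
  by (auto simp: tv_def coord_simps)

lemma fv_add: "u \<in> carrier_vec d \<Longrightarrow> v \<in> carrier_vec d \<Longrightarrow> fv (u + v) = fv u + fv v"
  and fv_diff: "u \<in> carrier_vec d \<Longrightarrow> v \<in> carrier_vec d \<Longrightarrow> fv (u - v) = fv u - fv v"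
  and fv_scaleR: "fv (c \<cdot>\<^sub>v u) = c *\<^sub>R fv u"
  by (auto intro!: fvec_eqI simp: coord_fv coord_simps)

lemma fv_eq_iff: "u \<in> carrier_vec d \<Longrightarrow> v \<in> carrier_vec d \<Longrightarrow> fv u = fv v \<longleftrightarrow> u = v"
  by (metis tv_fv)

lemma fv_0: "fv (0\<^sub>v d) = 0"
  by (auto intro!: fvec_eqI simp: coord_fv coord_simps)

lemma fv_eq_0: "v \<in> carrier_vec d \<Longrightarrow> fv v = 0 \<Longrightarrow> v = 0\<^sub>v d"
  using fv_eq_iff[of v d "0\<^sub>v d"] by (simp add: fv_0)

lemma inner_fv: "u \<in> carrier_vec d \<Longrightarrow> inner (fv u) x = u \<bullet> tv d x"
  by (subst inner_fvec_sum[of "{..<d}"]) (auto simp: coord_fv scalar_prod_def tv_def lessThan_atLeast0)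

lemma norm_fv: "norm (fv u) = enorm u"
  using inner_fv[of u "dim_vec u" "fv u"] by (simp add: norm_eq_sqrt_inner enorm_def)

lemma fv_tv_le: "norm (fv (tv d x)) \<le> norm x"
proof -
  define y where "y = fv (tv d x)"
  have "inner y x = inner y y" unfolding y_def by (simp add: inner_fv[of _ d])
  then have "(norm y)\<^sup>2 \<le> norm y * norm x" using norm_cauchy_schwarz[of y x] by (simp add: power2_norm_eq_inner)
  then show ?thesis unfolding y_def[symmetric] by (cases "norm y = 0") (auto simp: power2_eq_square)
qed

lemma enorm_tv_le: "enorm (tv d x) \<le> norm x"
  using fv_tv_le[of d x] by (simp add: norm_fv)

lemma enorm_nonneg: "enorm x \<ge> 0" by (metis norm_fv norm_ge_zero)

definition bas :: "nat \<Rightarrow> fvec" where "bas j = Fvec (\<lambda>i. if i = j then 1 else 0)"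

lemma coord_bas: "coord (bas j) i = (if i = j then 1 else 0)"
  unfolding bas_def by (subst Fvec_inverse) (auto intro: finite_subset[of _ "{j}"])

lemma inner_bas: "inner (bas j) x = coord x j"
  by (subst inner_fvec_sum[of "{j}"]) (auto simp: coord_bas)

lemma norm_bas: "norm (bas j) = 1"
  by (simp add: norm_eq_sqrt_inner inner_bas coord_bas)

lemma fv_bas: "v \<in> carrier_vec d \<Longrightarrow> fv v = (\<Sum>j<d. (v $ j) *\<^sub>R bas j)"
  by (rule fvec_eqI) (auto simp: coord_fv coord_sum coord_simps coord_bas if_distrib[of "\<lambda>x. _ * x"] cong: if_cong)

lemma coord_le_norm: "\<bar>coord x i\<bar> \<le> norm x"
  using Cauchy_Schwarz_ineq2[of "bas i" x] by (simp add: norm_bas inner_bas)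

lemma norm_le_coords: "v \<in> carrier_vec d \<Longrightarrow> norm (fv v) \<le> (\<Sum>j<d. \<bar>v $ j\<bar>)"
  unfolding fv_bas by (rule sum_norm_le[THEN order_trans, OF _ order_refl]) (simp add: norm_bas)

section \<open>Matrices as operators, spectral norm and smallest eigenvalue\<close>

definition mact :: "nat \<Rightarrow> real mat \<Rightarrow> fvec \<Rightarrow> fvec" where "mact d M h = fv (M *\<^sub>v tv d h)"

lemma mact_linear:
  assumes "M \<in> carrier_mat d d" shows "linear (mact d M)"
proof (rule linearI)
  fix x y r
  have "M *\<^sub>v (tv d x + tv d y) = M *\<^sub>v tv d x + M *\<^sub>v tv d y"
    using assms by (intro mult_add_distrib_mat_vec) auto
  then show "mact d M (x + y) = mact d M x + mact d M y"
    using assms by (simp add: mact_def tv_add fv_add[of _ d])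
  have "M *\<^sub>v (r \<cdot>\<^sub>v tv d x) = r \<cdot>\<^sub>v (M *\<^sub>v tv d x)" using assms by (intro mult_mat_vec) auto
  then show "mact d M (r *\<^sub>R x) = r *\<^sub>R mact d M x" by (simp add: mact_def tv_scaleR fv_scaleR)
qed

lemma mact_tv: "mact d M (fv (tv d h)) = mact d M h" by (simp add: mact_def)

lemma mact_bounded_linear:
  assumes "M \<in> carrier_mat d d" shows "bounded_linear (mact d M)"
proof -
  note L = mact_linear[OF assms]
  have "norm (mact d M h) \<le> norm h * (\<Sum>j<d. norm (mact d M (bas j)))" for h
  proof -
    have "mact d M h = mact d M (\<Sum>j<d. (tv d h $ j) *\<^sub>R bas j)" by (simp add: fv_bas[of _ d, symmetric] mact_tv)
    also have "\<dots> = (\<Sum>j<d. (tv d h $ j) *\<^sub>R mact d M (bas j))" by (simp add: linear_sum[OF L] linear_scale[OF L])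
    also have "norm \<dots> \<le> (\<Sum>j<d. norm h * norm (mact d M (bas j)))"
      by (rule sum_norm_le) (auto simp: tv_def intro!: mult_right_mono coord_le_norm)
    finally show ?thesis by (simp add: sum_distrib_left)
  qed
  then show ?thesis using L by (intro bounded_linear_intro) (auto simp: linear_add linear_scale)
qed

lemma spectral_norm_le:
  assumes "M \<in> carrier_mat d d" "\<And>v. v \<in> carrier_vec d \<Longrightarrow> enorm (M *\<^sub>v v) \<le> K * enorm v" "K \<ge> 0"
  shows "spectral_norm M \<le> K"
proof -
  have "enorm (0\<^sub>v d) \<le> 1" by (simp add: enorm_def)
  then have ne: "{v \<in> carrier_vec (dim_col M). enorm v \<le> 1} \<noteq> {}" using assms(1) by (intro ex_in_conv[THEN iffD1] exI[of _ "0\<^sub>v d"]) auto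
  show ?thesis unfolding spectral_norm_def
  proof (rule cSUP_least[OF ne])
    fix v assume "v \<in> {v \<in> carrier_vec (dim_col M). enorm v \<le> 1}"
    then have v: "v \<in> carrier_vec d" "enorm v \<le> 1" using assms(1) by auto
    have "K * enorm v \<le> K * 1" using v assms(3) by (intro mult_left_mono) auto
    then show "enorm (M *\<^sub>v v) \<le> K" using assms(2)[OF v(1)] by simp
  qed
qed

text \<open>The supremum in \<open>spectral_norm\<close> dominates its members only once the set is
  known to be bounded above, which follows from \<open>mact_bounded_linear\<close>.\<close>

lemma spectral_norm_bound:
  assumes M: "M \<in> carrier_mat d d" shows "norm (mact d M h) \<le> spectral_norm M * norm h"
proof -
  obtain K where K: "\<And>h. norm (mact d M h) \<le> norm h * K" "K \<ge> 0"
    using bounded_linear.nonneg_bounded[OF mact_bounded_linear[OF M]] by blast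
  have bdd: "bdd_above ((\<lambda>v. enorm (M *\<^sub>v v)) ` {v \<in> carrier_vec (dim_col M). enorm v \<le> 1})"
  proof (rule bdd_aboveI2)
    fix v assume "v \<in> {v \<in> carrier_vec (dim_col M). enorm v \<le> 1}"
    then have v: "v \<in> carrier_vec d" "enorm v \<le> 1" using M by auto
    have "enorm (M *\<^sub>v v) = norm (mact d M (fv v))" using v by (simp add: mact_def norm_fv)
    also have "\<dots> \<le> enorm v * K" using K(1)[of "fv v"] by (simp add: norm_fv)
    also have "\<dots> \<le> 1 * K" using v K by (intro mult_right_mono) auto
    finally show "enorm (M *\<^sub>v v) \<le> K" by simp
  qed
  define e where "e = enorm (tv d h)"
  show ?thesis
  proof (cases "e = 0")
    case True
    then have "fv (tv d h) = 0" by (simp add: e_def norm_fv[symmetric])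
    then have "mact d M h = 0" using mact_tv[of d M h] linear_0[OF mact_linear[OF M]] by simp
    moreover have "spectral_norm M \<ge> 0"
    proof -
      have "enorm (M *\<^sub>v 0\<^sub>v d) \<le> spectral_norm M" unfolding spectral_norm_def
        using M by (intro cSUP_upper bdd) (auto simp: enorm_def)
      then show ?thesis using enorm_nonneg order_trans by blast
    qed
    ultimately show ?thesis by simp
  next
    case False
    then have e: "e > 0" using enorm_nonneg[of "tv d h"] by (simp add: e_def)
    define w where "w = (1 / e) \<cdot>\<^sub>v tv d h"
    have fw: "fv w = (1 / e) *\<^sub>R fv (tv d h)" by (simp add: w_def fv_scaleR)
    have w: "w \<in> carrier_vec d" by (simp add: w_def)
    have "enorm w = 1" using e by (simp add: norm_fv[symmetric] fw) (simp add: norm_fv e_def)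
    then have "enorm (M *\<^sub>v w) \<le> spectral_norm M" unfolding spectral_norm_def
      using M w by (intro cSUP_upper bdd) auto
    moreover have "mact d M h = e *\<^sub>R fv (M *\<^sub>v w)"
    proof -
      have "mact d M h = mact d M (e *\<^sub>R fv w)" using e by (simp add: fw mact_tv)
      also have "\<dots> = e *\<^sub>R fv (M *\<^sub>v w)" using w by (simp add: linear_scale[OF mact_linear[OF M]]) (simp add: mact_def)
      finally show ?thesis .
    qed
    ultimately have "norm (mact d M h) \<le> e * spectral_norm M" using e by (simp add: norm_fv)
    also have "\<dots> \<le> norm h * spectral_norm M"
      using enorm_tv_le[of d h] \<open>enorm (M *\<^sub>v w) \<le> spectral_norm M\<close> enorm_nonneg[of "M *\<^sub>v w"] by (intro mult_right_mono) (auto simp: e_def)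
    finally show ?thesis by (simp add: mult.commute)
  qed
qed

text \<open>The Rayleigh quotient attains its minimum on the sphere, which is compact in the product topology
  of the coordinates, and a minimizer is an eigenvector.\<close>

lemma rayleigh_min:
  assumes M: "M \<in> carrier_mat d d" and d: "d \<ge> 1"
  shows "\<exists>u\<in>carrier_vec d. enorm u = 1 \<and> (\<forall>z. inner z (mact d M z) \<ge> inner (fv u) (mact d M (fv u)) * (norm (fv (tv d z)))\<^sup>2)"
proof -
  define S where "S = {x \<in> PiE {..<d} (\<lambda>_. {-1..1::real}). (\<Sum>i<d. (x i)\<^sup>2) = 1}"
  define q where "q = (\<lambda>x. (\<Sum>i<d. x i * (\<Sum>j<d. M $$ (i, j) * x j)) :: real)"
  have cx: "continuous_on UNIV (\<lambda>x::nat \<Rightarrow> real. x i)" for i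
    by (rule continuous_on_product_coordinates)
  have "compact (PiE {..<d} (\<lambda>_. {-1..1::real}))"
  proof -
    \<comment> \<open>Coordinates from d on are frozen at \<open>undefined\<close>, so that the cube
      becomes a product of compact sets indexed by all natural numbers.\<close>
    have "PiE {..<d} (\<lambda>_. {-1..1::real}) = PiE UNIV (\<lambda>i. if i < d then {-1..1} else {undefined})"
      by (auto simp: PiE_def Pi_def extensional_def split: if_splits)
    moreover have "compactin (product_topology (\<lambda>i. euclidean) UNIV) (PiE UNIV (\<lambda>i. if i < d then {-1..1::real} else {undefined}))"
      by (subst compactin_PiE) auto
    ultimately show ?thesis by (simp add: euclidean_product_topology)
  qed
  moreover have "closed {x::nat \<Rightarrow> real. (\<Sum>i<d. (x i)\<^sup>2) = 1}"
    by (intro closed_Collect_eq continuous_intros cx)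
  ultimately have cS: "compact S"
    unfolding S_def by (simp add: Collect_conj_eq compact_Int_closed)
  have "(\<lambda>i\<in>{..<d}. if i = 0 then 1 else 0 :: real) \<in> S"
  proof -
    have "(\<Sum>i<d. ((\<lambda>i\<in>{..<d}. if i = 0 then 1 else 0 :: real) i)\<^sup>2) = (\<Sum>i<d. if i = 0 then 1 else 0)"
      by (rule sum.cong) auto
    then show ?thesis using d by (auto simp: S_def)
  qed
  then have ne: "S \<noteq> {}" by auto
  have "continuous_on S q" unfolding q_def
    by (intro continuous_intros continuous_on_subset[OF cx]) auto
  from continuous_attains_inf[OF cS ne this] obtain x where x: "x \<in> S" "\<And>y. y \<in> S \<Longrightarrow> q x \<le> q y" by blast
  define u where "u = vec d x"
  have qv: "q y = v \<bullet> (M *\<^sub>v v)" if "v \<in> carrier_vec d" "\<And>i. i < d \<Longrightarrow> y i = v $ i" for v y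
    using that M by (auto simp: q_def scalar_prod_def lessThan_atLeast0 intro!: sum.cong)
  have u: "u \<in> carrier_vec d" by (simp add: u_def)
  have e: "(enorm v)\<^sup>2 = (\<Sum>i<d. (v $ i)\<^sup>2)" if "v \<in> carrier_vec d" for v
    using that by (auto simp: enorm_def scalar_prod_def lessThan_atLeast0 power2_eq_square sum_nonneg)
  have qu: "q x = inner (fv u) (mact d M (fv u))"
    using qv[of u x] M u by (simp add: mact_def inner_fv[of _ d] u_def)
  have u1: "enorm u = 1"
  proof -
    have "(enorm u)\<^sup>2 = 1" using e[OF u] x(1) by (simp add: u_def S_def)
    then show ?thesis using enorm_nonneg[of u] by (simp add: power2_eq_1_iff)
  qed
  have "inner z (mact d M z) \<ge> q x * (norm (fv (tv d z)))\<^sup>2" for z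
  proof -
    define v where "v = tv d z"
    have v: "v \<in> carrier_vec d" by (simp add: v_def)
    have iv: "inner z (mact d M z) = v \<bullet> (M *\<^sub>v v)"
      using M v by (subst inner_commute) (simp add: mact_def inner_fv[of _ d] v_def[symmetric] comm_scalar_prod[of _ d])
    show ?thesis
    proof (cases "enorm v = 0")
      case True
      then have "v = 0\<^sub>v d" using v by (intro fv_eq_0) (simp_all add: norm_fv[symmetric])
      then have "v \<bullet> (M *\<^sub>v v) = 0" using M by (auto simp: scalar_prod_def)
      then show ?thesis using iv True by (simp add: v_def[symmetric] norm_fv)
    next
      case False
      define en where "en = enorm v"
      have en: "en > 0" using False enorm_nonneg[of v] by (simp add: en_def)
      define w where "w = (1 / en) \<cdot>\<^sub>v v"
      have w: "w \<in> carrier_vec d" using v by (simp add: w_def)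
      have "fv w = (1 / en) *\<^sub>R fv v" by (simp add: w_def fv_scaleR)
      then have "enorm w = 1" using en by (simp add: norm_fv[symmetric]) (simp add: norm_fv en_def)
      then have s1: "(\<Sum>i<d. (w $ i)\<^sup>2) = 1" using e[OF w] by simp
      have wb: "\<bar>w $ i\<bar> \<le> 1" if "i < d" for i
      proof -
        have "(w $ i)\<^sup>2 \<le> (\<Sum>i<d. (w $ i)\<^sup>2)" using that by (intro member_le_sum) auto
        then show ?thesis using s1 by (simp add: abs_square_le_1)
      qed
      have "(\<lambda>i\<in>{..<d}. w $ i) \<in> S" using s1 wb by (auto simp: S_def abs_le_iff minus_le_iff)
      then have "q x \<le> w \<bullet> (M *\<^sub>v w)" using x(2) qv[OF w] by fastforce
      also have "\<dots> = (1 / en) * ((1 / en) * (v \<bullet> (M *\<^sub>v v)))"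
        using M v unfolding w_def by (simp add: mult_mat_vec[of _ d d])
      finally have "q x * (en * en) \<le> v \<bullet> (M *\<^sub>v v)" using en by (simp add: field_simps)
      then show ?thesis using iv by (simp add: norm_fv v_def[symmetric] en_def[symmetric] power2_eq_square)
    qed
  qed
  then show ?thesis using u u1 qu by auto
qed

lemma min_eigenpair:
  assumes M: "M \<in> carrier_mat d d" and d: "d \<ge> 1"
    and sym: "\<And>y z. inner y (mact d M z) = inner z (mact d M y)"
  obtains u \<mu> where "u \<in> carrier_vec d" "enorm u = 1" "mact d M (fv u) = \<mu> *\<^sub>R fv u"
    "\<And>z. inner z (mact d M z) \<ge> \<mu> * (norm (fv (tv d z)))\<^sup>2" "lambda_min M = \<mu>"
proof -
  obtain u where u: "u \<in> carrier_vec d" "enorm u = 1"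
    and min: "\<And>z. inner z (mact d M z) \<ge> inner (fv u) (mact d M (fv u)) * (norm (fv (tv d z)))\<^sup>2"
    using rayleigh_min[OF M d] by auto
  define \<mu> where "\<mu> = inner (fv u) (mact d M (fv u))"
  have nu: "norm (fv u) = 1" using u by (simp add: norm_fv)
  note L = mact_linear[OF M]
  have img: "fv (tv d (mact d M z)) = mact d M z" for z using M by (simp add: mact_def)
  define r where "r = mact d M (fv u) - \<mu> *\<^sub>R fv u"
  have r: "fv (tv d r) = r" using u by (simp add: r_def tv_diff tv_scaleR fv_diff[of _ d] fv_scaleR img)
  \<comment> \<open>Minimality along u + t r, with r the eigenvector residual of u, gives a
    nonnegative quadratic in t without constant term whose linear coefficient is 2 |r|^2. A small
    negative t then refutes r \<noteq> 0.\<close>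
  have ortho: "t\<^sup>2 * (inner r (mact d M r) - \<mu> * (norm r)\<^sup>2) + 2 * t * (norm r)\<^sup>2 \<ge> 0" for t
  proof -
    have "fv (tv d (fv u + t *\<^sub>R r)) = fv u + t *\<^sub>R r" using u by (simp add: tv_add tv_scaleR fv_add[of _ d] fv_scaleR r)
    then have "inner (fv u + t *\<^sub>R r) (mact d M (fv u + t *\<^sub>R r)) \<ge> \<mu> * (norm (fv u + t *\<^sub>R r))\<^sup>2"
      using min[of "fv u + t *\<^sub>R r"] by (simp add: \<mu>_def)
    moreover have "inner (fv u + t *\<^sub>R r) (mact d M (fv u + t *\<^sub>R r)) = \<mu> + 2 * t * inner r (mact d M (fv u)) + t\<^sup>2 * inner r (mact d M r)"
      using sym[of "fv u" r] by (simp add: linear_add[OF L] linear_scale[OF L] inner_add_left inner_add_right \<mu>_def power2_eq_square algebra_simps)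
    moreover have "(norm (fv u + t *\<^sub>R r))\<^sup>2 = 1 + 2 * t * inner r (fv u) + t\<^sup>2 * (norm r)\<^sup>2"
    proof -
      have "inner (fv u) (fv u) = 1" using nu by (simp add: norm_eq_1)
      then show ?thesis unfolding power2_norm_eq_inner
        by (simp add: inner_add_left inner_add_right inner_commute[of "fv u" r] power2_eq_square algebra_simps)
    qed
    moreover have "inner r (mact d M (fv u)) - \<mu> * inner r (fv u) = (norm r)\<^sup>2"
      by (simp add: power2_norm_eq_inner inner_diff_right r_def)
    ultimately show ?thesis by (simp add: algebra_simps)
  qed
  have "r = 0"
  proof (rule ccontr)
    assume "r \<noteq> 0"
    define a where "a = inner r (mact d M r) - \<mu> * (norm r)\<^sup>2"
    define k where "k = (norm r)\<^sup>2"
    have k: "k > 0" using \<open>r \<noteq> 0\<close> by (simp add: k_def)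
    define t where "t = - (k / (\<bar>a\<bar> + 1))"
    have "t * a + 2 * k > 0"
    proof -
      have "\<bar>t * a\<bar> = k * (\<bar>a\<bar> / (\<bar>a\<bar> + 1))" using k by (simp add: t_def abs_mult)
      also have "\<dots> \<le> k * 1" using k by (intro mult_left_mono) auto
      finally show ?thesis using k by linarith
    qed
    moreover have "t < 0" using k by (simp add: t_def)
    ultimately have "t * (t * a + 2 * k) < 0" by (simp add: mult_neg_pos)
    then show False using ortho[of t] by (simp add: a_def k_def power2_eq_square algebra_simps)
  qed
  then have eig: "mact d M (fv u) = \<mu> *\<^sub>R fv u" by (simp add: r_def)
  have Mu: "M *\<^sub>v u = \<mu> \<cdot>\<^sub>v u"
  proof -
    have "fv (M *\<^sub>v u) = fv (\<mu> \<cdot>\<^sub>v u)" using eig u by (simp add: mact_def fv_scaleR)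
    then show ?thesis using u M by (subst (asm) fv_eq_iff[of _ d]) auto
  qed
  have "u \<noteq> 0\<^sub>v d" using u(2) by (auto simp: enorm_def)
  then have "eigenvalue M \<mu>" unfolding eigenvalue_def eigenvector_def using Mu u M by auto
  then have in_spec: "\<mu> \<in> spectrum M" by (simp add: spectrum_def)
  have fin: "finite (spectrum M)" by (rule card_finite_spectrum(1)[OF M])
  have "\<mu> \<le> k" if "k \<in> spectrum M" for k
  proof -
    obtain v where v: "v \<in> carrier_vec d" "v \<noteq> 0\<^sub>v d" "M *\<^sub>v v = k \<cdot>\<^sub>v v"
      using \<open>k \<in> spectrum M\<close> M by (auto simp: spectrum_def eigenvalue_def eigenvector_def)
    have "inner (fv v) (mact d M (fv v)) = k * (norm (fv v))\<^sup>2"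
      using v by (simp add: mact_def fv_scaleR power2_norm_eq_inner)
    then have "\<mu> * (norm (fv v))\<^sup>2 \<le> k * (norm (fv v))\<^sup>2" using min[of "fv v"] v by (simp add: \<mu>_def)
    moreover have "fv v \<noteq> 0"
      using fv_eq_0 v by blast
    ultimately show ?thesis by simp
  qed
  then have "lambda_min M = \<mu>" unfolding lambda_min_def using in_spec fin by (intro Min_eqI) auto
  show ?thesis
    by (rule that[OF u(1) u(2) eig _ \<open>lambda_min M = \<mu>\<close>]) (use min in \<open>simp add: \<mu>_def\<close>)
qed

section \<open>Smooth functions\<close>

lemma line_deriv:
  fixes F :: "'v::real_inner \<Rightarrow> real"
  assumes "\<And>z. (F has_derivative (\<lambda>h. inner (g z) h)) (at z)"
  shows "((\<lambda>t. F (x + t *\<^sub>R w)) has_real_derivative inner (g (x + t *\<^sub>R w)) w) (at t)"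
proof -
  have "((\<lambda>t. x + t *\<^sub>R w) has_derivative (\<lambda>s. s *\<^sub>R w)) (at t)"
    by (auto intro!: derivative_eq_intros)
  from has_derivative_compose[OF this assms]
  show ?thesis unfolding has_field_derivative_def by (rule has_derivative_eq_rhs) (auto simp: fun_eq_iff)
qed

lemma descent_lemma:
  fixes F :: "'v::real_inner \<Rightarrow> real"
  assumes der: "\<And>z. (F has_derivative (\<lambda>h. inner (g z) h)) (at z)"
    and lip: "\<And>x y. norm (g x - g y) \<le> L * norm (x - y)"
  shows "F y \<le> F x + inner (g x) (y - x) + L / 2 * (norm (y - x))\<^sup>2"
proof -
  define w where "w = y - x"
  define \<psi> where "\<psi> = (\<lambda>t. F (x + t *\<^sub>R w) - t * inner (g x) w - L / 2 * (norm w)\<^sup>2 * t\<^sup>2)"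
  have "\<psi> 1 \<le> \<psi> 0"
  proof (rule DERIV_nonpos_imp_nonincreasing[of 0 1 \<psi>])
    fix t :: real assume t: "0 \<le> t" "t \<le> 1"
    have "(\<psi> has_real_derivative (inner (g (x + t *\<^sub>R w)) w - inner (g x) w - L * (norm w)\<^sup>2 * t)) (at t)"
      unfolding \<psi>_def by (auto intro!: derivative_eq_intros line_deriv[OF der])
    moreover have "inner (g (x + t *\<^sub>R w)) w - inner (g x) w \<le> L * (norm w)\<^sup>2 * t"
    proof -
      have "inner (g (x + t *\<^sub>R w) - g x) w \<le> norm (g (x + t *\<^sub>R w) - g x) * norm w" by (rule norm_cauchy_schwarz)
      also have "\<dots> \<le> (L * norm (x + t *\<^sub>R w - x)) * norm w" by (intro mult_right_mono lip) auto
      also have "\<dots> = L * (norm w)\<^sup>2 * t" using t by (simp add: power2_eq_square)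
      finally show ?thesis by (simp add: inner_diff_left)
    qed
    ultimately show "\<exists>y. (\<psi> has_real_derivative y) (at t) \<and> y \<le> 0" by (intro exI conjI) auto
  qed simp
  then show ?thesis by (simp add: \<psi>_def w_def)
qed

text \<open>The mean value inequality for z \<mapsto> g z - Hs x z, whose derivative is at most
  \<rho> |h| along the segment.\<close>

lemma grad_taylor:
  fixes g :: "'v::real_normed_vector \<Rightarrow> 'v"
  assumes der: "\<And>z. (g has_derivative Hs z) (at z)"
    and lip: "\<And>x y h. norm (Hs x h - Hs y h) \<le> \<rho> * norm (x - y) * norm h" and "\<rho> \<ge> 0"
  shows "norm (g (x + h) - g x - Hs x h) \<le> \<rho> * (norm h)\<^sup>2"
proof -
  have bl: "bounded_linear (Hs z)" for z using der has_derivative_bounded_linear by blast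
  interpret bounded_linear "Hs x" by (rule bl)
  have "norm ((g (x + h) - Hs x (x + h)) - (g x - Hs x x)) \<le> (\<rho> * norm h) * norm ((x + h) - x)"
  proof (rule differentiable_bound[of "closed_segment x (x + h)" "\<lambda>z. g z - Hs x z" "\<lambda>z k. Hs z k - Hs x k"])
    fix z assume z: "z \<in> closed_segment x (x + h)"
    show "((\<lambda>z. g z - Hs x z) has_derivative (\<lambda>k. Hs z k - Hs x k)) (at z within closed_segment x (x + h))"
      by (intro has_derivative_diff has_derivative_at_withinI[OF der] bounded_linear_imp_has_derivative bl)
    have "norm (z - x) \<le> norm h" using segment_bound(1)[OF z] by simp
    then have "\<rho> * norm (z - x) \<le> \<rho> * norm h" using \<open>\<rho> \<ge> 0\<close> by (intro mult_left_mono)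
    then have bnd: "norm (Hs z k - Hs x k) \<le> \<rho> * norm h * norm k" for k
      using order_trans[OF lip[of z k x] mult_right_mono[of _ _ "norm k"]] by simp
    show "onorm (\<lambda>k. Hs z k - Hs x k) \<le> \<rho> * norm h" by (rule onorm_bound[OF _ bnd]) (use \<open>\<rho> \<ge> 0\<close> in simp)
  qed auto
  then show ?thesis by (simp add: add power2_eq_square algebra_simps)
qed

text \<open>The symmetric difference removes the gradient at x. Its derivative in t differs from 2t
  <w, H w> by two Taylor remainders of at most \<rho> t^2 each, which integrate to 2/3 \<rho>
  T^3.\<close>

lemma second_order_bound:
  fixes F :: "'v::real_inner \<Rightarrow> real"
  assumes der: "\<And>z. (F has_derivative (\<lambda>h. inner (g z) h)) (at z)"
    and der2: "\<And>z. (g has_derivative Hs z) (at z)"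
    and lip2: "\<And>x y h. norm (Hs x h - Hs y h) \<le> \<rho> * norm (x - y) * norm h" and "\<rho> \<ge> 0"
    and w: "norm w = 1" and T: "T \<ge> 0"
  shows "F (x + T *\<^sub>R w) + F (x - T *\<^sub>R w) \<le> 2 * F x + T\<^sup>2 * inner w (Hs x w) + 2 * \<rho> / 3 * T ^ 3"
proof -
  interpret bounded_linear "Hs x" using der2 has_derivative_bounded_linear by blast
  define F1 where "F1 = (\<lambda>w t. F (x + t *\<^sub>R w))"
  have d1: "(F1 w has_real_derivative inner (g (x + t *\<^sub>R w)) w) (at t)" for w t
    unfolding F1_def by (rule line_deriv[OF der])
  define \<psi> where "\<psi> = (\<lambda>t. F1 w t + F1 (- w) t - t\<^sup>2 * inner w (Hs x w) - 2 * \<rho> / 3 * t ^ 3)"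
  have "\<psi> T \<le> \<psi> 0"
  proof (rule DERIV_nonpos_imp_nonincreasing[of 0 T \<psi>, OF T])
    fix t :: real assume t: "0 \<le> t" "t \<le> T"
    have "(\<psi> has_real_derivative (inner (g (x + t *\<^sub>R w)) w + inner (g (x + t *\<^sub>R (- w))) (- w) - 2 * t * inner w (Hs x w) - 2 * \<rho> * t\<^sup>2)) (at t)"
      unfolding \<psi>_def by (rule derivative_eq_intros d1 refl | simp)+
    moreover have "inner (g (x + t *\<^sub>R w)) w + inner (g (x + t *\<^sub>R (- w))) (- w) - 2 * t * inner w (Hs x w) - 2 * \<rho> * t\<^sup>2 \<le> 0"
    proof -
      define e1 where "e1 = g (x + t *\<^sub>R w) - g x - Hs x (t *\<^sub>R w)"
      define e2 where "e2 = g (x + t *\<^sub>R (- w)) - g x - Hs x (t *\<^sub>R (- w))"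
      have "norm e1 \<le> \<rho> * t\<^sup>2" "norm e2 \<le> \<rho> * t\<^sup>2"
        using grad_taylor[OF der2 lip2 \<open>\<rho> \<ge> 0\<close>, of x "t *\<^sub>R w"] grad_taylor[OF der2 lip2 \<open>\<rho> \<ge> 0\<close>, of x "t *\<^sub>R (- w)"] w t
        by (simp_all add: e1_def e2_def power_mult_distrib)
      moreover have "inner (g (x + t *\<^sub>R w)) w + inner (g (x + t *\<^sub>R (- w))) (- w) = 2 * t * inner w (Hs x w) + inner e1 w - inner e2 w"
        by (simp add: e1_def e2_def inner_diff_left inner_add_left scaleR neg inner_commute[of w])
      moreover have "inner e1 w \<le> norm e1" "- inner e2 w \<le> norm e2"
        using Cauchy_Schwarz_ineq2[of e1 w] Cauchy_Schwarz_ineq2[of e2 w] w by auto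
      ultimately show ?thesis by linarith
    qed
    ultimately show "\<exists>y. (\<psi> has_real_derivative y) (at t) \<and> y \<le> 0" by blast
  qed
  then show ?thesis by (simp add: \<psi>_def F1_def)
qed

text \<open>Schwarz's theorem: the mixed second difference Q a b t is symmetric in a and b and
  equals t^2 <a, H b> up to a multiple of t^3.\<close>

lemma hess_sym:
  fixes F :: "'v::real_inner \<Rightarrow> real"
  assumes der: "\<And>z. (F has_derivative (\<lambda>h. inner (g z) h)) (at z)"
    and der2: "\<And>z. (g has_derivative Hs z) (at z)"
    and lip2: "\<And>x y h. norm (Hs x h - Hs y h) \<le> \<rho> * norm (x - y) * norm h" and "\<rho> \<ge> 0"
  shows "inner a (Hs x b) = inner b (Hs x a)"
proof -
  interpret bounded_linear "Hs x" using der2 has_derivative_bounded_linear by blast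
  note tay = grad_taylor[OF der2 lip2 \<open>\<rho> \<ge> 0\<close>]
  define Q where "Q = (\<lambda>a b t. F (x + t *\<^sub>R a + t *\<^sub>R b) - F (x + t *\<^sub>R a) - F (x + t *\<^sub>R b) + F x)"
  have Qb: "\<bar>Q a b t - t\<^sup>2 * inner a (Hs x b)\<bar> \<le> 2 * \<rho> * (norm a + norm b) ^ 3 * t ^ 3" if t: "t > 0" for a b t
  proof -
    define N where "N = norm a + norm b"
    define F1 where "F1 = (\<lambda>s. F (x + t *\<^sub>R b + s *\<^sub>R (t *\<^sub>R a)) - F (x + s *\<^sub>R (t *\<^sub>R a)))"
    define D1 where "D1 = (\<lambda>s. inner (g (x + t *\<^sub>R b + s *\<^sub>R (t *\<^sub>R a))) (t *\<^sub>R a) - inner (g (x + s *\<^sub>R (t *\<^sub>R a))) (t *\<^sub>R a))"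
    have "(F1 has_real_derivative D1 s) (at s)" for s
      unfolding F1_def D1_def by (intro DERIV_diff line_deriv[OF der])
    then have "\<exists>s>0. s < 1 \<and> F1 1 - F1 0 = (1 - 0) * D1 s"
      by (intro MVT2) auto
    then obtain s where s: "0 < s" "s < 1"
      and e: "Q a b t = inner (g (x + t *\<^sub>R b + s *\<^sub>R (t *\<^sub>R a)) - g (x + s *\<^sub>R (t *\<^sub>R a))) (t *\<^sub>R a)"
      by (auto simp: Q_def F1_def D1_def inner_diff_left algebra_simps)
    define h1 where "h1 = t *\<^sub>R b + s *\<^sub>R (t *\<^sub>R a)"
    define h2 where "h2 = s *\<^sub>R (t *\<^sub>R a)"
    have sa: "s * norm a \<le> norm a" using s by (simp add: mult_left_le_one_le)
    have "norm h1 \<le> t * norm b + t * (s * norm a)" unfolding h1_def using t s by (intro order_trans[OF norm_triangle_ineq]) (simp add: mult_ac)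
    also have "\<dots> \<le> t * N" using sa t mult_left_mono[OF sa, of t] by (simp add: N_def distrib_left)
    finally have h1: "norm h1 \<le> t * N" .
    have "norm h2 = t * (s * norm a)" using s t by (simp add: h2_def mult_ac)
    also have "\<dots> \<le> t * N" using sa t by (intro mult_left_mono) (auto simp: N_def add_increasing2)
    finally have h2: "norm h2 \<le> t * N" .
    define r1 where "r1 = g (x + h1) - g x - Hs x h1"
    define r2 where "r2 = g (x + h2) - g x - Hs x h2"
    have "norm r1 \<le> \<rho> * (t * N)\<^sup>2" "norm r2 \<le> \<rho> * (t * N)\<^sup>2"
      unfolding r1_def r2_def using h1 h2 \<open>\<rho> \<ge> 0\<close> by (auto intro!: order_trans[OF tay] mult_left_mono power_mono)
    then have r: "norm (r1 - r2) \<le> 2 * \<rho> * (t * N)\<^sup>2" using norm_triangle_ineq4[of r1 r2] by simp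
    have "g (x + t *\<^sub>R b + s *\<^sub>R (t *\<^sub>R a)) - g (x + s *\<^sub>R (t *\<^sub>R a)) = t *\<^sub>R Hs x b + (r1 - r2)"
      by (simp add: r1_def r2_def h1_def h2_def add scaleR add.assoc)
    then have "Q a b t = inner (t *\<^sub>R Hs x b + (r1 - r2)) (t *\<^sub>R a)" unfolding e by (simp only:)
    then have "Q a b t - t\<^sup>2 * inner a (Hs x b) = inner (r1 - r2) (t *\<^sub>R a)"
      by (simp add: inner_add_left inner_commute[of a] power2_eq_square distrib_left)
    then have "\<bar>Q a b t - t\<^sup>2 * inner a (Hs x b)\<bar> \<le> norm (r1 - r2) * norm (t *\<^sub>R a)" using Cauchy_Schwarz_ineq2 by metis
    also have "\<dots> \<le> (2 * \<rho> * (t * N)\<^sup>2) * (t * N)"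
      using r t \<open>\<rho> \<ge> 0\<close> by (intro mult_mono) (auto simp: N_def intro!: mult_left_mono)
    also have "\<dots> = 2 * \<rho> * N ^ 3 * t ^ 3" by (simp add: power2_eq_square power3_eq_cube)
    finally show ?thesis by (simp add: N_def)
  qed
  define K where "K = 4 * \<rho> * (norm a + norm b) ^ 3"
  define D where "D = \<bar>inner a (Hs x b) - inner b (Hs x a)\<bar>"
  have Dt: "D \<le> K * t" if t: "t > 0" for t
  proof -
    have "Q a b t = Q b a t" by (simp add: Q_def add_ac)
    then have "\<bar>t\<^sup>2 * inner a (Hs x b) - t\<^sup>2 * inner b (Hs x a)\<bar> \<le> K * t ^ 3"
      using Qb[OF t, of a b] Qb[OF t, of b a] by (simp add: K_def add.commute[of "norm b"] abs_if split: if_splits)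
    then have "t\<^sup>2 * D \<le> t\<^sup>2 * (K * t)"
      by (simp add: D_def abs_mult[symmetric] right_diff_distrib[symmetric] power2_eq_square power3_eq_cube mult_ac)
    then show ?thesis using t by simp
  qed
  have K0: "K \<ge> 0" using \<open>\<rho> \<ge> 0\<close> by (simp add: K_def)
  have "D \<le> e" if "e > 0" for e
  proof -
    have "D \<le> K * (e / (K + 1))" using K0 that by (intro Dt) auto
    also have "\<dots> \<le> e" using K0 that by (simp add: field_simps)
    finally show ?thesis .
  qed
  then have "D \<le> 0" using dense_ge[of 0 D] by auto
  then show ?thesis by (simp add: D_def)
qed

lemma hv_error:
  fixes g :: "'v::real_normed_vector \<Rightarrow> 'v"
  assumes der: "\<And>z. (g has_derivative Hs z) (at z)"
    and lip: "\<And>x y h. norm (Hs x h - Hs y h) \<le> \<rho> * norm (x - y) * norm h" and "\<rho> \<ge> 0" and \<tau>: "\<tau> > 0"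
  shows "norm ((norm y / \<tau>) *\<^sub>R (g (x + (\<tau> / norm y) *\<^sub>R y) - g x) - Hs x y) \<le> \<rho> * \<tau> * norm y"
proof (cases "y = 0")
  case True
  interpret bounded_linear "Hs x" using der has_derivative_bounded_linear by blast
  show ?thesis using True by (simp add: zero)
next
  case False
  interpret bounded_linear "Hs x" using der has_derivative_bounded_linear by blast
  define h where "h = (\<tau> / norm y) *\<^sub>R y"
  have h: "norm h = \<tau>" "y = (norm y / \<tau>) *\<^sub>R h" using False \<tau> by (auto simp: h_def)
  have "Hs x y = (norm y / \<tau>) *\<^sub>R Hs x h" using h(2) scaleR by metis
  then have "(norm y / \<tau>) *\<^sub>R (g (x + h) - g x) - Hs x y = (norm y / \<tau>) *\<^sub>R (g (x + h) - g x - Hs x h)"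
    by (simp add: algebra_simps)
  then have "norm ((norm y / \<tau>) *\<^sub>R (g (x + h) - g x) - Hs x y) = norm y / \<tau> * norm (g (x + h) - g x - Hs x h)"
    using \<tau> by simp
  also have "\<dots> \<le> norm y / \<tau> * (\<rho> * \<tau>\<^sup>2)"
    using grad_taylor[OF der lip \<open>\<rho> \<ge> 0\<close>, of x h] h(1) \<tau> by (intro mult_left_mono) auto
  also have "\<dots> = \<rho> * \<tau> * norm y" using \<tau> by (simp add: power2_eq_square)
  finally show ?thesis by (simp add: h_def)
qed

text \<open>The difference quotient is bounded by L |y| for every \<tau> and tends to the Hessian
  product as \<tau> \<rightarrow> 0.\<close>

lemma hess_norm:
  fixes g :: "'v::real_normed_vector \<Rightarrow> 'v"
  assumes der: "\<And>z. (g has_derivative Hs z) (at z)"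
    and lip2: "\<And>x y h. norm (Hs x h - Hs y h) \<le> \<rho> * norm (x - y) * norm h" and "\<rho> \<ge> 0"
    and lip: "\<And>x y. norm (g x - g y) \<le> L * norm (x - y)"
  shows "norm (Hs x y) \<le> L * norm y"
proof (cases "y = 0")
  case True
  interpret bounded_linear "Hs x" using der has_derivative_bounded_linear by blast
  show ?thesis using True by (simp add: zero)
next
  case False
  have *: "norm (Hs x y) \<le> L * norm y + \<rho> * norm y * \<tau>" if \<tau>: "\<tau> > 0" for \<tau>
  proof -
    define k where "k = (norm y / \<tau>) *\<^sub>R (g (x + (\<tau> / norm y) *\<^sub>R y) - g x)"
    have "norm k = norm y / \<tau> * norm (g (x + (\<tau> / norm y) *\<^sub>R y) - g x)" using \<tau> by (simp add: k_def)
    also have "\<dots> \<le> norm y / \<tau> * (L * norm (x + (\<tau> / norm y) *\<^sub>R y - x))" using \<tau> by (intro mult_left_mono lip) auto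
    also have "\<dots> = L * norm y" using \<tau> False by simp
    finally have "norm k \<le> L * norm y" .
    moreover have "norm (k - Hs x y) \<le> \<rho> * \<tau> * norm y" unfolding k_def by (rule hv_error[OF der lip2 \<open>\<rho> \<ge> 0\<close> \<tau>])
    ultimately show ?thesis using norm_triangle_ineq4[of k "k - Hs x y"] by (simp add: mult_ac)
  qed
  show ?thesis
  proof (rule field_le_epsilon)
    fix e :: real assume e: "e > 0"
    define K where "K = \<rho> * norm y"
    have K0: "K \<ge> 0" using \<open>\<rho> \<ge> 0\<close> by (simp add: K_def)
    have "norm (Hs x y) \<le> L * norm y + K * (e / (K + 1))" unfolding K_def
      by (rule *) (use e K0 in \<open>simp add: K_def add_nonneg_pos\<close>)
    also have "K * (e / (K + 1)) \<le> e" using K0 e by (simp add: field_simps)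
    finally show "norm (Hs x y) \<le> L * norm y + e" by simp
  qed
qed

section \<open>Smoothness hypotheses carried over to finitely supported vectors\<close>

definition smooth1 :: "nat \<Rightarrow> (real vec \<Rightarrow> real) \<Rightarrow> real \<Rightarrow> real \<Rightarrow> bool" where
  "smooth1 d f L \<rho> \<longleftrightarrow> twice_differentiable d f \<and>
       (\<forall>x\<in>carrier_vec d. \<forall>y\<in>carrier_vec d.
          enorm (grad d f x - grad d f y) \<le> L * enorm (x - y) \<and>
          spectral_norm (hessian d f x - hessian d f y) \<le> \<rho> * enorm (x - y))"

lemma smooth_components_iff: "smooth_components d I F L \<rho> \<longleftrightarrow> (\<forall>i\<in>I. smooth1 d (F i) L \<rho>)"
  by (simp add: smooth_components_def smooth1_def)

text \<open>The gradient of the composition of f with the truncation \<open>tv d\<close>. Functions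
  on R^d are extended in this way, so their derivatives vanish in all further directions.\<close>

definition gF :: "nat \<Rightarrow> (real vec \<Rightarrow> real) \<Rightarrow> fvec \<Rightarrow> fvec" where "gF d f z = fv (grad d f (tv d z))"

definition HF :: "nat \<Rightarrow> (real vec \<Rightarrow> real) \<Rightarrow> fvec \<Rightarrow> fvec \<Rightarrow> fvec" where
  "HF d f z = mact d (hessian d f (tv d z))"

lemma enorm_diff: "u \<in> carrier_vec d \<Longrightarrow> v \<in> carrier_vec d \<Longrightarrow> enorm (u - v) = norm (fv u - fv v)"
  by (simp add: norm_fv[symmetric] fv_diff)

lemma has_gradient_derivative:
  assumes "has_gradient d f v (tv d z)"
  shows "((\<lambda>z. f (tv d z)) has_derivative (\<lambda>h. inner (fv v) h)) (at z)"
  unfolding has_derivative_at_alt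
proof (intro conjI allI impI)
  fix e :: real assume "e > 0"
  with assms obtain r where r: "r > 0" "\<And>y. y \<in> carrier_vec d \<Longrightarrow> enorm (y - tv d z) < r \<Longrightarrow>
     \<bar>f y - f (tv d z) - v \<bullet> (y - tv d z)\<bar> \<le> e * enorm (y - tv d z)"
    and v: "v \<in> carrier_vec d" unfolding has_gradient_def by blast
  have "norm (f (tv d y) - f (tv d z) - inner (fv v) (y - z)) \<le> e * norm (y - z)" if "norm (y - z) < r" for y
  proof -
    have le: "enorm (tv d y - tv d z) \<le> norm (y - z)" using enorm_tv_le[of d "y - z"] by (simp add: tv_diff)
    then have "\<bar>f (tv d y) - f (tv d z) - v \<bullet> (tv d y - tv d z)\<bar> \<le> e * enorm (tv d y - tv d z)" using that by (intro r) auto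
    also have "\<dots> \<le> e * norm (y - z)" using le \<open>e > 0\<close> by (intro mult_left_mono) auto
    finally show ?thesis using v by (simp add: inner_fv tv_diff)
  qed
  then show "\<exists>r>0. \<forall>y. norm (y - z) < r \<longrightarrow> norm (f (tv d y) - f (tv d z) - inner (fv v) (y - z)) \<le> e * norm (y - z)"
    using r by blast
qed (rule bounded_linear_inner_right)

text \<open>The definite description in \<open>grad\<close> is resolved by uniqueness of derivatives
  after the passage to \<open>fvec\<close>; \<open>hessian_eq\<close> follows the same
  route.\<close>

lemma grad_eq:
  assumes "has_gradient d f v x" shows "grad d f x = v"
  unfolding grad_def
proof (rule the_equality)
  show "has_gradient d f v x" by fact
next
  fix v' assume v': "has_gradient d f v' x"
  have c: "x \<in> carrier_vec d" "v \<in> carrier_vec d" "v' \<in> carrier_vec d" using assms v' by (auto simp: has_gradient_def)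
  have "(\<lambda>h. inner (fv v') h) = (\<lambda>h. inner (fv v) h)"
    using has_derivative_unique[OF has_gradient_derivative[of d f v' "fv x"] has_gradient_derivative[of d f v "fv x"]] assms v' c by simp
  then have "inner (fv v' - fv v) (fv v' - fv v) = 0" by (simp add: fun_eq_iff inner_diff_left)
  then show "v' = v" using c by (simp add: fv_eq_iff[of _ d])
qed

lemma has_hessian_derivative:
  assumes "has_hessian d f M (tv d z)" and g: "\<And>x. x \<in> carrier_vec d \<Longrightarrow> grad d f x \<in> carrier_vec d"
  shows "(gF d f has_derivative mact d M) (at z)"
  unfolding has_derivative_at_alt
proof (intro conjI allI impI)
  have M: "M \<in> carrier_mat d d" using assms by (simp add: has_hessian_def)
  show "bounded_linear (mact d M)" by (rule mact_bounded_linear[OF M])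
  fix e :: real assume "e > 0"
  with assms obtain r where r: "r > 0" "\<And>y. y \<in> carrier_vec d \<Longrightarrow> enorm (y - tv d z) < r \<Longrightarrow>
     enorm (grad d f y - grad d f (tv d z) - M *\<^sub>v (y - tv d z)) \<le> e * enorm (y - tv d z)"
    unfolding has_hessian_def by blast
  have "norm (gF d f y - gF d f z - mact d M (y - z)) \<le> e * norm (y - z)" if "norm (y - z) < r" for y
  proof -
    have le: "enorm (tv d y - tv d z) \<le> norm (y - z)" using enorm_tv_le[of d "y - z"] by (simp add: tv_diff)
    then have "enorm (grad d f (tv d y) - grad d f (tv d z) - M *\<^sub>v (tv d y - tv d z)) \<le> e * enorm (tv d y - tv d z)" using that by (intro r) auto
    also have "\<dots> \<le> e * norm (y - z)" using le \<open>e > 0\<close> by (intro mult_left_mono) auto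
    finally show ?thesis using g M by (simp add: norm_fv[symmetric] fv_diff[of _ d] gF_def mact_def tv_diff)
  qed
  then show "\<exists>r>0. \<forall>y. norm (y - z) < r \<longrightarrow> norm (gF d f y - gF d f z - mact d M (y - z)) \<le> e * norm (y - z)"
    using r by blast
qed

lemma mact_inj:
  assumes "M \<in> carrier_mat d d" "M' \<in> carrier_mat d d" "mact d M = mact d M'" shows "M = M'"
proof (rule eq_matI)
  fix i j assume "i < dim_row M'" "j < dim_col M'"
  then have ij: "i < d" "j < d" using assms by auto
  have "fv (M *\<^sub>v unit_vec d j) = fv (M' *\<^sub>v unit_vec d j)"
    using fun_cong[OF assms(3), of "fv (unit_vec d j)"] by (simp add: mact_def)
  then have "M *\<^sub>v unit_vec d j = M' *\<^sub>v unit_vec d j" using assms by (subst (asm) fv_eq_iff[of _ d]) auto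
  then have "(M *\<^sub>v unit_vec d j) $ i = (M' *\<^sub>v unit_vec d j) $ i" by simp
  then show "M $$ (i, j) = M' $$ (i, j)" using ij assms by simp
qed (use assms in auto)

lemma hessian_eq:
  assumes "has_hessian d f M x" and g: "\<And>x. x \<in> carrier_vec d \<Longrightarrow> grad d f x \<in> carrier_vec d"
  shows "hessian d f x = M"
  unfolding hessian_def
proof (rule the_equality)
  show "has_hessian d f M x" by fact
next
  fix M' assume M': "has_hessian d f M' x"
  have c: "x \<in> carrier_vec d" "M \<in> carrier_mat d d" "M' \<in> carrier_mat d d" using assms M' by (auto simp: has_hessian_def)
  have "mact d M' = mact d M"
    using has_derivative_unique[OF has_hessian_derivative[of d f M' "fv x", OF _ g] has_hessian_derivative[of d f M "fv x", OF _ g]] assms(1) M' c by simp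
  then show "M' = M" using c mact_inj by metis
qed

lemma grad_carrier: "twice_differentiable d f \<Longrightarrow> x \<in> carrier_vec d \<Longrightarrow> grad d f x \<in> carrier_vec d"
  unfolding twice_differentiable_def using grad_eq by (metis has_gradient_def)

lemma hessian_carrier: "twice_differentiable d f \<Longrightarrow> x \<in> carrier_vec d \<Longrightarrow> hessian d f x \<in> carrier_mat d d"
  using grad_carrier hessian_eq unfolding twice_differentiable_def by (metis has_hessian_def)

context
  fixes d f L \<rho> assumes sm: "smooth1 d f L \<rho>" and \<rho>: "\<rho> \<ge> 0" and L: "L \<ge> 0"
begin

lemma smooth1_td: "twice_differentiable d f" using sm by (simp add: smooth1_def)

lemma smooth1_grad: "((\<lambda>z. f (tv d z)) has_derivative (\<lambda>h. inner (gF d f z) h)) (at z)"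
proof -
  obtain v where v: "has_gradient d f v (tv d z)" using smooth1_td unfolding twice_differentiable_def by (meson tv_carrier)
  from has_gradient_derivative[OF v] show ?thesis by (simp add: gF_def grad_eq[OF v])
qed

lemma smooth1_hess: "(gF d f has_derivative HF d f z) (at z)"
proof -
  obtain M where M: "has_hessian d f M (tv d z)" using smooth1_td unfolding twice_differentiable_def by (meson tv_carrier)
  from has_hessian_derivative[OF M grad_carrier[OF smooth1_td]] show ?thesis
    by (simp add: HF_def hessian_eq[OF M grad_carrier[OF smooth1_td]])
qed

lemma smooth1_lip: "norm (gF d f x - gF d f y) \<le> L * norm (x - y)"
proof -
  have "norm (gF d f x - gF d f y) \<le> L * enorm (tv d x - tv d y)"
    using sm grad_carrier[OF smooth1_td] unfolding gF_def smooth1_def by (simp add: enorm_diff[of _ d, symmetric])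
  also have "\<dots> \<le> L * norm (x - y)" using enorm_tv_le[of d "x - y"] L by (intro mult_left_mono) (simp_all add: tv_diff)
  finally show ?thesis .
qed

lemma smooth1_lip2: "norm (HF d f x h - HF d f y h) \<le> \<rho> * norm (x - y) * norm h"
proof -
  have c: "hessian d f (tv d z) \<in> carrier_mat d d" for z using hessian_carrier[OF smooth1_td] by simp
  let ?M = "hessian d f (tv d x) - hessian d f (tv d y)"
  have "HF d f x h - HF d f y h = mact d ?M h"
    using c[of x] c[of y] unfolding HF_def mact_def
    by (simp add: fv_diff[of _ d, symmetric] minus_mult_distrib_mat_vec[of _ d d])
  also have "norm \<dots> \<le> spectral_norm ?M * norm h" by (intro spectral_norm_bound minus_carrier_mat c)
  also have "\<dots> \<le> (\<rho> * norm (x - y)) * norm h"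
  proof (intro mult_right_mono)
    have "spectral_norm ?M \<le> \<rho> * enorm (tv d x - tv d y)" using sm unfolding smooth1_def by simp
    also have "\<dots> \<le> \<rho> * norm (x - y)" using enorm_tv_le[of d "x - y"] \<rho> by (intro mult_left_mono) (simp_all add: tv_diff)
    finally show "spectral_norm ?M \<le> \<rho> * norm (x - y)" .
  qed auto
  finally show ?thesis .
qed

lemmas smooth1_descent = descent_lemma[OF smooth1_grad smooth1_lip]
lemmas smooth1_second = second_order_bound[OF smooth1_grad smooth1_hess smooth1_lip2 \<rho>]
lemmas smooth1_sym = hess_sym[OF smooth1_grad smooth1_hess smooth1_lip2 \<rho>]
lemmas smooth1_hv = hv_error[OF smooth1_hess smooth1_lip2 \<rho>]
lemmas smooth1_hess_norm = hess_norm[OF smooth1_hess smooth1_lip2 \<rho> smooth1_lip]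

text \<open>\<open>HF\<close> ignores the coordinates from d on, so the lower bound by \<mu> times
  the truncated squared norm extends to the full norm only for \<mu> < 0. This is why a direction of
  negative curvature is assumed.\<close>

lemma smooth1_eigen:
  assumes d: "d \<ge> 1" and neg: "inner z0 (HF d f x z0) < 0"
  shows "\<exists>lm u a. norm u = 1 \<and> HF d f x u = - (lm *\<^sub>R u) \<and>
        (\<forall>z. inner z (HF d f x z) \<ge> - lm * (norm z)\<^sup>2) \<and> u = (\<Sum>j<d. a j *\<^sub>R bas j) \<and> (\<forall>j. \<bar>a j\<bar> \<le> 1)"
proof -
  have M: "hessian d f (tv d x) \<in> carrier_mat d d" using hessian_carrier[OF smooth1_td] by simp
  obtain u \<mu> where u: "u \<in> carrier_vec d" "enorm u = 1" "mact d (hessian d f (tv d x)) (fv u) = \<mu> *\<^sub>R fv u"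
    and min: "\<And>z. inner z (mact d (hessian d f (tv d x)) z) \<ge> \<mu> * (norm (fv (tv d z)))\<^sup>2"
    using min_eigenpair[OF M d smooth1_sym[unfolded HF_def]] by metis
  have "\<mu> * (norm (fv (tv d z0)))\<^sup>2 < 0" using min[of z0] neg by (simp add: HF_def)
  then have \<mu>: "\<mu> < 0" by (simp add: mult_less_0_iff)
  have "\<mu> * (norm z)\<^sup>2 \<le> inner z (HF d f x z)" for z
  proof -
    have "\<mu> * (norm z)\<^sup>2 \<le> \<mu> * (norm (fv (tv d z)))\<^sup>2"
      using fv_tv_le[of d z] \<mu> by (intro mult_left_mono_neg power_mono) auto
    then show ?thesis using min[of z] by (simp add: HF_def)
  qed
  then have 1: "\<forall>z. inner z (HF d f x z) \<ge> - (- \<mu>) * (norm z)\<^sup>2" by simp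
  have 2: "\<forall>j. \<bar>coord (fv u) j\<bar> \<le> 1"
    using coord_le_norm[of "fv u"] u by (simp add: norm_fv)
  have 3: "fv u = (\<Sum>j<d. coord (fv u) j *\<^sub>R bas j)"
    by (subst fv_bas[OF u(1)], rule sum.cong) (use u in \<open>auto simp: coord_fv\<close>)
  have 4: "norm (fv u) = 1" "HF d f x (fv u) = - ((- \<mu>) *\<^sub>R fv u)" using u by (auto simp: norm_fv HF_def)
  show ?thesis using 1 2 3 4 by blast
qed

lemma smooth1_lambda_min:
  assumes d: "d \<ge> 1" and c: "\<And>z. inner z (HF d f x z) \<ge> - \<delta> * (norm z)\<^sup>2"
  shows "lambda_min (hessian d f (tv d x)) \<ge> - \<delta>"
proof -
  have M: "hessian d f (tv d x) \<in> carrier_mat d d" using hessian_carrier[OF smooth1_td] by simp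
  obtain u \<mu> where u: "u \<in> carrier_vec d" "enorm u = 1" "mact d (hessian d f (tv d x)) (fv u) = \<mu> *\<^sub>R fv u"
    and lm: "lambda_min (hessian d f (tv d x)) = \<mu>"
    using min_eigenpair[OF M d smooth1_sym[unfolded HF_def]] by metis
  have "inner (fv u) (HF d f x (fv u)) = \<mu>" using u by (simp add: HF_def norm_fv power2_norm_eq_inner[symmetric])
  then show ?thesis using c[of "fv u"] u lm by (simp add: norm_fv)
qed

end

section \<open>Programs as algorithms\<close>

text \<open>On [0,1] the \<open>min\<close> matters only at the endpoint u = 1, where the floor
  would be Suc m.\<close>

definition disc :: "nat \<Rightarrow> real \<Rightarrow> nat" where
  "disc m u = min m (nat \<lfloor>u * real (Suc m)\<rfloor>)"

definition shift :: "(nat \<Rightarrow> real) \<Rightarrow> nat \<Rightarrow> real" where "shift s = (\<lambda>i. s (Suc i))"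

text \<open>An algorithm has no memory, so the program is replayed from its beginning on the
  recorded answers at every call; each draw consumes one entry of the bit sequence.
  \<open>cv\<close> translates (and later rounds) answers, \<open>out\<close> translates queries and
  outputs.\<close>

primrec exec :: "('q \<Rightarrow> real vec) \<Rightarrow> (real vec \<Rightarrow> 'q) \<Rightarrow> ('q, 'q) prog \<Rightarrow> algorithm" where
  "exec out cv (Ret a) s as = Output (out a)"
| "exec out cv (Draw m k) s as = exec out cv (k (disc m (s 0))) (shift s) as"
| "exec out cv (Ask i x k) s as = (case as of [] \<Rightarrow> Query i (out x) | a # as' \<Rightarrow> exec out cv (k (cv a)) s as')"

primrec res :: "(nat \<Rightarrow> 'q \<Rightarrow> 'q) \<Rightarrow> ('q, 'a) prog \<Rightarrow> (nat \<Rightarrow> real) \<Rightarrow> 'a" where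
  "res G (Ret a) s = a"
| "res G (Draw m k) s = res G (k (disc m (s 0))) (shift s)"
| "res G (Ask i x k) s = res G (k (G i x)) s"

text \<open>The invariant of a run: after the answers \<open>pre\<close> the algorithm behaves like
  the residual program P with the residual bits s', and \<open>costs\<close> bounds how many answers
  are still to come.\<close>

lemma exec_answers:
  assumes "\<And>as. alg s (pre @ as) = exec out cv P s' as" "answers alg s orc t = pre" "costs P b"
  shows "\<exists>t'. alg s (answers alg s orc t') = Output (out (res (\<lambda>i x. cv (orc i (out x))) P s')) \<and>
    length (answers alg s orc t') \<le> length pre + b"
  using assms
proof (induction P arbitrary: s' pre t b)
  case (Ret a)
  then show ?case using Ret(1)[of "[]"] by (intro exI[of _ t]) auto
next
  case (Draw m k)
  have "costs (k (disc m (s' 0))) b" using Draw.prems(3) by (simp add: disc_def)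
  moreover have "alg s (pre @ as) = exec out cv (k (disc m (s' 0))) (shift s') as" for as
    using Draw.prems(1) by simp
  ultimately show ?case using Draw.IH[OF rangeI _ Draw.prems(2)] by simp
next
  case (Ask i x k)
  define a where "a = orc i (out x)"
  have b: "b > 0" "costs (k (cv a)) (b - 1)" using Ask.prems(3) by auto
  have 1: "alg s ((pre @ [a]) @ as) = exec out cv (k (cv a)) s' as" for as
    using Ask.prems(1)[of "a # as"] by simp
  have 2: "answers alg s orc (Suc t) = pre @ [a]"
    using Ask.prems(1)[of "[]"] Ask.prems(2) by (simp add: a_def)
  have "\<exists>t'. alg s (answers alg s orc t') = Output (out (res (\<lambda>i x. cv (orc i (out x))) (k (cv a)) s')) \<and>
    length (answers alg s orc t') \<le> length (pre @ [a]) + (b - 1)"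
    by (rule Ask.IH[OF rangeI 1 2 b(2)])
  then show ?case using b by (simp add: a_def)
qed

lemma exec_outputs:
  assumes "costs P b" "real b \<le> B"
  shows "outputs_within (exec out cv P) s orc B (out (res (\<lambda>i x. cv (orc i (out x))) P s))"
proof -
  have "\<exists>t'. exec out cv P s (answers (exec out cv P) s orc t') = Output (out (res (\<lambda>i x. cv (orc i (out x))) P s)) \<and>
    length (answers (exec out cv P) s orc t') \<le> length ([] :: real vec list) + b"
    by (rule exec_answers[where t = 0]) (use assms in auto)
  then show ?thesis using assms(2) unfolding outputs_within_def by fastforce
qed

section \<open>Random bits, discretised draws and their law\<close>

abbreviation unif :: "real measure" where "unif \<equiv> uniform_measure lborel {0..1}"

lemma prob_space_unif: "prob_space unif"
  by (rule prob_space_uniform_measure) auto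

interpretation unif: prob_space unif by (rule prob_space_unif)
interpretation bits: sequence_space unif ..

lemma random_bits_eq: "random_bits = bits.S" by (simp add: random_bits_def)

interpretation rb: prob_space random_bits
  unfolding random_bits_eq by (rule bits.prob_space_axioms)

lemma space_random_bits: "space random_bits = UNIV"
  by (simp add: random_bits_def space_PiM)

lemma measurable_shift[measurable]: "shift \<in> measurable random_bits random_bits"
  unfolding random_bits_def shift_def
  by (rule measurable_PiM_single') (auto intro!: measurable_component_singleton)

lemma measurable_disc[measurable]: "(\<lambda>s. disc m (s 0)) \<in> measurable random_bits (count_space UNIV)"
proof -
  have "(\<lambda>s. s 0) \<in> measurable random_bits unif" unfolding random_bits_def by measurable
  then have "(\<lambda>s. s 0) \<in> borel_measurable random_bits" by (simp cong: measurable_cong_sets)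
  moreover have "disc m \<in> measurable borel (count_space UNIV)" unfolding disc_def by measurable
  ultimately show ?thesis by (rule measurable_compose)
qed

lemma emeasure_disc:
  assumes "i \<le> m" shows "emeasure unif {u. disc m u = i} = ennreal (1 / real (Suc m))"
proof -
  define M where "M = real (Suc m)"
  have M: "M > 0" by (simp add: M_def)
  define A where "A = (if i < m then {real i / M ..< real (Suc i) / M} else {real i / M .. 1})"
  have "{0..1} \<inter> {u. disc m u = i} = A"
  proof -
    have *: "u \<in> A \<longleftrightarrow> u \<in> {0..1} \<and> disc m u = i" for u
    proof (cases "0 \<le> u \<and> u \<le> 1")
      case True
      have fl: "nat \<lfloor>u * M\<rfloor> = j \<longleftrightarrow> real j \<le> u * M \<and> u * M < real (Suc j)" for j
        using True M by (auto simp: nat_eq_iff2 floor_eq_iff) linarith+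
      have fl2: "j \<le> nat \<lfloor>u * M\<rfloor> \<longleftrightarrow> real j \<le> u * M" for j
        using True M by (simp add: le_nat_iff le_floor_iff)
      show ?thesis
      proof (cases "i < m")
        case im: True
        have "disc m u = i \<longleftrightarrow> nat \<lfloor>u * M\<rfloor> = i" using im by (auto simp: disc_def M_def min_def)
        moreover have "u \<in> A \<longleftrightarrow> real i \<le> u * M \<and> u * M < real (Suc i)"
          using im M by (simp add: A_def pos_divide_le_eq pos_less_divide_eq)
        ultimately show ?thesis using True fl[of i] by simp
      next
        case False
        then have "i = m" using assms by simp
        then have "disc m u = i \<longleftrightarrow> m \<le> nat \<lfloor>u * M\<rfloor>" by (auto simp: disc_def M_def min_def)
        moreover have "u \<in> A \<longleftrightarrow> real m \<le> u * M \<and> u \<le> 1"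
          using M \<open>i = m\<close> by (simp add: A_def pos_divide_le_eq)
        ultimately show ?thesis using True fl2[of m] by simp
      qed
    next
      case False
      have "A \<subseteq> {0..1}"
      proof
        fix x assume x: "x \<in> A"
        define e1 where "e1 = real i / M"
        define e2 where "e2 = real (Suc i) / M"
        have "e2 \<le> 1" if "i < m" using that by (simp add: M_def e2_def)
        moreover have "0 \<le> e1" using M by (simp add: e1_def)
        moreover have "x \<in> (if i < m then {e1..<e2} else {e1..1})" using x unfolding A_def e1_def e2_def .
        ultimately show "x \<in> {0..1}" by (cases "i < m") auto
      qed
      then show ?thesis using False by auto
    qed
    show ?thesis unfolding set_eq_iff Int_iff mem_Collect_eq using * by blast
  qed
  moreover have "emeasure lborel A = ennreal (1 / M)"
  proof (cases "i < m")
    case True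
    then show ?thesis using M by (simp add: A_def diff_divide_distrib[symmetric] divide_right_mono)
  next
    case False
    then have "i = m" using assms by simp
    then have le: "real i / M \<le> 1" and eq: "1 - real i / M = 1 / M" by (auto simp: M_def field_simps)
    have "A = {real i / M .. 1}" using False by (simp add: A_def)
    then show ?thesis using emeasure_lborel_Icc[OF le] unfolding eq by (simp only:)
  qed
  moreover have "{u. disc m u = i} \<in> sets borel"
  proof -
    have "disc m \<in> measurable borel (count_space UNIV)" unfolding disc_def by measurable
    from measurable_sets[OF this, of "{i}"] show ?thesis by (simp add: vimage_def)
  qed
  ultimately show ?thesis by (simp add: emeasure_uniform_measure M_def divide_ennreal_def)
qed

lemma sets_res: "{s. Q (res G P s)} \<in> sets random_bits"
proof (induction P)
  case (Ret a)
  then show ?case by (cases "Q a") (auto simp: space_random_bits[symmetric])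
next
  case (Draw m k)
  have "{s. Q (res G (Draw m k) s)} = (\<Union>i\<in>{..m}. {s \<in> space random_bits. disc m (s 0) = i} \<inter> (shift -` {s. Q (res G (k i) s)} \<inter> space random_bits))"
    by (auto simp: space_random_bits disc_def)
  also have "\<dots> \<in> sets random_bits"
  proof (intro sets.finite_UN)
    fix i
    have "{s \<in> space random_bits. disc m (s 0) = i} \<in> sets random_bits" by measurable
    moreover have "shift -` {s. Q (res G (k i) s)} \<inter> space random_bits \<in> sets random_bits"
      using Draw by (intro measurable_sets[OF measurable_shift]) auto
    ultimately show "{s \<in> space random_bits. disc m (s 0) = i} \<inter> (shift -` {s. Q (res G (k i) s)} \<inter> space random_bits) \<in> sets random_bits"
      by (rule sets.Int)
  qed auto
  finally show ?case .
qed auto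

lemma shift_case_nat: "shift (case_nat u w) = w" by (simp add: shift_def)

text \<open>Splitting off the first coordinate of the bit sequence turns a draw into an integral
  over one uniform variable, which \<open>disc\<close> cuts into Suc m pieces of equal
  measure.\<close>

lemma emeasure_res: "emeasure random_bits {s. Q (res G P s)} = ennreal (ev G P (\<lambda>a. of_bool (Q a)))"
proof (induction P)
  case (Ret a)
  then show ?case using rb.emeasure_space_1 by (simp add: space_random_bits)
next
  case (Ask i x k) then show ?case by auto
next
  case (Draw m k)
  define A where "A = {s. Q (res G (Draw m k) s)}"
  define h where "h = (\<lambda>i. ev G (k i) (\<lambda>a. of_bool (Q a)))"
  have h0: "h i \<ge> 0" for i unfolding h_def by (intro ev_nonneg) auto
  have A: "A \<in> sets bits.S" unfolding A_def random_bits_eq[symmetric] by (rule sets_res)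
  have it: "distr (unif \<Otimes>\<^sub>M bits.S) bits.S (\<lambda>(s, \<omega>). case_nat s \<omega>) = bits.S" by (rule bits.PiM_iter)
  have cn: "(\<lambda>(s, \<omega>). case_nat s \<omega>) \<in> measurable (unif \<Otimes>\<^sub>M bits.S) bits.S" by measurable
  have "emeasure random_bits A = emeasure (distr (unif \<Otimes>\<^sub>M bits.S) bits.S (\<lambda>(s, \<omega>). case_nat s \<omega>)) A"
    unfolding it random_bits_eq ..
  also have "\<dots> = emeasure (unif \<Otimes>\<^sub>M bits.S) ((\<lambda>(s, \<omega>). case_nat s \<omega>) -` A \<inter> space (unif \<Otimes>\<^sub>M bits.S))"
    by (rule emeasure_distr[OF cn A])
  also have "\<dots> = (\<integral>\<^sup>+u. emeasure bits.S (Pair u -` ((\<lambda>(s, \<omega>). case_nat s \<omega>) -` A \<inter> space (unif \<Otimes>\<^sub>M bits.S))) \<partial>unif)"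
    by (rule bits.emeasure_pair_measure_alt) (rule measurable_sets[OF cn A])
  also have "\<dots> = (\<integral>\<^sup>+u. ennreal (h (disc m u)) \<partial>unif)"
  proof (rule nn_integral_cong)
    fix u
    have "Pair u -` ((\<lambda>(s, \<omega>). case_nat s \<omega>) -` A \<inter> space (unif \<Otimes>\<^sub>M bits.S)) = {s. Q (res G (k (disc m u)) s)}"
      using space_random_bits by (auto simp: A_def space_pair_measure shift_case_nat random_bits_eq)
    then show "emeasure bits.S (Pair u -` ((\<lambda>(s, \<omega>). case_nat s \<omega>) -` A \<inter> space (unif \<Otimes>\<^sub>M bits.S))) = ennreal (h (disc m u))"
      using Draw[of "k (disc m u)"] by (simp add: random_bits_eq h_def)
  qed
  also have "\<dots> = (\<integral>\<^sup>+u. (\<Sum>i\<le>m. ennreal (h i) * indicator {u. disc m u = i} u) \<partial>unif)"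
  proof (rule nn_integral_cong)
    fix u
    have "(\<Sum>i\<le>m. ennreal (h i) * indicator {u. disc m u = i} u) = (\<Sum>i\<le>m. if i = disc m u then ennreal (h i) else 0)"
      by (rule sum.cong) (auto simp: indicator_def)
    also have "\<dots> = ennreal (h (disc m u))" by (simp add: disc_def)
    finally show "ennreal (h (disc m u)) = (\<Sum>i\<le>m. ennreal (h i) * indicator {u. disc m u = i} u)" by simp
  qed
  also have "\<dots> = (\<Sum>i\<le>m. ennreal (h i) * emeasure unif {u. disc m u = i})"
  proof -
    have "disc m \<in> measurable borel (count_space UNIV)" unfolding disc_def by measurable
    from measurable_sets[OF this, of "{i}" for i] have "{u. disc m u = i} \<in> sets borel" for i by (simp add: vimage_def)
    then have D: "{u. disc m u = i} \<in> sets unif" for i by simp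
    have "(\<integral>\<^sup>+u. (\<Sum>i\<le>m. ennreal (h i) * indicator {u. disc m u = i} u) \<partial>unif)
        = (\<Sum>i\<le>m. \<integral>\<^sup>+u. ennreal (h i) * indicator {u. disc m u = i} u \<partial>unif)"
      by (rule nn_integral_sum) (intro borel_measurable_times_ennreal borel_measurable_const borel_measurable_indicator D)
    then show ?thesis unfolding nn_integral_cmult_indicator[OF D] .
  qed
  also have "\<dots> = (\<Sum>i\<le>m. ennreal (h i * (1 / real (Suc m))))"
    using h0 by (intro sum.cong refl) (subst emeasure_disc, auto simp: ennreal_mult'[symmetric] simp del: of_nat_Suc)
  also have "\<dots> = ennreal (\<Sum>i\<le>m. h i * (1 / real (Suc m)))" using h0 by (intro sum_ennreal) auto
  also have "(\<Sum>i\<le>m. h i * (1 / real (Suc m))) = ev G (Draw m k) (\<lambda>a. of_bool (Q a))"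
    by (simp add: h_def sum_divide_distrib)
  finally show ?case unfolding A_def .
qed

lemma measure_res: "measure random_bits {s. Q (res G P s)} = ev G P (\<lambda>a. of_bool (Q a))"
  using emeasure_res[of Q G P] by (simp add: rb.emeasure_eq_measure ev_nonneg)

text \<open>Because the answers only take countably many values, joint measurability in the bits and the
  sample needs no regularity of the component gradients.\<close>

lemma sets_res_joint:
  fixes G :: "'w \<Rightarrow> nat \<Rightarrow> 'q \<Rightarrow> 'q"
  assumes C: "countable C" "\<And>w i x. G w i x \<in> C"
    and meas: "\<And>i x r. {w \<in> space N. G w i x = r} \<in> sets N"
  shows "{(s, w) \<in> space (random_bits \<Otimes>\<^sub>M N). Q (res (G w) P s)} \<in> sets (random_bits \<Otimes>\<^sub>M N)"
proof (induction P)
  case (Ret a)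
  then show ?case by (cases "Q a") auto
next
  case (Draw m k)
  let ?T = "\<lambda>(s, w). (shift s, w)"
  let ?R = "random_bits \<Otimes>\<^sub>M N"
  have T: "?T \<in> measurable ?R ?R" by measurable
  have "{(s, w) \<in> space ?R. Q (res (G w) (Draw m k) s)} =
     (\<Union>i\<in>{..m}. {z \<in> space ?R. disc m (fst z 0) = i} \<inter> (?T -` {(s, w) \<in> space ?R. Q (res (G w) (k i) s)} \<inter> space ?R))"
    by (auto simp: space_pair_measure space_random_bits disc_def)
  also have "\<dots> \<in> sets ?R"
  proof (intro sets.finite_UN)
    fix i
    have "(\<lambda>z. disc m (fst z 0)) \<in> measurable ?R (count_space UNIV)"
      using measurable_compose[OF measurable_fst measurable_disc] by simp
    from measurable_sets[OF this, of "{i}"]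
    have "{z \<in> space ?R. disc m (fst z 0) = i} \<in> sets ?R" by (simp add: vimage_def Int_def conj_commute)
    moreover have "?T -` {(s, w) \<in> space ?R. Q (res (G w) (k i) s)} \<inter> space ?R \<in> sets ?R"
      using Draw by (intro measurable_sets[OF T]) auto
    ultimately show "{z \<in> space ?R. disc m (fst z 0) = i} \<inter> (?T -` {(s, w) \<in> space ?R. Q (res (G w) (k i) s)} \<inter> space ?R) \<in> sets ?R"
      by (rule sets.Int)
  qed auto
  finally show ?case .
next
  case (Ask i x k)
  let ?R = "random_bits \<Otimes>\<^sub>M N"
  have "{(s, w) \<in> space ?R. Q (res (G w) (Ask i x k) s)} =
     (\<Union>r\<in>C. (space random_bits \<times> {w \<in> space N. G w i x = r}) \<inter> {(s, w) \<in> space ?R. Q (res (G w) (k r) s)})"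
    using C(2) by (auto simp: space_pair_measure)
  also have "\<dots> \<in> sets ?R"
  proof (intro sets.countable_UN'' C(1) sets.Int pair_measureI meas)
    show "{(s, w) \<in> space ?R. Q (res (G w) (k r) s)} \<in> sets ?R" for r using Ask by auto
  qed auto
  finally show ?case .
qed

section \<open>Expectations of smooth functions\<close>

context
  fixes d f L \<rho> assumes sm: "smooth1 d f L \<rho>" and \<rho>: "\<rho> \<ge> 0" and L: "L \<ge> 0"
begin

lemma vec_descent_abs:
  assumes "x \<in> carrier_vec d" "y \<in> carrier_vec d"
  shows "\<bar>f y - f x - grad d f x \<bullet> (y - x)\<bar> \<le> L * (enorm (y - x))\<^sup>2"
proof -
  note c = grad_carrier[OF smooth1_td[OF sm \<rho> L] assms(1)]
  have n: "norm (fv y - fv x) = enorm (y - x)" using assms by (simp add: enorm_diff)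
  have i: "inner (gF d f (fv x)) (fv y - fv x) = grad d f x \<bullet> (y - x)"
    using assms c by (simp add: gF_def inner_fv[of _ d] tv_diff)
  have up: "f y \<le> f x + grad d f x \<bullet> (y - x) + L / 2 * (enorm (y - x))\<^sup>2"
    using smooth1_descent[OF sm \<rho> L, of "fv y" "fv x"] assms by (simp add: i n)
  have der: "((\<lambda>z. - f (tv d z)) has_derivative (\<lambda>h. inner (- gF d f z) h)) (at z)" for z
    using has_derivative_minus[OF smooth1_grad[OF sm \<rho> L, of z]] by simp
  have lp: "norm (- gF d f x - - gF d f y) \<le> L * norm (x - y)" for x y
    using smooth1_lip[OF sm \<rho> L, of y x] by (simp add: norm_minus_commute)
  have lo: "- f y \<le> - f x - grad d f x \<bullet> (y - x) + L / 2 * (enorm (y - x))\<^sup>2"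
    using descent_lemma[OF der lp, of "fv y" "fv x"] assms by (simp add: i n)
  have "0 \<le> L * (enorm (y - x))\<^sup>2" using L by simp
  then show ?thesis using up lo by (simp add: abs_le_iff)
qed

lemma vec_taylor:
  assumes "x \<in> carrier_vec d" "y \<in> carrier_vec d"
  shows "enorm (grad d f y - grad d f x - hessian d f x *\<^sub>v (y - x)) \<le> \<rho> * (enorm (y - x))\<^sup>2"
proof -
  note g = grad_carrier[OF smooth1_td[OF sm \<rho> L]] and h = hessian_carrier[OF smooth1_td[OF sm \<rho> L] assms(1)]
  have "norm (gF d f (fv x + (fv y - fv x)) - gF d f (fv x) - HF d f (fv x) (fv y - fv x)) \<le> \<rho> * (norm (fv y - fv x))\<^sup>2"
    by (rule grad_taylor[OF smooth1_hess[OF sm \<rho> L] smooth1_lip2[OF sm \<rho> L] \<rho>])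
  then show ?thesis using assms g h
    by (simp add: gF_def HF_def mact_def tv_diff enorm_diff[of _ d] norm_fv[symmetric] fv_diff[of _ d])
qed

lemma vec_hess_norm:
  assumes "x \<in> carrier_vec d" "v \<in> carrier_vec d"
  shows "enorm (hessian d f x *\<^sub>v v) \<le> L * enorm v"
  using smooth1_hess_norm[OF sm \<rho> L, of "fv x" "fv v"] assms by (simp add: HF_def mact_def norm_fv)

lemma vec_grad_lip:
  assumes "x \<in> carrier_vec d" "y \<in> carrier_vec d"
  shows "enorm (grad d f x - grad d f y) \<le> L * enorm (x - y)"
  using sm assms by (simp add: smooth1_def)

lemma vec_hess_lip:
  assumes "x \<in> carrier_vec d" "y \<in> carrier_vec d" "v \<in> carrier_vec d"
  shows "enorm (hessian d f x *\<^sub>v v - hessian d f y *\<^sub>v v) \<le> \<rho> * enorm (x - y) * enorm v"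
proof -
  note h = hessian_carrier[OF smooth1_td[OF sm \<rho> L]]
  show ?thesis using smooth1_lip2[OF sm \<rho> L, of "fv x" "fv v" "fv y"] assms h[OF assms(1)] h[OF assms(2)]
    by (simp add: HF_def mact_def enorm_diff[of _ d] norm_fv)
qed

end

lemma abs_index_le_enorm: "v \<in> carrier_vec d \<Longrightarrow> j < d \<Longrightarrow> \<bar>v $ j\<bar> \<le> enorm v"
  using coord_le_norm[of "fv v" j] by (simp add: norm_fv coord_fv)

lemma scalar_prod_le: "u \<in> carrier_vec d \<Longrightarrow> v \<in> carrier_vec d \<Longrightarrow> u \<bullet> v \<le> enorm u * enorm v"
  using norm_cauchy_schwarz[of "fv u" "fv v"] by (simp add: inner_fv norm_fv)

lemma enorm_sq: "enorm v * enorm v = v \<bullet> v"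
  using power2_norm_eq_inner[of "fv v"] inner_fv[of v "dim_vec v" "fv v"] by (simp add: norm_fv power2_eq_square)

text \<open>The integral w is tested against itself: |w|^2 is the integral of <w, a i>, which is at
  most |w| B.\<close>

lemma (in prob_space) enorm_integral_le:
  assumes a: "\<And>i. i \<in> space M \<Longrightarrow> a i \<in> carrier_vec d" "\<And>j. j < d \<Longrightarrow> integrable M (\<lambda>i. a i $ j)"
    and B: "\<And>i. i \<in> space M \<Longrightarrow> enorm (a i) \<le> B"
  shows "enorm (vec d (\<lambda>j. LINT i|M. a i $ j)) \<le> B"
proof -
  define w where "w = vec d (\<lambda>j. LINT i|M. a i $ j)"
  have w: "w \<in> carrier_vec d" by (simp add: w_def)
  obtain i0 where "i0 \<in> space M" using not_empty by blast
  then have B0: "B \<ge> 0" using B enorm_nonneg order_trans by blast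
  have "enorm w * enorm w = (\<Sum>j<d. w $ j * (LINT i|M. a i $ j))"
    unfolding enorm_sq by (auto simp: scalar_prod_def w_def lessThan_atLeast0)
  also have "\<dots> = (LINT i|M. (\<Sum>j<d. w $ j * a i $ j))"
    using a(2) by (subst Bochner_Integration.integral_sum) auto
  also have "\<dots> \<le> (LINT i|M. enorm w * B)"
  proof (rule integral_mono)
    show "integrable M (\<lambda>i. \<Sum>j<d. w $ j * a i $ j)" using a(2) by auto
    show "integrable M (\<lambda>i. enorm w * B)" by simp
    fix i assume i: "i \<in> space M"
    have "(\<Sum>j<d. w $ j * a i $ j) = w \<bullet> a i" using a(1)[OF i] by (simp add: scalar_prod_def lessThan_atLeast0)
    also have "\<dots> \<le> enorm w * enorm (a i)" using w a(1)[OF i] by (rule scalar_prod_le)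
    also have "\<dots> \<le> enorm w * B" using B[OF i] enorm_nonneg by (intro mult_left_mono) auto
    finally show "(\<Sum>j<d. w $ j * a i $ j) \<le> enorm w * B" .
  qed
  also have "\<dots> = enorm w * B" by (simp add: prob_space)
  finally have "enorm w * enorm w \<le> enorm w * B" .
  then have "enorm w \<le> B" using B0 enorm_nonneg[of w] by (cases "enorm w = 0") auto
  then show ?thesis by (simp add: w_def)
qed

locale smooth_family = prob_space D for D :: "'i measure" +
  fixes F :: "'i \<Rightarrow> real vec \<Rightarrow> real" and d :: nat and L \<rho> :: real
  assumes int0: "\<And>x. x \<in> carrier_vec d \<Longrightarrow> integrable D (\<lambda>i. F i x)"
    and int1: "\<And>x j. x \<in> carrier_vec d \<Longrightarrow> j < d \<Longrightarrow> integrable D (\<lambda>i. grad d (F i) x $ j)"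
    and sm: "\<And>i. i \<in> space D \<Longrightarrow> smooth1 d (F i) L \<rho>"
    and L0: "L \<ge> 0" and \<rho>0: "\<rho> \<ge> 0"
begin

definition gE :: "real vec \<Rightarrow> real vec" where "gE x = vec d (\<lambda>j. LINT i|D. grad d (F i) x $ j)"

lemma gcar: "i \<in> space D \<Longrightarrow> x \<in> carrier_vec d \<Longrightarrow> grad d (F i) x \<in> carrier_vec d"
  using grad_carrier[OF smooth1_td[OF sm \<rho>0 L0]] .

lemma hcar: "i \<in> space D \<Longrightarrow> x \<in> carrier_vec d \<Longrightarrow> hessian d (F i) x \<in> carrier_mat d d"
  using hessian_carrier[OF smooth1_td[OF sm \<rho>0 L0]] .

lemma gdim: "i \<in> space D \<Longrightarrow> x \<in> carrier_vec d \<Longrightarrow> dim_vec (grad d (F i) x) = d"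
  using gcar by (rule carrier_vecD)

lemma small_ball: assumes "e > 0" "K \<ge> 0" obtains r where "r > 0" "\<And>t. 0 \<le> t \<Longrightarrow> t < r \<Longrightarrow> K * t\<^sup>2 \<le> e * (t::real)"
proof
  show "e / (K + 1) > 0" using assms by simp
  fix t assume t: "0 \<le> t" "t < e / (K + 1)"
  have "(K + 1) * t < e" using t assms by (simp add: field_simps)
  then have "K * t \<le> e" using t assms by (simp add: algebra_simps)
  then have "(K * t) * t \<le> e * t" using t by (intro mult_right_mono) auto
  then show "K * t\<^sup>2 \<le> e * t" by (simp add: power2_eq_square)
qed

text \<open>The first order remainder is at most L |y - x|^2 uniformly in i and therefore survives
  integration. The Hessian is treated alike, with \<rho> in place of L.\<close>

lemma has_gradient_expect:
  assumes x: "x \<in> carrier_vec d" shows "has_gradient d (expect D F) (gE x) x"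
  unfolding has_gradient_def
proof (intro conjI allI impI)
  fix e :: real assume "e > 0"
  then obtain r where r: "r > 0" "\<And>t. 0 \<le> t \<Longrightarrow> t < r \<Longrightarrow> L * t\<^sup>2 \<le> e * t" using small_ball[OF _ L0] by blast
  have "\<bar>expect D F y - expect D F x - gE x \<bullet> (y - x)\<bar> \<le> e * enorm (y - x)"
    if y: "y \<in> carrier_vec d" and yr: "enorm (y - x) < r" for y
  proof -
    let ?t = "\<lambda>i. F i y - F i x - (\<Sum>j<d. grad d (F i) x $ j * (y - x) $ j)"
    have i: "integrable D ?t"
      by (intro Bochner_Integration.integrable_diff Bochner_Integration.integrable_sum integrable_mult_left int0 int1 x y) simp
    have si: "integrable D (\<lambda>i. \<Sum>j<d. grad d (F i) x $ j * (y - x) $ j)"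
      by (intro Bochner_Integration.integrable_sum integrable_mult_left int1 x) simp
    have "(LINT i|D. ?t i) = (LINT i|D. F i y) - (LINT i|D. F i x) - (LINT i|D. (\<Sum>j<d. grad d (F i) x $ j * (y - x) $ j))"
      using int0[OF x] int0[OF y] si by simp
    also have "(LINT i|D. (\<Sum>j<d. grad d (F i) x $ j * (y - x) $ j)) = (\<Sum>j<d. (LINT i|D. grad d (F i) x $ j) * (y - x) $ j)"
      using int1[OF x] by (subst Bochner_Integration.integral_sum) auto
    also have "(\<Sum>j<d. (LINT i|D. grad d (F i) x $ j) * (y - x) $ j) = gE x \<bullet> (y - x)"
      using x y by (simp add: gE_def scalar_prod_def lessThan_atLeast0)
    finally have "expect D F y - expect D F x - gE x \<bullet> (y - x) = (LINT i|D. ?t i)" by (simp add: expect_def)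
    also have "\<bar>\<dots>\<bar> \<le> (LINT i|D. L * (enorm (y - x))\<^sup>2)"
    proof (rule order_trans[OF integral_abs_bound integral_mono])
      show "integrable D (\<lambda>i. \<bar>?t i\<bar>)" using i by auto
      fix i assume s: "i \<in> space D"
      have "?t i = F i y - F i x - grad d (F i) x \<bullet> (y - x)"
        using x y by (simp add: scalar_prod_def lessThan_atLeast0)
      then show "\<bar>?t i\<bar> \<le> L * (enorm (y - x))\<^sup>2" using vec_descent_abs[OF sm[OF s] \<rho>0 L0 x y] by simp
    qed auto
    also have "\<dots> = L * (enorm (y - x))\<^sup>2" by (simp add: prob_space)
    also have "\<dots> \<le> e * enorm (y - x)" using r(2)[OF enorm_nonneg yr] .
    finally show ?thesis .
  qed
  then show "\<exists>r>0. \<forall>y\<in>carrier_vec d. enorm (y - x) < r \<longrightarrow>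
      \<bar>expect D F y - expect D F x - gE x \<bullet> (y - x)\<bar> \<le> e * enorm (y - x)" using r(1) by blast
qed (use x in \<open>auto simp: gE_def\<close>)

lemma grad_expect: "x \<in> carrier_vec d \<Longrightarrow> grad d (expect D F) x = gE x"
  by (rule grad_eq[OF has_gradient_expect])

lemma gE_carrier: "gE x \<in> carrier_vec d" by (simp add: gE_def)

text \<open>Hessian entries are limits of difference quotients of gradient coordinates, which makes
  them measurable in i although only the gradients are assumed integrable.\<close>

lemma hess_entry:
  assumes i: "i \<in> space D" and x: "x \<in> carrier_vec d" and kj: "k < d" "j < d"
  shows "(\<lambda>m. real (Suc m) * (grad d (F i) (x + (1 / real (Suc m)) \<cdot>\<^sub>v unit_vec d j) $ k - grad d (F i) x $ k))
    \<longlonglongrightarrow> hessian d (F i) x $$ (k, j)"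
proof (rule Lim_null_comparison[THEN LIM_zero_cancel])
  show "(\<lambda>m. \<rho> * (1 / real (Suc m))) \<longlonglongrightarrow> 0"
    by (rule tendsto_mult_right_zero) (rule LIMSEQ_Suc[OF lim_1_over_n])
  show "\<forall>\<^sub>F m in sequentially. norm (real (Suc m) * (grad d (F i) (x + (1 / real (Suc m)) \<cdot>\<^sub>v unit_vec d j) $ k - grad d (F i) x $ k)
      - hessian d (F i) x $$ (k, j)) \<le> \<rho> * (1 / real (Suc m))"
  proof (rule always_eventually, rule allI)
    fix m
    define t where "t = 1 / real (Suc m)"
    have t: "t > 0" "real (Suc m) = 1 / t" by (auto simp: t_def)
    define y where "y = x + t \<cdot>\<^sub>v unit_vec d j"
    have y: "y \<in> carrier_vec d" using x by (simp add: y_def)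
    have yx: "y - x = t \<cdot>\<^sub>v unit_vec d j" using x by (auto simp: y_def)
    have u1: "enorm (unit_vec d j) = 1" using kj by (simp add: enorm_def)
    have e: "enorm (y - x) = t" using t u1 unfolding yx norm_fv[symmetric] fv_scaleR by simp
    let ?v = "grad d (F i) y - grad d (F i) x - hessian d (F i) x *\<^sub>v (y - x)"
    have v: "?v \<in> carrier_vec d" using gcar[OF i] hcar[OF i x] x y by auto
    have "(hessian d (F i) x *\<^sub>v (y - x)) $ k = t * hessian d (F i) x $$ (k, j)"
      using hcar[OF i x] kj unfolding yx by (simp add: mult_mat_vec[of _ d d])
    then have vk: "?v $ k = grad d (F i) y $ k - grad d (F i) x $ k - t * hessian d (F i) x $$ (k, j)"
      using gcar[OF i x] gcar[OF i y] hcar[OF i x] kj by simp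
    have "\<bar>?v $ k\<bar> \<le> enorm ?v" using v kj by (intro abs_index_le_enorm)
    also have "\<dots> \<le> \<rho> * t\<^sup>2" using vec_taylor[OF sm[OF i] \<rho>0 L0 x y] by (simp add: e)
    finally have *: "\<bar>grad d (F i) y $ k - grad d (F i) x $ k - t * hessian d (F i) x $$ (k, j)\<bar> \<le> \<rho> * t\<^sup>2" by (simp add: vk)
    have "1 / t * (grad d (F i) y $ k - grad d (F i) x $ k) - hessian d (F i) x $$ (k, j)
       = (grad d (F i) y $ k - grad d (F i) x $ k - t * hessian d (F i) x $$ (k, j)) / t" using t by (simp add: field_simps)
    then have "\<bar>1 / t * (grad d (F i) y $ k - grad d (F i) x $ k) - hessian d (F i) x $$ (k, j)\<bar>
       = \<bar>grad d (F i) y $ k - grad d (F i) x $ k - t * hessian d (F i) x $$ (k, j)\<bar> / t" using t by simp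
    also have "\<dots> \<le> \<rho> * t" using * t by (simp add: pos_divide_le_eq power2_eq_square mult.assoc)
    finally show "norm (real (Suc m) * (grad d (F i) (x + (1 / real (Suc m)) \<cdot>\<^sub>v unit_vec d j) $ k - grad d (F i) x $ k)
      - hessian d (F i) x $$ (k, j)) \<le> \<rho> * (1 / real (Suc m))" unfolding t(2) by (simp add: y_def)
  qed
qed

lemma hess_integrable:
  assumes x: "x \<in> carrier_vec d" and kj: "k < d" "j < d"
  shows "integrable D (\<lambda>i. hessian d (F i) x $$ (k, j))"
proof (rule integrable_const_bound[where B = L])
  show "(\<lambda>i. hessian d (F i) x $$ (k, j)) \<in> borel_measurable D"
  proof (rule borel_measurable_LIMSEQ_real)
    show "(\<lambda>m. real (Suc m) * (grad d (F i) (x + (1 / real (Suc m)) \<cdot>\<^sub>v unit_vec d j) $ k - grad d (F i) x $ k))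
       \<longlonglongrightarrow> hessian d (F i) x $$ (k, j)" if "i \<in> space D" for i
      by (rule hess_entry[OF that x kj])
    fix m
    have "x + (1 / real (Suc m)) \<cdot>\<^sub>v unit_vec d j \<in> carrier_vec d" using x by simp
    then show "(\<lambda>i. real (Suc m) * (grad d (F i) (x + (1 / real (Suc m)) \<cdot>\<^sub>v unit_vec d j) $ k - grad d (F i) x $ k)) \<in> borel_measurable D"
      using int1 x kj by (intro borel_measurable_times borel_measurable_diff borel_measurable_integrable) auto
  qed
  show "AE i in D. norm (hessian d (F i) x $$ (k, j)) \<le> L"
  proof (rule AE_I2)
    fix i assume i: "i \<in> space D"
    have "hessian d (F i) x $$ (k, j) = (hessian d (F i) x *\<^sub>v unit_vec d j) $ k" using hcar[OF i x] kj by simp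
    moreover have "\<bar>(hessian d (F i) x *\<^sub>v unit_vec d j) $ k\<bar> \<le> enorm (hessian d (F i) x *\<^sub>v unit_vec d j)"
      using hcar[OF i x] kj by (intro abs_index_le_enorm) auto
    moreover have "\<dots> \<le> L * 1" using vec_hess_norm[OF sm[OF i] \<rho>0 L0 x, of "unit_vec d j"] kj by (simp add: enorm_def)
    ultimately show "norm (hessian d (F i) x $$ (k, j)) \<le> L" by simp
  qed
qed

definition hE :: "real vec \<Rightarrow> real mat" where
  "hE x = mat d d (\<lambda>(k, j). LINT i|D. hessian d (F i) x $$ (k, j))"

lemma hE_mult:
  assumes "x \<in> carrier_vec d" "v \<in> carrier_vec d" "k < d"
  shows "integrable D (\<lambda>i. (hessian d (F i) x *\<^sub>v v) $ k)" "(hE x *\<^sub>v v) $ k = (LINT i|D. (hessian d (F i) x *\<^sub>v v) $ k)"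
proof -
  have e: "(hessian d (F i) x *\<^sub>v v) $ k = (\<Sum>j<d. hessian d (F i) x $$ (k, j) * v $ j)" if "i \<in> space D" for i
    using hcar[OF that assms(1)] assms by (auto simp: scalar_prod_def lessThan_atLeast0)
  have i: "integrable D (\<lambda>i. \<Sum>j<d. hessian d (F i) x $$ (k, j) * v $ j)"
    using hess_integrable[OF assms(1,3)] by auto
  show "integrable D (\<lambda>i. (hessian d (F i) x *\<^sub>v v) $ k)" using i by (subst Bochner_Integration.integrable_cong[OF refl e]) auto
  have "(hE x *\<^sub>v v) $ k = (\<Sum>j<d. (LINT i|D. hessian d (F i) x $$ (k, j)) * v $ j)"
    using assms by (auto simp: hE_def scalar_prod_def lessThan_atLeast0)
  also have "\<dots> = (LINT i|D. (\<Sum>j<d. hessian d (F i) x $$ (k, j) * v $ j))"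
    using hess_integrable[OF assms(1,3)] by (subst Bochner_Integration.integral_sum) auto
  also have "\<dots> = (LINT i|D. (hessian d (F i) x *\<^sub>v v) $ k)" by (rule Bochner_Integration.integral_cong[OF refl]) (simp add: e)
  finally show "(hE x *\<^sub>v v) $ k = (LINT i|D. (hessian d (F i) x *\<^sub>v v) $ k)" .
qed

lemma hE_carrier: "hE x \<in> carrier_mat d d" by (simp add: hE_def)

lemma has_hessian_expect:
  assumes x: "x \<in> carrier_vec d" shows "has_hessian d (expect D F) (hE x) x"
  unfolding has_hessian_def
proof (intro conjI allI impI)
  fix e :: real assume "e > 0"
  then obtain r where r: "r > 0" "\<And>t. 0 \<le> t \<Longrightarrow> t < r \<Longrightarrow> \<rho> * t\<^sup>2 \<le> e * t" using small_ball[OF _ \<rho>0] by blast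
  have "enorm (grad d (expect D F) y - grad d (expect D F) x - hE x *\<^sub>v (y - x)) \<le> e * enorm (y - x)"
    if y: "y \<in> carrier_vec d" and yr: "enorm (y - x) < r" for y
  proof -
    let ?a = "\<lambda>i. grad d (F i) y - grad d (F i) x - hessian d (F i) x *\<^sub>v (y - x)"
    have yx: "y - x \<in> carrier_vec d" using x y by simp
    have ak: "?a i $ k = grad d (F i) y $ k - grad d (F i) x $ k - (hessian d (F i) x *\<^sub>v (y - x)) $ k" if "i \<in> space D" "k < d" for i k
      using gcar[OF that(1) x] gcar[OF that(1) y] hcar[OF that(1) x] that by simp
    have ai: "integrable D (\<lambda>i. ?a i $ k)" if k: "k < d" for k
    proof (subst Bochner_Integration.integrable_cong[OF refl ak[OF _ k]])
      show "integrable D (\<lambda>i. grad d (F i) y $ k - grad d (F i) x $ k - (hessian d (F i) x *\<^sub>v (y - x)) $ k)"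
        by (intro Bochner_Integration.integrable_diff int1 hE_mult(1) x y yx k)
    qed
    have "grad d (expect D F) y - grad d (expect D F) x - hE x *\<^sub>v (y - x) = vec d (\<lambda>k. LINT i|D. ?a i $ k)"
    proof (rule eq_vecI)
      fix k assume "k < dim_vec (vec d (\<lambda>k. LINT i|D. ?a i $ k))"
      then have k: "k < d" by simp
      have "(LINT i|D. ?a i $ k) = (LINT i|D. grad d (F i) y $ k - grad d (F i) x $ k - (hessian d (F i) x *\<^sub>v (y - x)) $ k)"
        by (rule Bochner_Integration.integral_cong[OF refl]) (rule ak[OF _ k])
      also have "\<dots> = gE y $ k - gE x $ k - (hE x *\<^sub>v (y - x)) $ k"
        using int1[OF x k] int1[OF y k] hE_mult[OF x yx k] k by (simp add: gE_def)
      finally show "(grad d (expect D F) y - grad d (expect D F) x - hE x *\<^sub>v (y - x)) $ k = vec d (\<lambda>k. LINT i|D. ?a i $ k) $ k"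
        using k x y gE_carrier[of x] gE_carrier[of y] hE_carrier[of x] by (simp add: grad_expect)
    qed (use x y gE_carrier hE_carrier[of x] in \<open>auto simp: grad_expect\<close>)
    also have "enorm \<dots> \<le> \<rho> * (enorm (y - x))\<^sup>2"
      by (rule enorm_integral_le)
         (auto intro!: ai vec_taylor[OF sm \<rho>0 L0] x y minus_carrier_vec gcar mult_mat_vec_carrier[OF hcar])
    also have "\<dots> \<le> e * enorm (y - x)" using r(2)[OF enorm_nonneg yr] .
    finally show ?thesis .
  qed
  then show "\<exists>r>0. \<forall>y\<in>carrier_vec d. enorm (y - x) < r \<longrightarrow>
      enorm (grad d (expect D F) y - grad d (expect D F) x - hE x *\<^sub>v (y - x)) \<le> e * enorm (y - x)" using r(1) by blast
qed (use x in \<open>auto simp: hE_def\<close>)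

lemma hessian_expect: "x \<in> carrier_vec d \<Longrightarrow> hessian d (expect D F) x = hE x"
  by (rule hessian_eq[OF has_hessian_expect]) (auto simp: grad_expect gE_carrier)

lemma smooth_expect: "smooth1 d (expect D F) L \<rho>"
  unfolding smooth1_def twice_differentiable_def
proof (intro conjI ballI)
  fix x :: "real vec" assume x: "x \<in> carrier_vec d"
  show "\<exists>g. has_gradient d (expect D F) g x" "\<exists>H. has_hessian d (expect D F) H x"
    using has_gradient_expect[OF x] has_hessian_expect[OF x] by auto
  fix y :: "real vec" assume y: "y \<in> carrier_vec d"
  have "gE x - gE y = vec d (\<lambda>k. LINT i|D. (grad d (F i) x - grad d (F i) y) $ k)"
  proof (rule eq_vecI)
    fix k assume "k < dim_vec (vec d (\<lambda>k. LINT i|D. (grad d (F i) x - grad d (F i) y) $ k))"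
    then have k: "k < d" by simp
    have "(LINT i|D. (grad d (F i) x - grad d (F i) y) $ k) = (LINT i|D. grad d (F i) x $ k - grad d (F i) y $ k)"
      using gdim[OF _ y] k by (intro Bochner_Integration.integral_cong refl) simp
    then show "(gE x - gE y) $ k = vec d (\<lambda>k. LINT i|D. (grad d (F i) x - grad d (F i) y) $ k) $ k"
      using k int1 x y by (simp add: gE_def)
  qed (simp add: gE_def)
  moreover have "enorm (vec d (\<lambda>k. LINT i|D. (grad d (F i) x - grad d (F i) y) $ k)) \<le> L * enorm (x - y)"
  proof (rule enorm_integral_le)
    fix j assume j: "j < d"
    have "integrable D (\<lambda>i. grad d (F i) x $ j - grad d (F i) y $ j)" using int1 x y j by auto
    then show "integrable D (\<lambda>i. (grad d (F i) x - grad d (F i) y) $ j)"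
      by (rule Bochner_Integration.integrable_cong[OF refl, THEN iffD1, rotated]) (use gdim[OF _ y] j in simp)
  qed (use gcar x y vec_grad_lip[OF sm \<rho>0 L0] in auto)
  ultimately show "enorm (grad d (expect D F) x - grad d (expect D F) y) \<le> L * enorm (x - y)"
    using x y by (simp add: grad_expect)
  show "spectral_norm (hessian d (expect D F) x - hessian d (expect D F) y) \<le> \<rho> * enorm (x - y)"
    unfolding hessian_expect[OF x] hessian_expect[OF y]
  proof (rule spectral_norm_le)
    show "hE x - hE y \<in> carrier_mat d d" by (rule minus_carrier_mat[OF hE_carrier])
    show "0 \<le> \<rho> * enorm (x - y)" using \<rho>0 enorm_nonneg by simp
    fix v :: "real vec" assume v: "v \<in> carrier_vec d"
    let ?a = "\<lambda>i. hessian d (F i) x *\<^sub>v v - hessian d (F i) y *\<^sub>v v"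
    have ak: "?a i $ k = (hessian d (F i) x *\<^sub>v v) $ k - (hessian d (F i) y *\<^sub>v v) $ k" if "i \<in> space D" "k < d" for i k
      using hcar[OF that(1) x] hcar[OF that(1) y] that by simp
    have "(hE x - hE y) *\<^sub>v v = hE x *\<^sub>v v - hE y *\<^sub>v v"
      by (rule minus_mult_distrib_mat_vec[OF hE_carrier hE_carrier v])
    also have "\<dots> = vec d (\<lambda>k. LINT i|D. ?a i $ k)"
    proof (rule eq_vecI)
      fix k assume "k < dim_vec (vec d (\<lambda>k. LINT i|D. ?a i $ k))"
      then have k: "k < d" by simp
      have "(LINT i|D. ?a i $ k) = (LINT i|D. (hessian d (F i) x *\<^sub>v v) $ k - (hessian d (F i) y *\<^sub>v v) $ k)"
        by (rule Bochner_Integration.integral_cong[OF refl]) (rule ak[OF _ k])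
      also have "\<dots> = (hE x *\<^sub>v v) $ k - (hE y *\<^sub>v v) $ k"
        using hE_mult[OF x v k] hE_mult[OF y v k] by simp
      finally show "(hE x *\<^sub>v v - hE y *\<^sub>v v) $ k = vec d (\<lambda>k. LINT i|D. ?a i $ k) $ k"
        using k hE_carrier[of x] hE_carrier[of y] by simp
    qed (use hE_carrier[of x] hE_carrier[of y] in simp)
    also have "enorm \<dots> \<le> \<rho> * enorm (x - y) * enorm v"
    proof (rule enorm_integral_le)
      fix k assume k: "k < d"
      show "integrable D (\<lambda>i. ?a i $ k)"
        by (subst Bochner_Integration.integrable_cong[OF refl ak[OF _ k]], assumption)
           (intro Bochner_Integration.integrable_diff hE_mult(1) x y v k)
    qed (auto intro!: minus_carrier_vec mult_mat_vec_carrier[OF hcar] x y v vec_hess_lip[OF sm \<rho>0 L0])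
    finally show "enorm ((hE x - hE y) *\<^sub>v v) \<le> \<rho> * enorm (x - y) * enorm v" .
  qed
qed

end

section \<open>Rounded gradients of vector problems\<close>

text \<open>Rounding to a grid leaves only countably many answers, and its error is absorbed by the error tolerance
  of the search.\<close>

definition rnd :: "nat \<Rightarrow> real \<Rightarrow> real vec \<Rightarrow> fvec" where
  "rnd d r v = fv (vec d (\<lambda>j. r * of_int \<lfloor>v $ j / r\<rfloor>))"

lemma rnd_error:
  assumes v: "v \<in> carrier_vec d" and r: "r > 0"
  shows "norm (rnd d r v - fv v) \<le> real d * r"
proof -
  let ?w = "vec d (\<lambda>j. r * of_int \<lfloor>v $ j / r\<rfloor>)"
  have "rnd d r v - fv v = fv (?w - v)" using v by (simp add: rnd_def fv_diff[of _ d])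
  then have "norm (rnd d r v - fv v) \<le> (\<Sum>j<d. \<bar>(?w - v) $ j\<bar>)"
    using norm_le_coords[of "?w - v" d] v by simp
  also have "\<dots> \<le> (\<Sum>j<d. r)"
  proof (rule sum_mono)
    fix j assume "j \<in> {..<d}"
    then have j: "j < d" by simp
    have h: "v $ j / r - 1 \<le> of_int \<lfloor>v $ j / r\<rfloor>" "of_int \<lfloor>v $ j / r\<rfloor> \<le> v $ j / r" by linarith+
    have e: "r * (v $ j / r) = v $ j" "r * (v $ j / r - 1) = v $ j - r" using r by (auto simp: right_diff_distrib)
    have "v $ j - r \<le> r * of_int \<lfloor>v $ j / r\<rfloor>" using mult_left_mono[OF h(1), of r] r unfolding e by linarith
    moreover have "r * of_int \<lfloor>v $ j / r\<rfloor> \<le> v $ j" using mult_left_mono[OF h(2), of r] r unfolding e by linarith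
    ultimately have "\<bar>r * of_int \<lfloor>v $ j / r\<rfloor> - v $ j\<bar> \<le> r" using r unfolding abs_le_iff by linarith
    then show "\<bar>(?w - v) $ j\<bar> \<le> r" using j v by simp
  qed
  finally show ?thesis by simp
qed

lemma countable_rnd: "countable (range (rnd d r))"
proof -
  have "range (rnd d r) \<subseteq> (\<lambda>l. fv (vec d (\<lambda>j. r * of_int (l ! j)))) ` UNIV"
  proof
    fix z assume "z \<in> range (rnd d r)"
    then obtain v where z: "z = rnd d r v" by auto
    have "vec d (\<lambda>j. r * of_int \<lfloor>v $ j / r\<rfloor>) = vec d (\<lambda>j. r * of_int (map (\<lambda>j. \<lfloor>v $ j / r\<rfloor>) [0..<d] ! j))" by auto
    then show "z \<in> (\<lambda>l. fv (vec d (\<lambda>j. r * of_int (l ! j)))) ` UNIV" unfolding z rnd_def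
      by (intro image_eqI[where x = "map (\<lambda>j. \<lfloor>v $ j / r\<rfloor>) [0..<d]"]) simp_all
  qed
  then show ?thesis by (rule countable_subset) simp
qed

text \<open>The factor T 2^T d^2 is what the stability of Oja's recursion demands of the
  finite-difference error c \<tau>; the factor \<delta> \<epsilon>/64 puts \<tau> below the other
  tolerances as well.\<close>

definition tau_of :: "nat \<Rightarrow> real \<Rightarrow> real \<Rightarrow> real \<Rightarrow> real \<Rightarrow> real" where
  "tau_of d c \<epsilon> \<delta> La = \<delta> * \<epsilon> / (64 * c * (real (search_params.Tn c \<delta> La) * 2 ^ search_params.Tn c \<delta> La) * (real d)\<^sup>2)"

text \<open>The tolerance in \<open>close\<close> is \<tau>^2 because difference quotients divide it
  by \<tau>, and the margin 1 in its radius leaves room for a query at distance \<tau> from an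
  iterate. The components need to approximate f only in the mean, so a sample can stand in for a
  distribution.\<close>

locale vec_problem = search_consts m d "bas :: nat \<Rightarrow> fvec" c \<epsilon> \<delta> La "tau_of d c \<epsilon> \<delta> La" full p
  for m d :: nat and c \<epsilon> \<delta> La :: real and full :: bool and p :: real +
  fixes Fc :: "nat \<Rightarrow> real vec \<Rightarrow> real" and f :: "real vec \<Rightarrow> real" and x0 :: "real vec" and L \<rho> \<Delta> :: real
    and orc :: "nat \<Rightarrow> real vec \<Rightarrow> real vec"
  assumes L: "L \<ge> 0" "4 * L \<le> c" and \<rho>: "\<rho> \<ge> 0" "3 * \<rho> + 4 \<le> c" and \<Delta>: "\<Delta> \<le> c"
    and smf: "smooth1 d f L \<rho>" and smc: "\<And>i. i \<le> m \<Longrightarrow> smooth1 d (Fc i) L \<rho>"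
    and x0: "x0 \<in> carrier_vec d"
    and orc: "\<And>i x. i \<le> m \<Longrightarrow> x \<in> carrier_vec d \<Longrightarrow> orc i x = grad d (Fc i) x"
    and close: "\<And>z. norm (z - fv x0) \<le> radius + 1 \<Longrightarrow>
      norm ((1 / real (Suc m)) *\<^sub>R (\<Sum>i\<le>m. gF d (Fc i) z) - gF d f z) \<le> (tau_of d c \<epsilon> \<delta> La)\<^sup>2"
    and dev: "\<And>i z. i \<le> m \<Longrightarrow> \<not> full \<Longrightarrow>
      norm (gF d (Fc i) z - (1 / real (Suc m)) *\<^sub>R (\<Sum>i\<le>m. gF d (Fc i) z)) \<le> 2 * c"
    and gap: "\<And>x. x \<in> carrier_vec d \<Longrightarrow> f x0 - f x \<le> \<Delta>"
begin

abbreviation tau :: real where "tau \<equiv> tau_of d c \<epsilon> \<delta> La"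

lemma Tn_pos: "real Tn * 2 ^ Tn \<ge> 1"
proof -
  have "1 \<le> real Tn" using Jn(2) by (simp add: Tn_def)
  moreover have "(1::real) \<le> 2 ^ Tn" by (rule one_le_power) simp
  ultimately show ?thesis using mult_mono[of 1 "real Tn" 1 "2 ^ Tn"] by simp
qed

lemma tau: "tau > 0" "64 * (c * tau) \<le> \<delta> * \<epsilon>" "real Tn * 2 ^ Tn * (c * tau) * (4 * (real d)\<^sup>2) \<le> 1"
proof -
  define W where "W = real Tn * 2 ^ Tn"
  have W: "W \<ge> 1" using Tn_pos by (simp add: W_def)
  have dd: "(real d)\<^sup>2 \<ge> 1" using d1 by simp
  have t: "tau = \<delta> * \<epsilon> / (64 * c * W * (real d)\<^sup>2)" by (simp add: tau_of_def W_def)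
  have pos: "64 * c * W * (real d)\<^sup>2 > 0" using W dd c1 by (intro mult_pos_pos) linarith+
  show "tau > 0" unfolding t using c1 W d1 del eps by (intro divide_pos_pos mult_pos_pos) auto
  have ct: "64 * (c * tau) * (W * (real d)\<^sup>2) = \<delta> * \<epsilon>" unfolding t using pos c1 W d1 by (simp add: field_simps)
  have "1 * 1 \<le> W * (real d)\<^sup>2" using W dd by (intro mult_mono) auto
  then have "64 * (c * tau) * 1 \<le> 64 * (c * tau) * (W * (real d)\<^sup>2)" using \<open>tau > 0\<close> c1 by (intro mult_left_mono) auto
  then show "64 * (c * tau) \<le> \<delta> * \<epsilon>" unfolding ct by simp
  have "\<delta> * \<epsilon> \<le> 1 * 1" using del eps by (intro mult_mono) auto
  then show "real Tn * 2 ^ Tn * (c * tau) * (4 * (real d)\<^sup>2) \<le> 1" using ct by (simp add: W_def mult_ac)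
qed

lemma tau_small: "64 * tau \<le> \<epsilon>" "64 * tau \<le> \<delta>" "tau \<le> 1" "tau\<^sup>2 \<le> tau" "64 * (c * tau) \<le> \<delta>"
proof -
  have "1 * tau \<le> c * tau" using c1 tau(1) by (intro mult_right_mono) auto
  moreover have "\<delta> * \<epsilon> \<le> 1 * \<epsilon>" "\<delta> * \<epsilon> \<le> \<delta> * 1" using del eps by (auto intro!: mult_right_mono mult_left_mono)
  ultimately show "64 * tau \<le> \<epsilon>" "64 * tau \<le> \<delta>" "tau \<le> 1" "64 * (c * tau) \<le> \<delta>" using tau(2) del eps by linarith+
  then have "tau * tau \<le> 1 * tau" using tau(1) by (intro mult_right_mono) auto
  then show "tau\<^sup>2 \<le> tau" by (simp add: power2_eq_square)
qed

definition Go :: "nat \<Rightarrow> fvec \<Rightarrow> fvec" where "Go i z = rnd d (tau\<^sup>2 / real d) (orc i (tv d z))"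

lemma Go_error: "i \<le> m \<Longrightarrow> norm (Go i z - gF d (Fc i) z) \<le> tau\<^sup>2"
  using rnd_error[of "grad d (Fc i) (tv d z)" d "tau\<^sup>2 / real d"] grad_carrier[OF smooth1_td[OF smc \<rho>(1) L(1)], of i "tv d z"]
    tau(1) d1 by (simp add: Go_def gF_def orc)

definition mean :: "(nat \<Rightarrow> fvec) \<Rightarrow> fvec" where "mean h = (1 / real (Suc m)) *\<^sub>R (\<Sum>i\<le>m. h i)"

lemma norm_mean_le: assumes "\<And>i. i \<le> m \<Longrightarrow> norm (h i) \<le> B" shows "norm (mean h) \<le> B"
proof -
  have "norm (\<Sum>i\<le>m. h i) \<le> (\<Sum>i\<le>m. B)" using assms by (intro sum_norm_le) auto
  then have "norm (mean h) \<le> 1 / real (Suc m) * (real (Suc m) * B)"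
    unfolding mean_def norm_scaleR by (intro mult_mono) auto
  then show ?thesis by simp
qed

lemma mean_diff: "mean (\<lambda>i. h i - h' i) = mean h - mean h'"
  and mean_scaleR: "mean (\<lambda>i. r *\<^sub>R h i) = r *\<^sub>R mean h"
  by (simp_all add: mean_def sum_subtractf scaleR_diff_right scaleR_sum_right[symmetric] mult.commute)

text \<open>All component Hessians are shifted by one common operator so that their mean is exactly
  the Hessian of f, although the component gradients average only to an approximation of its
  gradient.\<close>

definition Ao :: "fvec \<Rightarrow> nat \<Rightarrow> fvec \<Rightarrow> fvec" where
  "Ao x i y = HF d (Fc i) x y - mean (\<lambda>j. HF d (Fc j) x y) + HF d f x y"

lemmas hc = smooth1_hess_norm[OF smc \<rho>(1) L(1)] and hf = smooth1_hess_norm[OF smf \<rho>(1) L(1)]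

lemma HF_lin: "smooth1 d h L \<rho> \<Longrightarrow> bounded_linear (HF d h x)"
  using smooth1_hess[OF _ \<rho>(1) L(1)] has_derivative_bounded_linear by blast

text \<open>Close gradients do not have close derivatives in general, but with Lipschitz Hessians a
  difference quotient at scale \<tau> compares them: there are two Taylor errors \<rho> \<tau>, and
  twice the gradient error \<tau>^2 is divided by \<tau>.\<close>

lemma mean_HF_close:
  assumes x: "norm (x - fv x0) \<le> radius"
  shows "norm (mean (\<lambda>j. HF d (Fc j) x y) - HF d f x y) \<le> (2 * \<rho> * tau + 2 * tau) * norm y"
proof (cases "y = 0")
  case True
  then show ?thesis using hc[of _ x 0] hf[of x 0] by (simp add: mean_def)
next
  case False
  define t where "t = norm y / tau"
  have t: "t \<ge> 0" using tau(1) by (simp add: t_def)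
  define x' where "x' = x + (tau / norm y) *\<^sub>R y"
  have "norm (x' - x) = tau" using False tau(1) by (simp add: x'_def)
  then have x': "norm (x' - fv x0) \<le> radius + 1"
    using norm_triangle_ineq[of "x' - x" "x - fv x0"] x tau_small by simp
  define e where "e = (\<lambda>h. t *\<^sub>R (gF d h x' - gF d h x) - HF d h x y)"
  have ef: "norm (e f) \<le> \<rho> * tau * norm y"
    unfolding e_def t_def x'_def by (rule smooth1_hv[OF smf \<rho>(1) L(1) tau(1)])
  have ec: "norm (mean (\<lambda>i. e (Fc i))) \<le> \<rho> * tau * norm y"
    unfolding e_def t_def x'_def by (rule norm_mean_le) (rule smooth1_hv[OF smc \<rho>(1) L(1) tau(1)])
  define k where "k = (\<lambda>z. mean (\<lambda>i. gF d (Fc i) z) - gF d f z)"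
  have k: "norm (k x') \<le> tau\<^sup>2" "norm (k x) \<le> tau\<^sup>2" using close[of x'] close[of x] x x' by (auto simp: k_def mean_def)
  have "mean (\<lambda>j. HF d (Fc j) x y) - HF d f x y = t *\<^sub>R (k x' - k x) - mean (\<lambda>i. e (Fc i)) + e f"
    unfolding e_def mean_diff mean_scaleR k_def by (simp add: algebra_simps)
  also have "norm \<dots> \<le> norm (t *\<^sub>R (k x' - k x)) + norm (mean (\<lambda>i. e (Fc i))) + norm (e f)"
    by (meson norm_triangle_ineq norm_triangle_ineq4 add_mono order_refl order_trans)
  also have "norm (t *\<^sub>R (k x' - k x)) \<le> t * (2 * tau\<^sup>2)"
    using norm_triangle_ineq4[of "k x'" "k x"] k t by (auto intro!: mult_left_mono)
  also have "t * (2 * tau\<^sup>2) = 2 * tau * norm y" using tau(1) by (simp add: t_def power2_eq_square)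
  finally show ?thesis using ef ec by (simp add: algebra_simps)
qed

sublocale search m d bas c \<epsilon> \<delta> La tau full p Go "\<lambda>z. f (tv d z)" "gF d f" "HF d f" Ao "fv x0" "f x0 - \<Delta>" "c * tau"
proof (intro search.intro search_axioms.intro search_consts_axioms)
  fix x y :: fvec
  show "f (tv d y) \<le> f (tv d x) + inner (gF d f x) (y - x) + c / 2 * (norm (y - x))\<^sup>2"
  proof -
    have "L / 2 * (norm (y - x))\<^sup>2 \<le> c / 2 * (norm (y - x))\<^sup>2" using L by (intro mult_right_mono) auto
    then show ?thesis using smooth1_descent[OF smf \<rho>(1) L(1), of y x] by linarith
  qed
next
  fix x w :: fvec and t :: real assume w: "norm w = 1" "t \<ge> 0"
  have "2 * \<rho> / 3 * t ^ 3 \<le> c / 3 * t ^ 3" using \<rho> w by (intro mult_right_mono) auto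
  then show "f (tv d (x + t *\<^sub>R w)) + f (tv d (x - t *\<^sub>R w)) \<le> 2 * f (tv d x) + t\<^sup>2 * inner w (HF d f x w) + c / 3 * t ^ 3"
    using smooth1_second[OF smf \<rho>(1) L(1) w, of x] by linarith
next
  fix x :: fvec assume x: "norm (x - fv x0) \<le> radius"
  have "norm (mean (\<lambda>i. Go i x) - mean (\<lambda>i. gF d (Fc i) x)) \<le> tau\<^sup>2"
    unfolding mean_diff[symmetric] by (rule norm_mean_le) (rule Go_error)
  moreover have "norm (mean (\<lambda>i. gF d (Fc i) x) - gF d f x) \<le> tau\<^sup>2" using close[of x] x by (simp add: mean_def)
  ultimately have "norm (mean (\<lambda>i. Go i x) - gF d f x) \<le> tau\<^sup>2 + tau\<^sup>2"
    using norm_triangle_ineq[of "mean (\<lambda>i. Go i x) - mean (\<lambda>i. gF d (Fc i) x)" "mean (\<lambda>i. gF d (Fc i) x) - gF d f x"] by simp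
  then show "norm ((1 / real (Suc m)) *\<^sub>R (\<Sum>i\<le>m. Go i x) - gF d f x) \<le> \<epsilon> / 16"
    using tau_small eps unfolding mean_def by linarith
next
  fix i and x y :: fvec and E :: real
  assume i: "i \<le> m" and xy: "norm (x - y) \<le> E" and E: "E = stp \<or> E = jmp"
  have e4: "8 * tau \<le> c * E" using E tau_small c1 eps del by (auto simp: stp_def jmp_def)
  have "norm (Go i x - Go i y) \<le> norm (Go i x - gF d (Fc i) x) + norm (gF d (Fc i) x - gF d (Fc i) y) + norm (Go i y - gF d (Fc i) y)"
    using norm_triangle_ineq[of "Go i x - gF d (Fc i) x" "gF d (Fc i) x - gF d (Fc i) y"]
      norm_triangle_ineq4[of "Go i x - gF d (Fc i) y" "Go i y - gF d (Fc i) y"] by simp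
  also have "\<dots> \<le> tau\<^sup>2 + L * norm (x - y) + tau\<^sup>2"
    using Go_error[OF i] smooth1_lip[OF smc[OF i] \<rho>(1) L(1)] by (intro add_mono) auto
  also have "L * norm (x - y) \<le> c * E" using xy L c1 by (intro mult_mono) auto
  finally show "norm (Go i x - Go i y) \<le> 2 * c * E" using e4 tau_small tau(1) by linarith
next
  fix i and x :: fvec assume i: "i \<le> m" and nf: "\<not> full"
  have "norm (mean (\<lambda>i. Go i x) - mean (\<lambda>i. gF d (Fc i) x)) \<le> tau\<^sup>2"
    unfolding mean_diff[symmetric] by (rule norm_mean_le) (rule Go_error)
  moreover have "norm (Go i x - gF d (Fc i) x) \<le> tau\<^sup>2" by (rule Go_error[OF i])
  moreover have "norm (gF d (Fc i) x - mean (\<lambda>i. gF d (Fc i) x)) \<le> 2 * c" using dev[OF i nf] by (simp add: mean_def)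
  moreover have "norm (Go i x - mean (\<lambda>i. Go i x)) \<le> norm (Go i x - gF d (Fc i) x) +
      norm (gF d (Fc i) x - mean (\<lambda>i. gF d (Fc i) x)) + norm (mean (\<lambda>i. Go i x) - mean (\<lambda>i. gF d (Fc i) x))"
    using norm_triangle_ineq[of "Go i x - gF d (Fc i) x" "gF d (Fc i) x - mean (\<lambda>i. gF d (Fc i) x)"]
      norm_triangle_ineq4[of "Go i x - mean (\<lambda>i. gF d (Fc i) x)" "mean (\<lambda>i. Go i x) - mean (\<lambda>i. gF d (Fc i) x)"] by simp
  ultimately show "norm (Go i x - (1 / real (Suc m)) *\<^sub>R (\<Sum>i\<le>m. Go i x)) \<le> 4 * c"
    using tau_small c1 unfolding mean_def by linarith
next
  fix x :: fvec and i assume i: "i \<le> m"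
  have "linear (\<lambda>y. HF d (Fc i) x y - mean (\<lambda>j. HF d (Fc j) x y) + HF d f x y)"
    unfolding mean_def
    by (intro linear_compose_add linear_compose_sub linear_compose_scale_right linear_compose_sum ballI
        bounded_linear.linear[OF HF_lin] smf smc i) auto
  then show "linear (Ao x i)" by (simp add: Ao_def[abs_def])
next
  fix x y :: fvec and i assume i: "i \<le> m"
  have "norm (Ao x i y) \<le> norm (HF d (Fc i) x y) + norm (mean (\<lambda>j. HF d (Fc j) x y)) + norm (HF d f x y)"
    unfolding Ao_def by (meson norm_triangle_ineq norm_triangle_ineq4 add_mono order_refl order_trans)
  also have "\<dots> \<le> L * norm y + L * norm y + L * norm y"
    using hc[OF i] hf norm_mean_le[OF hc] by (intro add_mono) auto
  also have "\<dots> = (3 * L) * norm y" by simp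
  also have "\<dots> \<le> c * norm y" using L by (intro mult_right_mono) auto
  finally show "norm (Ao x i y) \<le> c * norm y" .
next
  fix x y :: fvec
  show "(\<Sum>i\<le>m. Ao x i y) = real (Suc m) *\<^sub>R HF d f x y"
    by (simp add: Ao_def mean_def sum.distrib sum_subtractf sum_constant_scaleR)
next
  fix x y :: fvec and i assume x: "norm (x - fv x0) \<le> radius" and i: "i \<le> m"
  define t where "t = norm y / tau"
  have t: "t \<ge> 0" using tau(1) by (simp add: t_def)
  define x' where "x' = x + (tau / norm y) *\<^sub>R y"
  define k where "k = (\<lambda>z. Go i z - gF d (Fc i) z)"
  define e where "e = t *\<^sub>R (gF d (Fc i) x' - gF d (Fc i) x) - HF d (Fc i) x y"
  define q where "q = mean (\<lambda>j. HF d (Fc j) x y) - HF d f x y"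
  have e: "norm e \<le> \<rho> * tau * norm y" unfolding e_def t_def x'_def by (rule smooth1_hv[OF smc[OF i] \<rho>(1) L(1) tau(1)])
  have q: "norm q \<le> (2 * \<rho> * tau + 2 * tau) * norm y" unfolding q_def by (rule mean_HF_close[OF x])
  have "norm (t *\<^sub>R (k x' - k x)) \<le> t * (2 * tau\<^sup>2)"
    using norm_triangle_ineq4[of "k x'" "k x"] Go_error[OF i, of x'] Go_error[OF i, of x] t by (auto simp: k_def intro!: mult_left_mono)
  also have "t * (2 * tau\<^sup>2) = 2 * tau * norm y" using tau(1) by (simp add: t_def power2_eq_square)
  finally have k: "norm (t *\<^sub>R (k x' - k x)) \<le> 2 * tau * norm y" .
  have "t *\<^sub>R (Go i x' - Go i x) - Ao x i y = t *\<^sub>R (k x' - k x) + e + q"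
    by (simp add: Ao_def k_def e_def q_def algebra_simps)
  also have "norm \<dots> \<le> norm (t *\<^sub>R (k x' - k x)) + norm e + norm q"
    by (meson norm_triangle_ineq add_mono order_refl order_trans)
  also have "\<dots> \<le> 2 * tau * norm y + \<rho> * tau * norm y + (2 * \<rho> * tau + 2 * tau) * norm y"
    using k e q by (intro add_mono)
  \<comment> \<open>The origin of 3 \<rho> + 4: rounding contributes 2, the Taylor error of the
    component \<rho>, and the shift in \<open>Ao\<close> 2 \<rho> + 2.\<close>
  also have "\<dots> = (3 * \<rho> + 4) * (tau * norm y)" by (simp add: algebra_simps)
  also have "\<dots> \<le> c * (tau * norm y)" using \<rho> tau(1) by (intro mult_right_mono) auto
  finally show "norm ((norm y / tau) *\<^sub>R (Go i (x + (tau / norm y) *\<^sub>R y) - Go i x) - Ao x i y) \<le> c * tau * norm y"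
    by (simp add: t_def x'_def)
next
  fix x z :: fvec assume "inner z (HF d f x z) < - \<delta> * (norm z)\<^sup>2"
  moreover have "- \<delta> * (norm z)\<^sup>2 \<le> 0" using del by simp
  ultimately have "inner z (HF d f x z) < 0" by linarith
  from smooth1_eigen[OF smf \<rho>(1) L(1) d1 this]
  show "\<exists>lm u a. norm u = 1 \<and> HF d f x u = - (lm *\<^sub>R u) \<and>
        (\<forall>z. inner z (HF d f x z) \<ge> - lm * (norm z)\<^sup>2) \<and> u = (\<Sum>j<d. a j *\<^sub>R bas j) \<and> (\<forall>j. \<bar>a j\<bar> \<le> 1)" .
next
  show "real Tn * 2 ^ Tn * (c * tau) * (4 * (real d)\<^sup>2) \<le> 1" by (rule tau(3))
  show "f x0 - \<Delta> \<le> f (tv d x)" for x using gap[of "tv d x"] by simp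
  show "f (tv d (fv x0)) - (f x0 - \<Delta>) \<le> c" using x0 \<Delta> by simp
  show "c * tau \<le> \<delta> / 16" using tau_small(5) tau(1) c1 mult_pos_pos[of c tau] by linarith
qed (use tau(1) c1 in \<open>auto simp: norm_bas\<close>)

theorem vec_search_fails:
  "ev Go (searchP (fv x0)) (\<lambda>z. of_bool (\<not> approx_sosp d f \<epsilon> \<delta> (tv d z))) \<le> p"
proof (rule order_trans[OF ev_mono search_fails])
  fix z
  have "approx_sosp d f \<epsilon> \<delta> (tv d z)" if "sosp z"
    unfolding approx_sosp_def
  proof (intro conjI)
    show "enorm (grad d f (tv d z)) \<le> \<epsilon>" using that by (simp add: sosp_def gF_def norm_fv)
    show "lambda_min (hessian d f (tv d z)) \<ge> - \<delta>"
      using that by (intro smooth1_lambda_min[OF smf \<rho>(1) L(1) d1]) (simp add: sosp_def curv_ok_def)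
  qed simp
  then show "of_bool (\<not> approx_sosp d f \<epsilon> \<delta> (tv d z)) \<le> (of_bool (\<not> sosp z) :: real)" by auto
qed

end

section \<open>Uniform approximation by a finite sample\<close>

lemma iid_mean_tail:
  assumes D: "prob_space D" and Y: "integrable D Y" "\<And>i. i \<in> space D \<Longrightarrow> \<bar>Y i - (LINT i|D. Y i)\<bar> \<le> B"
    and "B > 0" "N > 0" "t \<ge> 0"
  shows "measure (\<Pi>\<^sub>M _\<in>(UNIV :: nat set). D)
     {w \<in> space (\<Pi>\<^sub>M _\<in>(UNIV :: nat set). D). \<bar>(\<Sum>k<N. Y (w k)) / real N - (LINT i|D. Y i)\<bar> \<ge> t}
     \<le> 2 * exp (- (real N * t\<^sup>2 / (2 * B\<^sup>2)))"
proof -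
  interpret D: prob_space D by fact
  let ?S = "\<Pi>\<^sub>M _\<in>(UNIV :: nat set). D"
  interpret S: prob_space ?S by (rule prob_space_PiM) (rule D)
  interpret P: product_prob_space "\<lambda>_. D" "UNIV :: nat set" ..
  define \<mu> where "\<mu> = (LINT i|D. Y i)"
  have [measurable]: "Y \<in> borel_measurable D" using Y(1) by auto
  have comp: "distr ?S D (\<lambda>w. w k) = D" for k using P.PiM_component[of k] by simp
  \<comment> \<open>Independence of the coordinates of the infinite product: its restriction to
    finitely many indices is again a product measure.\<close>
  have ind: "S.indep_vars (\<lambda>_. D) (\<lambda>k w. w k) {..<N}"
  proof (subst S.indep_vars_iff_distr_eq_PiM')
    have "distr ?S (\<Pi>\<^sub>M i\<in>{..<N}. D) (\<lambda>x. restrict x {..<N}) = (\<Pi>\<^sub>M i\<in>{..<N}. D)"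
      by (rule P.distr_PiM_restrict_finite) auto
    then show "distr ?S (\<Pi>\<^sub>M i\<in>{..<N}. D) (\<lambda>x. \<lambda>i\<in>{..<N}. x i) = (\<Pi>\<^sub>M i\<in>{..<N}. distr ?S D (\<lambda>w. w i))"
      by (simp add: comp)
  qed (use \<open>N > 0\<close> in auto)
  have d: "distr ?S borel (\<lambda>w. Y (w k)) = distr D borel Y" for k
  proof -
    have "distr ?S borel (\<lambda>w. Y (w k)) = distr (distr ?S D (\<lambda>w. w k)) borel Y"
      by (subst distr_distr) (auto simp: o_def)
    then show ?thesis by (simp only: comp)
  qed
  interpret X: iid_interval_bounded_random_variables ?S "{..<N}" "\<lambda>k w. Y (w k)" "\<lambda>w. Y (w 0)" "\<mu> - B" "\<mu> + B"
  proof unfold_locales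
    show "S.indep_vars (\<lambda>_. borel) (\<lambda>k w. Y (w k)) {..<N}"
      by (rule S.indep_vars_compose2[OF ind]) simp
    show "AE w in ?S. Y (w 0) \<in> {\<mu> - B..\<mu> + B}"
    proof (rule AE_I2)
      fix w assume "w \<in> space ?S"
      then have "w 0 \<in> space D" by (auto simp: space_PiM)
      then show "Y (w 0) \<in> {\<mu> - B..\<mu> + B}" using Y(2)[of "w 0"] by (auto simp: \<mu>_def abs_le_iff)
    qed
  qed (auto simp: d)
  have e: "S.expectation (\<lambda>w. Y (w 0)) = \<mu>"
  proof -
    have "S.expectation (\<lambda>w. Y (w 0)) = (LINT i|distr ?S D (\<lambda>w. w 0). Y i)" by (subst integral_distr) auto
    then show ?thesis by (simp only: comp \<mu>_def)
  qed
  interpret X: Hoeffding_ineq_iid ?S "{..<N}" "\<lambda>k w. Y (w k)" "\<lambda>w. Y (w 0)" "\<mu> - B" "\<mu> + B" "S.expectation (\<lambda>w. Y (w 0))"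
    by unfold_locales simp
  have "measure ?S {w \<in> space ?S. \<bar>(\<Sum>k<N. Y (w k)) / real (card {..<N}) - S.expectation (\<lambda>w. Y (w 0))\<bar> \<ge> t}
     \<le> 2 * exp (-2 * real (card {..<N}) * t\<^sup>2 / ((\<mu> + B) - (\<mu> - B))\<^sup>2)"
    by (rule X.Hoeffding_ineq_abs_ge') (use \<open>t \<ge> 0\<close> \<open>B > 0\<close> \<open>N > 0\<close> in auto)
  also have "-2 * real (card {..<N}) * t\<^sup>2 / ((\<mu> + B) - (\<mu> - B))\<^sup>2 = - (real N * t\<^sup>2 / (2 * B\<^sup>2))"
    using \<open>B > 0\<close> by (simp add: power2_eq_square field_simps)
  finally show ?thesis unfolding e by (simp add: \<mu>_def)
qed

section \<open>A finite grid in the ball and the size of the sample\<close>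

definition mesh :: "nat \<Rightarrow> real \<Rightarrow> real \<Rightarrow> real" where "mesh d L \<kappa> = \<kappa> / (4 * (L + 1) * real d)"

definition grid_range :: "nat \<Rightarrow> real \<Rightarrow> real \<Rightarrow> real \<Rightarrow> int" where
  "grid_range d L R \<kappa> = \<lceil>R / mesh d L \<kappa>\<rceil> + 1"

definition grid :: "nat \<Rightarrow> real \<Rightarrow> real \<Rightarrow> real \<Rightarrow> real vec \<Rightarrow> real vec set" where
  "grid d L R \<kappa> x0 = (\<lambda>l. x0 + vec d (\<lambda>j. mesh d L \<kappa> * of_int (l j))) `
     (PiE {..<d} (\<lambda>_. {- grid_range d L R \<kappa>..grid_range d L R \<kappa>}))"

definition grid_card :: "nat \<Rightarrow> real \<Rightarrow> real \<Rightarrow> real \<Rightarrow> nat" where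
  "grid_card d L R \<kappa> = (nat (2 * grid_range d L R \<kappa> + 1)) ^ d"

text \<open>The size at which Hoeffding's bound for a deviation of \<kappa>/(2d) in one coordinate,
  summed over d coordinates and all grid points, is at most q. It depends on known data only; the
  added 1 keeps it positive.\<close>

definition sample_size :: "nat \<Rightarrow> real \<Rightarrow> real \<Rightarrow> real \<Rightarrow> real \<Rightarrow> real \<Rightarrow> nat" where
  "sample_size d L \<sigma> R \<kappa> q = nat \<lceil>2 * \<sigma>\<^sup>2 / (\<kappa> / (2 * real d))\<^sup>2 * ln (2 * real d * real (grid_card d L R \<kappa>) / q)\<rceil> + 1"

lemma finite_grid: "finite (grid d L R \<kappa> x0)"
  unfolding grid_def by (intro finite_imageI finite_PiE) auto

lemma card_grid: "card (grid d L R \<kappa> x0) \<le> grid_card d L R \<kappa>"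
proof -
  have "card (grid d L R \<kappa> x0) \<le> card (PiE {..<d} (\<lambda>_. {- grid_range d L R \<kappa>..grid_range d L R \<kappa>}))"
    unfolding grid_def by (intro card_image_le finite_PiE) auto
  also have "\<dots> = grid_card d L R \<kappa>" by (simp add: card_PiE grid_card_def)
  finally show ?thesis .
qed

lemma grid_carrier: "x0 \<in> carrier_vec d \<Longrightarrow> \<gamma> \<in> grid d L R \<kappa> x0 \<Longrightarrow> \<gamma> \<in> carrier_vec d"
  unfolding grid_def by (elim imageE) simp

lemma grid_near:
  assumes x: "x \<in> carrier_vec d" "x0 \<in> carrier_vec d" "enorm (x - x0) \<le> R" and d: "d \<ge> 1" and \<kappa>: "\<kappa> > 0" and L: "L \<ge> 0"
  shows "\<exists>\<gamma>\<in>grid d L R \<kappa> x0. enorm (x - \<gamma>) \<le> real d * mesh d L \<kappa>"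
proof -
  define h where "h = mesh d L \<kappa>"
  have h: "h > 0" using d \<kappa> L by (simp add: h_def mesh_def)
  define l where "l = (\<lambda>j\<in>{..<d}. \<lfloor>(x - x0) $ j / h\<rfloor>)"
  define \<gamma> where "\<gamma> = x0 + vec d (\<lambda>j. h * of_int (l j))"
  have lr: "l j \<in> {- grid_range d L R \<kappa>..grid_range d L R \<kappa>}" if j: "j < d" for j
  proof -
    define y where "y = (x - x0) $ j / h"
    have "\<bar>(x - x0) $ j\<bar> \<le> R" using abs_index_le_enorm[of "x - x0" d j] x j by simp
    then have "\<bar>y\<bar> \<le> R / h" using h by (simp add: y_def divide_right_mono)
    then have "- (\<lceil>R / h\<rceil> + 1) \<le> \<lfloor>y\<rfloor> \<and> \<lfloor>y\<rfloor> \<le> \<lceil>R / h\<rceil> + 1" by linarith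
    moreover have "l j = \<lfloor>y\<rfloor>" using j by (simp add: l_def y_def)
    ultimately show ?thesis by (simp only: grid_range_def h_def[symmetric] atLeastAtMost_iff)
  qed
  have "l \<in> PiE {..<d} (\<lambda>_. {- grid_range d L R \<kappa>..grid_range d L R \<kappa>})"
    by (rule PiE_I) (simp only: lessThan_iff lr, simp add: l_def)
  then have "\<gamma> \<in> grid d L R \<kappa> x0" unfolding grid_def \<gamma>_def h_def[symmetric] by (rule imageI)
  moreover have "enorm (x - \<gamma>) \<le> real d * h"
  proof -
    have c: "x - \<gamma> \<in> carrier_vec d" using x by (simp add: \<gamma>_def)
    have "enorm (x - \<gamma>) \<le> (\<Sum>j<d. \<bar>(x - \<gamma>) $ j\<bar>)" using norm_le_coords[OF c] by (simp add: norm_fv)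
    also have "\<dots> \<le> (\<Sum>j<d. h)"
    proof (rule sum_mono)
      fix j assume "j \<in> {..<d}"
      then have j: "j < d" by simp
      define y where "y = (x - x0) $ j"
      have e: "(x - \<gamma>) $ j = y - h * of_int \<lfloor>y / h\<rfloor>" using x j by (simp add: \<gamma>_def l_def y_def)
      have b: "0 \<le> y / h - of_int \<lfloor>y / h\<rfloor>" "y / h - of_int \<lfloor>y / h\<rfloor> \<le> 1" by linarith+
      have "h * (y / h - of_int \<lfloor>y / h\<rfloor>) \<le> h * 1" "0 \<le> h * (y / h - of_int \<lfloor>y / h\<rfloor>)" using b h by (auto intro!: mult_left_mono)
      then show "\<bar>(x - \<gamma>) $ j\<bar> \<le> h" unfolding e using h by (simp add: right_diff_distrib)
    qed
    finally show ?thesis by simp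
  qed
  ultimately show ?thesis by (auto simp: h_def)
qed

context smooth_family
begin

abbreviation samples :: "(nat \<Rightarrow> 'i) measure" where "samples \<equiv> \<Pi>\<^sub>M _\<in>(UNIV :: nat set). D"

lemma prob_space_samples: "prob_space samples"
  by (rule prob_space_PiM) unfold_locales

lemma gF_expect: "gF d (expect D F) z = fv (gE (tv d z))"
  by (simp add: gF_def grad_expect)

text \<open>Half of \<kappa> is spent at a grid point, through Hoeffding and a union bound; a
  quarter each goes into moving the sample mean and the true gradient from there to x. The L + 1 in
  \<open>mesh\<close> keeps the spacing finite for L = 0.\<close>

lemma sample_mean_uniform:
  assumes dev: "\<And>i x. i \<in> space D \<Longrightarrow> x \<in> carrier_vec d \<Longrightarrow> enorm (grad d (F i) x - gE x) \<le> \<sigma>"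
    and \<sigma>: "\<sigma> > 0" and d: "d \<ge> 1" and \<kappa>: "\<kappa> > 0" and q: "0 < q" and x0: "x0 \<in> carrier_vec d" and R: "R \<ge> 0"
    and N: "N = sample_size d L \<sigma> R \<kappa> q"
  shows "\<exists>E\<in>sets samples. measure samples E \<ge> 1 - q \<and> (\<forall>w\<in>E. \<forall>z. norm (z - fv x0) \<le> R \<longrightarrow>
     norm ((1 / real N) *\<^sub>R (\<Sum>k<N. gF d (F (w k)) z) - gF d (expect D F) z) \<le> \<kappa>)"
proof -
  interpret S: prob_space samples by (rule prob_space_samples)
  have N0: "N > 0" by (simp add: N sample_size_def)
  define t where "t = \<kappa> / (2 * real d)"
  have t: "t > 0" using \<kappa> d by (simp add: t_def)
  define \<Gamma> where "\<Gamma> = grid d L R \<kappa> x0"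
  define K where "K = real (grid_card d L R \<kappa>)"
  define bad where "bad = (\<lambda>(\<gamma>, j). {w \<in> space samples. \<bar>(\<Sum>k<N. grad d (F (w k)) \<gamma> $ j) / real N - gE \<gamma> $ j\<bar> \<ge> t})"
  define I where "I = \<Gamma> \<times> {..<d}"
  have finI: "finite I" by (simp add: I_def \<Gamma>_def finite_grid)
  have \<Gamma>c: "\<gamma> \<in> carrier_vec d" if "\<gamma> \<in> \<Gamma>" for \<gamma> using that grid_carrier[OF x0] by (simp add: \<Gamma>_def)
  have meas: "bad i \<in> sets samples" if i: "i \<in> I" for i
  proof -
    obtain \<gamma> j where ij: "i = (\<gamma>, j)" by (cases i)
    then have gj: "\<gamma> \<in> carrier_vec d" "j < d" using i \<Gamma>c by (auto simp: I_def)
    have [measurable]: "(\<lambda>i. grad d (F i) \<gamma> $ j) \<in> borel_measurable D" using int1[OF gj] by auto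
    show ?thesis unfolding ij bad_def by simp
  qed
  have K1: "K \<ge> 1"
  proof -
    have "mesh d L \<kappa> > 0" using d \<kappa> L0 by (simp add: mesh_def)
    then have "R / mesh d L \<kappa> \<ge> 0" using R by simp
    then have "grid_range d L R \<kappa> \<ge> 0" unfolding grid_range_def by linarith
    then have "nat (2 * grid_range d L R \<kappa> + 1) \<ge> 1" by linarith
    then show ?thesis by (simp add: K_def grid_card_def)
  qed
  have tail: "measure samples (bad i) \<le> q / (real d * K)" if i: "i \<in> I" for i
  proof -
    obtain \<gamma> j where ij: "i = (\<gamma>, j)" by (cases i)
    then have gj: "\<gamma> \<in> carrier_vec d" "j < d" using i \<Gamma>c by (auto simp: I_def)
    have mu: "(LINT i|D. grad d (F i) \<gamma> $ j) = gE \<gamma> $ j" using gj by (simp add: gE_def)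
    have "measure samples (bad i) \<le> 2 * exp (- (real N * t\<^sup>2 / (2 * \<sigma>\<^sup>2)))"
      unfolding ij bad_def prod.case mu[symmetric]
    proof (rule iid_mean_tail)
      show "prob_space D" by unfold_locales
      show "integrable D (\<lambda>i. grad d (F i) \<gamma> $ j)" by (rule int1[OF gj])
      fix i assume i: "i \<in> space D"
      have "\<bar>(grad d (F i) \<gamma> - gE \<gamma>) $ j\<bar> \<le> enorm (grad d (F i) \<gamma> - gE \<gamma>)"
        using gcar[OF i gj(1)] gE_carrier gj by (intro abs_index_le_enorm) auto
      then show "\<bar>grad d (F i) \<gamma> $ j - (LINT i|D. grad d (F i) \<gamma> $ j)\<bar> \<le> \<sigma>"
        using dev[OF i gj(1)] gE_carrier[of \<gamma>] gj by (simp add: mu)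
    qed (use \<sigma> N0 t in auto)
    also have "\<dots> \<le> 2 * exp (- ln (2 * real d * K / q))"
    proof -
      have "2 * \<sigma>\<^sup>2 / t\<^sup>2 * ln (2 * real d * K / q) \<le> real N"
        unfolding N sample_size_def t_def K_def by linarith
      then have "2 * \<sigma>\<^sup>2 / t\<^sup>2 * ln (2 * real d * K / q) * (t\<^sup>2 / (2 * \<sigma>\<^sup>2)) \<le> real N * (t\<^sup>2 / (2 * \<sigma>\<^sup>2))"
        by (intro mult_right_mono) auto
      then have "ln (2 * real d * K / q) \<le> real N * t\<^sup>2 / (2 * \<sigma>\<^sup>2)" using t \<sigma> by simp
      then show ?thesis by simp
    qed
    also have "\<dots> = q / (real d * K)" using K1 d q by (simp add: exp_minus)
    finally show ?thesis .
  qed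
  define E where "E = space samples - (\<Union>i\<in>I. bad i)"
  have U: "(\<Union>i\<in>I. bad i) \<in> sets samples" using finI meas by auto
  have "measure samples (\<Union>i\<in>I. bad i) \<le> (\<Sum>i\<in>I. measure samples (bad i))"
    using finI meas by (intro S.finite_measure_subadditive_finite) auto
  also have "\<dots> \<le> (\<Sum>i\<in>I. q / (real d * K))" using tail by (rule sum_mono)
  also have "\<dots> = real (card \<Gamma>) * real d * (q / (real d * K))" by (simp add: I_def card_cartesian_product)
  also have "\<dots> \<le> K * real d * (q / (real d * K))"
    using K1 q card_grid[of d L R \<kappa> x0] by (intro mult_right_mono) (auto simp: K_def \<Gamma>_def)
  also have "\<dots> = q" using K1 d by simp
  finally have "measure samples E \<ge> 1 - q" unfolding E_def using S.prob_compl[OF U] by simp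
  moreover have "E \<in> sets samples" unfolding E_def using U by auto
  moreover have "norm ((1 / real N) *\<^sub>R (\<Sum>k<N. gF d (F (w k)) z) - gF d (expect D F) z) \<le> \<kappa>"
    if w: "w \<in> E" and z: "norm (z - fv x0) \<le> R" for w z
  proof -
    define x where "x = tv d z"
    have x: "x \<in> carrier_vec d" by (simp add: x_def)
    have wD: "w k \<in> space D" for k using w by (auto simp: E_def space_PiM)
    have "enorm (x - x0) \<le> R" using enorm_tv_le[of d "z - fv x0"] z x0 by (simp add: x_def tv_diff)
    from grid_near[OF x x0 this d \<kappa> L0] obtain \<gamma> where \<gamma>: "\<gamma> \<in> \<Gamma>" "enorm (x - \<gamma>) \<le> real d * mesh d L \<kappa>" by (auto simp: \<Gamma>_def)
    have \<gamma>c: "\<gamma> \<in> carrier_vec d" by (rule \<Gamma>c[OF \<gamma>(1)])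
    define mn where "mn = (\<lambda>x. (1 / real N) *\<^sub>R (\<Sum>k<N. fv (grad d (F (w k)) x)))"
    have lipm: "norm (mn x - mn \<gamma>) \<le> L * enorm (x - \<gamma>)"
    proof -
      have "mn x - mn \<gamma> = (1 / real N) *\<^sub>R (\<Sum>k<N. fv (grad d (F (w k)) x) - fv (grad d (F (w k)) \<gamma>))"
        by (simp add: mn_def sum_subtractf scaleR_diff_right)
      moreover have "norm (\<Sum>k<N. fv (grad d (F (w k)) x) - fv (grad d (F (w k)) \<gamma>)) \<le> (\<Sum>k<N. L * enorm (x - \<gamma>))"
        using vec_grad_lip[OF sm[OF wD] \<rho>0 L0 x \<gamma>c] enorm_diff[OF gcar[OF wD x] gcar[OF wD \<gamma>c]] by (intro sum_norm_le) simp
      ultimately show ?thesis using N0 by (simp add: field_simps)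
    qed
    have lipf: "norm (fv (gE x) - fv (gE \<gamma>)) \<le> L * enorm (x - \<gamma>)"
      using vec_grad_lip[OF smooth_expect \<rho>0 L0 x \<gamma>c] gE_carrier x \<gamma>c by (simp add: grad_expect enorm_diff[of _ d])
    have near: "norm (mn \<gamma> - fv (gE \<gamma>)) \<le> \<kappa> / 2"
    proof -
      define v where "v = tv d (mn \<gamma> - fv (gE \<gamma>))"
      have vj: "v $ j = (\<Sum>k<N. grad d (F (w k)) \<gamma> $ j) / real N - gE \<gamma> $ j" if "j < d" for j
        using that gcar[OF wD \<gamma>c] gE_carrier[of \<gamma>]
        by (simp add: v_def tv_def coord_simps mn_def coord_sum coord_fv carrier_vecD[OF gcar[OF wD \<gamma>c]] carrier_vecD[OF gE_carrier])
      have fvv: "fv v = mn \<gamma> - fv (gE \<gamma>)"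
        by (rule fvec_eqI)
           (auto simp: v_def coord_fv tv_def coord_simps mn_def coord_sum carrier_vecD[OF gcar[OF wD \<gamma>c]] carrier_vecD[OF gE_carrier])
      have "norm (fv v) \<le> (\<Sum>j<d. \<bar>v $ j\<bar>)" by (rule norm_le_coords) (simp add: v_def)
      also have "\<dots> \<le> (\<Sum>j<d. t)"
      proof (rule sum_mono)
        fix j assume "j \<in> {..<d}"
        then have "(\<gamma>, j) \<in> I" "j < d" using \<gamma> by (auto simp: I_def)
        then show "\<bar>v $ j\<bar> \<le> t" using w unfolding vj[OF \<open>j < d\<close>] E_def bad_def by force
      qed
      also have "\<dots> = \<kappa> / 2" using d by (simp add: t_def)
      finally show ?thesis by (simp add: fvv)
    qed
    have "norm (mn x - fv (gE x)) \<le> norm (mn x - mn \<gamma>) + norm (mn \<gamma> - fv (gE \<gamma>)) + norm (fv (gE x) - fv (gE \<gamma>))"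
      using norm_triangle_ineq[of "mn x - mn \<gamma>" "mn \<gamma> - fv (gE \<gamma>)"] norm_triangle_ineq4[of "mn x - fv (gE \<gamma>)" "fv (gE x) - fv (gE \<gamma>)"] by simp
    also have "\<dots> \<le> L * enorm (x - \<gamma>) + \<kappa> / 2 + L * enorm (x - \<gamma>)" using lipm lipf near by (intro add_mono)
    also have "L * enorm (x - \<gamma>) \<le> (L + 1) * (real d * mesh d L \<kappa>)" using \<gamma>(2) L0 enorm_nonneg by (intro mult_mono) auto
    also have "(L + 1) * (real d * mesh d L \<kappa>) = \<kappa> / 4"
    proof -
      define Z where "Z = (L + 1) * real d"
      have "Z > 0" using L0 d by (simp add: Z_def)
      then have "Z * (\<kappa> / (4 * Z)) = \<kappa> / 4" by simp
      then show ?thesis by (simp only: Z_def mesh_def mult.assoc)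
    qed
    finally have "norm (mn x - fv (gE x)) \<le> \<kappa>" by simp
    then show ?thesis unfolding gF_expect by (simp add: gF_def mn_def x_def)
  qed
  ultimately show ?thesis by blast
qed

end

section \<open>The algorithm\<close>

lemma answers_stable:
  "alg s (answers alg s G t) = Output x \<Longrightarrow> answers alg s G (t + k) = answers alg s G t"
  by (induction k) auto

lemma outputs_unique:
  assumes "outputs_within alg s G B x" "outputs_within alg s G B' y" shows "x = y"
proof -
  obtain t u where t: "alg s (answers alg s G t) = Output x" and u: "alg s (answers alg s G u) = Output y"
    using assms by (auto simp: outputs_within_def)
  have "answers alg s G (t + u) = answers alg s G t" "answers alg s G (u + t) = answers alg s G u"
    using answers_stable t u by metis+
  then show ?thesis using t u by (simp add: add.commute)
qed

text \<open>An output freezes the list of answers, so outputs are unique and success within the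
  budget is a property of \<open>res\<close> alone, whose law is known.\<close>

lemma exec_success:
  assumes "costs P b" "real b \<le> B"
  shows "(\<exists>x. outputs_within (exec out cv P) s orc B x \<and> Q x) \<longleftrightarrow> Q (out (res (\<lambda>i x. cv (orc i (out x))) P s))"
  using exec_outputs[OF assms, of out cv s orc] outputs_unique by metis

definition run :: "nat \<Rightarrow> nat \<Rightarrow> bool \<Rightarrow> real \<Rightarrow> real \<Rightarrow> real \<Rightarrow> real \<Rightarrow> real \<Rightarrow> real vec \<Rightarrow> algorithm" where
  "run d m full c \<epsilon> \<delta> La \<tau> x0 = exec (tv d) (rnd d (\<tau>\<^sup>2 / real d)) (search_params.searchP m d bas c \<epsilon> \<delta> La \<tau> full (fv x0))"

lemma (in search_consts) search_cost_full:
  assumes full and l: "La \<le> 2 * l"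
  shows "real (Rn * nat \<lceil>once_cost\<rceil>) \<le> 10 ^ 16 * (c ^ 7 * k1 ^ 5) * l ^ 6 *
    (sqrt (real (Suc m)) / \<epsilon>\<^sup>2 + sqrt (real (Suc m)) / (\<epsilon> * \<delta>\<^sup>2) + real (Suc m) + 1 / \<delta> ^ 5)"
proof -
  have s: "shape \<ge> 0" unfolding shape_full[OF assms(1)] using eps del by simp
  have "c ^ 5 * k1 ^ 3 * La ^ 4 \<le> c ^ 7 * k1 ^ 5 * La ^ 6"
    using c1 k1 La1 by (intro mult_mono power_increasing) auto
  also have "La ^ 6 \<le> (2 * l) ^ 6" using La1 l by (intro power_mono) auto
  finally have "c ^ 5 * k1 ^ 3 * La ^ 4 \<le> 64 * (c ^ 7 * k1 ^ 5 * l ^ 6)"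
    using c1 k1 by (simp add: power_mult_distrib)
  then have "10000000000 * (c ^ 5 * k1 ^ 3 * La ^ 4) * shape \<le> 10000000000 * (64 * (c ^ 7 * k1 ^ 5 * l ^ 6)) * shape"
    using s by (intro mult_right_mono mult_left_mono) auto
  also have "\<dots> \<le> 10 ^ 16 * (c ^ 7 * k1 ^ 5) * l ^ 6 * shape"
    using s c1 k1 La1 l by (simp add: mult.assoc)
  finally show ?thesis using search_cost unfolding shape_full[OF assms(1)] by linarith
qed

lemma (in search_consts) search_cost_sampled:
  assumes nf: "\<not> full" and l: "La \<le> 2 * l"
  shows "real (Rn * nat \<lceil>once_cost\<rceil>) \<le> 10 ^ 16 * (c ^ 7 * k1 ^ 5) * l ^ 6 *
    (1 / \<epsilon> ^ 3 + 1 / (\<epsilon>\<^sup>2 * \<delta>\<^sup>2) + 1 / \<delta> ^ 5)"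
proof -
  define S where "S = 1 / \<epsilon> ^ 3 + 1 / (\<epsilon>\<^sup>2 * \<delta>\<^sup>2) + 1 / \<delta> ^ 5"
  have S: "S \<ge> 0" unfolding S_def using eps del by simp
  have "10000000000 * (c ^ 5 * k1 ^ 3 * La ^ 4) * shape \<le> 10000000000 * (c ^ 5 * k1 ^ 3 * La ^ 4) * (10000 * (c\<^sup>2 * k1\<^sup>2 * La\<^sup>2) * S)"
    using shape_sampled[OF nf] c1 k1 La1 by (intro mult_left_mono) (auto simp: S_def)
  also have "\<dots> = 10 ^ 14 * (c ^ 7 * k1 ^ 5) * S * La ^ 6" by (simp add: eval_nat_numeral)
  also have "\<dots> \<le> 10 ^ 14 * (c ^ 7 * k1 ^ 5) * S * (2 * l) ^ 6"
    using La1 l c1 k1 S by (intro mult_left_mono power_mono) auto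
  also have "\<dots> \<le> 10 ^ 16 * (c ^ 7 * k1 ^ 5) * l ^ 6 * S"
    using S c1 k1 La1 l by (simp add: power_mult_distrib mult.assoc mult_left_mono mult_nonneg_nonneg mult.left_commute)
  finally show ?thesis using search_cost unfolding S_def by linarith
qed

theorem (in vec_problem) measure_run:
  assumes B: "real (Rn * nat \<lceil>once_cost\<rceil>) \<le> B"
  shows "measure random_bits {s \<in> space random_bits.
      \<exists>x. outputs_within (run d m full c \<epsilon> \<delta> La tau x0) s orc B x \<and> approx_sosp d f \<epsilon> \<delta> x} \<ge> 1 - p"
proof -
  let ?Q = "\<lambda>z. approx_sosp d f \<epsilon> \<delta> (tv d z)"
  have G: "(\<lambda>i x. rnd d (tau\<^sup>2 / real d) (orc i (tv d x))) = Go" by (simp add: Go_def fun_eq_iff)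
  have "{s \<in> space random_bits. \<exists>x. outputs_within (run d m full c \<epsilon> \<delta> La tau x0) s orc B x \<and> approx_sosp d f \<epsilon> \<delta> x}
      = {s. ?Q (res Go (searchP (fv x0)) s)}"
    unfolding run_def exec_success[OF costs_searchP B] G by (simp add: space_random_bits)
  moreover have "ev Go (searchP (fv x0)) (\<lambda>z. of_bool (?Q z)) = ev Go (searchP (fv x0)) (\<lambda>z. 1 - of_bool (\<not> ?Q z))"
    by (rule arg_cong[where f = "ev Go (searchP (fv x0))"]) auto
  ultimately show ?thesis
    using measure_res[of ?Q Go "searchP (fv x0)"] vec_search_fails by (simp add: ev_diff ev_const)
qed

lemma initial_gap_le: "initial_gap d f x0 \<Delta> \<Longrightarrow> x \<in> carrier_vec d \<Longrightarrow> f x0 - f x \<le> \<Delta>"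
  using cINF_lower[of f "carrier_vec d" x] by (auto simp: initial_gap_def)

lemma bounded_deviation_le:
  assumes "bounded_deviation d I F f \<sigma>" "\<sigma> \<ge> 0" "i \<in> I" "x \<in> carrier_vec d"
  shows "enorm (grad d (F i) x - grad d f x) \<le> \<sigma>"
proof (rule power2_le_imp_le)
  show "(enorm (grad d (F i) x - grad d f x))\<^sup>2 \<le> \<sigma>\<^sup>2" using assms by (simp add: bounded_deviation_def)
qed (use assms in simp)

text \<open>A single constant c that dominates 4L, 3 \<rho> + 4, \<Delta> and \<sigma>
  simultaneously.\<close>

definition scale :: "real \<Rightarrow> real \<Rightarrow> real \<Rightarrow> real \<Rightarrow> real" where "scale \<Delta> L \<rho> \<sigma> = 4 * (1 + \<Delta> + L + \<rho> + \<sigma>)"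

text \<open>The search is run with failure p/2; in the on-line case the other half is spent on the
  sample.\<close>

definition La_of :: "nat \<Rightarrow> real \<Rightarrow> real \<Rightarrow> real \<Rightarrow> real" where
  "La_of d \<epsilon> \<delta> p = 1 + ln (real d) - ln \<epsilon> - ln \<delta> - ln (p / 2)"

definition cost_const :: "real \<Rightarrow> real" where "cost_const c = 10 ^ 16 * (c ^ 7 * (60 + 7 * c) ^ 5)"

lemma ln2_le_1: "ln (2 :: real) \<le> 1" using ln_le_minus_one[of 2] by simp

lemma La_of_le:
  assumes "d \<ge> 1" "0 < \<epsilon>" "\<epsilon> < 1" "0 < \<delta>" "\<delta> < 1" "0 < p" "p < 1"
  shows "La_of d \<epsilon> \<delta> p \<le> 2 * log_factor [real d, \<epsilon>, \<delta>, p]"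
    and "La_of d \<epsilon> \<delta> p \<le> 2 * log_factor [real d, real n, \<epsilon>, \<delta>, p]"
proof -
  have "ln (real d) \<ge> 0" "ln \<epsilon> \<le> 0" "ln \<delta> \<le> 0" "ln p \<le> 0" "ln (p / 2) = ln p - ln 2"
    using assms by (auto simp: ln_div)
  then show "La_of d \<epsilon> \<delta> p \<le> 2 * log_factor [real d, \<epsilon>, \<delta>, p]"
    "La_of d \<epsilon> \<delta> p \<le> 2 * log_factor [real d, real n, \<epsilon>, \<delta>, p]"
    using ln2_le_1 by (auto simp: La_of_def log_factor_def)
qed

locale accuracies =
  fixes d :: nat and \<epsilon> \<delta> p \<Delta> L \<rho> \<sigma> c La :: real
  assumes d: "d \<ge> 1" and eps: "0 < \<epsilon>" "\<epsilon> < 1" and del: "0 < \<delta>" "\<delta> < 1" and p: "0 < p" "p < 1"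
    and pos: "\<Delta> \<ge> 0" "L \<ge> 0" "\<rho> \<ge> 0" "\<sigma> \<ge> 0"
    and c: "c = scale \<Delta> L \<rho> \<sigma>" and La: "La = La_of d \<epsilon> \<delta> p"
begin

abbreviation prec :: real where "prec \<equiv> tau_of d c \<epsilon> \<delta> La"

lemma c_ge: "c \<ge> 1" "4 * L \<le> c" "3 * \<rho> + 4 \<le> c" "\<Delta> \<le> c" "\<sigma> \<le> c" using pos by (auto simp: c scale_def)

lemma half: "search_consts d c \<epsilon> \<delta> La (p / 2)"
  by unfold_locales (use d eps del p c_ge in \<open>auto simp: La La_of_def\<close>)

lemma tau_pos: "prec > 0"
proof -
  interpret search_consts 0 d bas c \<epsilon> \<delta> La prec False "p / 2" using half .
  have T: "0 < Tn" using Jn(2) by (simp add: Tn_def)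
  have "64 * c * (real Tn * 2 ^ Tn) * (real d)\<^sup>2 > 0" using c_ge(1) d T by (intro mult_pos_pos) auto
  then show ?thesis unfolding tau_of_def using eps del by (intro divide_pos_pos) auto
qed

end

subsection \<open>Finite sums\<close>

lemma expect_uniform: "n \<ge> 1 \<Longrightarrow> expect (uniform_count_measure {..<n}) F = avg n F"
  by (rule ext) (simp add: expect_def avg_def integral_uniform_count_measure)

text \<open>A finite sum is an expectation under the uniform distribution, so smoothness of the
  average and its gradient need no separate proof.\<close>

lemma smooth_family_uniform:
  fixes n :: nat
  assumes "n \<ge> 1" "\<And>i. i < n \<Longrightarrow> smooth1 d (F i) L \<rho>" "L \<ge> 0" "\<rho> \<ge> 0"
  shows "smooth_family (uniform_count_measure {..<n}) F d L \<rho>"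
proof (intro smooth_family.intro smooth_family_axioms.intro)
  show "prob_space (uniform_count_measure {..<n})" using assms by (intro prob_space_uniform_count_measure) (auto simp: lessThan_empty_iff)
qed (use assms in \<open>auto simp: space_uniform_count_measure uniform_count_measure_def integrable_point_measure_finite space_point_measure\<close>)

lemma gF_avg:
  assumes "n \<ge> 1" "\<And>i. i < n \<Longrightarrow> smooth1 d (F i) L \<rho>" "L \<ge> 0" "\<rho> \<ge> 0"
  shows "gF d (avg n F) z = (1 / real n) *\<^sub>R (\<Sum>i<n. gF d (F i) z)"
proof -
  interpret smooth_family "uniform_count_measure {..<n}" F d L \<rho> by (rule smooth_family_uniform[OF assms])
  have g: "dim_vec (grad d (F i) (tv d z)) = d" if "i < n" for i
    using that by (intro gdim) (auto simp: space_uniform_count_measure)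
  have e: "gF d (avg n F) z = fv (gE (tv d z))" using gF_expect[of z] assms(1) by (simp add: expect_uniform)
  show ?thesis unfolding e
    by (rule fvec_eqI)
      (auto simp: coord_fv gE_def coord_simps coord_sum gF_def g integral_uniform_count_measure sum_divide_distrib)
qed

text \<open>Without \<open>full\<close> the finite sum is treated like an on-line problem: batches
  are sampled, and \<sigma> bounds the deviation of the components.\<close>

lemma (in accuracies) finite_sum_run:
  assumes n: "n \<ge> 1" and prob: "finite_sum_problem d n F x0 \<Delta> L \<rho>"
    and dev: "full \<or> bounded_deviation d {..<n} F (avg n F) \<sigma>"
    and l: "La \<le> 2 * l"
    and B: "cost_const c * l ^ 6 * (if full then sqrt (real n) / \<epsilon>\<^sup>2 + sqrt (real n) / (\<epsilon> * \<delta>\<^sup>2) + real n + 1 / \<delta> ^ 5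
       else 1 / \<epsilon> ^ 3 + 1 / (\<epsilon>\<^sup>2 * \<delta>\<^sup>2) + 1 / \<delta> ^ 5) \<le> B"
  shows "finite_sum_finds (run d (n - 1) full c \<epsilon> \<delta> La prec x0) d n F \<epsilon> \<delta> p B"
proof -
  have sm: "smooth1 d (F i) L \<rho>" if "i < n" for i
    using prob that by (auto simp: finite_sum_problem_def smooth_components_iff)
  have gap: "initial_gap d (avg n F) x0 \<Delta>" using prob by (simp add: finite_sum_problem_def)
  then have x0: "x0 \<in> carrier_vec d" by (simp add: initial_gap_def)
  interpret sf: smooth_family "uniform_count_measure {..<n}" F d L \<rho>
    by (rule smooth_family_uniform[OF n sm pos(2,3)])
  have smf: "smooth1 d (avg n F) L \<rho>" using sf.smooth_expect n by (simp add: expect_uniform)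
  have gf: "gF d (avg n F) z = (1 / real n) *\<^sub>R (\<Sum>i<n. gF d (F i) z)" for z by (rule gF_avg[OF n sm pos(2,3)])
  have n1: "Suc (n - 1) = n" using n by simp
  have ne: "{..n - 1} = {..<n}" using n by auto
  let ?orc = "\<lambda>k y. if k < n then grad d (F k) y else 0\<^sub>v d"
  interpret sc: search_consts "n - 1" d bas c \<epsilon> \<delta> La prec full "p / 2" using half .
  interpret vec_problem "n - 1" d c \<epsilon> \<delta> La full "p / 2" F "avg n F" x0 L \<rho> \<Delta> ?orc
  proof unfold_locales
    show "norm ((1 / real (Suc (n - 1))) *\<^sub>R (\<Sum>i\<le>n - 1. gF d (F i) z) - gF d (avg n F) z) \<le> prec\<^sup>2" for z
      unfolding n1 ne gf by simp
    fix i z assume i: "i \<le> n - 1" and "\<not> full"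
    then have bd: "bounded_deviation d {..<n} F (avg n F) \<sigma>" using dev by simp
    have "norm (gF d (F i) z - gF d (avg n F) z) = enorm (grad d (F i) (tv d z) - grad d (avg n F) (tv d z))"
      unfolding gF_def using i n grad_carrier[OF smooth1_td[OF smf pos(3,2)]] grad_carrier[OF smooth1_td[OF sm pos(3,2)], of i]
      by (intro enorm_diff[of _ d, symmetric]) auto
    also have "\<dots> \<le> \<sigma>" using i n by (intro bounded_deviation_le[OF bd pos(4)]) auto
    finally show "norm (gF d (F i) z - (1 / real (Suc (n - 1))) *\<^sub>R (\<Sum>i\<le>n - 1. gF d (F i) z)) \<le> 2 * c"
      unfolding n1 ne gf using c_ge by linarith
  qed (use c_ge pos smf sm x0 n initial_gap_le[OF gap] in auto)
  have "real (sc.Rn * nat \<lceil>sc.once_cost\<rceil>) \<le> B"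
  proof (cases full)
    case True
    show ?thesis using sc.search_cost_full[OF True l] B unfolding if_P[OF True] n1 cost_const_def sc.k1_def by linarith
  next
    case False
    show ?thesis using sc.search_cost_sampled[OF False l] B unfolding if_not_P[OF False] cost_const_def sc.k1_def by linarith
  qed
  from measure_run[OF this] show ?thesis unfolding finite_sum_finds_def using p by linarith
qed

subsection \<open>Independent samples\<close>

text \<open>Two rounded vectors agree iff finitely many floors do, so measurability of the gradient
  coordinates suffices.\<close>

lemma (in smooth_family) sets_rounded_grad:
  assumes y: "y \<in> carrier_vec d"
  shows "{w \<in> space samples. rnd d r (grad d (F (w i)) y) = z} \<in> sets samples"
proof (cases "z \<in> range (rnd d r)")
  case True
  then obtain v where v: "z = rnd d r v" by auto
  have "{w \<in> space samples. rnd d r (grad d (F (w i)) y) = z} =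
    {w \<in> space samples. \<forall>j\<in>{..<d}. r * of_int \<lfloor>grad d (F (w i)) y $ j / r\<rfloor> = r * of_int \<lfloor>v $ j / r\<rfloor>}"
    by (auto simp: v rnd_def fv_eq_iff[of _ d] vec_eq_iff)
  also have "\<dots> \<in> sets samples"
  proof (rule sets.sets_Collect_finite_All)
    fix j assume "j \<in> {..<d}"
    then have [measurable]: "(\<lambda>i. grad d (F i) y $ j) \<in> borel_measurable D" using int1[OF y] by auto
    show "{w \<in> space samples. r * of_int \<lfloor>grad d (F (w i)) y $ j / r\<rfloor> = r * of_int \<lfloor>v $ j / r\<rfloor>} \<in> sets samples"
      by measurable
  qed simp
  finally show ?thesis .
next
  case False
  then have "{w \<in> space samples. rnd d r (grad d (F (w i)) y) = z} = {}" by blast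
  then show ?thesis by (simp only: sets.empty_sets)
qed

text \<open>For samples in the good event E the first Suc m components form a finite sum that
  imitates f on the ball, and the search succeeds with conditional probability at least 1 - p/2.
  Integration over the samples gives (1 - p/2)^2 \<ge> 1 - p. The size of m does not enter the cost,
  since sampled batches never run through all components.\<close>

lemma (in accuracies) online_run:
  assumes prob: "online_problem d D F x0 \<Delta> L \<sigma> \<rho>" and \<sigma>: "\<sigma> > 0"
    and m: "m = sample_size d L \<sigma> (search_params.radius c \<epsilon> \<delta> + 1) (prec\<^sup>2) (p / 2) - 1"
    and l: "La \<le> 2 * l"
    and B: "cost_const c * l ^ 6 * (1 / \<epsilon> ^ 3 + 1 / (\<epsilon>\<^sup>2 * \<delta>\<^sup>2) + 1 / \<delta> ^ 5) \<le> B"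
  shows "online_finds (run d m False c \<epsilon> \<delta> La prec x0) d D F \<epsilon> \<delta> p B"
proof -
  interpret D: prob_space D using prob by (simp add: online_problem_def)
  interpret sf: smooth_family D F d L \<rho>
    by unfold_locales (use prob pos in \<open>auto simp: online_problem_def smooth_components_iff\<close>)
  interpret S: prob_space sf.samples by (rule sf.prob_space_samples)
  have gap: "initial_gap d (expect D F) x0 \<Delta>" using prob by (simp add: online_problem_def)
  then have x0: "x0 \<in> carrier_vec d" by (simp add: initial_gap_def)
  have bd: "bounded_deviation d (space D) F (expect D F) \<sigma>" using prob by (simp add: online_problem_def)
  interpret sc: search_consts m d bas c \<epsilon> \<delta> La prec False "p / 2" using half .
  let ?N = "Suc m" and ?R = "sc.radius + 1"
  have N: "?N = sample_size d L \<sigma> ?R (prec\<^sup>2) (p / 2)" by (simp add: m sample_size_def)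
  have R: "?R \<ge> 0" using sc.sj by (simp add: sc.radius_def)
  have dev: "enorm (grad d (F i) x - sf.gE x) \<le> \<sigma>" if "i \<in> space D" "x \<in> carrier_vec d" for i x
    using bounded_deviation_le[OF bd pos(4) that] that by (simp add: sf.grad_expect)
  obtain E where E: "E \<in> sets sf.samples" "measure sf.samples E \<ge> 1 - p / 2"
    and close: "\<And>w z. w \<in> E \<Longrightarrow> norm (z - fv x0) \<le> ?R \<Longrightarrow>
       norm ((1 / real ?N) *\<^sub>R (\<Sum>k<?N. gF d (F (w k)) z) - gF d (expect D F) z) \<le> prec\<^sup>2"
    using sf.sample_mean_uniform[OF dev \<sigma> d _ _ x0 R N] tau_pos p by auto
  have Es: "w k \<in> space D" if "w \<in> E" for w k
    using sets.sets_into_space[OF E(1)] that by (auto simp: space_PiM)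
  define alg where "alg = run d m False c \<epsilon> \<delta> La prec x0"
  define orc where "orc = (\<lambda>\<iota> (k::nat) y. grad d (F (\<iota> k)) y)"
  define suc where "suc = (\<lambda>s \<iota>. \<exists>x. outputs_within alg s (orc \<iota>) B x \<and> approx_sosp d (expect D F) \<epsilon> \<delta> x)"
  have cost: "real (sc.Rn * nat \<lceil>sc.once_cost\<rceil>) \<le> B"
    using sc.search_cost_sampled[OF _ l] B unfolding cost_const_def sc.k1_def by simp
  have good: "measure random_bits {s \<in> space random_bits. suc s w} \<ge> 1 - p / 2" if w: "w \<in> E" for w
  proof -
    interpret vec_problem m d c \<epsilon> \<delta> La False "p / 2" "\<lambda>k. F (w k)" "expect D F" x0 L \<rho> \<Delta> "orc w"
    proof unfold_locales
      fix z assume "norm (z - fv x0) \<le> ?R"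
      then show "norm ((1 / real ?N) *\<^sub>R (\<Sum>i\<le>m. gF d (F (w i)) z) - gF d (expect D F) z) \<le> prec\<^sup>2"
        using close[OF w] by (simp only: lessThan_Suc_atMost)
    next
      fix i and z :: fvec
      have tri: "norm (gF d (F (w i)) z - gF d (F (w k)) z) \<le> 2 * c" for k
      proof -
        have "norm (gF d (F (w k)) z - gF d (expect D F) z) \<le> \<sigma>" for k
          using dev[OF Es[OF w], of "tv d z"] sf.gcar[OF Es[OF w], of "tv d z"] sf.gE_carrier
          by (simp add: gF_def sf.grad_expect enorm_diff[of _ d])
        from this[of i] this[of k] show ?thesis using c_ge(5)
          norm_triangle_ineq4[of "gF d (F (w i)) z - gF d (expect D F) z" "gF d (F (w k)) z - gF d (expect D F) z"] by simp
      qed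
      have "gF d (F (w i)) z - (1 / real (Suc m)) *\<^sub>R (\<Sum>i\<le>m. gF d (F (w i)) z)
         = (1 / real (Suc m)) *\<^sub>R (\<Sum>k\<le>m. gF d (F (w i)) z - gF d (F (w k)) z)"
        by (simp add: sum_subtractf scaleR_diff_right sum_constant_scaleR del: of_nat_Suc)
      also have "norm \<dots> \<le> 1 / real (Suc m) * (\<Sum>k\<le>m. 2 * c)"
        unfolding norm_scaleR using tri by (intro mult_mono sum_norm_le) auto
      finally show "norm (gF d (F (w i)) z - (1 / real (Suc m)) *\<^sub>R (\<Sum>i\<le>m. gF d (F (w i)) z)) \<le> 2 * c" by simp
    qed (use c_ge pos sf.smooth_expect sf.sm[OF Es[OF w]] x0 initial_gap_le[OF gap] in \<open>auto simp: orc_def\<close>)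
    show ?thesis unfolding suc_def alg_def by (rule measure_run[OF cost])
  qed
  let ?P = "random_bits \<Otimes>\<^sub>M sf.samples"
  define U where "U = {(s, w) \<in> space ?P. suc s w}"
  define G where "G = (\<lambda>w i x. rnd d (prec\<^sup>2 / real d) (orc w i (tv d x)))"
  have U: "U \<in> sets ?P"
  proof -
    have "U = {(s, w) \<in> space ?P. approx_sosp d (expect D F) \<epsilon> \<delta> (tv d (res (G w) (sc.searchP (fv x0)) s))}"
      unfolding U_def suc_def alg_def run_def exec_success[OF sc.costs_searchP cost] G_def ..
    also have "\<dots> \<in> sets ?P"
    proof (rule sets_res_joint[OF countable_rnd[of d "prec\<^sup>2 / real d"]])
      show "G w i x \<in> range (rnd d (prec\<^sup>2 / real d))" for w i x unfolding G_def by (rule rangeI)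
      show "{w \<in> space sf.samples. G w i x = r} \<in> sets sf.samples" for i x r
        unfolding G_def orc_def by (rule sf.sets_rounded_grad) simp
    qed
    finally show ?thesis .
  qed
  interpret PP: pair_prob_space random_bits sf.samples ..
  have "ennreal ((1 - p / 2) * (1 - p / 2)) \<le> ennreal ((1 - p / 2) * measure sf.samples E)"
    using E(2) p by (intro ennreal_leI mult_left_mono) auto
  also have "\<dots> = ennreal (1 - p / 2) * emeasure sf.samples E"
    using p by (subst ennreal_mult) (auto simp: S.emeasure_eq_measure)
  also have "\<dots> = (\<integral>\<^sup>+w. ennreal (1 - p / 2) * indicator E w \<partial>sf.samples)"
    by (rule nn_integral_cmult_indicator[OF E(1), symmetric])
  also have "\<dots> \<le> (\<integral>\<^sup>+w. emeasure random_bits ((\<lambda>s. (s, w)) -` U) \<partial>sf.samples)"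
  proof (rule nn_integral_mono)
    fix w assume ws: "w \<in> space sf.samples"
    have "(\<lambda>s. (s, w)) -` U = {s \<in> space random_bits. suc s w}"
      using ws by (auto simp: U_def space_pair_measure)
    then show "ennreal (1 - p / 2) * indicator E w \<le> emeasure random_bits ((\<lambda>s. (s, w)) -` U)"
      using good[of w] by (auto simp: indicator_def rb.emeasure_eq_measure intro!: ennreal_leI)
  qed
  also have "\<dots> = emeasure ?P U" by (rule PP.emeasure_pair_measure_alt2[OF U, symmetric])
  also have "\<dots> = ennreal (measure ?P U)" by (rule PP.emeasure_eq_measure)
  finally have "(1 - p / 2) * (1 - p / 2) \<le> measure ?P U" using measure_nonneg by (simp add: ennreal_le_iff)
  moreover have "1 - p \<le> (1 - p / 2) * (1 - p / 2)" using p by (simp add: algebra_simps)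
  ultimately have "1 - p \<le> measure ?P U" by linarith
  then show ?thesis by (simp add: online_finds_def U_def suc_def alg_def orc_def)
qed

section \<open>Complexity\<close>

text \<open>Full batches are used if no deviation bound is given, or if n \<le> 1/\<epsilon>^2,
  where they are smaller than the sampled ones. The index bounds are \<open>n - 1\<close> and
  \<open>sample_size - 1\<close> because indices are drawn from 0..m.\<close>

definition solver :: "params \<Rightarrow> algorithm" where
  "solver P = (let d = dimension P; \<epsilon> = accuracy P; \<delta> = curvature P; L = grad_lipschitz P;
      \<sigma> = (case deviation P of None \<Rightarrow> 0 | Some s \<Rightarrow> s);
      c = scale (gap P) L (hess_lipschitz P) \<sigma>; La = La_of d \<epsilon> \<delta> (failure P); \<tau> = tau_of d c \<epsilon> \<delta> La
    in case components P of
      None \<Rightarrow> run d (sample_size d L \<sigma> (search_params.radius c \<epsilon> \<delta> + 1) (\<tau>\<^sup>2) (failure P / 2) - 1) False c \<epsilon> \<delta> La \<tau> (start P)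
    | Some n \<Rightarrow> run d (n - 1) (deviation P = None \<or> real n \<le> 1 / \<epsilon>\<^sup>2) c \<epsilon> \<delta> La \<tau> (start P))"

definition sampled_bound :: "real \<Rightarrow> real \<Rightarrow> real" where
  "sampled_bound \<epsilon> \<delta> = 1 / \<epsilon> ^ 3 + 1 / (\<epsilon>\<^sup>2 * \<delta>\<^sup>2) + 1 / \<delta> ^ 5"

definition full_bound :: "nat \<Rightarrow> real \<Rightarrow> real \<Rightarrow> real" where
  "full_bound n \<epsilon> \<delta> = sqrt (real n) / \<epsilon>\<^sup>2 + sqrt (real n) / (\<epsilon> * \<delta>\<^sup>2) + real n + 1 / \<delta> ^ 5"

lemma scale_ge_1: "\<Delta> \<ge> 0 \<Longrightarrow> L \<ge> 0 \<Longrightarrow> \<rho> \<ge> 0 \<Longrightarrow> \<sigma> \<ge> 0 \<Longrightarrow> scale \<Delta> L \<rho> \<sigma> \<ge> 1"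
  by (simp add: scale_def)

lemma cost_const_nonneg: "c \<ge> 0 \<Longrightarrow> cost_const c \<ge> 0" by (simp add: cost_const_def)

lemma log_factor_nonneg: "log_factor xs \<ge> 0"
  unfolding log_factor_def by (intro add_nonneg_nonneg sum_list_nonneg) auto

lemma solver_online:
  assumes r: "d \<ge> 1" "0 < \<epsilon>" "\<epsilon> < 1" "0 < \<delta>" "\<delta> < 1" "0 < p" "p < 1" and pos0: "\<Delta> > 0" "L > 0" "\<sigma> > 0" "\<rho> > 0"
    and prob: "online_problem d D F x0 \<Delta> L \<sigma> \<rho>"
    and B: "cost_const (scale \<Delta> L \<rho> \<sigma>) * log_factor [real d, \<epsilon>, \<delta>, p] ^ 6 * sampled_bound \<epsilon> \<delta> \<le> B"
  shows "online_finds (solver \<lparr>dimension = d, components = None, start = x0, gap = \<Delta>, grad_lipschitz = L,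
     deviation = Some \<sigma>, hess_lipschitz = \<rho>, accuracy = \<epsilon>, curvature = \<delta>, failure = p\<rparr>) d D F \<epsilon> \<delta> p B"
proof -
  interpret accuracies d \<epsilon> \<delta> p \<Delta> L \<rho> \<sigma> "scale \<Delta> L \<rho> \<sigma>" "La_of d \<epsilon> \<delta> p"
    by unfold_locales (use r pos0 in auto)
  show ?thesis using online_run[OF prob pos0(3) refl La_of_le(1)[OF r] B[unfolded sampled_bound_def]]
    by (simp add: solver_def Let_def)
qed

lemma solver_finite_sum:
  assumes r: "d \<ge> 1" "0 < \<epsilon>" "\<epsilon> < 1" "0 < \<delta>" "\<delta> < 1" "0 < p" "p < 1" and pos0: "\<Delta> > 0" "L > 0" "\<rho> > 0"
    and n: "n \<ge> 1" and prob: "finite_sum_problem d n F x0 \<Delta> L \<rho>"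
    and \<sigma>: "\<sigma> = (case s of None \<Rightarrow> 0 | Some s \<Rightarrow> s)" "\<sigma> \<ge> 0"
    and dev: "\<And>s'. s = Some s' \<Longrightarrow> bounded_deviation d {..<n} F (avg n F) s'"
    and full: "full \<longleftrightarrow> s = None \<or> real n \<le> 1 / \<epsilon>\<^sup>2"
    and B: "cost_const (scale \<Delta> L \<rho> \<sigma>) * log_factor [real d, real n, \<epsilon>, \<delta>, p] ^ 6 *
      (if full then full_bound n \<epsilon> \<delta> else sampled_bound \<epsilon> \<delta>) \<le> B"
  shows "finite_sum_finds (solver \<lparr>dimension = d, components = Some n, start = x0, gap = \<Delta>, grad_lipschitz = L,
     deviation = s, hess_lipschitz = \<rho>, accuracy = \<epsilon>, curvature = \<delta>, failure = p\<rparr>) d n F \<epsilon> \<delta> p B"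
proof -
  interpret accuracies d \<epsilon> \<delta> p \<Delta> L \<rho> \<sigma> "scale \<Delta> L \<rho> \<sigma>" "La_of d \<epsilon> \<delta> p"
    by unfold_locales (use r pos0 \<sigma> in auto)
  have "full \<or> bounded_deviation d {..<n} F (avg n F) \<sigma>" using dev full \<sigma> by (cases s) auto
  from finite_sum_run[OF n prob this La_of_le(2)[OF r] B[unfolded sampled_bound_def full_bound_def]]
  show ?thesis by (simp add: solver_def Let_def \<sigma>(1) full)
qed

lemma powr_eqs:
  assumes "(x::real) > 0"
  shows "x powr (-1) = 1 / x" "x powr (-2) = 1 / x\<^sup>2" "x powr (-3) = 1 / x ^ 3" "x powr (-5) = 1 / x ^ 5"
    "x powr (1/2) = sqrt x" "x powr (-5/2) = 1 / sqrt x ^ 5"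
proof -
  show "x powr (-1) = 1 / x" "x powr (-2) = 1 / x\<^sup>2" "x powr (-3) = 1 / x ^ 3" "x powr (-5) = 1 / x ^ 5"
    using assms by (simp_all add: powr_minus_divide)
  show h: "x powr (1/2) = sqrt x" using assms by (simp add: powr_half_sqrt)
  have "sqrt x ^ 5 = (x powr (1/2)) powr 5" using assms unfolding h by simp
  also have "\<dots> = x powr (5/2)" by (simp add: powr_powr)
  finally show "x powr (-5/2) = 1 / sqrt x ^ 5" using powr_minus_divide[of x "5/2"] by simp
qed

section \<open>Comparison of the bounds for \<delta> of order sqrt \<epsilon>\<close>

lemma curvature_terms:
  fixes s c1 \<delta> :: real
  assumes s: "0 < s" "s < 1" and c1: "c1 > 0" and \<delta>: "c1 * s \<le> \<delta>"
  shows "1 / \<delta>\<^sup>2 \<le> 1 / c1\<^sup>2 * (1 / s\<^sup>2)" "1 / \<delta> ^ 5 \<le> 1 / c1 ^ 5 * (1 / s ^ 5)"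
proof -
  have "c1 * s > 0" using s c1 by simp
  then have "\<delta> > 0" using \<delta> by linarith
  then have "1 / \<delta> ^ k \<le> 1 / (c1 * s) ^ k" for k
    using s c1 \<delta> by (intro divide_left_mono power_mono) (auto intro!: mult_pos_pos zero_less_power)
  then show "1 / \<delta>\<^sup>2 \<le> 1 / c1\<^sup>2 * (1 / s\<^sup>2)" "1 / \<delta> ^ 5 \<le> 1 / c1 ^ 5 * (1 / s ^ 5)"
    by (simp_all add: power_mult_distrib)
qed

text \<open>The outer 2 pays for replacing a sum by twice a minimum, the inner one for the two
  summands sqrt(n)/\<epsilon>^2 and n of the full bound.\<close>

definition balance :: "real \<Rightarrow> real" where "balance c1 = 2 * (2 + 1 / c1\<^sup>2 + 1 / c1 ^ 5)"

lemma sampled_bound_balanced: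
  assumes e: "0 < \<epsilon>" "\<epsilon> < 1" and c1: "c1 > 0" and \<delta>: "c1 * sqrt \<epsilon> \<le> \<delta>"
  shows "sampled_bound \<epsilon> \<delta> \<le> balance c1 * (1 / \<epsilon> ^ 3)"
proof -
  define s where "s = sqrt \<epsilon>"
  have s: "0 < s" "s < 1" and es: "\<epsilon> = s\<^sup>2" using e by (auto simp: s_def)
  note t = curvature_terms[OF s c1 \<delta>[folded s_def]]
  have "1 / (\<epsilon>\<^sup>2 * \<delta>\<^sup>2) = 1 / \<epsilon>\<^sup>2 * (1 / \<delta>\<^sup>2)" by simp
  also have "\<dots> \<le> 1 / \<epsilon>\<^sup>2 * (1 / c1\<^sup>2 * (1 / s\<^sup>2))" by (rule mult_left_mono[OF t(1)]) simp
  also have "\<dots> = 1 / c1\<^sup>2 * (1 / \<epsilon> ^ 3)" by (simp add: es eval_nat_numeral)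
  finally have 1: "1 / (\<epsilon>\<^sup>2 * \<delta>\<^sup>2) \<le> 1 / c1\<^sup>2 * (1 / \<epsilon> ^ 3)" .
  have "s ^ 6 \<le> s ^ 5" using s by (intro power_decreasing) auto
  then have "1 / s ^ 5 \<le> 1 / \<epsilon> ^ 3" using s by (simp add: es frac_le flip: power_mult)
  then have "1 / c1 ^ 5 * (1 / s ^ 5) \<le> 1 / c1 ^ 5 * (1 / \<epsilon> ^ 3)" using c1 by (intro mult_left_mono) auto
  then have 2: "1 / \<delta> ^ 5 \<le> 1 / c1 ^ 5 * (1 / \<epsilon> ^ 3)" using t(2) by linarith
  have "sampled_bound \<epsilon> \<delta> \<le> (1 + 1 / c1\<^sup>2 + 1 / c1 ^ 5) * (1 / \<epsilon> ^ 3)"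
    unfolding sampled_bound_def distrib_right mult_1_left using 1 2 by linarith
  also have "\<dots> \<le> balance c1 * (1 / \<epsilon> ^ 3)"
  proof (rule mult_right_mono)
    have "0 \<le> 1 / c1\<^sup>2" "0 \<le> 1 / c1 ^ 5" using c1 by auto
    then show "1 + 1 / c1\<^sup>2 + 1 / c1 ^ 5 \<le> balance c1" unfolding balance_def by (simp only: distrib_left)
  qed (use e in simp)
  finally show ?thesis .
qed

text \<open>Since sqrt n \<le> 1/\<epsilon>, the summand n is at most sqrt(n)/\<epsilon>^2, and this
  in turn is at most \<epsilon>^-3. The full bound thus stays within a constant of both entries of
  the minimum.\<close>

lemma full_bound_balanced:
  assumes e: "0 < \<epsilon>" "\<epsilon> < 1" and c1: "c1 > 0" and \<delta>: "c1 * sqrt \<epsilon> \<le> \<delta>" and n: "real n \<le> 1 / \<epsilon>\<^sup>2"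
  shows "full_bound n \<epsilon> \<delta> \<le> balance c1 * min (sqrt (real n) / \<epsilon>\<^sup>2 + 1 / sqrt \<epsilon> ^ 5) (1 / \<epsilon> ^ 3)"
proof -
  define s where "s = sqrt \<epsilon>"
  define r where "r = sqrt (real n)"
  define Q where "Q = r / \<epsilon>\<^sup>2 + 1 / s ^ 5"
  have s: "0 < s" "s < 1" and es: "\<epsilon> = s\<^sup>2" using e by (auto simp: s_def)
  note t = curvature_terms[OF s c1 \<delta>[folded s_def]]
  have r: "r \<ge> 0" "real n = r\<^sup>2" by (auto simp: r_def)
  have re: "r \<le> 1 / \<epsilon>" using n e by (intro power2_le_imp_le[of r "1 / \<epsilon>"]) (auto simp: r power_divide)
  have "r / (\<epsilon> * \<delta>\<^sup>2) = r / \<epsilon> * (1 / \<delta>\<^sup>2)" by simp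
  also have "\<dots> \<le> r / \<epsilon> * (1 / c1\<^sup>2 * (1 / s\<^sup>2))" using r e by (intro mult_left_mono[OF t(1)]) simp
  also have "\<dots> = 1 / c1\<^sup>2 * (r / \<epsilon>\<^sup>2)" by (simp add: es eval_nat_numeral)
  finally have 1: "r / (\<epsilon> * \<delta>\<^sup>2) \<le> 1 / c1\<^sup>2 * (r / \<epsilon>\<^sup>2)" .
  have "1 / \<epsilon> \<le> 1 / \<epsilon>\<^sup>2" using e by (intro divide_left_mono) (auto simp: power2_eq_square mult_le_cancel_left1)
  then have "r * r \<le> r * (1 / \<epsilon>\<^sup>2)" using r re by (intro mult_left_mono) auto
  then have 2: "real n \<le> r / \<epsilon>\<^sup>2" by (simp add: r power2_eq_square)
  have q: "r / \<epsilon>\<^sup>2 \<le> Q" "1 / s ^ 5 \<le> Q" "0 \<le> Q" using r e s by (auto simp: Q_def)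
  have 3: "1 / c1\<^sup>2 * (r / \<epsilon>\<^sup>2) \<le> 1 / c1\<^sup>2 * Q" "1 / c1 ^ 5 * (1 / s ^ 5) \<le> 1 / c1 ^ 5 * Q"
    using q c1 by (auto intro!: mult_left_mono simp del: times_divide_eq_left times_divide_eq_right)
  have "full_bound n \<epsilon> \<delta> \<le> 2 * Q + 1 / c1\<^sup>2 * Q + 1 / c1 ^ 5 * Q"
    unfolding full_bound_def r_def[symmetric] using 1 2 3 q t(2) by linarith
  then have fQ: "full_bound n \<epsilon> \<delta> \<le> balance c1 / 2 * Q"
    by (simp only: balance_def nonzero_mult_div_cancel_left zero_neq_numeral distrib_right not_False_eq_True)
  have "r * (1 / \<epsilon>\<^sup>2) \<le> 1 / \<epsilon> * (1 / \<epsilon>\<^sup>2)" using re by (intro mult_right_mono) auto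
  then have "r / \<epsilon>\<^sup>2 \<le> 1 / \<epsilon> ^ 3" by (simp add: eval_nat_numeral)
  moreover have "s ^ 6 \<le> s ^ 5" using s by (intro power_decreasing) auto
  then have "1 / s ^ 5 \<le> 1 / \<epsilon> ^ 3" using s by (simp add: es frac_le flip: power_mult)
  ultimately have "Q \<le> 2 * (1 / \<epsilon> ^ 3)" by (simp add: Q_def)
  then have "Q \<le> 2 * min Q (1 / \<epsilon> ^ 3)" using q by (auto simp: min_def)
  then have "balance c1 / 2 * Q \<le> balance c1 / 2 * (2 * min Q (1 / \<epsilon> ^ 3))"
    using c1 by (intro mult_left_mono) (auto simp: balance_def)
  then show ?thesis using fQ by (simp add: Q_def r_def s_def)
qed

theorem corollary7:
  shows "\<exists>A :: params \<Rightarrow> algorithm.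
    \<forall>\<Delta> L \<sigma> \<rho> :: real. \<Delta> > 0 \<and> L > 0 \<and> \<sigma> > 0 \<and> \<rho> > 0 \<longrightarrow>
    (\<comment> \<open>on-line case\<close>
     \<exists>(C::real) (k::nat). \<forall>(d::nat) (\<epsilon>::real) (\<delta>::real) (p::real).
       d \<ge> 1 \<and> 0 < \<epsilon> \<and> \<epsilon> < 1 \<and> 0 < \<delta> \<and> \<delta> < 1 \<and> 0 < p \<and> p < 1 \<longrightarrow>
       (\<forall>(D :: 'i measure) F x0. online_problem d D F x0 \<Delta> L \<sigma> \<rho> \<longrightarrow>
          online_finds
            (A \<lparr>dimension = d, components = None, start = x0, gap = \<Delta>, grad_lipschitz = L,
                deviation = Some \<sigma>, hess_lipschitz = \<rho>, accuracy = \<epsilon>, curvature = \<delta>, failure = p\<rparr>)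
            d D F \<epsilon> \<delta> p
            (C * log_factor [real d, \<epsilon>, \<delta>, p] ^ k *
              (\<epsilon> powr (-3) + \<delta> powr (-2) * \<epsilon> powr (-2) + \<delta> powr (-5)))))
    \<and>
    (\<comment> \<open>finite-sum case\<close>
     \<exists>(C::real) (k::nat). \<forall>(d::nat) (n::nat) (\<epsilon>::real) (\<delta>::real) (p::real).
       d \<ge> 1 \<and> n \<ge> 1 \<and> 0 < \<epsilon> \<and> \<epsilon> < 1 \<and> 0 < \<delta> \<and> \<delta> < 1 \<and> 0 < p \<and> p < 1 \<longrightarrow>
       (\<forall>F x0. finite_sum_problem d n F x0 \<Delta> L \<rho> \<longrightarrow>
          finite_sum_finds
            (A \<lparr>dimension = d, components = Some n, start = x0, gap = \<Delta>, grad_lipschitz = L,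
                deviation = None, hess_lipschitz = \<rho>, accuracy = \<epsilon>, curvature = \<delta>, failure = p\<rparr>)
            d n F \<epsilon> \<delta> p
            (C * log_factor [real d, real n, \<epsilon>, \<delta>, p] ^ k *
              (real n powr (1/2) * \<epsilon> powr (-2) + real n powr (1/2) * \<delta> powr (-2) * \<epsilon> powr (-1)
               + \<delta> powr (-3) * \<epsilon> powr (-1) + \<delta> powr (-5) + real n))))
    \<and>
    (\<comment> \<open>curvature accuracy of the order of the square root of the gradient accuracy\<close>
     \<forall>c1 c2 :: real. 0 < c1 \<and> 0 < c2 \<longrightarrow>
     (\<exists>(C::real) (k::nat). \<forall>(d::nat) (\<epsilon>::real) (\<delta>::real) (p::real).
       d \<ge> 1 \<and> 0 < \<epsilon> \<and> \<epsilon> < 1 \<and> 0 < \<delta> \<and> \<delta> < 1 \<and> 0 < p \<and> p < 1 \<and>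
       c1 * \<epsilon> powr (1/2) \<le> \<delta> \<and> \<delta> \<le> c2 * \<epsilon> powr (1/2) \<longrightarrow>
       (\<forall>(n::nat) F x0. n \<ge> 1 \<and> finite_sum_problem d n F x0 \<Delta> L \<rho> \<and>
            bounded_deviation d {..<n} F (avg n F) \<sigma> \<longrightarrow>
          finite_sum_finds
            (A \<lparr>dimension = d, components = Some n, start = x0, gap = \<Delta>, grad_lipschitz = L,
                deviation = Some \<sigma>, hess_lipschitz = \<rho>, accuracy = \<epsilon>, curvature = \<delta>, failure = p\<rparr>)
            d n F \<epsilon> \<delta> p
            (C * log_factor [real d, real n, \<epsilon>, \<delta>, p] ^ k *
              min (real n powr (1/2) * \<epsilon> powr (-2) + \<epsilon> powr (-5/2)) (\<epsilon> powr (-3)))) \<and>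
       (\<forall>(D :: 'i measure) F x0. online_problem d D F x0 \<Delta> L \<sigma> \<rho> \<longrightarrow>
          online_finds
            (A \<lparr>dimension = d, components = None, start = x0, gap = \<Delta>, grad_lipschitz = L,
                deviation = Some \<sigma>, hess_lipschitz = \<rho>, accuracy = \<epsilon>, curvature = \<delta>, failure = p\<rparr>)
            d D F \<epsilon> \<delta> p
            (C * log_factor [real d, \<epsilon>, \<delta>, p] ^ k * \<epsilon> powr (-3)))))"
proof (intro exI[of _ solver] allI impI, elim conjE, intro conjI)
  fix \<Delta> L \<sigma> \<rho> :: real assume pos: "\<Delta> > 0" "L > 0" "\<sigma> > 0" "\<rho> > 0"
  define c where "c = scale \<Delta> L \<rho> \<sigma>"
  \<comment> \<open>Without a deviation bound \<open>solver\<close> takes 0 for \<sigma>, hence a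
    second constant for the finite-sum claim.\<close>
  define c' where "c' = scale \<Delta> L \<rho> 0"
  have cc: "cost_const c \<ge> 0" "cost_const c' \<ge> 0"
    unfolding c_def c'_def using pos by (auto intro!: cost_const_nonneg order_trans[OF _ scale_ge_1])
  show "\<exists>(C::real) (k::nat). \<forall>(d::nat) (\<epsilon>::real) (\<delta>::real) (p::real).
       d \<ge> 1 \<and> 0 < \<epsilon> \<and> \<epsilon> < 1 \<and> 0 < \<delta> \<and> \<delta> < 1 \<and> 0 < p \<and> p < 1 \<longrightarrow>
       (\<forall>(D :: 'i measure) F x0. online_problem d D F x0 \<Delta> L \<sigma> \<rho> \<longrightarrow>
          online_finds
            (solver \<lparr>dimension = d, components = None, start = x0, gap = \<Delta>, grad_lipschitz = L,
                deviation = Some \<sigma>, hess_lipschitz = \<rho>, accuracy = \<epsilon>, curvature = \<delta>, failure = p\<rparr>)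
            d D F \<epsilon> \<delta> p
            (C * log_factor [real d, \<epsilon>, \<delta>, p] ^ k *
              (\<epsilon> powr (-3) + \<delta> powr (-2) * \<epsilon> powr (-2) + \<delta> powr (-5))))"
  \<comment> \<open>The exponent 6: four powers of the logarithm come from
    \<open>search_cost\<close> and two more from the sampled batch size.\<close>
  proof (rule exI[of _ "cost_const c"], rule exI[of _ 6], intro allI impI, elim conjE)
    fix d :: nat and \<epsilon> \<delta> p :: real and D :: "'i measure" and F x0
    assume r: "1 \<le> d" "0 < \<epsilon>" "\<epsilon> < 1" "0 < \<delta>" "\<delta> < 1" "0 < p" "p < 1" and prob: "online_problem d D F x0 \<Delta> L \<sigma> \<rho>"
    have "\<epsilon> powr (-3) + \<delta> powr (-2) * \<epsilon> powr (-2) + \<delta> powr (-5) = sampled_bound \<epsilon> \<delta>"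
      by (simp add: powr_eqs r sampled_bound_def mult.commute)
    then show "online_finds
            (solver \<lparr>dimension = d, components = None, start = x0, gap = \<Delta>, grad_lipschitz = L,
                deviation = Some \<sigma>, hess_lipschitz = \<rho>, accuracy = \<epsilon>, curvature = \<delta>, failure = p\<rparr>)
            d D F \<epsilon> \<delta> p
            (cost_const c * log_factor [real d, \<epsilon>, \<delta>, p] ^ 6 *
              (\<epsilon> powr (-3) + \<delta> powr (-2) * \<epsilon> powr (-2) + \<delta> powr (-5)))"
      by (intro solver_online r pos prob) (simp add: c_def)
  qed
  show "\<exists>(C::real) (k::nat). \<forall>(d::nat) (n::nat) (\<epsilon>::real) (\<delta>::real) (p::real).
       d \<ge> 1 \<and> n \<ge> 1 \<and> 0 < \<epsilon> \<and> \<epsilon> < 1 \<and> 0 < \<delta> \<and> \<delta> < 1 \<and> 0 < p \<and> p < 1 \<longrightarrow>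
       (\<forall>F x0. finite_sum_problem d n F x0 \<Delta> L \<rho> \<longrightarrow>
          finite_sum_finds
            (solver \<lparr>dimension = d, components = Some n, start = x0, gap = \<Delta>, grad_lipschitz = L,
                deviation = None, hess_lipschitz = \<rho>, accuracy = \<epsilon>, curvature = \<delta>, failure = p\<rparr>)
            d n F \<epsilon> \<delta> p
            (C * log_factor [real d, real n, \<epsilon>, \<delta>, p] ^ k *
              (real n powr (1/2) * \<epsilon> powr (-2) + real n powr (1/2) * \<delta> powr (-2) * \<epsilon> powr (-1)
               + \<delta> powr (-3) * \<epsilon> powr (-1) + \<delta> powr (-5) + real n)))"
  proof (rule exI[of _ "cost_const c'"], rule exI[of _ 6], intro allI impI, elim conjE)
    fix d n :: nat and \<epsilon> \<delta> p :: real and F x0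
    assume r: "1 \<le> d" "0 < \<epsilon>" "\<epsilon> < 1" "0 < \<delta>" "\<delta> < 1" "0 < p" "p < 1" and n: "n \<ge> 1"
      and prob: "finite_sum_problem d n F x0 \<Delta> L \<rho>"
    let ?R = "real n powr (1/2) * \<epsilon> powr (-2) + real n powr (1/2) * \<delta> powr (-2) * \<epsilon> powr (-1)
               + \<delta> powr (-3) * \<epsilon> powr (-1) + \<delta> powr (-5) + real n"
    have n0: "real n > 0" using n by simp
    have "full_bound n \<epsilon> \<delta> \<le> ?R"
      using r by (simp add: powr_eqs r powr_eqs[OF n0] full_bound_def mult.commute[of _ "\<epsilon>"] abs_of_pos less_imp_le)
    then show "finite_sum_finds
            (solver \<lparr>dimension = d, components = Some n, start = x0, gap = \<Delta>, grad_lipschitz = L,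
                deviation = None, hess_lipschitz = \<rho>, accuracy = \<epsilon>, curvature = \<delta>, failure = p\<rparr>)
            d n F \<epsilon> \<delta> p (cost_const c' * log_factor [real d, real n, \<epsilon>, \<delta>, p] ^ 6 * ?R)"
      using cc by (intro solver_finite_sum[where \<sigma> = 0 and full = True] r pos n prob)
        (auto simp: c'_def[symmetric] intro!: mult_left_mono mult_nonneg_nonneg zero_le_power log_factor_nonneg)
  qed
  show "\<forall>c1 c2 :: real. 0 < c1 \<and> 0 < c2 \<longrightarrow>
     (\<exists>(C::real) (k::nat). \<forall>(d::nat) (\<epsilon>::real) (\<delta>::real) (p::real).
       d \<ge> 1 \<and> 0 < \<epsilon> \<and> \<epsilon> < 1 \<and> 0 < \<delta> \<and> \<delta> < 1 \<and> 0 < p \<and> p < 1 \<and>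
       c1 * \<epsilon> powr (1/2) \<le> \<delta> \<and> \<delta> \<le> c2 * \<epsilon> powr (1/2) \<longrightarrow>
       (\<forall>n F x0. n \<ge> 1 \<and> finite_sum_problem d n F x0 \<Delta> L \<rho> \<and>
            bounded_deviation d {..<n} F (avg n F) \<sigma> \<longrightarrow>
          finite_sum_finds
            (solver \<lparr>dimension = d, components = Some n, start = x0, gap = \<Delta>, grad_lipschitz = L,
                deviation = Some \<sigma>, hess_lipschitz = \<rho>, accuracy = \<epsilon>, curvature = \<delta>, failure = p\<rparr>)
            d n F \<epsilon> \<delta> p
            (C * log_factor [real d, real n, \<epsilon>, \<delta>, p] ^ k *
              min (real n powr (1/2) * \<epsilon> powr (-2) + \<epsilon> powr (-5/2)) (\<epsilon> powr (-3)))) \<and>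
       (\<forall>(D :: 'i measure) F x0. online_problem d D F x0 \<Delta> L \<sigma> \<rho> \<longrightarrow>
          online_finds
            (solver \<lparr>dimension = d, components = None, start = x0, gap = \<Delta>, grad_lipschitz = L,
                deviation = Some \<sigma>, hess_lipschitz = \<rho>, accuracy = \<epsilon>, curvature = \<delta>, failure = p\<rparr>)
            d D F \<epsilon> \<delta> p
            (C * log_factor [real d, \<epsilon>, \<delta>, p] ^ k * \<epsilon> powr (-3))))"
  proof (intro allI impI, elim conjE)
    fix c1 c2 :: real assume c1: "0 < c1"
    have bound: "cost_const c * log_factor xs ^ 6 * S \<le> cost_const c * balance c1 * log_factor xs ^ 6 * T"
      if "S \<le> balance c1 * T" for S T xs
    proof -
      have "cost_const c * log_factor xs ^ 6 * S \<le> cost_const c * log_factor xs ^ 6 * (balance c1 * T)"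
        using that cc log_factor_nonneg by (intro mult_left_mono) auto
      then show ?thesis by (simp add: mult_ac)
    qed
    show "\<exists>(C::real) (k::nat). \<forall>(d::nat) (\<epsilon>::real) (\<delta>::real) (p::real).
       d \<ge> 1 \<and> 0 < \<epsilon> \<and> \<epsilon> < 1 \<and> 0 < \<delta> \<and> \<delta> < 1 \<and> 0 < p \<and> p < 1 \<and>
       c1 * \<epsilon> powr (1/2) \<le> \<delta> \<and> \<delta> \<le> c2 * \<epsilon> powr (1/2) \<longrightarrow>
       (\<forall>n F x0. n \<ge> 1 \<and> finite_sum_problem d n F x0 \<Delta> L \<rho> \<and>
            bounded_deviation d {..<n} F (avg n F) \<sigma> \<longrightarrow>
          finite_sum_finds
            (solver \<lparr>dimension = d, components = Some n, start = x0, gap = \<Delta>, grad_lipschitz = L,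
                deviation = Some \<sigma>, hess_lipschitz = \<rho>, accuracy = \<epsilon>, curvature = \<delta>, failure = p\<rparr>)
            d n F \<epsilon> \<delta> p
            (C * log_factor [real d, real n, \<epsilon>, \<delta>, p] ^ k *
              min (real n powr (1/2) * \<epsilon> powr (-2) + \<epsilon> powr (-5/2)) (\<epsilon> powr (-3)))) \<and>
       (\<forall>(D :: 'i measure) F x0. online_problem d D F x0 \<Delta> L \<sigma> \<rho> \<longrightarrow>
          online_finds
            (solver \<lparr>dimension = d, components = None, start = x0, gap = \<Delta>, grad_lipschitz = L,
                deviation = Some \<sigma>, hess_lipschitz = \<rho>, accuracy = \<epsilon>, curvature = \<delta>, failure = p\<rparr>)
            d D F \<epsilon> \<delta> p
            (C * log_factor [real d, \<epsilon>, \<delta>, p] ^ k * \<epsilon> powr (-3)))"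
    proof (rule exI[of _ "cost_const c * balance c1"], rule exI[of _ 6], intro allI impI, elim conjE, intro conjI allI impI)
      fix d :: nat and \<epsilon> \<delta> p :: real
      assume r: "1 \<le> d" "0 < \<epsilon>" "\<epsilon> < 1" "0 < \<delta>" "\<delta> < 1" "0 < p" "p < 1" and "c1 * \<epsilon> powr (1/2) \<le> \<delta>"
      then have \<delta>: "c1 * sqrt \<epsilon> \<le> \<delta>" by (simp add: powr_eqs)
      note sb = sampled_bound_balanced[OF r(2,3) c1 \<delta>]
      {
        fix D :: "'i measure" and F x0 assume prob: "online_problem d D F x0 \<Delta> L \<sigma> \<rho>"
        show "online_finds
            (solver \<lparr>dimension = d, components = None, start = x0, gap = \<Delta>, grad_lipschitz = L,
                deviation = Some \<sigma>, hess_lipschitz = \<rho>, accuracy = \<epsilon>, curvature = \<delta>, failure = p\<rparr>)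
            d D F \<epsilon> \<delta> p
            (cost_const c * balance c1 * log_factor [real d, \<epsilon>, \<delta>, p] ^ 6 * \<epsilon> powr (-3))"
          unfolding powr_eqs[OF r(2)] by (intro solver_online r pos prob) (unfold c_def[symmetric], rule bound[OF sb])
      next
        fix n :: nat and F x0
        assume "n \<ge> 1 \<and> finite_sum_problem d n F x0 \<Delta> L \<rho> \<and> bounded_deviation d {..<n} F (avg n F) \<sigma>"
        then have n: "n \<ge> 1" and prob: "finite_sum_problem d n F x0 \<Delta> L \<rho>"
          and dev: "bounded_deviation d {..<n} F (avg n F) \<sigma>" by auto
        have n0: "real n > 0" using n by simp
        let ?T = "min (sqrt (real n) / \<epsilon>\<^sup>2 + 1 / sqrt \<epsilon> ^ 5) (1 / \<epsilon> ^ 3)"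
        have T: "min (real n powr (1/2) * \<epsilon> powr (-2) + \<epsilon> powr (-5/2)) (\<epsilon> powr (-3)) = ?T"
          by (simp only: powr_eqs[OF r(2)] powr_eqs[OF n0] times_divide_eq_right mult_1_right)
        have S: "(if real n \<le> 1 / \<epsilon>\<^sup>2 then full_bound n \<epsilon> \<delta> else sampled_bound \<epsilon> \<delta>) \<le> balance c1 * ?T"
        proof (cases "real n \<le> 1 / \<epsilon>\<^sup>2")
          case True
          show ?thesis unfolding if_P[OF True] by (rule full_bound_balanced[OF r(2,3) c1 \<delta> True])
        next
          case False
          \<comment> \<open>For n > 1/\<epsilon>^2 the minimum equals \<epsilon>^-3, which sampled
            batches attain.\<close>
          have "1 / \<epsilon> \<le> sqrt (real n)" using False r by (intro real_le_rsqrt) (simp add: power_divide)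
          then have "1 / \<epsilon> * (1 / \<epsilon>\<^sup>2) \<le> sqrt (real n) * (1 / \<epsilon>\<^sup>2)" by (intro mult_right_mono) auto
          then have "1 / \<epsilon> ^ 3 \<le> sqrt (real n) / \<epsilon>\<^sup>2" by (simp add: eval_nat_numeral)
          moreover have "0 \<le> 1 / sqrt \<epsilon> ^ 5" using r by simp
          ultimately have "1 / \<epsilon> ^ 3 \<le> sqrt (real n) / \<epsilon>\<^sup>2 + 1 / sqrt \<epsilon> ^ 5" by linarith
          then have "?T = 1 / \<epsilon> ^ 3" by (rule min_absorb2)
          then show ?thesis unfolding if_not_P[OF False] using sb by simp
        qed
        show "finite_sum_finds
            (solver \<lparr>dimension = d, components = Some n, start = x0, gap = \<Delta>, grad_lipschitz = L,
                deviation = Some \<sigma>, hess_lipschitz = \<rho>, accuracy = \<epsilon>, curvature = \<delta>, failure = p\<rparr>)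
            d n F \<epsilon> \<delta> p
            (cost_const c * balance c1 * log_factor [real d, real n, \<epsilon>, \<delta>, p] ^ 6 *
              min (real n powr (1/2) * \<epsilon> powr (-2) + \<epsilon> powr (-5/2)) (\<epsilon> powr (-3)))"
          unfolding T
          by (rule solver_finite_sum[where \<sigma> = \<sigma> and full = "real n \<le> 1 / \<epsilon>\<^sup>2", OF r pos(1,2,4) n prob])
            (use pos dev bound[OF S] in \<open>simp_all add: c_def\<close>)
      }
    qed
  qed
qed

end
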